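(* Let $V$ be a finite-dimensional vector space over a field $\mathbb K$, let $H$ be a countable (finite or infinite) set of linear hyperplanes of $V$, and let $\mathcal L(H)$ be the arrangement lattice of $H$. For $i,j\ge 0$ put $d_{i,j}=\dim_{\mathbb K} H_i(\mathcal L(H)\setminus\{V\};\Lambda^j(-))$. Then $d_{i,j}=0$ whenever $(i,j)\notin A\cup B$, where \[ A=\{(0,j)\mid 0\le j\le \dim(V)-1\}, \] \[ B=\{(i,j)\mid 1\le i\le \mathrm d(\mathcal L(H))-2\ \text{ and }\ \mathrm d(\mathcal L(H))-1\le i+j\le \dim(V)-1\}. \] Moreover, $d_{0,j}=\binom{\dim(V)}{j}$ if $0\le j\le \mathrm d(\mathcal L(H))-2$, and $d_{0,\dim(V)-1}=\#H$. In addition, if $H$ is finite, $\dim(\hat 0)=0$, $1\le i\le \mathrm d(\mathcal L(H))-2$, and $i+j=\mathrm d(\mathcal L(H))-1$, then \[ d_{i,j}=(-1)^{i+1}\binom{\dim(V)}{j}+\sum_{k=\mathrm d(\mathcal L(H))-1-i}^{\mathrm d(\mathcal L(H))-1}(-1)^{k-\mathrm d(\mathcal L(H))+1+i}\binom{k}{j}\sum_{\substack{x\in\mathcal L(H)\\ \mathrm d(x)=k}}|\mu(x,V)| . \]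
   Context: The arrangement lattice $\mathcal L(H)$ is the set of all possible intersections of hyperplanes in $H$ (including the empty intersection $V$), ordered by inclusion; its maximum is $\hat 1=V$, its minimum is $\hat 0=\bigcap_{h\in H}h$, its degree function is $\mathrm d(x)=\dim(x)-\dim(\hat 0)$, and $\mathrm d(\mathcal L(H))=\mathrm d(V)=\dim(V)-\dim(\hat 0)$. $\Lambda^j\colon\mathcal L(H)\to\mathbb K\text{-mod}$ is the covariant functor sending a subspace $W$ to its $j$-th exterior power $\Lambda^j(W)$ and an inclusion $W'\le W$ to the inclusion $\Lambda^j(W')\le\Lambda^j(W)$. For a poset $\mathcal Q$ and a functor $F\colon\mathcal Q\to\mathbb K\text{-mod}$, $H_*(\mathcal Q;F)$ denotes the left derived functors of $\operatorname{colim}\colon\mathrm{Fun}(\mathcal Q,\mathbb K\text{-mod})\to\mathbb K\text{-mod}$ evaluated at $F$. For a finite poset and $p\le q$, $\mu(p,q)=1$ if $p=q$ and $\mu(p,q)=-\sum_{p<r\le q}\mu(r,q)$ otherwise. *)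

theory Defs
  imports Complex_Main "HOL-Library.Poly_Mapping" "HOL-Library.Countable_Set"
begin

unbundle cardinal_syntax

section \<open>Vector spaces\<close>

text \<open>
  A vector space is a subspace of an ambient type carrying a scalar multiplication \<open>s\<close> (locale
  \<open>vector_space\<close>). The type \<open>'a \<Rightarrow>\<^sub>0 'b\<close> of finitely supported functions is the direct sum of copies
  of \<open>'b\<close> indexed by \<open>'a\<close>, with the following scalar multiplication.
\<close>

definition pm_scale :: "('k \<Rightarrow> 'b \<Rightarrow> 'b) \<Rightarrow> 'k \<Rightarrow> ('a \<Rightarrow>\<^sub>0 'b) \<Rightarrow> ('a \<Rightarrow>\<^sub>0 'b::zero)" where
  "pm_scale s c = Poly_Mapping.map (s c)"

lemma lookup_pm_scale:
  assumes "vector_space s"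
  shows "Poly_Mapping.lookup (pm_scale s c f) a = s c (Poly_Mapping.lookup f a)"
proof -
  interpret vector_space s by fact
  show ?thesis by (simp add: pm_scale_def map.rep_eq when_def)
qed

lemma vector_space_pm_scale:
  assumes "vector_space s"
  shows "vector_space (pm_scale s)"
proof -
  interpret vector_space s by fact
  show ?thesis
    by unfold_locales
      (auto intro!: poly_mapping_eqI
        simp: lookup_pm_scale[OF assms] lookup_add scale_right_distrib scale_left_distrib)
qed

text \<open>
  The dimension of a subspace as a cardinal (\<open>vector_space.dim\<close> is \<open>0\<close> on spaces of infinite
  dimension).
\<close>

definition vdim :: "('k::field \<Rightarrow> 'b::ab_group_add \<Rightarrow> 'b) \<Rightarrow> 'b set \<Rightarrow> 'b rel" where
  "vdim s U = |SOME B. \<not> module.dependent s B \<and> module.span s B = U|"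

text \<open>
  The quotient map by a subspace \<open>N\<close>: an idempotent linear map with kernel \<open>N\<close>. For subspaces
  \<open>N \<subseteq> U\<close>, the image of \<open>U\<close> is \<open>U/N\<close>, every class being replaced by a
  representative chosen linearly.
\<close>

definition quot_map :: "('k::field \<Rightarrow> 'b::ab_group_add \<Rightarrow> 'b) \<Rightarrow> 'b set \<Rightarrow> 'b \<Rightarrow> 'b" where
  "quot_map s N = (SOME f. Vector_Spaces.linear s s f \<and> (\<forall>x. f (f x) = f x) \<and> {x. f x = 0} = N)"

definition quot :: "('k::field \<Rightarrow> 'b::ab_group_add \<Rightarrow> 'b) \<Rightarrow> 'b set \<Rightarrow> 'b set \<Rightarrow> 'b set" where
  "quot s U N = quot_map s N ` U"

lemma quot_map:
  assumes "vector_space s" "module.subspace s N"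
  shows "Vector_Spaces.linear s s (quot_map s N)"
    and "quot_map s N (quot_map s N x) = quot_map s N x"
    and "{x. quot_map s N x = 0} = N"
proof -
  interpret vector_space s by fact
  interpret vector_space_pair s s by unfold_locales
  obtain B where B: "B \<subseteq> N" "independent B" "N \<subseteq> span B"
    using maximal_independent_subset[of N] by blast
  have span_B: "span B = N"
    using B assms(2) span_minimal by blast
  define g where "g = construct B id"
  have lin_g: "Vector_Spaces.linear s s g"
    unfolding g_def by (rule linear_construct[OF B(2)])
  then interpret g: Vector_Spaces.linear s s g .
  have g_in: "g x \<in> N" for x
    using construct_in_span[OF B(2), of id x] span_B by (simp add: g_def)
  have g_id: "g x = x" if "x \<in> N" for x
    by (rule linear_eq_on[OF lin_g linear_id, unfolded id_apply, of _ B])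
      (use that span_B construct_basis[OF B(2), of _ id] in \<open>auto simp: g_def\<close>)
  have "Vector_Spaces.linear s s (\<lambda>x. x - g x)"
    by (rule linear_compose_sub[OF linear_ident lin_g])
  moreover have "(x - g x) - g (x - g x) = x - g x" for x
    using g_id[OF g_in] by (simp add: g.diff)
  moreover have "{x. x - g x = 0} = N"
    using g_in g_id by (auto simp: eq_iff_diff_eq_0[symmetric]) (metis)
  ultimately have "\<exists>f. Vector_Spaces.linear s s f \<and> (\<forall>x. f (f x) = f x) \<and> {x. f x = 0} = N"
    by (intro exI[of _ "\<lambda>x. x - g x"]) blast
  then have *: "Vector_Spaces.linear s s (quot_map s N) \<and>
      (\<forall>x. quot_map s N (quot_map s N x) = quot_map s N x) \<and> {x. quot_map s N x = 0} = N"
    unfolding quot_map_def by (rule someI_ex)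
  show "Vector_Spaces.linear s s (quot_map s N)"
    "quot_map s N (quot_map s N x) = quot_map s N x"
    "{x. quot_map s N x = 0} = N"
    using * by blast+
qed

section \<open>Functors from posets to vector spaces\<close>

text \<open>
  All maps are total linear maps on the ambient space; only their restrictions to the subspaces
  under consideration matter, and every linear map defined on a subspace has such an extension.
\<close>

record ('q, 'b) vfunctor =
  obj :: "'q \<Rightarrow> 'b set"
  arr :: "'q \<Rightarrow> 'q \<Rightarrow> 'b \<Rightarrow> 'b"

definition is_functor ::
  "('k::field \<Rightarrow> 'b::ab_group_add \<Rightarrow> 'b) \<Rightarrow> 'q::order set \<Rightarrow> ('q, 'b) vfunctor \<Rightarrow> bool" where
  "is_functor s Q F \<longleftrightarrow>
     (\<forall>q\<in>Q. module.subspace s (obj F q)) \<and>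
     (\<forall>p\<in>Q. \<forall>q\<in>Q. p \<le> q \<longrightarrow>
        Vector_Spaces.linear s s (arr F p q) \<and> arr F p q ` obj F p \<subseteq> obj F q) \<and>
     (\<forall>q\<in>Q. \<forall>x\<in>obj F q. arr F q q x = x) \<and>
     (\<forall>p\<in>Q. \<forall>q\<in>Q. \<forall>r\<in>Q. p \<le> q \<longrightarrow> q \<le> r \<longrightarrow>
        (\<forall>x\<in>obj F p. arr F q r (arr F p q x) = arr F p r x))"

definition is_nat_trans ::
  "('k::field \<Rightarrow> 'b::ab_group_add \<Rightarrow> 'b) \<Rightarrow> ('k \<Rightarrow> 'c::ab_group_add \<Rightarrow> 'c) \<Rightarrow> 'q::order set \<Rightarrow>
   ('q, 'b) vfunctor \<Rightarrow> ('q, 'c) vfunctor \<Rightarrow> ('q \<Rightarrow> 'b \<Rightarrow> 'c) \<Rightarrow> bool" where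
  "is_nat_trans s t Q F G \<eta> \<longleftrightarrow>
     (\<forall>q\<in>Q. Vector_Spaces.linear s t (\<eta> q) \<and> \<eta> q ` obj F q \<subseteq> obj G q) \<and>
     (\<forall>p\<in>Q. \<forall>q\<in>Q. p \<le> q \<longrightarrow> (\<forall>x\<in>obj F p. \<eta> q (arr F p q x) = arr G p q (\<eta> p x)))"

text \<open>Epimorphisms of functors are the pointwise surjective natural transformations.\<close>

definition is_projective ::
  "('k::field \<Rightarrow> 'b::ab_group_add \<Rightarrow> 'b) \<Rightarrow> 'q::order set \<Rightarrow> ('q, 'b) vfunctor \<Rightarrow> bool" where
  "is_projective s Q P \<longleftrightarrow> is_functor s Q P \<and>
     (\<forall>(E :: ('q, 'b) vfunctor) (G :: ('q, 'b) vfunctor) \<pi> \<phi>.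
        is_functor s Q E \<and> is_functor s Q G \<and>
        is_nat_trans s s Q E G \<pi> \<and> (\<forall>q\<in>Q. \<pi> q ` obj E q = obj G q) \<and>
        is_nat_trans s s Q P G \<phi> \<longrightarrow>
        (\<exists>\<psi>. is_nat_trans s s Q P E \<psi> \<and> (\<forall>q\<in>Q. \<forall>x\<in>obj P q. \<pi> q (\<psi> q x) = \<phi> q x)))"

definition is_proj_resolution ::
  "('k::field \<Rightarrow> 'b::ab_group_add \<Rightarrow> 'b) \<Rightarrow> ('k \<Rightarrow> 'c::ab_group_add \<Rightarrow> 'c) \<Rightarrow> 'q::order set \<Rightarrow>
   (nat \<Rightarrow> ('q, 'b) vfunctor) \<Rightarrow> (nat \<Rightarrow> 'q \<Rightarrow> 'b \<Rightarrow> 'b) \<Rightarrow> ('q \<Rightarrow> 'b \<Rightarrow> 'c) \<Rightarrow>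
   ('q, 'c) vfunctor \<Rightarrow> bool" where
  "is_proj_resolution s t Q P d \<epsilon> F \<longleftrightarrow>
     (\<forall>n. is_projective s Q (P n)) \<and>
     (\<forall>n. is_nat_trans s s Q (P (Suc n)) (P n) (d n)) \<and>
     is_nat_trans s t Q (P 0) F \<epsilon> \<and>
     (\<forall>q\<in>Q. \<epsilon> q ` obj (P 0) q = obj F q) \<and>
     (\<forall>q\<in>Q. d 0 q ` obj (P 1) q = {x \<in> obj (P 0) q. \<epsilon> q x = 0}) \<and>
     (\<forall>q\<in>Q. \<forall>n. d (Suc n) q ` obj (P (Suc (Suc n))) q = {x \<in> obj (P (Suc n)) q. d n q x = 0})"

section \<open>Colimits and their left derived functors\<close>

definition dsum :: "'q set \<Rightarrow> ('q, 'b::zero) vfunctor \<Rightarrow> ('q \<Rightarrow>\<^sub>0 'b) set" where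
  "dsum Q F = {x. Poly_Mapping.keys x \<subseteq> Q \<and> (\<forall>q\<in>Q. Poly_Mapping.lookup x q \<in> obj F q)}"

definition colim_rel ::
  "('k::field \<Rightarrow> 'b::ab_group_add \<Rightarrow> 'b) \<Rightarrow> 'q::order set \<Rightarrow> ('q, 'b) vfunctor \<Rightarrow> ('q \<Rightarrow>\<^sub>0 'b) set" where
  "colim_rel s Q F = module.span (pm_scale s)
     {Poly_Mapping.single p x - Poly_Mapping.single q (arr F p q x) | p q x.
        p \<in> Q \<and> q \<in> Q \<and> p \<le> q \<and> x \<in> obj F p}"

definition colim ::
  "('k::field \<Rightarrow> 'b::ab_group_add \<Rightarrow> 'b) \<Rightarrow> 'q::order set \<Rightarrow> ('q, 'b) vfunctor \<Rightarrow> ('q \<Rightarrow>\<^sub>0 'b) set" where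
  "colim s Q F = quot (pm_scale s) (dsum Q F) (colim_rel s Q F)"

text \<open>The map \<open>colim F \<rightarrow> colim G\<close> induced by a natural transformation \<open>\<eta>\<close> from \<open>F\<close> to \<open>G\<close>.\<close>

definition colim_map ::
  "('k::field \<Rightarrow> 'b::ab_group_add \<Rightarrow> 'b) \<Rightarrow> 'q::order set \<Rightarrow> ('q, 'b) vfunctor \<Rightarrow>
   ('q \<Rightarrow> 'b \<Rightarrow> 'b) \<Rightarrow> ('q \<Rightarrow>\<^sub>0 'b) \<Rightarrow> ('q \<Rightarrow>\<^sub>0 'b)" where
  "colim_map s Q G \<eta> x = quot_map (pm_scale s) (colim_rel s Q G) (Poly_Mapping.mapp \<eta> x)"

fun colim_homology ::
  "('k::field \<Rightarrow> 'b::ab_group_add \<Rightarrow> 'b) \<Rightarrow> 'q::order set \<Rightarrow>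
   (nat \<Rightarrow> ('q, 'b) vfunctor) \<Rightarrow> (nat \<Rightarrow> 'q \<Rightarrow> 'b \<Rightarrow> 'b) \<Rightarrow> nat \<Rightarrow> ('q \<Rightarrow>\<^sub>0 'b) set" where
  "colim_homology s Q P d 0 =
     quot (pm_scale s) (colim s Q (P 0)) (colim_map s Q (P 0) (d 0) ` colim s Q (P 1))"
| "colim_homology s Q P d (Suc n) =
     quot (pm_scale s)
       {x \<in> colim s Q (P (Suc n)). colim_map s Q (P n) (d n) x = 0}
       (colim_map s Q (P (Suc n)) (d (Suc n)) ` colim s Q (P (Suc (Suc n))))"

text \<open>
  \<open>derived_colim s Q F i\<close> is \<open>H\<^sub>i(Q; F)\<close>: the \<open>i\<close>-th homology of the colimit of a projective resolution
  of \<open>F\<close>. Resolutions and the test objects in \<open>is_projective\<close> take values in the subspaces of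
  \<open>'q list \<Rightarrow>\<^sub>0 'c\<close>. This space is large enough for the choice of resolution not to matter:

  \<^item> the bar resolution, with \<open>P\<^sub>n(q) = \<Oplus> F(p\<^sub>0)\<close> over the chains \<open>p\<^sub>0 \<le> \<dots> \<le> p\<^sub>n \<le> q\<close> in \<open>Q\<close>, takes values
    in it (send \<open>x \<in> F(p\<^sub>0)\<close> in the summand of such a chain to \<open>single [p\<^sub>0,\<dots>,p\<^sub>n] x\<close>);

  \<^item> if \<open>P\<close> takes values in it, then so does the free cover of \<open>P\<close>, given by \<open>q \<mapsto> \<Oplus> P(p)\<close> over
    \<open>p \<le> q\<close> in \<open>Q\<close> (prepend \<open>p\<close> to the lists). Hence a projective in the sense of \<open>is_projective\<close> is a
    direct summand of a free functor, and so projective against functors with arbitrary values.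
\<close>

definition derived_colim ::
  "('k::field \<Rightarrow> 'c::ab_group_add \<Rightarrow> 'c) \<Rightarrow> 'q::order set \<Rightarrow> ('q, 'c) vfunctor \<Rightarrow> nat \<Rightarrow>
   ('q \<Rightarrow>\<^sub>0 ('q list \<Rightarrow>\<^sub>0 'c)) set" where
  "derived_colim s Q F i =
     (let (P, d, \<epsilon>) = (SOME (P, d, \<epsilon>). is_proj_resolution (pm_scale s) s Q P d \<epsilon> F)
      in colim_homology (pm_scale s) Q P d i)"

definition derived_colim_dim ::
  "('k::field \<Rightarrow> 'c::ab_group_add \<Rightarrow> 'c) \<Rightarrow> 'q::order set \<Rightarrow> ('q, 'c) vfunctor \<Rightarrow> nat \<Rightarrow>
   ('q \<Rightarrow>\<^sub>0 ('q list \<Rightarrow>\<^sub>0 'c)) rel" where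
  "derived_colim_dim s Q F i = vdim (pm_scale (pm_scale s)) (derived_colim s Q F i)"

section \<open>Exterior powers\<close>

text \<open>
  \<open>\<Lambda>\<^sup>j(W)\<close> is the vector space with basis \<open>W\<^sup>j\<close> (lists of length \<open>j\<close>) modulo the relations making
  \<open>(w\<^sub>1,\<dots>,w\<^sub>j) \<mapsto> w\<^sub>1 \<and> \<dots> \<and> w\<^sub>j\<close> multilinear and alternating. For \<open>W' \<subseteq> W\<close> the map
  \<open>\<Lambda>\<^sup>j(W') \<rightarrow> \<Lambda>\<^sup>j(W)\<close> sends the class of an element to its class.
\<close>

definition tuples :: "nat \<Rightarrow> 'v set \<Rightarrow> 'v list set" where
  "tuples j W = {ws. length ws = j \<and> set ws \<subseteq> W}"

definition free_tuples :: "nat \<Rightarrow> 'v set \<Rightarrow> ('v list \<Rightarrow>\<^sub>0 'k::field) set" where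
  "free_tuples j W = {x. Poly_Mapping.keys x \<subseteq> tuples j W}"

definition ext_rel ::
  "('k::field \<Rightarrow> 'v::ab_group_add \<Rightarrow> 'v) \<Rightarrow> nat \<Rightarrow> 'v set \<Rightarrow> ('v list \<Rightarrow>\<^sub>0 'k) set" where
  "ext_rel s j W = module.span (pm_scale (*))
     ({Poly_Mapping.single (ws[m := u + v]) 1 - Poly_Mapping.single (ws[m := u]) 1
         - Poly_Mapping.single (ws[m := v]) 1 | ws m u v.
         ws \<in> tuples j W \<and> m < j \<and> u \<in> W \<and> v \<in> W} \<union>
      {Poly_Mapping.single (ws[m := s c u]) 1 - Poly_Mapping.single (ws[m := u]) c | ws m c u.
         ws \<in> tuples j W \<and> m < j \<and> u \<in> W} \<union>
      {Poly_Mapping.single ws 1 | ws l m.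
         ws \<in> tuples j W \<and> l < m \<and> m < j \<and> ws ! l = ws ! m})"

definition ext_power ::
  "('k::field \<Rightarrow> 'v::ab_group_add \<Rightarrow> 'v) \<Rightarrow> nat \<Rightarrow> ('v set, 'v list \<Rightarrow>\<^sub>0 'k) vfunctor" where
  "ext_power s j =
     \<lparr>obj = (\<lambda>W. quot (pm_scale (*)) (free_tuples j W) (ext_rel s j W)),
      arr = (\<lambda>W' W. quot_map (pm_scale (*)) (ext_rel s j W))\<rparr>"

section \<open>Hyperplane arrangements\<close>

definition hyperplane :: "('k::field \<Rightarrow> 'v::ab_group_add \<Rightarrow> 'v) \<Rightarrow> 'v set \<Rightarrow> bool" where
  "hyperplane s h \<longleftrightarrow>
     module.subspace s h \<and> vector_space.dim s h + 1 = vector_space.dim s UNIV"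

text \<open>Note that \<open>\<Inter>{} = UNIV\<close> is the whole space.\<close>

definition arr_lattice :: "'v set set \<Rightarrow> 'v set set" where
  "arr_lattice H = {\<Inter>S | S. S \<subseteq> H}"

definition lat_deg :: "('k::field \<Rightarrow> 'v::ab_group_add \<Rightarrow> 'v) \<Rightarrow> 'v set set \<Rightarrow> 'v set \<Rightarrow> nat" where
  "lat_deg s H x = vector_space.dim s x - vector_space.dim s (\<Inter>H)"

function moebius :: "'q::order set \<Rightarrow> 'q \<Rightarrow> 'q \<Rightarrow> int" where
  "moebius Q p q =
     (if p = q then 1
      else if finite Q then - (\<Sum>r\<in>{r \<in> Q. p < r \<and> r \<le> q}. moebius Q r q)
      else undefined)"
  by pat_completeness auto
termination
proof (relation "measure (\<lambda>(Q, p, q). card {r \<in> Q. p < r})")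
  fix Q :: "'q::order set" and p q x :: 'q
  assume "finite Q" and "x \<in> {r \<in> Q. p < r \<and> r \<le> q}"
  then have "card {r \<in> Q. x < r} < card {r \<in> Q. p < r}"
    by (intro psubset_card_mono) (auto intro: less_trans)
  then show "((Q, x, q), (Q, p, q)) \<in> measure (\<lambda>(Q, p, q). card {r \<in> Q. p < r})"
    by simp
qed simp

declare moebius.simps [simp del]

text \<open>The cardinal \<open>d\<^sub>i\<^sub>j\<close>, the dimension of \<open>H\<^sub>i(L(H) - {V}; \<Lambda>\<^sup>j)\<close>.\<close>

definition arr_hdim ::
  "('k::field \<Rightarrow> 'v::ab_group_add \<Rightarrow> 'v) \<Rightarrow> 'v set set \<Rightarrow> nat \<Rightarrow> nat \<Rightarrow>
   ('v set \<Rightarrow>\<^sub>0 ('v set list \<Rightarrow>\<^sub>0 ('v list \<Rightarrow>\<^sub>0 'k))) rel" where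
  "arr_hdim s H i j =
     derived_colim_dim (pm_scale (*)) (arr_lattice H - {UNIV}) (ext_power s j) i"

end

theory Submission
  imports Defs "HOL-Library.Function_Algebras"
begin

text \<open>
  The poset \<open>\<L>(H) - {V}\<close> is covered by the principal ideals below the hyperplanes, and finite
  intersections of these ideals are principal. Hence a functor \<open>F\<close> has a Cech complex
  \<open>T\<^sub>n(F) = \<Oplus> F(\<Inter>S)\<close> over the sets \<open>S\<close> of \<open>n + 1\<close> hyperplanes. It is exact in positive degrees
  for free functors, so also for projective ones, and its homology in degree \<open>0\<close> is the colimit.
  The double complex \<open>T\<^sub>n(P\<^sub>m)\<close> of a projective resolution \<open>P\<close> of \<open>F\<close> therefore identifies the derived
  functors of the colimit with the homology of \<open>T(F)\<close>.

  Let \<open>F = \<Lambda>\<^sup>j\<close> and augment \<open>T(F)\<close> by \<open>\<Lambda>\<^sup>j(V)\<close>. For a hyperplane \<open>w\<close> the augmented complex of \<open>H\<close> in \<open>V\<close>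
  is the mapping cone of that of the restriction \<open>{h \<inter> w | h \<in> H - {w}}\<close> in \<open>w\<close> into that of \<open>H - {w}\<close>
  in \<open>V\<close>, and the complex of a restriction containing \<open>w\<close> itself is contractible. By induction on
  \<open>H\<close> this gives the vanishing, except for \<open>i + j < d(\<L>(H)) - 1\<close> when deleting \<open>w\<close> lowers the rank. In
  that case a vector \<open>v\<close> outside \<open>w\<close> lies in all other hyperplanes, the decomposition
  \<open>\<Lambda>\<^sup>j(U \<oplus> \<langle>v\<rangle>) = \<Lambda>\<^sup>j(U) \<oplus> v \<and> \<Lambda>\<^sup>j\<^sup>-\<^sup>1(U)\<close> is compatible with the complex, and the cone reduces to the complex
  of \<open>\<Lambda>\<^sup>j\<^sup>-\<^sup>1\<close> on the restriction to \<open>w\<close>.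

  Infinite \<open>H\<close> reduce to finite ones because chains have finite support. When the homology is
  concentrated in one degree, its dimension is an Euler characteristic, which the cross-cut theorem
  expresses by the Moebius function.
\<close>

section \<open>Linear algebra\<close>

text \<open>All exactness statements concern the augmented complex, graded by the number k of
  hyperplanes: homology in degree i sits at k = i + 1, and k = 0 holds the exterior power of V.
  Three ranges suffice: k + j below the rank, k + j above dim V, and k at least the rank (with k
  \<ge> 1). The first also yields degree 0 by comparison with the augmentation. If the total
  intersection is 0, rank and dim V agree and only k + j = dim V is left for the Euler
  characteristic. The induction meets an obstacle: on w several hyperplanes may have the same trace,
  and some may contain the ambient subspace. So the arrangement itself is never restricted. The
  indices remain hyperplanes of V, and only the subspace U in which they are intersected shrinks to
  U \<inter> w; repeated traces are then harmless. A second obstacle is that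
  \<open>derived_colim\<close> selects an unspecified resolution inside a fixed type. The double
  complex is therefore formed for an arbitrary resolution, and the one proving existence must remain
  in that type, which is why free functors are encoded by the heads of lists.\<close>

definition fscale :: "('k \<Rightarrow> 'b \<Rightarrow> 'b) \<Rightarrow> 'k \<Rightarrow> ('i \<Rightarrow> 'b) \<Rightarrow> 'i \<Rightarrow> 'b" where
  "fscale s c f = (\<lambda>x. s c (f x))"

lemma fscale_apply [simp]: "fscale s c f x = s c (f x)"
  by (simp add: fscale_def)

lemma vector_space_fscale:
  assumes "vector_space s"
  shows "vector_space (fscale s)"
proof -
  interpret vector_space s by fact
  show ?thesis
    by unfold_locales (auto simp: fun_eq_iff scale_right_distrib scale_left_distrib)
qed

lemma vector_space_times: "vector_space ((*) :: 'k::field \<Rightarrow> 'k \<Rightarrow> 'k)"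
  by unfold_locales (auto simp: algebra_simps)

lemma sum_fun_apply: "(\<Sum>a\<in>A. f a) x = (\<Sum>a\<in>A. f a x)"
  by (induction A rule: infinite_finite_induct) auto

lemma linearD:
  assumes "Vector_Spaces.linear s t f"
  shows "f (x + y) = f x + f y" "f (s c x) = t c (f x)" "f 0 = 0" "f (x - y) = f x - f y"
    "f (- x) = - f x" "f (sum g A) = (\<Sum>a\<in>A. f (g a))"
proof -
  interpret Vector_Spaces.linear s t f by fact
  show "f (x + y) = f x + f y" "f (s c x) = t c (f x)" "f 0 = 0" "f (x - y) = f x - f y"
    "f (- x) = - f x" "f (sum g A) = (\<Sum>a\<in>A. f (g a))"
    by (simp_all add: add scale zero diff neg sum)
qed

lemma linearI:
  assumes "vector_space s" "vector_space t"
    and "\<And>x y. f (x + y) = f x + f y" "\<And>c x. f (s c x) = t c (f x)"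
  shows "Vector_Spaces.linear s t f"
  using assms by (simp add: Vector_Spaces.linear_iff)

lemma module_vs: "vector_space s \<Longrightarrow> module s"
  by (simp add: module_iff_vector_space)

lemma subspaceD:
  assumes "vector_space s" "module.subspace s U"
  shows "0 \<in> U" "x \<in> U \<Longrightarrow> y \<in> U \<Longrightarrow> x + y \<in> U" "x \<in> U \<Longrightarrow> y \<in> U \<Longrightarrow> x - y \<in> U"
    "x \<in> U \<Longrightarrow> s c x \<in> U" "x \<in> U \<Longrightarrow> - x \<in> U" "(\<And>a. a \<in> A \<Longrightarrow> g a \<in> U) \<Longrightarrow> sum g A \<in> U"
proof -
  interpret vector_space s by fact
  show "0 \<in> U" "x \<in> U \<Longrightarrow> y \<in> U \<Longrightarrow> x + y \<in> U" "x \<in> U \<Longrightarrow> y \<in> U \<Longrightarrow> x - y \<in> U"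
    "x \<in> U \<Longrightarrow> s c x \<in> U" "x \<in> U \<Longrightarrow> - x \<in> U" "(\<And>a. a \<in> A \<Longrightarrow> g a \<in> U) \<Longrightarrow> sum g A \<in> U"
    using assms(2) by (blast intro: subspace_0 subspace_add subspace_diff subspace_scale
        subspace_neg subspace_sum)+
qed

section \<open>Cardinal dimensions and quotient spaces\<close>

lemma vdim_basis:
  assumes "vector_space s" "\<not> module.dependent s B" "module.span s B = U"
  shows "vdim s U =o |B|"
proof -
  interpret vector_space s by fact
  let ?B = "SOME B. \<not> dependent B \<and> span B = U"
  have "\<not> dependent ?B \<and> span ?B = U"
    by (rule someI[where x = B]) (use assms in auto)
  then obtain f where "bij_betw f ?B B"
    using bij_if_span_eq_span_bases[of ?B B] assms by auto
  then show ?thesis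
    unfolding vdim_def using card_of_ordIso by blast
qed

lemma vdim_zero:
  assumes "vector_space s"
  shows "vdim s {0} =o |{} :: 'z set|"
proof -
  interpret vector_space s by fact
  have "vdim s {0} =o |{} :: 'b set|"
    by (rule vdim_basis[OF assms]) (auto simp: independent_empty)
  then show ?thesis
    using card_of_empty_ordIso ordIso_transitive by blast
qed

lemma vdim_image:
  assumes s: "vector_space s" and t: "vector_space t" and U: "module.subspace s U"
    and g: "Vector_Spaces.linear s t g" "inj_on g U" "g ` U = U'"
  shows "vdim s U =o vdim t U'"
proof -
  interpret s: vector_space s by fact
  interpret t: vector_space t by fact
  interpret vector_space_pair s t by unfold_locales
  obtain B where B: "B \<subseteq> U" "\<not> s.dependent B" "U \<subseteq> s.span B"
    using s.maximal_independent_subset[of U] by blast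
  have sp: "s.span B = U"
    using B U s.span_minimal by blast
  have "vdim s U =o |B|"
    using vdim_basis[OF s B(2) sp] .
  moreover have "|B| =o |g ` B|"
    using card_of_ordIsoI[of g B "g ` B"] g(2) B(1) by (meson inj_on_imp_bij_betw inj_on_subset)
  moreover have "vdim t U' =o |g ` B|"
  proof (rule vdim_basis[OF t])
    show "\<not> t.dependent (g ` B)"
      using linear_independent_injective_image[OF g(1) B(2)] g(2) sp by simp
    show "t.span (g ` B) = U'"
      using linear_span_image[OF g(1)] sp g(3) by simp
  qed
  ultimately show ?thesis
    by (meson ordIso_symmetric ordIso_transitive)
qed

lemma quot_map_diff_in:
  assumes s: "vector_space s" and N: "module.subspace s N"
  shows "x - quot_map s N x \<in> N" "quot_map s N x - x \<in> N"
proof -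
  note q = quot_map[OF s N]
  have "quot_map s N (x - quot_map s N x) = 0"
    using q(2) linearD(4)[OF q(1)] by simp
  then show *: "x - quot_map s N x \<in> N"
    using q(3) by blast
  show "quot_map s N x - x \<in> N"
    using subspaceD(5)[OF s N *] by simp
qed

lemma quot_map_eq_0_iff:
  assumes s: "vector_space s" and N: "module.subspace s N"
  shows "quot_map s N x = 0 \<longleftrightarrow> x \<in> N"
  using quot_map(3)[OF s N] by blast

lemma quot_map_eq_iff:
  assumes s: "vector_space s" and N: "module.subspace s N"
  shows "quot_map s N x = quot_map s N y \<longleftrightarrow> x - y \<in> N"
  using quot_map_eq_0_iff[OF assms, of "x - y"] linearD(4)[OF quot_map(1)[OF assms], of x y] by simp

lemma quot_map_in:
  assumes s: "vector_space s" and N: "module.subspace s N" and U: "module.subspace s U"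
    and "N \<subseteq> U" "x \<in> U"
  shows "quot_map s N x \<in> U"
proof -
  have "x - (x - quot_map s N x) \<in> U"
    using subspaceD(3)[OF s U assms(5)] quot_map_diff_in[OF s N] assms(4) by blast
  then show ?thesis by simp
qed

lemma quot_sub:
  assumes "vector_space s" "module.subspace s N" "module.subspace s U" "N \<subseteq> U"
  shows "quot s U N \<subseteq> U"
  using quot_map_in[OF assms] by (auto simp: quot_def)

lemma subspace_quot:
  assumes "vector_space s" "module.subspace s N" "module.subspace s U"
  shows "module.subspace s (quot s U N)"
proof -
  interpret Vector_Spaces.linear s s "quot_map s N" using quot_map(1)[OF assms(1,2)] .
  show ?thesis unfolding quot_def using assms(3) by (rule subspace_image)
qed

lemma quot_zero:
  assumes "vector_space s" "module.subspace s U"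
  shows "quot s U {0} = U"
proof -
  interpret vector_space s by fact
  have "quot_map s {0} x = x" for x
    using quot_map_diff_in[OF assms(1), of "{0}"] by simp
  then show ?thesis by (simp add: quot_def)
qed

text \<open>Diagram chases produce relations rather than maps: a zigzag determines its far end only
  up to a boundary. A linear relation that is total on both sides and matches boundaries with
  boundaries still induces an isomorphism of the quotients.\<close>

lemma vdim_quot_cong:
  assumes s: "vector_space s" and t: "vector_space t"
    and ZA: "module.subspace s ZA" and BA: "module.subspace s BA" "BA \<subseteq> ZA"
    and ZB: "module.subspace t ZB" and BB: "module.subspace t BB" "BB \<subseteq> ZB"
    and R_sub: "\<And>a b. R a b \<Longrightarrow> a \<in> ZA \<and> b \<in> ZB"
    and R_add: "\<And>a b a' b'. R a b \<Longrightarrow> R a' b' \<Longrightarrow> R (a + a') (b + b')"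
    and R_scale: "\<And>c a b. R a b \<Longrightarrow> R (s c a) (t c b)"
    and R_left: "\<And>a. a \<in> ZA \<Longrightarrow> \<exists>b. R a b"
    and R_right: "\<And>b. b \<in> ZB \<Longrightarrow> \<exists>a. R a b"
    and R_bnd: "\<And>a b. R a b \<Longrightarrow> a \<in> BA \<longleftrightarrow> b \<in> BB"
  shows "vdim s (quot s ZA BA) =o vdim t (quot t ZB BB)"
proof -
  interpret s: vector_space s by fact
  interpret t: vector_space t by fact
  interpret vector_space_pair s t by unfold_locales
  let ?U = "quot s ZA BA"
  note qs = quot_map[OF s BA(1)] and qt = quot_map[OF t BB(1)]
  have UZ: "?U \<subseteq> ZA" by (rule quot_sub[OF s BA(1) ZA BA(2)])
  have subU: "s.subspace ?U" by (rule subspace_quot[OF s BA(1) ZA])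
  obtain X where X: "X \<subseteq> ?U" "\<not> s.dependent X" "?U \<subseteq> s.span X"
    using s.maximal_independent_subset[of ?U] by blast
  have spX: "s.span X = ?U"
    using X subU s.span_minimal by blast
  \<comment> \<open>Partners are chosen only on a basis of the quotient and extended linearly; a
    pointwise choice on all of it would not be linear.\<close>
  define b where "b x = (SOME y. R x y)" for x
  have b: "R x (b x)" if "x \<in> X" for x
    unfolding b_def by (rule someI_ex) (use R_left that X(1) UZ in blast)
  define f where "f = construct X b"
  have lf: "Vector_Spaces.linear s t f"
    unfolding f_def by (rule linear_construct[OF X(2)])
  have R00: "R 0 0"
  proof -
    obtain y where "R 0 y" using R_left subspaceD(1)[OF s ZA] by blast
    from R_scale[OF this, of 0] show ?thesis by simp
  qed
  have Rf: "R x (f x)" if "x \<in> s.span X" for x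
    using that
  proof (induction rule: s.span_induct_alt)
    case base
    show ?case using R00 linearD(3)[OF lf] by simp
  next
    case (step c x y)
    have "R x (f x)"
      using b[OF step(1)] construct_basis[OF X(2) step(1), of b] by (simp add: f_def)
    from R_add[OF R_scale[OF this] step(2)] show ?case
      by (simp add: linearD[OF lf])
  qed
  define g where "g x = quot_map t BB (f x)" for x
  have lg: "Vector_Spaces.linear s t g"
    using Vector_Spaces.linear_compose[OF lf qt(1)] by (simp add: g_def[abs_def] comp_def)
  have inj: "inj_on g ?U"
  proof (rule inj_onI)
    fix x y assume xy: "x \<in> ?U" "y \<in> ?U" "g x = g y"
    then have d: "x - y \<in> ?U" using subspaceD(3)[OF s subU] by blast
    have "quot_map t BB (f (x - y)) = 0"
      using xy(3) by (simp add: g_def linearD[OF lf] linearD[OF qt(1)])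
    then have "f (x - y) \<in> BB"
      using quot_map_eq_0_iff[OF t BB(1)] by simp
    then have "x - y \<in> BA"
      using R_bnd[OF Rf] d spX by blast
    then have "quot_map s BA (x - y) = 0"
      using quot_map_eq_0_iff[OF s BA(1)] by simp
    moreover have "quot_map s BA (x - y) = x - y"
      using d qs(2) by (auto simp: quot_def)
    ultimately show "x = y" by simp
  qed
  have im: "g ` ?U = quot t ZB BB"
  proof (intro equalityI subsetI)
    fix y assume "y \<in> g ` ?U"
    then show "y \<in> quot t ZB BB"
      using Rf R_sub spX by (fastforce simp: g_def quot_def)
  next
    fix y assume "y \<in> quot t ZB BB"
    then obtain z where z: "z \<in> ZB" "y = quot_map t BB z" by (auto simp: quot_def)
    obtain a where a: "R a z" using R_right z by blast
    define x where "x = quot_map s BA a"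
    have x: "x \<in> ?U" using a R_sub by (auto simp: quot_def x_def)
    \<comment> \<open>Differences are written with the scalar -1 because R is closed under sums and
      multiples. As a - x lies in BA, its partner z - f x lies in BB.\<close>
    have "R (a + s (-1) x) (z + t (-1) (f x))"
      using R_add[OF a R_scale[OF Rf]] x spX by blast
    moreover have "a + s (-1) x \<in> BA"
      using quot_map_diff_in(1)[OF s BA(1), of a] by (simp add: x_def)
    ultimately have "z - f x \<in> BB" using R_bnd by fastforce
    then have "y = g x"
      using quot_map_eq_iff[OF t BB(1)] z(2) by (simp add: g_def)
    then show "y \<in> g ` ?U" using x by blast
  qed
  show ?thesis by (rule vdim_image[OF s t subU lg inj im])
qed

section \<open>Free functors and the existence of projective resolutions\<close>

text \<open>\<open>prepend p\<close> and \<open>tail_at p\<close> are the inclusion and the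
  projection of the summand with index p. Recording the index as the head of a list keeps a direct
  sum over p inside the type it started from, so that free covers can be iterated.\<close>

definition prepend :: "'q \<Rightarrow> ('q list \<Rightarrow>\<^sub>0 'c::zero) \<Rightarrow> 'q list \<Rightarrow>\<^sub>0 'c" where
  "prepend p x = Abs_poly_mapping
     (\<lambda>l. case l of [] \<Rightarrow> 0 | a # l' \<Rightarrow> if a = p then Poly_Mapping.lookup x l' else 0)"

definition tail_at :: "'q \<Rightarrow> ('q list \<Rightarrow>\<^sub>0 'c::zero) \<Rightarrow> 'q list \<Rightarrow>\<^sub>0 'c" where
  "tail_at p y = Abs_poly_mapping (\<lambda>l. Poly_Mapping.lookup y (p # l))"

lemma lookup_prepend:
  "Poly_Mapping.lookup (prepend p x) l =
     (case l of [] \<Rightarrow> 0 | a # l' \<Rightarrow> if a = p then Poly_Mapping.lookup x l' else 0)"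
proof -
  let ?f = "\<lambda>l. case l of [] \<Rightarrow> 0 | a # l' \<Rightarrow> if a = p then Poly_Mapping.lookup x l' else 0"
  have "{l. ?f l \<noteq> 0} \<subseteq> (#) p ` Poly_Mapping.keys x"
  proof
    fix l assume "l \<in> {l. ?f l \<noteq> 0}"
    then show "l \<in> (#) p ` Poly_Mapping.keys x"
      by (cases l) (auto split: if_splits simp: in_keys_iff)
  qed
  then have "finite {l. ?f l \<noteq> 0}"
    by (rule finite_subset) simp
  then show ?thesis by (simp add: prepend_def)
qed

lemma lookup_tail_at [simp]: "Poly_Mapping.lookup (tail_at p y) l = Poly_Mapping.lookup y (p # l)"
proof -
  have "{l. Poly_Mapping.lookup y (p # l) \<noteq> 0} = (#) p -` Poly_Mapping.keys y"
    by (auto simp: in_keys_iff)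
  moreover have "finite ((#) p -` Poly_Mapping.keys y)"
    by (rule finite_vimageI) auto
  ultimately show ?thesis by (simp add: tail_at_def)
qed

lemma tail_at_prepend: "tail_at p (prepend p' x) = (if p = p' then x else 0)"
  by (auto intro!: poly_mapping_eqI simp: lookup_prepend)

lemma linear_prepend:
  assumes "vector_space s"
  shows "Vector_Spaces.linear (pm_scale s) (pm_scale s) (prepend p)"
proof -
  interpret vector_space s by fact
  show ?thesis
    by (rule linearI)
      (auto intro!: poly_mapping_eqI vector_space_pm_scale[OF assms]
        simp: lookup_prepend lookup_add lookup_pm_scale[OF assms] split: list.splits)
qed

lemma linear_tail_at:
  assumes "vector_space s"
  shows "Vector_Spaces.linear (pm_scale s) (pm_scale s) (tail_at p)"
  by (rule linearI)
    (auto intro!: poly_mapping_eqI vector_space_pm_scale[OF assms]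
      simp: lookup_add lookup_pm_scale[OF assms])

lemma finite_tails: "finite {p. tail_at p y \<noteq> 0}"
proof (rule finite_subset)
  show "{p. tail_at p y \<noteq> 0} \<subseteq> hd ` Poly_Mapping.keys y"
  proof
    fix p assume "p \<in> {p. tail_at p y \<noteq> 0}"
    then obtain l where "Poly_Mapping.lookup (tail_at p y) l \<noteq> 0"
      by (metis (mono_tags) mem_Collect_eq poly_mapping_eqI lookup_zero)
    then have "p # l \<in> Poly_Mapping.keys y" by (simp add: in_keys_iff)
    then show "p \<in> hd ` Poly_Mapping.keys y" by force
  qed
qed simp

text \<open>
  The free functor \<open>q \<mapsto> \<Oplus> G(p)\<close> over \<open>p \<le> q\<close>; the summand of \<open>p\<close> consists of the elements
  supported on lists with head \<open>p\<close>.
\<close>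

definition free_obj :: "'q::order set \<Rightarrow> ('q, 'q list \<Rightarrow>\<^sub>0 'c::zero) vfunctor \<Rightarrow> 'q \<Rightarrow> ('q list \<Rightarrow>\<^sub>0 'c) set"
  where "free_obj Q G q = {y. (\<forall>l\<in>Poly_Mapping.keys y. l \<noteq> [] \<and> hd l \<in> Q \<and> hd l \<le> q) \<and>
     (\<forall>p\<in>Q. tail_at p y \<in> obj G p)}"

definition free_functor ::
  "'q::order set \<Rightarrow> ('q, 'q list \<Rightarrow>\<^sub>0 'c::zero) vfunctor \<Rightarrow> ('q, 'q list \<Rightarrow>\<^sub>0 'c) vfunctor" where
  "free_functor Q G = \<lparr>obj = free_obj Q G, arr = (\<lambda>_ _ y. y)\<rparr>"

text \<open>The universal property of the free functor: linear maps from G p to X p, with no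
  compatibility between different p, extend to the sum of their transports to q. Only the finitely
  many nonzero tails are summed.\<close>

definition free_ext ::
  "'q::order set \<Rightarrow> ('q, 'd::comm_monoid_add) vfunctor \<Rightarrow> ('q \<Rightarrow> ('q list \<Rightarrow>\<^sub>0 'c::zero) \<Rightarrow> 'd) \<Rightarrow>
   'q \<Rightarrow> ('q list \<Rightarrow>\<^sub>0 'c) \<Rightarrow> 'd" where
  "free_ext Q X m q y = (\<Sum>p | p \<in> Q \<and> p \<le> q \<and> tail_at p y \<noteq> 0. arr X p q (m p (tail_at p y)))"

lemma obj_free_functor [simp]: "obj (free_functor Q G) = free_obj Q G"
  and arr_free_functor [simp]: "arr (free_functor Q G) p q = (\<lambda>y. y)"
  by (simp_all add: free_functor_def)

lemma is_functorD:
  assumes "is_functor s Q F"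
  shows "q \<in> Q \<Longrightarrow> module.subspace s (obj F q)"
    and "p \<in> Q \<Longrightarrow> q \<in> Q \<Longrightarrow> p \<le> q \<Longrightarrow> Vector_Spaces.linear s s (arr F p q)"
    and "p \<in> Q \<Longrightarrow> q \<in> Q \<Longrightarrow> p \<le> q \<Longrightarrow> x \<in> obj F p \<Longrightarrow> arr F p q x \<in> obj F q"
    and "q \<in> Q \<Longrightarrow> x \<in> obj F q \<Longrightarrow> arr F q q x = x"
    and "p \<in> Q \<Longrightarrow> q \<in> Q \<Longrightarrow> r \<in> Q \<Longrightarrow> p \<le> q \<Longrightarrow> q \<le> r \<Longrightarrow> x \<in> obj F p \<Longrightarrow>
      arr F q r (arr F p q x) = arr F p r x"
  using assms by (simp_all add: is_functor_def image_subset_iff)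

lemma is_nat_transD:
  assumes "is_nat_trans s t Q F G \<eta>"
  shows "q \<in> Q \<Longrightarrow> Vector_Spaces.linear s t (\<eta> q)"
    and "q \<in> Q \<Longrightarrow> x \<in> obj F q \<Longrightarrow> \<eta> q x \<in> obj G q"
    and "p \<in> Q \<Longrightarrow> q \<in> Q \<Longrightarrow> p \<le> q \<Longrightarrow> x \<in> obj F p \<Longrightarrow> \<eta> q (arr F p q x) = arr G p q (\<eta> p x)"
  using assms by (simp_all add: is_nat_trans_def image_subset_iff)

text \<open>Replaces the summation range, which depends on y, by any finite set containing it, so
  that sums for different arguments can be compared over a common range.\<close>

lemma free_ext_eq_sum:
  assumes "\<And>p. p \<in> Q \<Longrightarrow> p \<le> q \<Longrightarrow> arr X p q (m p 0) = 0"
    and "finite J" "\<And>p. p \<in> Q \<Longrightarrow> p \<le> q \<Longrightarrow> tail_at p y \<noteq> 0 \<Longrightarrow> p \<in> J"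
  shows "free_ext Q X m q y = (\<Sum>p\<in>{p \<in> J. p \<in> Q \<and> p \<le> q}. arr X p q (m p (tail_at p y)))"
  unfolding free_ext_def
  by (rule sum.mono_neutral_left) (use assms in auto)

lemma linear_free_ext:
  fixes s :: "'k::field \<Rightarrow> 'c::ab_group_add \<Rightarrow> 'c" and X :: "('q::order, 'd::ab_group_add) vfunctor"
  assumes s: "vector_space s" and u: "vector_space u" and X: "is_functor u Q X"
    and m: "\<And>p. p \<in> Q \<Longrightarrow> Vector_Spaces.linear (pm_scale s) u (m p)" and q: "q \<in> Q"
  shows "Vector_Spaces.linear (pm_scale s) u (free_ext Q X m q)"
proof (rule linearI[OF vector_space_pm_scale[OF s] u])
  interpret u: vector_space u by fact
  have z: "arr X p q (m p 0) = 0" if "p \<in> Q" "p \<le> q" for p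
    using linearD(3)[OF m[OF that(1)]] linearD(3)[OF is_functorD(2)[OF X that(1) q that(2)]] by simp
  note lt = linearD[OF linear_tail_at[OF s]]
  fix x y :: "'q list \<Rightarrow>\<^sub>0 'c" and c
  define J where "J = {p. tail_at p x \<noteq> 0} \<union> {p. tail_at p y \<noteq> 0}"
  have fJ: "finite J" by (simp add: J_def finite_tails)
  have *: "free_ext Q X m q w = (\<Sum>p\<in>{p \<in> J. p \<in> Q \<and> p \<le> q}. arr X p q (m p (tail_at p w)))"
    if "\<And>p. tail_at p w \<noteq> 0 \<Longrightarrow> p \<in> J" for w
    by (rule free_ext_eq_sum) (use z fJ that in auto)
  have a: "arr X p q (m p (v + w)) = arr X p q (m p v) + arr X p q (m p w)"
    "arr X p q (m p (pm_scale s c v)) = u c (arr X p q (m p v))"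
    if "p \<in> Q" "p \<le> q" for p v w
    using linearD(1,2)[OF m[OF that(1)]] linearD(1,2)[OF is_functorD(2)[OF X that(1) q that(2)]]
    by simp_all
  have "free_ext Q X m q (x + y) = (\<Sum>p\<in>{p \<in> J. p \<in> Q \<and> p \<le> q}. arr X p q (m p (tail_at p (x + y))))"
    by (rule *) (auto simp: J_def lt)
  also have "\<dots> = (\<Sum>p\<in>{p \<in> J. p \<in> Q \<and> p \<le> q}. arr X p q (m p (tail_at p x)))
      + (\<Sum>p\<in>{p \<in> J. p \<in> Q \<and> p \<le> q}. arr X p q (m p (tail_at p y)))"
    unfolding sum.distrib[symmetric] by (rule sum.cong) (auto simp: lt a)
  also have "\<dots> = free_ext Q X m q x + free_ext Q X m q y"
    by (subst (1 2) *) (auto simp: J_def)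
  finally show "free_ext Q X m q (x + y) = free_ext Q X m q x + free_ext Q X m q y" .
  have "free_ext Q X m q (pm_scale s c x) =
      (\<Sum>p\<in>{p \<in> J. p \<in> Q \<and> p \<le> q}. arr X p q (m p (tail_at p (pm_scale s c x))))"
    by (rule *) (auto simp: J_def lt module.scale_zero_right[OF module_vs[OF vector_space_pm_scale[OF s]]])
  also have "\<dots> = (\<Sum>p\<in>{p \<in> J. p \<in> Q \<and> p \<le> q}. u c (arr X p q (m p (tail_at p x))))"
    by (rule sum.cong) (auto simp: lt a)
  also have "\<dots> = u c (free_ext Q X m q x)"
    by (subst *) (auto simp: J_def u.scale_sum_right)
  finally show "free_ext Q X m q (pm_scale s c x) = u c (free_ext Q X m q x)" .
qed

lemma tail_at_free_obj:
  assumes "y \<in> free_obj Q G q" "tail_at p y \<noteq> 0"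
  shows "p \<in> Q" "p \<le> q" "tail_at p y \<in> obj G p"
proof -
  obtain l where "Poly_Mapping.lookup (tail_at p y) l \<noteq> 0"
    using assms(2) by (metis poly_mapping_eqI lookup_zero)
  then have "p # l \<in> Poly_Mapping.keys y" by (simp add: in_keys_iff)
  then show "p \<in> Q" "p \<le> q" using assms(1) by (force simp: free_obj_def)+
  then show "tail_at p y \<in> obj G p" using assms(1) by (simp add: free_obj_def)
qed

lemma free_obj_mono: "p \<le> q \<Longrightarrow> free_obj Q G p \<subseteq> free_obj Q G q"
  by (auto simp: free_obj_def intro: order_trans)

lemma nat_trans_free_ext:
  fixes s :: "'k::field \<Rightarrow> 'c::ab_group_add \<Rightarrow> 'c" and X :: "('q::order, 'd::ab_group_add) vfunctor"
  assumes s: "vector_space s" and u: "vector_space u" and X: "is_functor u Q X"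
    and m: "\<And>p. p \<in> Q \<Longrightarrow> Vector_Spaces.linear (pm_scale s) u (m p)"
      "\<And>p x. p \<in> Q \<Longrightarrow> x \<in> obj G p \<Longrightarrow> m p x \<in> obj X p"
  shows "is_nat_trans (pm_scale s) u Q (free_functor Q G) X (free_ext Q X m)"
  unfolding is_nat_trans_def
proof (intro conjI ballI impI)
  fix q assume q: "q \<in> Q"
  show "Vector_Spaces.linear (pm_scale s) u (free_ext Q X m q)"
    by (rule linear_free_ext[OF s u X m(1) q])
  show "free_ext Q X m q ` obj (free_functor Q G) q \<subseteq> obj X q"
  proof
    fix z assume "z \<in> free_ext Q X m q ` obj (free_functor Q G) q"
    then obtain y where y: "y \<in> free_obj Q G q" "z = free_ext Q X m q y" by auto
    show "z \<in> obj X q"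
      unfolding y(2) free_ext_def
      by (rule subspaceD(6)[OF u is_functorD(1)[OF X q]])
        (use m(2) q tail_at_free_obj[OF y(1)] is_functorD(3)[OF X] in auto)
  qed
next
  fix p q y assume pq: "p \<in> Q" "q \<in> Q" "p \<le> q" and "y \<in> obj (free_functor Q G) p"
  then have y: "y \<in> free_obj Q G p" by simp
  note la = linearD[OF is_functorD(2)[OF X pq]]
  have "arr X p q (free_ext Q X m p y) =
      (\<Sum>r | r \<in> Q \<and> r \<le> p \<and> tail_at r y \<noteq> 0. arr X p q (arr X r p (m r (tail_at r y))))"
    by (simp add: free_ext_def la)
  also have "\<dots> = (\<Sum>r | r \<in> Q \<and> r \<le> q \<and> tail_at r y \<noteq> 0. arr X r q (m r (tail_at r y)))"
  proof (rule sum.cong)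
    show "{r \<in> Q. r \<le> p \<and> tail_at r y \<noteq> 0} = {r \<in> Q. r \<le> q \<and> tail_at r y \<noteq> 0}"
      using tail_at_free_obj[OF y] pq by (auto intro: order_trans)
    fix r assume "r \<in> {r \<in> Q. r \<le> q \<and> tail_at r y \<noteq> 0}"
    then show "arr X p q (arr X r p (m r (tail_at r y))) = arr X r q (m r (tail_at r y))"
      using tail_at_free_obj[OF y, of r] m(2)[of r "tail_at r y"] is_functorD(5)[OF X _ pq(1,2) _ pq(3)]
      by blast
  qed
  finally show "free_ext Q X m q (arr (free_functor Q G) p q y) = arr X p q (free_ext Q X m p y)"
    by (simp add: free_ext_def)
qed

lemma prepend_in_free_obj:
  assumes "\<And>q. q \<in> Q \<Longrightarrow> 0 \<in> obj G q" "p \<in> Q" "p \<le> q" "x \<in> obj G p"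
  shows "prepend p x \<in> free_obj Q G q"
  using assms
  by (auto simp: free_obj_def tail_at_prepend in_keys_iff lookup_prepend split: list.splits if_splits)

lemma is_functor_free:
  fixes s :: "'k::field \<Rightarrow> 'c::ab_group_add \<Rightarrow> 'c"
  assumes s: "vector_space s" and G: "is_functor (pm_scale s) Q G"
  shows "is_functor (pm_scale s) Q (free_functor Q G)"
proof -
  interpret vector_space s by fact
  interpret p: vector_space "pm_scale s :: 'k \<Rightarrow> ('b list \<Rightarrow>\<^sub>0 'c) \<Rightarrow> _"
    by (rule vector_space_pm_scale[OF s])
  note lt = linearD[OF linear_tail_at[OF s]]
  have "p.subspace (free_obj Q G q)" if "q \<in> Q" for q
  proof (rule p.subspaceI)
    show "0 \<in> free_obj Q G q"
      by (auto simp: free_obj_def lt intro: subspaceD(1)[OF p.vector_space_axioms is_functorD(1)[OF G]])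
  next
    fix x y assume xy: "x \<in> free_obj Q G q" "y \<in> free_obj Q G q"
    then have "Poly_Mapping.keys (x + y) \<subseteq> Poly_Mapping.keys x \<union> Poly_Mapping.keys y"
      by (simp add: keys_add)
    then show "x + y \<in> free_obj Q G q"
      using xy unfolding free_obj_def
      by (auto simp: lt intro!: subspaceD(2)[OF p.vector_space_axioms is_functorD(1)[OF G]])
  next
    fix c x assume x: "x \<in> free_obj Q G q"
    have "Poly_Mapping.keys (pm_scale s c x) \<subseteq> Poly_Mapping.keys x"
      by (auto simp: in_keys_iff lookup_pm_scale[OF s])
    then show "pm_scale s c x \<in> free_obj Q G q"
      using x unfolding free_obj_def
      by (auto simp: lt intro!: subspaceD(4)[OF p.vector_space_axioms is_functorD(1)[OF G]])
  qed
  then show ?thesis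
    unfolding is_functor_def
    using free_obj_mono[of _ _ Q G] p.linear_ident by auto
qed

lemma sum_prepend_tail_at:
  assumes "y \<in> free_obj Q G q"
  shows "(\<Sum>p | p \<in> Q \<and> p \<le> q \<and> tail_at p y \<noteq> 0. prepend p (tail_at p y)) = (y :: 'q::order list \<Rightarrow>\<^sub>0 'c::ab_group_add)"
proof (rule poly_mapping_eqI)
  fix l :: "'q list"
  let ?J = "{p. p \<in> Q \<and> p \<le> q \<and> tail_at p y \<noteq> 0}"
  have fin: "finite ?J" by (rule finite_subset[OF _ finite_tails[of y]]) auto
  show "Poly_Mapping.lookup (\<Sum>p\<in>?J. prepend p (tail_at p y)) l = Poly_Mapping.lookup y l"
  proof (cases l)
    case Nil
    then show ?thesis using assms
      by (auto simp: lookup_sum lookup_prepend free_obj_def in_keys_iff)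
  next
    case (Cons a l')
    have "Poly_Mapping.lookup y l = 0" if "a \<notin> ?J"
    proof (rule ccontr)
      assume "Poly_Mapping.lookup y l \<noteq> 0"
      then have "Poly_Mapping.lookup (tail_at a y) l' \<noteq> 0" by (simp add: Cons)
      then have "tail_at a y \<noteq> 0" by (metis lookup_zero)
      then show False using that tail_at_free_obj[OF assms] by blast
    qed
    then show ?thesis using fin
      by (auto simp: Cons lookup_sum lookup_prepend)
  qed
qed

text \<open>Over a field each surjection \<open>\<pi> q\<close> has a linear section. The sections
  are chosen objectwise and applied to generators only; the universal property then extends the
  result to a natural transformation, and naturality of \<pi> and \<phi> shows that it lifts
  \<phi>.\<close>

lemma is_projective_free:
  fixes s :: "'k::field \<Rightarrow> 'c::ab_group_add \<Rightarrow> 'c" and G :: "('q::order, 'q list \<Rightarrow>\<^sub>0 'c) vfunctor"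
  assumes s: "vector_space s" and G: "is_functor (pm_scale s) Q G"
  shows "is_projective (pm_scale s) Q (free_functor Q G)"
  unfolding is_projective_def
proof (intro conjI allI impI)
  show "is_functor (pm_scale s) Q (free_functor Q G)" by (rule is_functor_free[OF s G])
  let ?s = "pm_scale s :: 'k \<Rightarrow> ('q list \<Rightarrow>\<^sub>0 'c) \<Rightarrow> _"
  fix X Y :: "('q, 'q list \<Rightarrow>\<^sub>0 'c) vfunctor" and \<pi> \<phi>
  assume asm: "is_functor ?s Q X \<and> is_functor ?s Q Y \<and> is_nat_trans ?s ?s Q X Y \<pi> \<and>
    (\<forall>q\<in>Q. \<pi> q ` obj X q = obj Y q) \<and> is_nat_trans ?s ?s Q (free_functor Q G) Y \<phi>"
  then have X: "is_functor ?s Q X" and Y: "is_functor ?s Q Y" and \<pi>: "is_nat_trans ?s ?s Q X Y \<pi>"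
    and sur: "\<And>q. q \<in> Q \<Longrightarrow> \<pi> q ` obj X q = obj Y q"
    and \<phi>: "is_nat_trans ?s ?s Q (free_functor Q G) Y \<phi>" by auto
  have vs: "vector_space ?s" by (rule vector_space_pm_scale[OF s])
  interpret v: vector_space ?s by (rule vs)
  interpret vector_space_pair ?s ?s by unfold_locales
  have "\<exists>\<tau>. \<forall>q\<in>Q. Vector_Spaces.linear ?s ?s (\<tau> q) \<and> range (\<tau> q) \<subseteq> obj X q \<and> (\<forall>y\<in>obj Y q. \<pi> q (\<tau> q y) = y)"
  proof (rule bchoice, rule ballI)
    fix q assume q: "q \<in> Q"
    obtain g where "range g \<subseteq> obj X q" "Vector_Spaces.linear ?s ?s g" "\<forall>v\<in>\<pi> q ` obj X q. \<pi> q (g v) = v"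
      using linear_exists_right_inverse_on[OF is_nat_transD(1)[OF \<pi> q] is_functorD(1)[OF X q]] by auto
    then show "\<exists>x. Vector_Spaces.linear ?s ?s x \<and> range x \<subseteq> obj X q \<and> (\<forall>y\<in>obj Y q. \<pi> q (x y) = y)"
      using sur[OF q] by auto
  qed
  then obtain \<tau> where \<tau>: "\<And>q. q \<in> Q \<Longrightarrow> Vector_Spaces.linear ?s ?s (\<tau> q)"
    "\<And>q y. q \<in> Q \<Longrightarrow> \<tau> q y \<in> obj X q" "\<And>q y. q \<in> Q \<Longrightarrow> y \<in> obj Y q \<Longrightarrow> \<pi> q (\<tau> q y) = y"
    by (metis rangeI subsetD)
  define m where "m p x = \<tau> p (\<phi> p (prepend p x))" for p x
  have lm: "Vector_Spaces.linear ?s ?s (m p)" if "p \<in> Q" for p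
    using Vector_Spaces.linear_compose[OF Vector_Spaces.linear_compose[OF linear_prepend[OF s, of p]
          is_nat_transD(1)[OF \<phi> that]] \<tau>(1)[OF that]]
    by (simp add: m_def[abs_def] comp_def)
  have m_in: "m p x \<in> obj X p" if "p \<in> Q" for p x
    using \<tau>(2)[OF that] by (simp add: m_def)
  have G0: "0 \<in> obj G q" if "q \<in> Q" for q
    using subspaceD(1)[OF vs is_functorD(1)[OF G that]] .
  show "\<exists>\<psi>. is_nat_trans ?s ?s Q (free_functor Q G) X \<psi> \<and>
      (\<forall>q\<in>Q. \<forall>x\<in>obj (free_functor Q G) q. \<pi> q (\<psi> q x) = \<phi> q x)"
  proof (intro exI[of _ "free_ext Q X m"] conjI ballI)
    show "is_nat_trans ?s ?s Q (free_functor Q G) X (free_ext Q X m)"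
      by (rule nat_trans_free_ext[OF s vs X lm m_in])
    fix q y assume q: "q \<in> Q" and "y \<in> obj (free_functor Q G) q"
    then have y: "y \<in> free_obj Q G q" by simp
    let ?J = "{p. p \<in> Q \<and> p \<le> q \<and> tail_at p y \<noteq> 0}"
    have "\<pi> q (free_ext Q X m q y) = (\<Sum>p\<in>?J. \<pi> q (arr X p q (m p (tail_at p y))))"
      by (simp add: free_ext_def linearD[OF is_nat_transD(1)[OF \<pi> q]])
    also have "\<dots> = (\<Sum>p\<in>?J. \<phi> q (prepend p (tail_at p y)))"
    proof (rule sum.cong[OF refl])
      fix p assume p: "p \<in> ?J"
      then have pr: "prepend p (tail_at p y) \<in> free_obj Q G p"
        using prepend_in_free_obj[OF G0, where p = p] tail_at_free_obj[OF y, of p] by simp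
      then have "\<phi> p (prepend p (tail_at p y)) \<in> obj Y p"
        using is_nat_transD(2)[OF \<phi>, of p] p by simp
      then have "\<pi> p (m p (tail_at p y)) = \<phi> p (prepend p (tail_at p y))"
        using \<tau>(3) p by (simp add: m_def)
      then have "\<pi> q (arr X p q (m p (tail_at p y))) = arr Y p q (\<phi> p (prepend p (tail_at p y)))"
        using is_nat_transD(3)[OF \<pi> _ q] p m_in by simp
      also have "\<dots> = \<phi> q (prepend p (tail_at p y))"
        using is_nat_transD(3)[OF \<phi> _ q, of p "prepend p (tail_at p y)"] p pr by simp
      finally show "\<pi> q (arr X p q (m p (tail_at p y))) = \<phi> q (prepend p (tail_at p y))" .
    qed
    also have "\<dots> = \<phi> q y"
      by (simp add: linearD(6)[OF is_nat_transD(1)[OF \<phi> q], symmetric] sum_prepend_tail_at[OF y])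
    finally show "\<pi> q (free_ext Q X m q y) = \<phi> q y" .
  qed
qed

abbreviation free_cover :: "'q::order set \<Rightarrow> ('q, 'q list \<Rightarrow>\<^sub>0 'c::ab_group_add) vfunctor \<Rightarrow>
    'q \<Rightarrow> ('q list \<Rightarrow>\<^sub>0 'c) \<Rightarrow> 'q list \<Rightarrow>\<^sub>0 'c" where
  "free_cover Q G \<equiv> free_ext Q G (\<lambda>_ x. x)"

lemma nat_trans_free_cover:
  fixes s :: "'k::field \<Rightarrow> 'c::ab_group_add \<Rightarrow> 'c"
  assumes s: "vector_space s" and G: "is_functor (pm_scale s) Q G"
  shows "is_nat_trans (pm_scale s) (pm_scale s) Q (free_functor Q G) G (free_cover Q G)"
proof -
  interpret vector_space "pm_scale s :: 'k \<Rightarrow> ('b list \<Rightarrow>\<^sub>0 'c) \<Rightarrow> _"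
    by (rule vector_space_pm_scale[OF s])
  show ?thesis
    by (rule nat_trans_free_ext[OF s vector_space_axioms G]) (auto intro: linear_ident)
qed

lemma free_cover_prepend:
  fixes s :: "'k::field \<Rightarrow> 'c::ab_group_add \<Rightarrow> 'c"
  assumes s: "vector_space s" and G: "is_functor (pm_scale s) Q G" and q: "q \<in> Q" "x \<in> obj G q"
  shows "free_cover Q G q (prepend q x) = x"
proof -
  have "free_cover Q G q (prepend q x) = (\<Sum>p\<in>{p \<in> {q}. p \<in> Q \<and> p \<le> q}. arr G p q (tail_at p (prepend q x)))"
  proof (rule free_ext_eq_sum)
    show "arr G p q 0 = 0" if "p \<in> Q" "p \<le> q" for p
      by (rule linearD(3)[OF is_functorD(2)[OF G that(1) q(1) that(2)]])
  qed (auto simp: tail_at_prepend split: if_splits)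
  also have "{p \<in> {q}. p \<in> Q \<and> p \<le> q} = {q}" using q by auto
  finally show ?thesis using is_functorD(4)[OF G q] by (simp add: tail_at_prepend)
qed

lemma free_cover_surj:
  fixes s :: "'k::field \<Rightarrow> 'c::ab_group_add \<Rightarrow> 'c"
  assumes s: "vector_space s" and G: "is_functor (pm_scale s) Q G" and q: "q \<in> Q"
  shows "free_cover Q G q ` free_obj Q G q = obj G q"
proof
  show "free_cover Q G q ` free_obj Q G q \<subseteq> obj G q"
    using is_nat_transD(2)[OF nat_trans_free_cover[OF s G] q] by auto
  have G0: "0 \<in> obj G q" if "q \<in> Q" for q
    using subspaceD(1)[OF vector_space_pm_scale[OF s] is_functorD(1)[OF G that]] .
  show "obj G q \<subseteq> free_cover Q G q ` free_obj Q G q"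
  proof
    fix x assume x: "x \<in> obj G q"
    then show "x \<in> free_cover Q G q ` free_obj Q G q"
      using free_cover_prepend[OF s G q x] prepend_in_free_obj[OF G0 q order_refl x] by force
  qed
qed

text \<open>Lifting the identity along the free cover exhibits a projective functor as a retract of
  a free one. The free cover is an admissible test object in \<open>is_projective\<close> because it
  has values in the same type as P.\<close>

lemma projective_section:
  fixes s :: "'k::field \<Rightarrow> 'c::ab_group_add \<Rightarrow> 'c" and P :: "('q::order, 'q list \<Rightarrow>\<^sub>0 'c) vfunctor"
  assumes s: "vector_space s" and P: "is_projective (pm_scale s) Q P"
  obtains \<sigma> where "is_nat_trans (pm_scale s) (pm_scale s) Q P (free_functor Q P) \<sigma>"
    "\<And>q x. q \<in> Q \<Longrightarrow> x \<in> obj P q \<Longrightarrow> free_cover Q P q (\<sigma> q x) = x"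
proof -
  interpret vector_space "pm_scale s :: 'k \<Rightarrow> ('q list \<Rightarrow>\<^sub>0 'c) \<Rightarrow> _"
    by (rule vector_space_pm_scale[OF s])
  have F: "is_functor (pm_scale s) Q P" using P by (simp add: is_projective_def)
  have i: "is_nat_trans (pm_scale s) (pm_scale s) Q P P (\<lambda>_ x. x)"
    by (simp add: is_nat_trans_def linear_ident)
  have "\<exists>\<sigma>. is_nat_trans (pm_scale s) (pm_scale s) Q P (free_functor Q P) \<sigma> \<and>
      (\<forall>q\<in>Q. \<forall>x\<in>obj P q. free_cover Q P q (\<sigma> q x) = x)"
    by (rule P[unfolded is_projective_def, THEN conjunct2, rule_format,
          of "free_functor Q P" P "free_cover Q P" "\<lambda>_ x. x"])
      (use nat_trans_free_cover[OF s F] free_cover_surj[OF s F] is_functor_free[OF s F] F i in auto)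
  then show thesis using that by blast
qed

text \<open>The functor \<open>F\<close> itself is \<open>syzygy 0\<close>, with its values placed on the empty list.\<close>

primrec syzygy :: "'q::order set \<Rightarrow> ('q, 'c::ab_group_add) vfunctor \<Rightarrow> nat \<Rightarrow> ('q, 'q list \<Rightarrow>\<^sub>0 'c) vfunctor" where
  "syzygy Q F 0 = \<lparr>obj = (\<lambda>q. Poly_Mapping.single [] ` obj F q),
     arr = (\<lambda>p q y. Poly_Mapping.single [] (arr F p q (Poly_Mapping.lookup y [])))\<rparr>"
| "syzygy Q F (Suc n) = \<lparr>obj = (\<lambda>q. {y \<in> free_obj Q (syzygy Q F n) q. free_cover Q (syzygy Q F n) q y = 0}),
     arr = (\<lambda>_ _ y. y)\<rparr>"

lemma linear_single:
  assumes "vector_space s"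
  shows "Vector_Spaces.linear s (pm_scale s) (Poly_Mapping.single a)"
proof -
  interpret vector_space s by fact
  show ?thesis
    by (rule linearI[OF assms vector_space_pm_scale[OF assms]])
      (auto intro!: poly_mapping_eqI simp: single_add lookup_pm_scale[OF assms] lookup_single when_def)
qed

lemma linear_lookup:
  assumes "vector_space s"
  shows "Vector_Spaces.linear (pm_scale s) s (\<lambda>y. Poly_Mapping.lookup y a)"
  by (rule linearI[OF vector_space_pm_scale[OF assms] assms])
    (auto simp: lookup_add lookup_pm_scale[OF assms])

lemma is_functor_syzygy:
  fixes s :: "'k::field \<Rightarrow> 'c::ab_group_add \<Rightarrow> 'c"
  assumes s: "vector_space s" and F: "is_functor s Q F"
  shows "is_functor (pm_scale s) Q (syzygy Q F n)"
proof (induction n)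
  case 0
  have l: "Vector_Spaces.linear (pm_scale s) (pm_scale s)
      (\<lambda>y. Poly_Mapping.single [] (arr F p q (Poly_Mapping.lookup y [])))"
    if "p \<in> Q" "q \<in> Q" "p \<le> q" for p q
    using Vector_Spaces.linear_compose[OF Vector_Spaces.linear_compose[OF linear_lookup[OF s]
        is_functorD(2)[OF F that]] linear_single[OF s]] by (simp add: comp_def)
  show ?case
    unfolding is_functor_def
    using is_functorD(1,3,4,5)[OF F] l
    by (auto intro!: module_hom.subspace_image[OF linear_single[OF s, THEN Vector_Spaces.linear.axioms(3)]])
next
  case (Suc n)
  interpret p: vector_space "pm_scale s :: 'k \<Rightarrow> ('b list \<Rightarrow>\<^sub>0 'c) \<Rightarrow> _"
    by (rule vector_space_pm_scale[OF s])
  let ?K = "syzygy Q F n"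
  note nt = nat_trans_free_cover[OF s Suc] and fr = is_functor_free[OF s Suc]
  have sub: "p.subspace {y \<in> free_obj Q ?K q. free_cover Q ?K q y = 0}" if "q \<in> Q" for q
  proof -
    interpret l: Vector_Spaces.linear "pm_scale s" "pm_scale s" "free_cover Q ?K q"
      using is_nat_transD(1)[OF nt that] .
    have "{y \<in> free_obj Q ?K q. free_cover Q ?K q y = 0} = free_obj Q ?K q \<inter> {y. free_cover Q ?K q y = 0}"
      by auto
    then show ?thesis
      using p.subspace_inter[OF _ l.subspace_kernel] is_functorD(1)[OF fr that] by simp
  qed
  have mono: "free_cover Q ?K q y = 0" if "p \<in> Q" "q \<in> Q" "p \<le> q" "y \<in> free_obj Q ?K p" "free_cover Q ?K p y = 0" for p q y
    using is_nat_transD(3)[OF nt that(1-3), of y] that(4,5) linearD(3)[OF is_functorD(2)[OF Suc that(1-3)]]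
    by simp
  show ?case
    unfolding is_functor_def
    using sub mono subsetD[OF free_obj_mono[of _ _ Q ?K]] p.linear_ident by auto
qed

text \<open>Splices the free covers of successive syzygies: each syzygy is the kernel of the
  preceding cover, so exactness is surjectivity of the next one. This gives meaning to the choice in
  \<open>derived_colim\<close>.\<close>

lemma proj_resolution_exists:
  fixes s :: "'k::field \<Rightarrow> 'c::ab_group_add \<Rightarrow> 'c" and F :: "('q::order, 'c) vfunctor"
  assumes s: "vector_space s" and F: "is_functor s Q F"
  shows "\<exists>(P :: nat \<Rightarrow> ('q, 'q list \<Rightarrow>\<^sub>0 'c) vfunctor) d \<epsilon>.
    is_proj_resolution (pm_scale s) s Q P d \<epsilon> F"
proof -
  let ?K = "syzygy Q F"
  \<comment> \<open>Values of \<open>syzygy Q F 0\<close> are supported on the empty list, so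
    reading the coefficient there identifies them with the values of F.\<close>
  define \<epsilon> where "\<epsilon> q y = Poly_Mapping.lookup (free_cover Q (?K 0) q y) []" for q and y :: "'q list \<Rightarrow>\<^sub>0 'c"
  note K = is_functor_syzygy[OF s F]
  note nt = nat_trans_free_cover[OF s K]
  have objS: "obj (?K (Suc n)) q = {y \<in> free_obj Q (?K n) q. free_cover Q (?K n) q y = 0}" for n q
    by simp
  have arrS: "arr (?K (Suc n)) p q = (\<lambda>y. y)" for n p q by simp
  have \<epsilon>0: "\<epsilon> q y = 0 \<longleftrightarrow> free_cover Q (?K 0) q y = 0" if "q \<in> Q" "y \<in> free_obj Q (?K 0) q" for q y
  proof -
    have "free_cover Q (?K 0) q y \<in> obj (?K 0) q"
      using is_nat_transD(2)[OF nt[of 0] that(1)] that(2) by (simp del: syzygy.simps)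
    then show ?thesis by (auto simp: \<epsilon>_def)
  qed
  have "is_proj_resolution (pm_scale s) s Q (\<lambda>n. free_functor Q (?K n))
      (\<lambda>n. free_cover Q (?K (Suc n))) \<epsilon> F"
    unfolding is_proj_resolution_def
  proof (intro conjI allI ballI)
    show "is_projective (pm_scale s) Q (free_functor Q (?K n))" for n
      by (rule is_projective_free[OF s K])
    show "is_nat_trans (pm_scale s) (pm_scale s) Q (free_functor Q (?K (Suc n)))
        (free_functor Q (?K n)) (free_cover Q (?K (Suc n)))" for n
      unfolding is_nat_trans_def
    proof (intro conjI ballI impI)
      fix q assume q: "q \<in> Q"
      show "Vector_Spaces.linear (pm_scale s) (pm_scale s) (free_cover Q (?K (Suc n)) q)"
        by (rule is_nat_transD(1)[OF nt q])
      show "free_cover Q (?K (Suc n)) q ` obj (free_functor Q (?K (Suc n))) q \<subseteq> obj (free_functor Q (?K n)) q"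
        using is_nat_transD(2)[OF nt[of "Suc n"] q] by (auto simp only: objS obj_free_functor)
    next
      fix p q x assume "p \<in> Q" "q \<in> Q" "p \<le> q" "x \<in> obj (free_functor Q (?K (Suc n))) p"
      from is_nat_transD(3)[OF nt[of "Suc n"] this]
      show "free_cover Q (?K (Suc n)) q (arr (free_functor Q (?K (Suc n))) p q x) =
          arr (free_functor Q (?K n)) p q (free_cover Q (?K (Suc n)) p x)"
        by (simp only: arrS arr_free_functor)
    qed
    show "is_nat_trans (pm_scale s) s Q (free_functor Q (?K 0)) F \<epsilon>"
      unfolding is_nat_trans_def
    proof (intro conjI ballI impI)
      fix q assume q: "q \<in> Q"
      show "Vector_Spaces.linear (pm_scale s) s (\<epsilon> q)"
        using Vector_Spaces.linear_compose[OF is_nat_transD(1)[OF nt q] linear_lookup[OF s]]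
        by (simp add: \<epsilon>_def[abs_def] comp_def del: syzygy.simps)
      show "\<epsilon> q ` obj (free_functor Q (?K 0)) q \<subseteq> obj F q"
        using is_nat_transD(2)[OF nt[of 0] q] by (fastforce simp: \<epsilon>_def)
    next
      fix p q x assume pq: "p \<in> Q" "q \<in> Q" "p \<le> q" and x: "x \<in> obj (free_functor Q (?K 0)) p"
      show "\<epsilon> q (arr (free_functor Q (?K 0)) p q x) = arr F p q (\<epsilon> p x)"
        unfolding \<epsilon>_def is_nat_transD(3)[OF nt[of 0] pq x] by simp
    qed
    fix q assume q: "q \<in> Q"
    have "\<epsilon> q ` free_obj Q (?K 0) q = (\<lambda>y. Poly_Mapping.lookup y []) ` obj (?K 0) q"
      unfolding free_cover_surj[OF s K q, symmetric] image_image by (simp add: \<epsilon>_def)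
    then show "\<epsilon> q ` obj (free_functor Q (?K 0)) q = obj F q"
      by (simp add: image_image)
    show "free_cover Q (?K (Suc 0)) q ` obj (free_functor Q (?K 1)) q =
        {x \<in> obj (free_functor Q (?K 0)) q. \<epsilon> q x = 0}"
      using free_cover_surj[OF s K q, of 1] \<epsilon>0[OF q] objS[of 0 q] by (auto simp del: syzygy.simps)
    show "free_cover Q (?K (Suc (Suc n))) q ` obj (free_functor Q (?K (Suc (Suc n)))) q =
        {x \<in> obj (free_functor Q (?K (Suc n))) q. free_cover Q (?K (Suc n)) q x = 0}" for n
      using free_cover_surj[OF s K q, of "Suc (Suc n)"] objS[of "Suc n" q] by (simp del: syzygy.simps)
  qed
  then show ?thesis by (intro exI)
qed

section \<open>Augmented double complexes\<close>

text \<open>Boundary operators and the maps induced on colimits are guaranteed to be linear only on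
  chains and on elements supported in the poset; hence linearity relative to subspaces.\<close>

definition lin_on :: "('k \<Rightarrow> 'a::plus \<Rightarrow> 'a) \<Rightarrow> ('k \<Rightarrow> 'b::plus \<Rightarrow> 'b) \<Rightarrow> 'a set \<Rightarrow> 'b set \<Rightarrow> ('a \<Rightarrow> 'b) \<Rightarrow> bool"
  where "lin_on s t U V f \<longleftrightarrow> (\<forall>x\<in>U. f x \<in> V) \<and> (\<forall>x\<in>U. \<forall>y\<in>U. f (x + y) = f x + f y) \<and>
    (\<forall>c. \<forall>x\<in>U. f (s c x) = t c (f x))"

lemma lin_onD:
  fixes s :: "'k::field \<Rightarrow> 'a::ab_group_add \<Rightarrow> 'a" and t :: "'k \<Rightarrow> 'b::ab_group_add \<Rightarrow> 'b"
  assumes "vector_space s" "vector_space t" "module.subspace s U" "lin_on s t U V f"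
  shows "x \<in> U \<Longrightarrow> f x \<in> V" "x \<in> U \<Longrightarrow> y \<in> U \<Longrightarrow> f (x + y) = f x + f y"
    "x \<in> U \<Longrightarrow> f (s c x) = t c (f x)" "x \<in> U \<Longrightarrow> y \<in> U \<Longrightarrow> f (x - y) = f x - f y" "f 0 = 0"
proof -
  interpret s: vector_space s by fact
  interpret t: vector_space t by fact
  show *: "x \<in> U \<Longrightarrow> f x \<in> V" "x \<in> U \<Longrightarrow> y \<in> U \<Longrightarrow> f (x + y) = f x + f y"
    "x \<in> U \<Longrightarrow> f (s c x) = t c (f x)" for x y c
    using assms(4) by (auto simp: lin_on_def)
  show "f (x - y) = f x - f y" if "x \<in> U" "y \<in> U"
    using *(2)[OF that(1) subspaceD(4)[OF assms(1,3) that(2)], of "-1"] *(3)[OF that(2), of "-1"] by simp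
  show "f 0 = 0"
    using *(3)[OF subspaceD(1)[OF assms(1,3)], of 0] by simp
qed

lemma subspace_lin_on_image:
  fixes s :: "'k::field \<Rightarrow> 'a::ab_group_add \<Rightarrow> 'a" and t :: "'k \<Rightarrow> 'b::ab_group_add \<Rightarrow> 'b"
  assumes "vector_space s" "vector_space t" "module.subspace s U" "lin_on s t U V f"
  shows "module.subspace t (f ` U)"
proof -
  interpret t: vector_space t by fact
  note l = lin_onD[OF assms] and u = subspaceD[OF assms(1,3)]
  show ?thesis
  proof (rule t.subspaceI)
    show "0 \<in> f ` U" using l(5) u(1) by force
    show "x + y \<in> f ` U" if "x \<in> f ` U" "y \<in> f ` U" for x y
      using that l(2) u(2) by (auto simp: image_iff) metis
    show "t c x \<in> f ` U" if "x \<in> f ` U" for x c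
      using that l(3) u(4) by (auto simp: image_iff) metis
  qed
qed

lemma subspace_lin_on_kernel:
  fixes s :: "'k::field \<Rightarrow> 'a::ab_group_add \<Rightarrow> 'a" and t :: "'k \<Rightarrow> 'b::ab_group_add \<Rightarrow> 'b"
  assumes "vector_space s" "vector_space t" "module.subspace s U" "lin_on s t U V f"
  shows "module.subspace s {x \<in> U. f x = 0}"
proof -
  interpret s: vector_space s by fact
  interpret t: vector_space t by fact
  note l = lin_onD[OF assms] and u = subspaceD[OF assms(1,3)]
  show ?thesis
    by (rule s.subspaceI) (auto simp: l u)
qed

text \<open>\<open>f\<close> lowers the first index and \<open>g\<close> the second; \<epsilon>
  augments the lines along \<open>f\<close> and \<pi> those along \<open>g\<close>, and all
  augmented lines are exact. In the application m is the degree in a projective resolution and n the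
  Cech degree, so that A consists of colimits and B of chains of the resolved functor.\<close>

locale bicomplex =
  fixes sC :: "'k::field \<Rightarrow> 'x::ab_group_add \<Rightarrow> 'x" and sA :: "'k \<Rightarrow> 'a::ab_group_add \<Rightarrow> 'a"
    and sB :: "'k \<Rightarrow> 'b::ab_group_add \<Rightarrow> 'b"
    and C :: "nat \<Rightarrow> nat \<Rightarrow> 'x set" and A :: "nat \<Rightarrow> 'a set" and B :: "nat \<Rightarrow> 'b set"
    and f :: "nat \<Rightarrow> nat \<Rightarrow> 'x \<Rightarrow> 'x" and g :: "nat \<Rightarrow> nat \<Rightarrow> 'x \<Rightarrow> 'x"
    and \<pi> :: "nat \<Rightarrow> 'x \<Rightarrow> 'a" and \<epsilon> :: "nat \<Rightarrow> 'x \<Rightarrow> 'b"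
    and dA :: "nat \<Rightarrow> 'a \<Rightarrow> 'a" and dB :: "nat \<Rightarrow> 'b \<Rightarrow> 'b"
  assumes vsC: "vector_space sC" and vsA: "vector_space sA" and vsB: "vector_space sB"
    and subC: "\<And>m n. module.subspace sC (C m n)"
    and subA: "\<And>m. module.subspace sA (A m)" and subB: "\<And>n. module.subspace sB (B n)"
    and linf: "\<And>m n. lin_on sC sC (C (Suc m) n) (C m n) (f m n)"
    and ling: "\<And>m n. lin_on sC sC (C m (Suc n)) (C m n) (g m n)"
    and lin\<pi>: "\<And>m. lin_on sC sA (C m 0) (A m) (\<pi> m)"
    and lin\<epsilon>: "\<And>n. lin_on sC sB (C 0 n) (B n) (\<epsilon> n)"
    and lindA: "\<And>m. lin_on sA sA (A (Suc m)) (A m) (dA m)"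
    and lindB: "\<And>n. lin_on sB sB (B (Suc n)) (B n) (dB n)"
    and comm: "\<And>m n x. x \<in> C (Suc m) (Suc n) \<Longrightarrow> f m n (g (Suc m) n x) = g m n (f m (Suc n) x)"
    and ff: "\<And>m n x. x \<in> C (Suc (Suc m)) n \<Longrightarrow> f m n (f (Suc m) n x) = 0"
    and gg: "\<And>m n x. x \<in> C m (Suc (Suc n)) \<Longrightarrow> g m n (g m (Suc n) x) = 0"
    and \<pi>g: "\<And>m x. x \<in> C m (Suc 0) \<Longrightarrow> \<pi> m (g m 0 x) = 0"
    and \<epsilon>f: "\<And>n x. x \<in> C (Suc 0) n \<Longrightarrow> \<epsilon> n (f 0 n x) = 0"
    and \<pi>f: "\<And>m x. x \<in> C (Suc m) 0 \<Longrightarrow> \<pi> m (f m 0 x) = dA m (\<pi> (Suc m) x)"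
    and \<epsilon>g: "\<And>n x. x \<in> C 0 (Suc n) \<Longrightarrow> \<epsilon> n (g 0 n x) = dB n (\<epsilon> (Suc n) x)"
    and exf: "\<And>m n x. x \<in> C (Suc m) n \<Longrightarrow> f m n x = 0 \<Longrightarrow> \<exists>y\<in>C (Suc (Suc m)) n. f (Suc m) n y = x"
    and exg: "\<And>m n x. x \<in> C m (Suc n) \<Longrightarrow> g m n x = 0 \<Longrightarrow> \<exists>y\<in>C m (Suc (Suc n)). g m (Suc n) y = x"
    and ex\<pi>: "\<And>m x. x \<in> C m 0 \<Longrightarrow> \<pi> m x = 0 \<Longrightarrow> \<exists>y\<in>C m (Suc 0). g m 0 y = x"
    and ex\<epsilon>: "\<And>n x. x \<in> C 0 n \<Longrightarrow> \<epsilon> n x = 0 \<Longrightarrow> \<exists>y\<in>C (Suc 0) n. f 0 n y = x"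
    and sur\<pi>: "\<And>m a. a \<in> A m \<Longrightarrow> \<exists>x\<in>C m 0. \<pi> m x = a"
    and sur\<epsilon>: "\<And>n b. b \<in> B n \<Longrightarrow> \<exists>x\<in>C 0 n. \<epsilon> n x = b"
begin

lemmas lf = lin_onD[OF vsC vsC subC linf]
  and lg = lin_onD[OF vsC vsC subC ling]
  and l\<pi> = lin_onD[OF vsC vsA subC lin\<pi>]
  and l\<epsilon> = lin_onD[OF vsC vsB subC lin\<epsilon>]
  and lA = lin_onD[OF vsA vsA subA lindA]
  and lB = lin_onD[OF vsB vsB subB lindB]
  and sC = subspaceD[OF vsC subC]

definition ZA :: "nat \<Rightarrow> 'a set" where
  "ZA i = (case i of 0 \<Rightarrow> A 0 | Suc j \<Rightarrow> {a \<in> A (Suc j). dA j a = 0})"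

definition ZB :: "nat \<Rightarrow> 'b set" where
  "ZB i = (case i of 0 \<Rightarrow> B 0 | Suc j \<Rightarrow> {b \<in> B (Suc j). dB j b = 0})"

text \<open>
  A zigzag links a cycle of the augmentation column \<open>A\<close> to one of the row \<open>B\<close>. Swapping the two
  directions reverses it, so that each statement about \<open>A\<close> yields one about \<open>B\<close>.
\<close>

definition zigzag :: "nat \<Rightarrow> (nat \<Rightarrow> 'x) \<Rightarrow> bool" where
  "zigzag i c \<longleftrightarrow> (\<forall>p q. p + q = i \<longrightarrow> c q \<in> C p q) \<and>
     (\<forall>p q. Suc (p + q) = i \<longrightarrow> f p q (c q) = g p q (c (Suc q)))"

definition connected :: "nat \<Rightarrow> 'a \<Rightarrow> 'b \<Rightarrow> bool" where
  "connected i a b \<longleftrightarrow> (\<exists>c. zigzag i c \<and> \<pi> i (c 0) = a \<and> \<epsilon> i (c i) = b)"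

lemma zigzag_ends:
  assumes "zigzag i c"
  shows "\<pi> i (c 0) \<in> ZA i" "\<epsilon> i (c i) \<in> ZB i"
proof -
  have c: "c q \<in> C p q" if "p + q = i" for p q
    using assms that by (auto simp: zigzag_def)
  have e: "f p q (c q) = g p q (c (Suc q))" if "Suc (p + q) = i" for p q
    using assms that by (auto simp: zigzag_def)
  show "\<pi> i (c 0) \<in> ZA i"
  proof (cases i)
    case 0
    then show ?thesis using l\<pi>(1)[OF c[of 0 0]] by (simp add: ZA_def)
  next
    case (Suc j)
    have "dA j (\<pi> i (c 0)) = \<pi> j (g j 0 (c (Suc 0)))"
      using \<pi>f[of "c 0" j] c[of i 0] e[of j 0] Suc by simp
    also have "\<dots> = 0" using \<pi>g[of "c (Suc 0)" j] c[of j "Suc 0"] Suc by simp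
    finally show ?thesis using l\<pi>(1)[OF c[of i 0]] Suc by (simp add: ZA_def)
  qed
  show "\<epsilon> i (c i) \<in> ZB i"
  proof (cases i)
    case 0
    then show ?thesis using l\<epsilon>(1)[OF c[of 0 0]] by (simp add: ZB_def)
  next
    case (Suc j)
    have "dB j (\<epsilon> i (c i)) = \<epsilon> j (f 0 j (c j))"
      using \<epsilon>g[of "c i" j] c[of 0 i] e[of 0 j] Suc by simp
    also have "\<dots> = 0" using \<epsilon>f[of "c j" j] c[of "Suc 0" j] Suc by simp
    finally show ?thesis using l\<epsilon>(1)[OF c[of 0 i]] Suc by (simp add: ZB_def)
  qed
qed

text \<open>Walks down the staircase from \<open>C i 0\<close> to \<open>C 0 i\<close>: the f-image
  of the last entry is a g-cycle by \<open>comm\<close>, \<open>ff\<close> and the link already made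
  (at the start it is in the kernel of \<pi>), and exactness along g supplies the next
  entry.\<close>

lemma zigzag_extend:
  assumes a: "a \<in> ZA i"
  shows "\<exists>c. zigzag i c \<and> \<pi> i (c 0) = a"
proof -
  have "k \<le> i \<Longrightarrow> \<exists>c. (\<forall>p q. p + q = i \<and> q \<le> k \<longrightarrow> c q \<in> C p q) \<and> \<pi> i (c 0) = a \<and>
     (\<forall>p q. Suc (p + q) = i \<and> q < k \<longrightarrow> f p q (c q) = g p q (c (Suc q)))" for k
  proof (induction k)
    case 0
    have "a \<in> A i" using a by (auto simp: ZA_def split: nat.splits)
    then obtain x where "x \<in> C i 0" "\<pi> i x = a" using sur\<pi> by blast
    then show ?case by (intro exI[of _ "\<lambda>_. x"]) auto
  next
    case (Suc k)
    then obtain c where c: "\<And>p q. p + q = i \<Longrightarrow> q \<le> k \<Longrightarrow> c q \<in> C p q" "\<pi> i (c 0) = a"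
      "\<And>p q. Suc (p + q) = i \<Longrightarrow> q < k \<Longrightarrow> f p q (c q) = g p q (c (Suc q))"
      using Suc_leD by blast
    define p where "p = i - Suc k"
    have i: "i = Suc (p + k)" using Suc.prems by (simp add: p_def)
    have ck: "c k \<in> C (Suc p) k" using c(1) i by simp
    have "\<exists>y\<in>C p (Suc k). g p k y = f p k (c k)"
    proof (cases k)
      case 0
      have "\<pi> p (f p 0 (c 0)) = 0"
        using \<pi>f[of "c 0" p] ck 0 a c(2) i by (simp add: ZA_def)
      then show ?thesis using ex\<pi> lf(1)[OF ck] 0 by simp
    next
      case (Suc k')
      have "g p k' (f p k (c k)) = f p k' (g (Suc p) k' (c k))"
        using comm[of "c k" p k'] ck Suc by simp
      also have "g (Suc p) k' (c k) = f (Suc p) k' (c k')"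
        using c(3)[of "Suc p" k'] i Suc by simp
      also have "f p k' \<dots> = 0"
        using ff[of "c k'" p k'] c(1)[of "Suc (Suc p)" k'] i Suc by simp
      finally show ?thesis using exg[of "f p k (c k)" p k'] lf(1)[OF ck] Suc by simp
    qed
    then obtain y where y: "y \<in> C p (Suc k)" "g p k y = f p k (c k)" by blast
    show ?case
    proof (intro exI[of _ "c(Suc k := y)"] conjI allI impI)
      fix p' q assume "p' + q = i \<and> q \<le> Suc k"
      then show "(c(Suc k := y)) q \<in> C p' q"
        using c(1)[of p' q] y(1) i by (auto simp: le_Suc_eq)
    next
      fix p' q assume pq: "Suc (p' + q) = i \<and> q < Suc k"
      show "f p' q ((c(Suc k := y)) q) = g p' q ((c(Suc k := y)) (Suc q))"
      proof (cases "q = k")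
        case True
        then have "p' = p" using pq i by simp
        then show ?thesis using True y(2) by simp
      next
        case False
        then show ?thesis using c(3) pq by simp
      qed
    qed (use c(2) in simp)
  qed
  from this[of i] obtain c where c: "\<forall>p q. p + q = i \<and> q \<le> i \<longrightarrow> c q \<in> C p q" "\<pi> i (c 0) = a"
     "\<forall>p q. Suc (p + q) = i \<and> q < i \<longrightarrow> f p q (c q) = g p q (c (Suc q))" by blast
  then have "zigzag i c" unfolding zigzag_def by (metis le_add2 less_Suc_eq_le)
  then show ?thesis using c(2) by blast
qed

text \<open>Along the staircase every entry turns out to be an f-image plus a g-image. At the far
  end \<epsilon> kills the first summand and sends the second to a boundary of B.\<close>

lemma zigzag_boundary:
  assumes z: "zigzag i c" and a: "\<pi> i (c 0) \<in> dA i ` A (Suc i)"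
  shows "\<epsilon> i (c i) \<in> dB i ` B (Suc i)"
proof -
  have c: "c q \<in> C p q" if "p + q = i" for p q
    using z that by (auto simp: zigzag_def)
  have e: "f p q (c q) = g p q (c (Suc q))" if "Suc (p + q) = i" for p q
    using z that by (auto simp: zigzag_def)
  have "p + q = i \<Longrightarrow> \<exists>x\<in>C (Suc p) q. \<exists>y\<in>C p (Suc q). c q - f p q x = g p q y" for p q
  proof (induction q arbitrary: p)
    case 0
    obtain a' where a': "a' \<in> A (Suc i)" "\<pi> i (c 0) = dA i a'" using a by auto
    obtain x where x: "x \<in> C (Suc i) 0" "\<pi> (Suc i) x = a'" using sur\<pi> a'(1) by blast
    have c0: "c 0 \<in> C i 0" using c by simp
    have "\<pi> i (c 0 - f i 0 x) = 0"
      using l\<pi>(4)[OF c0 lf(1)[OF x(1)]] \<pi>f[OF x(1)] x(2) a'(2) by simp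
    then obtain y where "y \<in> C i (Suc 0)" "g i 0 y = c 0 - f i 0 x"
      using ex\<pi>[OF sC(3)[OF c0 lf(1)[OF x(1)]]] by blast
    then show ?case using x(1) 0 by (intro bexI[of _ x] bexI[of _ y]) auto
  next
    case (Suc q)
    then obtain x y where xy: "x \<in> C (Suc (Suc p)) q" "y \<in> C (Suc p) (Suc q)"
      "c q - f (Suc p) q x = g (Suc p) q y" by (metis add_Suc add_Suc_right)
    have cq: "c q \<in> C (Suc p) q" and cSq: "c (Suc q) \<in> C p (Suc q)" using c Suc.prems by auto
    note fy = lf(1)[OF xy(2)] and fx = lf(1)[OF xy(1)]
    \<comment> \<open>The element y found for the previous entry corrects the present one:
      subtracting its f-image leaves a g-cycle.\<close>
    have "g p q (c (Suc q) - f p (Suc q) y) = f p q (c q) - f p q (g (Suc p) q y)"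
      using lg(4)[OF cSq fy] comm[OF xy(2)] e[of p q] Suc.prems by simp
    also have "\<dots> = f p q (c q) - f p q (c q - f (Suc p) q x)"
      using xy(3) by simp
    also have "\<dots> = 0"
      using lf(4)[OF cq fx] ff[OF xy(1)] by simp
    finally obtain w where "w \<in> C p (Suc (Suc q))" "g p (Suc q) w = c (Suc q) - f p (Suc q) y"
      using exg[OF sC(3)[OF cSq fy]] by blast
    then show ?case using xy(2) by (intro bexI[of _ y] bexI[of _ w]) auto
  qed
  from this[of 0 i] obtain x y where xy: "x \<in> C (Suc 0) i" "y \<in> C 0 (Suc i)" "c i - f 0 i x = g 0 i y"
    by auto
  have "dB i (\<epsilon> (Suc i) y) = \<epsilon> i (c i - f 0 i x)"
    using \<epsilon>g[OF xy(2)] xy(3) by simp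
  also have "\<dots> = \<epsilon> i (c i)"
    using l\<epsilon>(4)[OF c[of 0 i] lf(1)[OF xy(1)]] \<epsilon>f[OF xy(1)] by simp
  finally show ?thesis using l\<epsilon>(1)[OF xy(2)] by force
qed

lemma swap: "bicomplex sC sB sA (\<lambda>m n. C n m) B A (\<lambda>m n. g n m) (\<lambda>m n. f n m) \<epsilon> \<pi> dB dA"
  by (intro bicomplex.intro; (rule vsC vsA vsB subC subA subB linf ling lin\<pi> lin\<epsilon> lindA lindB
        comm[symmetric] ff gg \<pi>g \<epsilon>f \<pi>f \<epsilon>g exf exg ex\<pi> ex\<epsilon> sur\<pi> sur\<epsilon>; assumption?))

lemma zigzag_swap:
  assumes "zigzag i c"
  shows "bicomplex.zigzag (\<lambda>m n. C n m) (\<lambda>m n. g n m) (\<lambda>m n. f n m) i (\<lambda>q. c (i - q))"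
proof -
  interpret sw: bicomplex sC sB sA "\<lambda>m n. C n m" B A "\<lambda>m n. g n m" "\<lambda>m n. f n m" \<epsilon> \<pi> dB dA
    by (rule swap)
  have "g q p (c (i - q)) = f q p (c (i - Suc q))" if "Suc (p + q) = i" for p q
  proof -
    have "i - q = Suc p" "i - Suc q = p" using that by auto
    then show ?thesis using assms that by (auto simp: zigzag_def add.commute)
  qed
  moreover have "c (i - q) \<in> C q p" if "p + q = i" for p q
    using assms that by (auto simp: zigzag_def add.commute)
  ultimately show ?thesis by (auto simp: sw.zigzag_def)
qed

lemma connected_sub: "connected i a b \<Longrightarrow> a \<in> ZA i \<and> b \<in> ZB i"
  using zigzag_ends by (auto simp: connected_def)

lemma connected_left: "a \<in> ZA i \<Longrightarrow> \<exists>b. connected i a b"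
  using zigzag_extend by (auto simp: connected_def)

lemma connected_swap:
  assumes "connected i a b"
  shows "bicomplex.connected (\<lambda>m n. C n m) (\<lambda>m n. g n m) (\<lambda>m n. f n m) \<epsilon> \<pi> i b a"
proof -
  interpret sw: bicomplex sC sB sA "\<lambda>m n. C n m" B A "\<lambda>m n. g n m" "\<lambda>m n. f n m" \<epsilon> \<pi> dB dA
    by (rule swap)
  from assms obtain c where "zigzag i c" "\<pi> i (c 0) = a" "\<epsilon> i (c i) = b"
    by (auto simp: connected_def)
  then show ?thesis
    using zigzag_swap[of i c] by (auto simp: sw.connected_def intro!: exI[of _ "\<lambda>q. c (i - q)"])
qed

lemma connected_right:
  assumes "b \<in> ZB i"
  shows "\<exists>a. connected i a b"
proof -
  interpret sw: bicomplex sC sB sA "\<lambda>m n. C n m" B A "\<lambda>m n. g n m" "\<lambda>m n. f n m" \<epsilon> \<pi> dB dA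
    by (rule swap)
  have "b \<in> sw.ZA i" using assms by (auto simp: sw.ZA_def ZB_def split: nat.splits)
  then obtain a where "sw.connected i b a" using sw.connected_left by blast
  from sw.connected_swap[OF this] show ?thesis by blast
qed

lemma connected_bnd:
  assumes "connected i a b"
  shows "a \<in> dA i ` A (Suc i) \<longleftrightarrow> b \<in> dB i ` B (Suc i)"
proof
  interpret sw: bicomplex sC sB sA "\<lambda>m n. C n m" B A "\<lambda>m n. g n m" "\<lambda>m n. f n m" \<epsilon> \<pi> dB dA
    by (rule swap)
  show "b \<in> dB i ` B (Suc i)" if "a \<in> dA i ` A (Suc i)"
    using assms that zigzag_boundary by (auto simp: connected_def)
  show "a \<in> dA i ` A (Suc i)" if "b \<in> dB i ` B (Suc i)"
    using connected_swap[OF assms] that sw.zigzag_boundary by (auto simp: sw.connected_def)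
qed

lemma connected_add:
  assumes "connected i a b" "connected i a' b'"
  shows "connected i (a + a') (b + b')"
proof -
  obtain c c' where c: "zigzag i c" "\<pi> i (c 0) = a" "\<epsilon> i (c i) = b"
    and c': "zigzag i c'" "\<pi> i (c' 0) = a'" "\<epsilon> i (c' i) = b'"
    using assms by (auto simp: connected_def)
  have m: "c q \<in> C p q" "c' q \<in> C p q" if "p + q = i" for p q
    using c(1) c'(1) that by (auto simp: zigzag_def)
  have "zigzag i (\<lambda>q. c q + c' q)"
    unfolding zigzag_def
  proof (intro conjI allI impI)
    show "c q + c' q \<in> C p q" if "p + q = i" for p q
      using sC(2)[OF m[OF that]] .
    show "f p q (c q + c' q) = g p q (c (Suc q) + c' (Suc q))" if "Suc (p + q) = i" for p q
      using c(1) c'(1) that lf(2)[OF m[of "Suc p" q]] lg(2)[OF m[of p "Suc q"]]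
      by (simp add: zigzag_def)
  qed
  then show ?thesis
    using c(2,3) c'(2,3) l\<pi>(2)[OF m[of i 0]] l\<epsilon>(2)[OF m[of 0 i]]
    by (auto simp: connected_def intro!: exI[of _ "\<lambda>q. c q + c' q"])
qed

lemma connected_scale:
  assumes "connected i a b"
  shows "connected i (sA r a) (sB r b)"
proof -
  obtain c where c: "zigzag i c" "\<pi> i (c 0) = a" "\<epsilon> i (c i) = b"
    using assms by (auto simp: connected_def)
  have m: "c q \<in> C p q" if "p + q = i" for p q
    using c(1) that by (auto simp: zigzag_def)
  have "zigzag i (\<lambda>q. sC r (c q))"
    unfolding zigzag_def
  proof (intro conjI allI impI)
    show "sC r (c q) \<in> C p q" if "p + q = i" for p q
      using sC(4)[OF m[OF that]] .
    show "f p q (sC r (c q)) = g p q (sC r (c (Suc q)))" if "Suc (p + q) = i" for p q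
      using c(1) that lf(3)[OF m[of "Suc p" q]] lg(3)[OF m[of p "Suc q"]]
      by (simp add: zigzag_def)
  qed
  then show ?thesis
    using c(2,3) l\<pi>(3)[OF m[of i 0]] l\<epsilon>(3)[OF m[of 0 i]]
    by (auto simp: connected_def intro!: exI[of _ "\<lambda>q. sC r (c q)"])
qed

lemma subspace_ZA: "module.subspace sA (ZA i)"
  using subA subspace_lin_on_kernel[OF vsA vsA subA lindA] by (auto simp: ZA_def split: nat.splits)

lemma subspace_BA: "module.subspace sA (dA i ` A (Suc i))"
  by (rule subspace_lin_on_image[OF vsA vsA subA lindA])

text \<open>That \<open>dA\<close> squares to zero is inherited from \<open>ff\<close> by lifting
  along the surjections \<pi>.\<close>

lemma BA_sub: "dA i ` A (Suc i) \<subseteq> ZA i"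
proof
  fix a assume "a \<in> dA i ` A (Suc i)"
  then obtain a' where a': "a' \<in> A (Suc i)" "a = dA i a'" by blast
  then obtain x where x: "x \<in> C (Suc i) 0" "\<pi> (Suc i) x = a'" using sur\<pi> by blast
  have "dA j a = 0" if "i = Suc j" for j
  proof -
    have x': "f i 0 x \<in> C (Suc j) 0" using lf(1)[OF x(1)] that by simp
    have "dA j a = dA j (\<pi> (Suc j) (f i 0 x))" using a'(2) x that \<pi>f[OF x(1)] by simp
    also have "\<dots> = \<pi> j (f j 0 (f (Suc j) 0 x))" using \<pi>f[OF x'] that by simp
    also have "\<dots> = 0" using ff[of x j 0] x(1) that l\<pi>(5) by simp
    finally show ?thesis .
  qed
  then show "a \<in> ZA i" using lA(1)[OF a'(1)] a'(2) by (auto simp: ZA_def split: nat.splits)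
qed

lemma vdim_quot_eq:
  "vdim sA (quot sA (ZA i) (dA i ` A (Suc i))) =o vdim sB (quot sB (ZB i) (dB i ` B (Suc i)))"
proof -
  interpret sw: bicomplex sC sB sA "\<lambda>m n. C n m" B A "\<lambda>m n. g n m" "\<lambda>m n. f n m" \<epsilon> \<pi> dB dA
    by (rule swap)
  have ZB: "ZB i = sw.ZA i" by (simp add: ZB_def sw.ZA_def)
  show ?thesis
    by (rule vdim_quot_cong[OF vsA vsB subspace_ZA subspace_BA BA_sub, where R = "connected i"])
      (use sw.subspace_ZA sw.subspace_BA sw.BA_sub connected_sub connected_add connected_scale
        connected_left connected_right connected_bnd ZB in auto)
qed

end

section \<open>Chains on finite subsets\<close>

text \<open>
  The sign of a face is an operator on an abelian group, so that chains need no scalars.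
\<close>

definition sgd :: "('i \<Rightarrow> nat) \<Rightarrow> 'i \<Rightarrow> 'i set \<Rightarrow> 'b::ab_group_add \<Rightarrow> 'b" where
  "sgd f a S x = (if even (card {c \<in> S. f c < f a}) then x else - x)"

lemma sgd_0 [simp]: "sgd f a S 0 = 0"
  and sgd_add: "sgd f a S (x + y) = sgd f a S x + sgd f a S y"
  and sgd_minus: "sgd f a S (- x) = - sgd f a S x"
  and sgd_sgd [simp]: "sgd f a S (sgd f a S x) = x"
  and sgd_comm: "sgd f a S (sgd f b T x) = sgd f b T (sgd f a S x)"
  and sgd_eq_0_iff [simp]: "sgd f a S x = 0 \<longleftrightarrow> x = 0"
  by (simp_all add: sgd_def)

lemma sgd_sum: "sgd f a S (\<Sum>i\<in>I. g i) = (\<Sum>i\<in>I. sgd f a S (g i))"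
  by (simp add: sgd_def sum_negf)

lemma sgd_linear: "Vector_Spaces.linear s t L \<Longrightarrow> L (sgd f a S x) = sgd f a S (L x)"
  by (simp add: sgd_def linearD(5))

lemma sgd_in: "vector_space s \<Longrightarrow> module.subspace s U \<Longrightarrow> x \<in> U \<Longrightarrow> sgd f a S x \<in> U"
  by (simp add: sgd_def subspaceD(5))

lemma sgd_insert:
  assumes "finite S" "b \<notin> S"
  shows "sgd f a (insert b S) x = (if f b < f a then - sgd f a S x else sgd f a S x)"
proof -
  have "{c \<in> insert b S. f c < f a} = (if f b < f a then insert b {c \<in> S. f c < f a} else {c \<in> S. f c < f a})"
    by auto
  then show ?thesis using assms by (simp add: sgd_def)
qed

text \<open>Exactly one of a and b has the smaller number, so exactly one of the two insertions
  flips a parity. This is the cancellation behind d \<circ> d = 0; in the primed version both signs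
  are taken with the other index present.\<close>

lemma sgd_swap:
  assumes "finite S" "a \<notin> S" "b \<notin> S" "f a \<noteq> f b"
  shows "sgd f a (insert b S) (sgd f b S x) = - sgd f b (insert a S) (sgd f a S x)"
  using assms by (auto simp: sgd_insert sgd_minus sgd_comm)

lemma sgd_swap':
  assumes "finite S" "a \<notin> S" "b \<notin> S" "f a \<noteq> f b"
  shows "sgd f a (insert b S) (sgd f b (insert a S) x) = - sgd f b S (sgd f a S x)"
  using assms by (auto simp: sgd_insert sgd_minus sgd_comm)

text \<open>The simplicial boundary read at a fixed face S: the coefficients at all sets with one
  more index are pushed along t. Summing over nonzero coefficients only makes the sum finite on
  chains even when there are infinitely many indices.\<close>

definition bd :: "('i \<Rightarrow> nat) \<Rightarrow> ('i set \<Rightarrow> 'i set \<Rightarrow> 'b \<Rightarrow> 'b) \<Rightarrow> ('i set \<Rightarrow> 'b::ab_group_add) \<Rightarrow> 'i set \<Rightarrow> 'b"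
  where "bd f t x S = (\<Sum>a | a \<notin> S \<and> x (insert a S) \<noteq> 0. sgd f a S (t (insert a S) S (x (insert a S))))"

text \<open>Graded by cardinality: sets of size k are simplices of dimension k - 1, and k = 0 is the
  augmentation.\<close>

definition set_chains :: "'i set \<Rightarrow> ('i set \<Rightarrow> 'b set) \<Rightarrow> nat \<Rightarrow> ('i set \<Rightarrow> 'b::ab_group_add) set" where
  "set_chains H X k = {x. finite {S. x S \<noteq> 0} \<and>
     (\<forall>S. x S \<noteq> 0 \<longrightarrow> finite S \<and> S \<subseteq> H \<and> card S = k \<and> x S \<in> X S)}"

lemma chainsD:
  assumes "x \<in> set_chains H X k"
  shows "finite {S. x S \<noteq> 0}" "x S \<noteq> 0 \<Longrightarrow> finite S" "x S \<noteq> 0 \<Longrightarrow> S \<subseteq> H" "x S \<noteq> 0 \<Longrightarrow> card S = k"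
    "x S \<noteq> 0 \<Longrightarrow> x S \<in> X S"
  using assms by (auto simp: set_chains_def)

lemma bd_eq:
  assumes "finite I" "\<And>S. x S \<noteq> 0 \<Longrightarrow> S \<subseteq> I"
    and "\<And>a. a \<in> I \<Longrightarrow> a \<notin> S \<Longrightarrow> t (insert a S) S 0 = 0"
  shows "bd f t x S = (\<Sum>a\<in>I - S. sgd f a S (t (insert a S) S (x (insert a S))))"
  unfolding bd_def
proof (rule sum.mono_neutral_left)
  show "finite (I - S)" using assms(1) by simp
  show "{a. a \<notin> S \<and> x (insert a S) \<noteq> 0} \<subseteq> I - S"
  proof
    fix a assume "a \<in> {a. a \<notin> S \<and> x (insert a S) \<noteq> 0}"
    then show "a \<in> I - S" using assms(2)[of "insert a S"] by simp
  qed
  show "\<forall>a\<in>I - S - {a. a \<notin> S \<and> x (insert a S) \<noteq> 0}. sgd f a S (t (insert a S) S (x (insert a S))) = 0"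
    using assms(3) by (intro ballI) force
qed

lemma bd_eq_0:
  assumes "\<And>a. a \<notin> S \<Longrightarrow> x (insert a S) = 0"
  shows "bd f t x S = 0"
  unfolding bd_def using assms by (intro sum.neutral) auto

lemma bd_nonzeroE:
  assumes "bd f t x S \<noteq> 0"
  obtains a where "a \<notin> S" "x (insert a S) \<noteq> 0"
  using bd_eq_0[of S x f t] assms by blast

text \<open>By induction on I. Exchanging the two summation indices would only show that twice the
  sum is 0, which says nothing in characteristic 2.\<close>

lemma sum_offdiag_antisym:
  fixes F :: "'i \<Rightarrow> 'i \<Rightarrow> 'b::ab_group_add"
  assumes "finite I" "\<And>a b. a \<in> I \<Longrightarrow> b \<in> I \<Longrightarrow> a \<noteq> b \<Longrightarrow> F a b = - F b a"
  shows "(\<Sum>a\<in>I. \<Sum>b\<in>I - {a}. F a b) = 0"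
  using assms
proof (induction I rule: finite_induct)
  case (insert c I)
  have "(\<Sum>a\<in>I. \<Sum>b\<in>insert c I - {a}. F a b) = (\<Sum>a\<in>I. F a c + (\<Sum>b\<in>I - {a}. F a b))"
  proof (rule sum.cong[OF refl])
    fix a assume "a \<in> I"
    then have "insert c I - {a} = insert c (I - {a})" using insert(2) by auto
    then show "(\<Sum>b\<in>insert c I - {a}. F a b) = F a c + (\<Sum>b\<in>I - {a}. F a b)"
      using insert.hyps by simp
  qed
  moreover have "(\<Sum>b\<in>insert c I - {c}. F c b) = (\<Sum>a\<in>I. - F a c)"
  proof (rule sum.cong)
    show "insert c I - {c} = I" using insert.hyps(2) by auto
    show "F c a = - F a c" if "a \<in> I" for a
      using insert.prems[of c a] that insert.hyps(2) by blast
  qed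
  moreover have "(\<Sum>a\<in>I. \<Sum>b\<in>I - {a}. F a b) = 0"
    by (rule insert.IH) (use insert.prems in blast)
  ultimately show ?case
    using insert.hyps by (simp add: sum.distrib sum_negf)
qed simp

text \<open>The bound \<open>k0\<close> says from which cardinality on coefficients exist. It is 1
  for a functor on the lattice without its top, which has no value at the empty intersection, and 0
  for augmented complexes.\<close>

locale cech =
  fixes H :: "'i set" and f :: "'i \<Rightarrow> nat" and s :: "'k::field \<Rightarrow> 'b::ab_group_add \<Rightarrow> 'b"
    and X :: "'i set \<Rightarrow> 'b set" and t :: "'i set \<Rightarrow> 'i set \<Rightarrow> 'b \<Rightarrow> 'b" and k0 :: nat
  assumes inj: "inj_on f H" and vs: "vector_space s"
    and subX: "\<And>S. finite S \<Longrightarrow> S \<subseteq> H \<Longrightarrow> k0 \<le> card S \<Longrightarrow> module.subspace s (X S)"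
    and lint: "\<And>S a. finite S \<Longrightarrow> S \<subseteq> H \<Longrightarrow> k0 \<le> card S \<Longrightarrow> a \<in> H \<Longrightarrow> a \<notin> S \<Longrightarrow>
      Vector_Spaces.linear s s (t (insert a S) S)"
    and tin: "\<And>S a x. finite S \<Longrightarrow> S \<subseteq> H \<Longrightarrow> k0 \<le> card S \<Longrightarrow> a \<in> H \<Longrightarrow> a \<notin> S \<Longrightarrow>
      x \<in> X (insert a S) \<Longrightarrow> t (insert a S) S x \<in> X S"
    and tt: "\<And>S a b x. finite S \<Longrightarrow> S \<subseteq> H \<Longrightarrow> k0 \<le> card S \<Longrightarrow> a \<in> H \<Longrightarrow> a \<notin> S \<Longrightarrow> b \<in> H \<Longrightarrow> b \<notin> S \<Longrightarrow>
      a \<noteq> b \<Longrightarrow> x \<in> X (insert a (insert b S)) \<Longrightarrow>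
      t (insert a S) S (t (insert b (insert a S)) (insert a S) x) =
      t (insert b S) S (t (insert a (insert b S)) (insert b S) x)"
begin

abbreviation "d \<equiv> bd f t"

lemma subspace_chains:
  assumes "k0 \<le> k"
  shows "module.subspace (fscale s) (set_chains H X k)"
proof -
  interpret fs: vector_space "fscale s :: 'k \<Rightarrow> ('i set \<Rightarrow> 'b) \<Rightarrow> _" by (rule vector_space_fscale[OF vs])
  interpret s: vector_space s by (rule vs)
  show ?thesis
  proof (rule fs.subspaceI)
    show "0 \<in> set_chains H X k" by (simp add: set_chains_def)
  next
    fix x y assume xy: "x \<in> set_chains H X k" "y \<in> set_chains H X k"
    have "finite {S. (x + y) S \<noteq> 0}"
      by (rule finite_subset[OF _ finite_UnI[OF chainsD(1)[OF xy(1)] chainsD(1)[OF xy(2)]]]) auto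
    moreover have "finite S \<and> S \<subseteq> H \<and> card S = k \<and> (x + y) S \<in> X S" if "(x + y) S \<noteq> 0" for S
    proof -
      have "x S \<noteq> 0 \<or> y S \<noteq> 0" using that by auto
      then have *: "finite S" "S \<subseteq> H" "card S = k" using chainsD[OF xy(1)] chainsD[OF xy(2)] by blast+
      then have sub: "module.subspace s (X S)" using subX assms by simp
      have "x S \<in> X S" "y S \<in> X S"
        using chainsD(5)[OF xy(1), of S] chainsD(5)[OF xy(2), of S] subspaceD(1)[OF vs sub] by fastforce+
      then show ?thesis using * subspaceD(2)[OF vs sub] by simp
    qed
    ultimately show "x + y \<in> set_chains H X k" by (auto simp: set_chains_def)
  next
    fix c x assume x: "x \<in> set_chains H X k"
    have "finite {S. fscale s c x S \<noteq> 0}"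
      by (rule finite_subset[OF _ chainsD(1)[OF x]]) auto
    moreover have "finite S \<and> S \<subseteq> H \<and> card S = k \<and> fscale s c x S \<in> X S" if "fscale s c x S \<noteq> 0" for S
    proof -
      have "x S \<noteq> 0" using that by auto
      then show ?thesis using chainsD[OF x] subspaceD(4)[OF vs subX] assms by simp
    qed
    ultimately show "fscale s c x \<in> set_chains H X k" by (auto simp: set_chains_def)
  qed
qed

lemma bd_sum:
  assumes x: "x \<in> set_chains H X (Suc k)" and k: "k0 \<le> k" and I: "finite I" "I \<subseteq> H" "\<And>T. x T \<noteq> 0 \<Longrightarrow> T \<subseteq> I"
  shows "d x S = (if finite S \<and> S \<subseteq> H \<and> card S = k
    then \<Sum>a\<in>I - S. sgd f a S (t (insert a S) S (x (insert a S))) else 0)"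
proof (cases "finite S \<and> S \<subseteq> H \<and> card S = k")
  case True
  then have z: "t (insert a S) S 0 = 0" if "a \<in> I" "a \<notin> S" for a
    using linearD(3)[OF lint[of S a]] that I(2) k by auto
  have "d x S = (\<Sum>a\<in>I - S. sgd f a S (t (insert a S) S (x (insert a S))))"
    by (rule bd_eq) (use I z in auto)
  then show ?thesis using True by simp
next
  case False
  have "x (insert a S) = 0" if "a \<notin> S" for a
  proof (rule ccontr)
    assume "x (insert a S) \<noteq> 0"
    from chainsD(2-4)[OF x this] show False using False that by auto
  qed
  then show ?thesis using False bd_eq_0[of S x] by auto
qed

lemma support_bound:
  assumes "x \<in> set_chains H X k"
  shows "finite (\<Union>{S. x S \<noteq> 0})" "\<Union>{S. x S \<noteq> 0} \<subseteq> H" "x T \<noteq> 0 \<Longrightarrow> T \<subseteq> \<Union>{S. x S \<noteq> 0}"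
proof -
  show "finite (\<Union>{S. x S \<noteq> 0})"
    by (rule finite_Union[OF chainsD(1)[OF assms]]) (use chainsD(2)[OF assms] in auto)
  show "\<Union>{S. x S \<noteq> 0} \<subseteq> H" using chainsD(3)[OF assms] by blast
qed auto

lemma bd_in:
  assumes x: "x \<in> set_chains H X (Suc k)" and k: "k0 \<le> k"
  shows "d x \<in> set_chains H X k"
proof -
  define I where "I = \<Union>{S. x S \<noteq> 0}"
  have I: "finite I" "I \<subseteq> H" "\<And>T. x T \<noteq> 0 \<Longrightarrow> T \<subseteq> I"
    using support_bound[OF x] by (auto simp: I_def)
  have *: "finite S \<and> S \<subseteq> H \<and> card S = k \<and> d x S \<in> X S \<and> S \<subseteq> I" if nz: "d x S \<noteq> 0" for S
  proof -
    have S: "finite S" "S \<subseteq> H" "card S = k"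
      using nz bd_sum[OF x k I, of S] by (auto split: if_splits)
    have "d x S \<in> X S"
    proof -
      have sub: "module.subspace s (X S)" using subX S k by simp
      have "sgd f a S (t (insert a S) S (x (insert a S))) \<in> X S" if a: "a \<in> I - S" for a
      proof (cases "x (insert a S) = 0")
        case True
        then show ?thesis
          using linearD(3)[OF lint[of S a]] S k a I(2) subspaceD(1)[OF vs sub] by auto
      next
        case False
        then show ?thesis
          using a I(2) S k
          by (intro sgd_in[OF vs sub] tin[OF S(1,2) _ _ _ chainsD(5)[OF x False]]) auto
      qed
      then have "(\<Sum>a\<in>I - S. sgd f a S (t (insert a S) S (x (insert a S)))) \<in> X S"
        by (rule subspaceD(6)[OF vs sub])
      then show ?thesis using bd_sum[OF x k I, of S] S by simp
    qed
    moreover have "S \<subseteq> I"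
    proof -
      obtain a where "a \<in> I - S" "sgd f a S (t (insert a S) S (x (insert a S))) \<noteq> 0"
        using nz bd_sum[OF x k I, of S] S by (auto elim: sum.not_neutral_contains_not_neutral)
      then have "x (insert a S) \<noteq> 0"
        using linearD(3)[OF lint[of S a]] S k I(2) by auto
      then show ?thesis using I(3) by blast
    qed
    ultimately show ?thesis using S by simp
  qed
  moreover have "finite {S. d x S \<noteq> 0}"
    by (rule finite_subset[of _ "Pow I"]) (use * I(1) in auto)
  ultimately show ?thesis by (auto simp: set_chains_def)
qed

lemma lin_on_bd:
  assumes k: "k0 \<le> k"
  shows "lin_on (fscale s) (fscale s) (set_chains H X (Suc k)) (set_chains H X k) d"
proof -
  interpret s: vector_space s by (rule vs)
  show ?thesis
    unfolding lin_on_def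
  proof (intro conjI ballI allI)
    show "d x \<in> set_chains H X k" if "x \<in> set_chains H X (Suc k)" for x
      using bd_in[OF that k] .
  next
    fix x y assume x: "x \<in> set_chains H X (Suc k)" and y: "y \<in> set_chains H X (Suc k)"
    have xy: "x + y \<in> set_chains H X (Suc k)"
      using subspaceD(2)[OF vector_space_fscale[OF vs] subspace_chains x y] k by simp
    define I where "I = \<Union>{S. x S \<noteq> 0} \<union> \<Union>{S. y S \<noteq> 0}"
    have I: "finite I" "I \<subseteq> H" "\<And>T. x T \<noteq> 0 \<Longrightarrow> T \<subseteq> I" "\<And>T. y T \<noteq> 0 \<Longrightarrow> T \<subseteq> I"
      using support_bound[OF x] support_bound[OF y] by (auto simp: I_def)
    have I': "(x + y) T \<noteq> 0 \<Longrightarrow> T \<subseteq> I" for T using I(3,4)[of T] by (cases "x T = 0") auto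
    show "d (x + y) = d x + d y"
    proof
      fix S show "d (x + y) S = (d x + d y) S"
      proof (cases "finite S \<and> S \<subseteq> H \<and> card S = k")
        case True
        have "sgd f a S (t (insert a S) S ((x + y) (insert a S))) =
          sgd f a S (t (insert a S) S (x (insert a S))) + sgd f a S (t (insert a S) S (y (insert a S)))"
          if "a \<in> I - S" for a
          using linearD(1)[OF lint[of S a]] True k that I(2) by (auto simp: sgd_add)
        moreover have "d (x + y) S = (\<Sum>a\<in>I - S. sgd f a S (t (insert a S) S ((x + y) (insert a S))))"
          using bd_sum[OF xy k I(1,2) I', of S] True by simp
        moreover have "d x S = (\<Sum>a\<in>I - S. sgd f a S (t (insert a S) S (x (insert a S))))"
          using bd_sum[OF x k I(1,2,3), of S] True by simp
        moreover have "d y S = (\<Sum>a\<in>I - S. sgd f a S (t (insert a S) S (y (insert a S))))"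
          using bd_sum[OF y k I(1,2,4), of S] True by simp
        ultimately show ?thesis
          by (simp add: sum.distrib[symmetric])
      next
        case False
        then show ?thesis
          using bd_sum[OF x k I(1,2,3), of S] bd_sum[OF y k I(1,2,4), of S] bd_sum[OF xy k I(1,2) I', of S]
          unfolding if_not_P[OF False] by simp
      qed
    qed
  next
    fix c x assume x: "x \<in> set_chains H X (Suc k)"
    have cx: "fscale s c x \<in> set_chains H X (Suc k)"
      using subspaceD(4)[OF vector_space_fscale[OF vs] subspace_chains x] k by simp
    define I where "I = \<Union>{S. x S \<noteq> 0}"
    have I: "finite I" "I \<subseteq> H" "\<And>T. x T \<noteq> 0 \<Longrightarrow> T \<subseteq> I"
      using support_bound[OF x] by (auto simp: I_def)
    have I': "fscale s c x T \<noteq> 0 \<Longrightarrow> T \<subseteq> I" for T using I(3)[of T] by auto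
    show "d (fscale s c x) = fscale s c (d x)"
    proof
      fix S show "d (fscale s c x) S = fscale s c (d x) S"
      proof (cases "finite S \<and> S \<subseteq> H \<and> card S = k")
        case True
        have "sgd f a S (t (insert a S) S (s c (x (insert a S)))) =
          s c (sgd f a S (t (insert a S) S (x (insert a S))))"
          if "a \<in> I - S" for a
          using linearD(2)[OF lint[of S a]] True k that I(2) by (auto simp: sgd_def)
        then show ?thesis
          using bd_sum[OF x k I(1,2,3), of S] bd_sum[OF cx k I(1,2) I', of S] True
          by (simp add: s.scale_sum_right)
      next
        case False
        then show ?thesis
          using bd_sum[OF x k I(1,2,3), of S] bd_sum[OF cx k I(1,2) I', of S]
          unfolding if_not_P[OF False] by simp
      qed
    qed
  qed
qed

text \<open>Dropping a and then b leads to the same coefficient as the other order by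
  \<open>tt\<close>, but with the opposite sign by \<open>sgd_swap\<close>; the double sum is
  antisymmetric.\<close>

lemma bd_bd:
  assumes x: "x \<in> set_chains H X (Suc (Suc k))" and k: "k0 \<le> k"
  shows "d (d x) = 0"
proof
  fix S
  define I where "I = \<Union>{S. x S \<noteq> 0}"
  have I: "finite I" "I \<subseteq> H" "\<And>T. x T \<noteq> 0 \<Longrightarrow> T \<subseteq> I"
    using support_bound[OF x] by (auto simp: I_def)
  have dx: "d x \<in> set_chains H X (Suc k)" using bd_in[OF x] k by simp
  have Id: "T \<subseteq> I" if nz: "d x T \<noteq> 0" for T
  proof -
    obtain a where "x (insert a T) \<noteq> 0" using bd_nonzeroE[OF nz] by blast
    then show ?thesis using I(3) by blast
  qed
  show "d (d x) S = 0 S"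
  proof (cases "finite S \<and> S \<subseteq> H \<and> card S = k")
    case False
    then show ?thesis using bd_sum[OF dx k I(1,2) Id, of S] unfolding if_not_P[OF False] by simp
  next
    case True
    define F where "F a b = sgd f a S (t (insert a S) S (sgd f b (insert a S)
      (t (insert b (insert a S)) (insert a S) (x (insert b (insert a S))))))" for a b
    have lin1: "Vector_Spaces.linear s s (t (insert a S) S)" if "a \<in> I - S" for a
      using lint[of S a] True k I(2) that by auto
    have "d (d x) S = (\<Sum>a\<in>I - S. sgd f a S (t (insert a S) S (d x (insert a S))))"
      using bd_sum[OF dx k I(1,2) Id, of S] True by simp
    also have "\<dots> = (\<Sum>a\<in>I - S. \<Sum>b\<in>(I - S) - {a}. F a b)"
    proof (rule sum.cong[OF refl])
      fix a assume a: "a \<in> I - S"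
      have "d x (insert a S) = (\<Sum>b\<in>I - insert a S. sgd f b (insert a S)
          (t (insert b (insert a S)) (insert a S) (x (insert b (insert a S)))))"
        using bd_sum[OF x _ I, of "insert a S"] True k a I(2) by auto
      moreover have "I - insert a S = (I - S) - {a}" by auto
      ultimately show "sgd f a S (t (insert a S) S (d x (insert a S))) = (\<Sum>b\<in>(I - S) - {a}. F a b)"
        by (simp add: F_def linearD(6)[OF lin1[OF a]] sgd_sum)
    qed
    also have "\<dots> = 0"
    proof (rule sum_offdiag_antisym)
      show "finite (I - S)" using I(1) by simp
      fix a b assume ab: "a \<in> I - S" "b \<in> I - S" "a \<noteq> b"
      have fab: "f a \<noteq> f b" using inj ab I(2) by (meson DiffD1 inj_on_def subsetD)
      let ?y = "x (insert a (insert b S))"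
      let ?u = "t (insert b S) S (t (insert a (insert b S)) (insert b S) ?y)"
      show "F a b = - F b a"
      proof (cases "?y = 0")
        case True
        have 1: "t (insert b (insert a S)) (insert a S) 0 = 0" "t (insert a (insert b S)) (insert b S) 0 = 0"
          using linearD(3)[OF lint[of "insert a S" b]] linearD(3)[OF lint[of "insert b S" a]]
            \<open>finite S \<and> S \<subseteq> H \<and> card S = k\<close> k ab I(2) by auto
        show ?thesis using True 1 linearD(3)[OF lin1[OF ab(1)]] linearD(3)[OF lin1[OF ab(2)]]
          by (simp add: F_def insert_commute)
      next
        case False
        have u: "t (insert a S) S (t (insert b (insert a S)) (insert a S) ?y) = ?u"
          using tt[of S a b ?y] True k ab I(2) chainsD(5)[OF x False] by auto
        have "F a b = sgd f a S (sgd f b (insert a S) ?u)"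
          by (simp add: F_def sgd_linear[OF lin1[OF ab(1)]] u[symmetric] insert_commute)
        also have "\<dots> = - sgd f b S (sgd f a (insert b S) ?u)"
          using sgd_swap[of S b a f ?u] ab fab True by (simp add: sgd_comm)
        also have "sgd f b S (sgd f a (insert b S) ?u) = F b a"
          by (simp add: F_def sgd_linear[OF lin1[OF ab(2)]])
        finally show ?thesis .
      qed
    qed
    finally show ?thesis by simp
  qed
qed

end

text \<open>
  Removing an index \<open>w\<close> exhibits the chains as a mapping cone; \<open>join w y' y''\<close> is the chain with
  components \<open>y'\<close> (subsets without \<open>w\<close>) and \<open>y''\<close> (subsets containing \<open>w\<close>).
\<close>

abbreviation ibd :: "('i \<Rightarrow> nat) \<Rightarrow> ('i set \<Rightarrow> 'b::ab_group_add) \<Rightarrow> 'i set \<Rightarrow> 'b" where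
  "ibd f \<equiv> bd f (\<lambda>_ _ y. y)"

definition join :: "('i \<Rightarrow> nat) \<Rightarrow> 'i \<Rightarrow> ('i set \<Rightarrow> 'b::ab_group_add) \<Rightarrow> ('i set \<Rightarrow> 'b) \<Rightarrow> 'i set \<Rightarrow> 'b" where
  "join f w y' y'' S = (if w \<in> S then sgd f w (S - {w}) (y'' (S - {w})) else y' S)"

text \<open>The sign built into \<open>join\<close> cancels when w is dropped, which contributes y''
  itself, and anticommutes with dropping any other index. What results is the differential of a
  mapping cone.\<close>

lemma bd_join:
  assumes I: "finite I" "w \<notin> I" "inj_on f (insert w I)"
    and y': "\<And>S. y' S \<noteq> 0 \<Longrightarrow> S \<subseteq> I" and y'': "\<And>S. y'' S \<noteq> 0 \<Longrightarrow> S \<subseteq> I"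
  shows "ibd f (join f w y' y'') = join f w (ibd f y' + y'') (- ibd f y'')"
proof
  fix S
  have J: "S \<subseteq> insert w I" if "join f w y' y'' S \<noteq> 0" for S
    using that y'[of S] y''[of "S - {w}"] by (auto simp: join_def split: if_splits)
  have d: "ibd f (join f w y' y'') S = (\<Sum>a\<in>insert w I - S. sgd f a S (join f w y' y'' (insert a S)))"
    by (rule bd_eq) (use I J in auto)
  have d': "ibd f y' T = (\<Sum>a\<in>I - T. sgd f a T (y' (insert a T)))" for T
    by (rule bd_eq) (use I y' in auto)
  have d'': "ibd f y'' T = (\<Sum>a\<in>I - T. sgd f a T (y'' (insert a T)))" for T
    by (rule bd_eq) (use I y'' in auto)
  show "ibd f (join f w y' y'') S = join f w (ibd f y' + y'') (- ibd f y'') S"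
  proof (cases "w \<in> S")
    case False
    have e: "insert w I - S = insert w (I - S)" using False by auto
    have "(\<Sum>a\<in>I - S. sgd f a S (join f w y' y'' (insert a S))) = (\<Sum>a\<in>I - S. sgd f a S (y' (insert a S)))"
      using False I(2) by (intro sum.cong) (auto simp: join_def)
    moreover have "sgd f w S (join f w y' y'' (insert w S)) = y'' S"
      using False by (simp add: join_def)
    ultimately show ?thesis
      unfolding d e using False I d' by (simp add: join_def add.commute)
  next
    case True
    define T where "T = S - {w}"
    have S: "S = insert w T" "w \<notin> T" using True by (auto simp: T_def)
    have e: "insert w I - S = I - T" using I(2) by (auto simp: S(1))
    have "sgd f a S (join f w y' y'' (insert a S)) = - sgd f w T (sgd f a T (y'' (insert a T)))"
      if a: "a \<in> I - T" for a
    proof -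
      have "insert a S - {w} = insert a T" using S a I(2) by auto
      then have j: "join f w y' y'' (insert a S) = sgd f w (insert a T) (y'' (insert a T))"
        using True by (simp add: join_def)
      show ?thesis
      proof (cases "y'' (insert a T) = 0")
        case False
        then have "T \<subseteq> I" using y'' by blast
        then have "finite T" using I(1) finite_subset by blast
        moreover have "f a \<noteq> f w" using I a by (auto simp: inj_on_def)
        ultimately show ?thesis unfolding j unfolding S(1)
          using sgd_swap'[of T a w f] S(2) a by simp
      qed (simp add: j)
    qed
    then have "ibd f (join f w y' y'') S = - sgd f w T (ibd f y'' T)"
      unfolding d e d'' by (simp add: sgd_sum sum_negf)
    then show ?thesis using True by (simp add: join_def T_def sgd_minus)
  qed
qed

lemma join_split:
  "x = join f w (\<lambda>S. if w \<in> S then 0 else x S) (\<lambda>S. if w \<in> S then 0 else sgd f w S (x (insert w S)))"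
  by (auto simp: join_def fun_eq_iff insert_absorb)

lemma join_inject:
  assumes "join f w y' y'' = join f w z' z''"
    and "\<And>S. w \<in> S \<Longrightarrow> y' S = 0" "\<And>S. w \<in> S \<Longrightarrow> z' S = 0" "\<And>S. w \<in> S \<Longrightarrow> y'' S = 0" "\<And>S. w \<in> S \<Longrightarrow> z'' S = 0"
  shows "y' = z'" "y'' = z''"
proof -
  show "y' = z'"
  proof
    fix S show "y' S = z' S"
      using fun_cong[OF assms(1), of S] assms(2,3)[of S] by (cases "w \<in> S") (auto simp: join_def)
  qed
  show "y'' = z''"
  proof
    fix S
    have "sgd f w S (y'' S) = sgd f w S (z'' S)" if "w \<notin> S"
      using fun_cong[OF assms(1), of "insert w S"] that by (simp add: join_def)
    then have "sgd f w S (sgd f w S (y'' S)) = sgd f w S (sgd f w S (z'' S))" if "w \<notin> S"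
      using that by simp
    then show "y'' S = z'' S" using assms(4,5)[of S] by (cases "w \<in> S") auto
  qed
qed

text \<open>A cycle with components x' and x'' satisfies d x' + x'' = 0, so the chain with
  components 0 and x' has boundary x. Only the boundary is computed here; that the cone has
  coefficients in the right subspaces is checked where it is applied.\<close>

lemma bd_cone:
  assumes x: "finite {S. x S \<noteq> 0}" "\<And>S. x S \<noteq> 0 \<Longrightarrow> finite S" "\<And>S. x S \<noteq> 0 \<Longrightarrow> S \<subseteq> H"
    and w: "w \<in> H" and inj: "inj_on f H" and dx: "ibd f x = 0"
  shows "ibd f (join f w 0 (\<lambda>S. if w \<in> S then 0 else x S)) = x"
proof -
  define I where "I = \<Union>{S. x S \<noteq> 0} - {w}"
  define x' x'' where "x' = (\<lambda>S. if w \<in> S then 0 else x S)"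
    and "x'' = (\<lambda>S. if w \<in> S then 0 else sgd f w S (x (insert w S)))"
  have "insert w I \<subseteq> H" using x(3) w by (auto simp: I_def)
  then have "inj_on f (insert w I)" by (rule inj_on_subset[OF inj])
  moreover have "finite I" using x(1,2) by (auto simp: I_def)
  ultimately have I: "finite I" "w \<notin> I" "inj_on f (insert w I)"
    by (simp_all add: I_def)
  have b': "S \<subseteq> I" if "x' S \<noteq> 0" for S
    using that by (auto simp: x'_def I_def split: if_splits)
  have b'': "S \<subseteq> I" if "x'' S \<noteq> 0" for S
    using that by (auto simp: x''_def I_def split: if_splits)
  have xj: "x = join f w x' x''" unfolding x'_def x''_def by (rule join_split)
  have wz: "ibd f x' S = 0" "ibd f x'' S = 0" if "w \<in> S" for S
    using that by (auto intro!: bd_eq_0 simp: x'_def x''_def)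
  have "join f w (ibd f x' + x'') (- ibd f x'') = join f w 0 0"
  proof -
    have "join f w (ibd f x' + x'') (- ibd f x'') = ibd f (join f w x' x'')"
      by (rule bd_join[OF I, symmetric]) (use b' b'' in auto)
    also have "\<dots> = 0" using dx xj by simp
    also have "0 = join f w 0 (0 :: 'a set \<Rightarrow> 'b)" by (auto simp: join_def fun_eq_iff)
    finally show ?thesis .
  qed
  then have "ibd f x' + x'' = 0"
    by (rule join_inject(1)) (simp_all add: wz, simp add: x''_def)
  then have e: "- ibd f x' = x''" by (simp add: neg_eq_iff_add_eq_0)
  have z: "ibd f (0 :: 'a set \<Rightarrow> 'b) = 0" by (rule ext) (auto intro!: bd_eq_0)
  show ?thesis
    unfolding x'_def[symmetric] using bd_join[OF I, of 0 x'] b' e xj z by simp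
qed

section \<open>The homology of a poset covered by principal ideals\<close>

locale cover =
  fixes Q H :: "'v set set" and f :: "'v set \<Rightarrow> nat"
  assumes inj: "inj_on f H" and HQ: "H \<subseteq> Q"
    and cov: "\<And>p. p \<in> Q \<Longrightarrow> \<exists>h\<in>H. p \<subseteq> h"
    and Inter_in: "\<And>S. finite S \<Longrightarrow> S \<subseteq> H \<Longrightarrow> S \<noteq> {} \<Longrightarrow> \<Inter>S \<in> Q"
begin

abbreviation fchains :: "('v set, 'b::ab_group_add) vfunctor \<Rightarrow> nat \<Rightarrow> ('v set set \<Rightarrow> 'b) set" where
  "fchains F \<equiv> set_chains H (\<lambda>S. obj F (\<Inter>S))"

abbreviation fbd :: "('v set, 'b::ab_group_add) vfunctor \<Rightarrow> ('v set set \<Rightarrow> 'b) \<Rightarrow> 'v set set \<Rightarrow> 'b" where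
  "fbd F \<equiv> bd f (\<lambda>T S. arr F (\<Inter>T) (\<Inter>S))"

text \<open>The case distinction keeps the support from growing, since \<eta> is known to map 0 to 0
  only at elements of Q.\<close>

definition mapf :: "('v set \<Rightarrow> 'b::zero \<Rightarrow> 'c::zero) \<Rightarrow> ('v set set \<Rightarrow> 'b) \<Rightarrow> 'v set set \<Rightarrow> 'c" where
  "mapf \<eta> x S = (if x S = 0 then 0 else \<eta> (\<Inter>S) (x S))"

lemma Inter_in': "finite S \<Longrightarrow> S \<subseteq> H \<Longrightarrow> 1 \<le> card S \<Longrightarrow> \<Inter>S \<in> Q"
  by (rule Inter_in) auto

lemma cech_functor:
  assumes u: "vector_space u" and F: "is_functor u Q F"
  shows "cech H f u (\<lambda>S. obj F (\<Inter>S)) (\<lambda>T S. arr F (\<Inter>T) (\<Inter>S)) 1"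
proof (rule cech.intro)
  note FD = is_functorD[OF F]
  show "inj_on f H" by (rule inj)
  show "vector_space u" by (rule u)
  fix S :: "'v set set" assume S: "finite S" "S \<subseteq> H" "1 \<le> card S"
  have S1: "\<Inter>S \<in> Q" using Inter_in' S by blast
  show "module.subspace u (obj F (\<Inter>S))" by (rule FD(1)[OF S1])
  fix a assume a: "a \<in> H" "a \<notin> S"
  have Q1: "\<Inter>(insert a S) \<in> Q" using Inter_in[of "insert a S"] S a by auto
  have le: "\<Inter>(insert a S) \<subseteq> \<Inter>S" by auto
  show "Vector_Spaces.linear u u (arr F (\<Inter>(insert a S)) (\<Inter>S))" by (rule FD(2)[OF Q1 S1 le])
  show "arr F (\<Inter>(insert a S)) (\<Inter>S) x \<in> obj F (\<Inter>S)" if "x \<in> obj F (\<Inter>(insert a S))" for x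
    by (rule FD(3)[OF Q1 S1 le that])
  fix b x assume b: "b \<in> H" "b \<notin> S" "a \<noteq> b" and x: "x \<in> obj F (\<Inter>(insert a (insert b S)))"
  have Q2: "\<Inter>(insert b S) \<in> Q" using Inter_in[of "insert b S"] S b by auto
  have Q3: "\<Inter>(insert a (insert b S)) \<in> Q" using Inter_in[of "insert a (insert b S)"] S a b by auto
  have le': "\<Inter>(insert b S) \<subseteq> \<Inter>S" "\<Inter>(insert a (insert b S)) \<subseteq> \<Inter>(insert b S)"
    "\<Inter>(insert a (insert b S)) \<subseteq> \<Inter>(insert a S)" by auto
  show "arr F (\<Inter>(insert a S)) (\<Inter>S) (arr F (\<Inter>(insert b (insert a S))) (\<Inter>(insert a S)) x) =
    arr F (\<Inter>(insert b S)) (\<Inter>S) (arr F (\<Inter>(insert a (insert b S))) (\<Inter>(insert b S)) x)"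
    unfolding insert_commute[of b a S]
    using FD(5)[OF Q3 Q1 S1 le'(3) le x] FD(5)[OF Q3 Q2 S1 le'(2) le'(1) x] by simp
qed

lemma chains_Inter:
  assumes "x \<in> set_chains H X k" "1 \<le> k" "x S \<noteq> 0"
  shows "\<Inter>S \<in> Q"
  using Inter_in'[of S] chainsD[OF assms(1)] assms(2,3) by blast

context
  fixes u :: "'k::field \<Rightarrow> 'b::ab_group_add \<Rightarrow> 'b" and w :: "'k \<Rightarrow> 'c::ab_group_add \<Rightarrow> 'c"
    and F F' \<eta>
  assumes u: "vector_space u" and w: "vector_space w" and F: "is_functor u Q F" and F': "is_functor w Q F'"
    and \<eta>: "is_nat_trans u w Q F F' \<eta>"
begin

lemma mapf_apply:
  assumes "\<Inter>S \<in> Q"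
  shows "mapf \<eta> x S = \<eta> (\<Inter>S) (x S)"
  using linearD(3)[OF is_nat_transD(1)[OF \<eta> assms]] by (simp add: mapf_def)

lemma lin_on_mapf:
  assumes k: "1 \<le> k"
  shows "lin_on (fscale u) (fscale w) (fchains F k) (fchains F' k) (mapf \<eta>)"
proof -
  interpret c: cech H f u "\<lambda>S. obj F (\<Inter>S)" "\<lambda>T S. arr F (\<Inter>T) (\<Inter>S)" 1 by (rule cech_functor[OF u F])
  interpret wv: vector_space w by (rule w)
  note sub = subspaceD[OF vector_space_fscale[OF u] c.subspace_chains[OF k]]
  show ?thesis
    unfolding lin_on_def
  proof (intro conjI ballI allI)
    fix x assume x: "x \<in> fchains F k"
    have "finite {S. mapf \<eta> x S \<noteq> 0}"
      by (rule finite_subset[OF _ chainsD(1)[OF x]]) (auto simp: mapf_def)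
    then show "mapf \<eta> x \<in> fchains F' k"
      using chainsD[OF x] is_nat_transD(2)[OF \<eta> chains_Inter[OF x k]]
      by (auto simp: set_chains_def mapf_def split: if_splits)
    fix y assume y: "y \<in> fchains F k"
    show "mapf \<eta> (x + y) = mapf \<eta> x + mapf \<eta> y"
    proof
      fix S show "mapf \<eta> (x + y) S = (mapf \<eta> x + mapf \<eta> y) S"
      proof (cases "x S = 0 \<and> y S = 0")
        case False
        then have "\<Inter>S \<in> Q" using chains_Inter[OF x k] chains_Inter[OF y k] by blast
        then show ?thesis using linearD(1)[OF is_nat_transD(1)[OF \<eta>]] by (simp add: mapf_apply)
      qed (simp add: mapf_def)
    qed
  next
    fix c x assume x: "x \<in> fchains F k"
    show "mapf \<eta> (fscale u c x) = fscale w c (mapf \<eta> x)"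
    proof
      fix S show "mapf \<eta> (fscale u c x) S = fscale w c (mapf \<eta> x) S"
      proof (cases "x S = 0")
        case False
        then have "\<Inter>S \<in> Q" using chains_Inter[OF x k] by blast
        then show ?thesis using linearD(2)[OF is_nat_transD(1)[OF \<eta>]] by (simp add: mapf_apply)
      next
        case True
        interpret uv: vector_space u by (rule u)
        show ?thesis using True by (simp add: mapf_def)
      qed
    qed
  qed
qed

lemma mapf_bd:
  assumes x: "x \<in> fchains F (Suc k)" and k: "1 \<le> k"
  shows "fbd F' (mapf \<eta> x) = mapf \<eta> (fbd F x)"
proof
  interpret c: cech H f u "\<lambda>S. obj F (\<Inter>S)" "\<lambda>T S. arr F (\<Inter>T) (\<Inter>S)" 1 by (rule cech_functor[OF u F])
  interpret c': cech H f w "\<lambda>S. obj F' (\<Inter>S)" "\<lambda>T S. arr F' (\<Inter>T) (\<Inter>S)" 1 by (rule cech_functor[OF w F'])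
  define I where "I = \<Union>{S. x S \<noteq> 0}"
  have I: "finite I" "I \<subseteq> H" "\<And>T. x T \<noteq> 0 \<Longrightarrow> T \<subseteq> I"
    using c.support_bound[OF x] by (auto simp: I_def)
  have mx: "mapf \<eta> x \<in> fchains F' (Suc k)"
    using lin_on_mapf[of "Suc k"] x by (auto simp: lin_on_def)
  have I': "mapf \<eta> x T \<noteq> 0 \<Longrightarrow> T \<subseteq> I" for T using I(3) by (auto simp: mapf_def split: if_splits)
  fix S
  show "fbd F' (mapf \<eta> x) S = mapf \<eta> (fbd F x) S"
  proof (cases "finite S \<and> S \<subseteq> H \<and> card S = k")
    case False
    then show ?thesis
      using c.bd_sum[OF x k I, of S] c'.bd_sum[OF mx k I(1,2) I', of S]
      unfolding if_not_P[OF False] by (simp add: mapf_def)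
  next
    case True
    then have S: "\<Inter>S \<in> Q" using Inter_in' k by blast
    note l\<eta> = is_nat_transD(1)[OF \<eta> S]
    have "mapf \<eta> (fbd F x) S = \<eta> (\<Inter>S) (\<Sum>a\<in>I - S. sgd f a S (arr F (\<Inter>(insert a S)) (\<Inter>S) (x (insert a S))))"
      using c.bd_sum[OF x k I, of S] True by (simp add: mapf_apply[OF S])
    also have "\<dots> = (\<Sum>a\<in>I - S. sgd f a S (arr F' (\<Inter>(insert a S)) (\<Inter>S) (mapf \<eta> x (insert a S))))"
      unfolding linearD(6)[OF l\<eta>]
    proof (rule sum.cong[OF refl])
      fix a assume a: "a \<in> I - S"
      have Q1: "\<Inter>(insert a S) \<in> Q" using Inter_in[of "insert a S"] True a I(2) by auto
      have le: "\<Inter>(insert a S) \<subseteq> \<Inter>S" by auto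
      have ob: "x (insert a S) \<in> obj F (\<Inter>(insert a S))"
        using chainsD(5)[OF x, of "insert a S"] subspaceD(1)[OF u is_functorD(1)[OF F Q1]] by fastforce
      show "\<eta> (\<Inter>S) (sgd f a S (arr F (\<Inter>(insert a S)) (\<Inter>S) (x (insert a S)))) =
          sgd f a S (arr F' (\<Inter>(insert a S)) (\<Inter>S) (mapf \<eta> x (insert a S)))"
        using is_nat_transD(3)[OF \<eta> Q1 S le ob] by (simp add: sgd_linear[OF l\<eta>] mapf_apply[OF Q1])
    qed
    also have "\<dots> = fbd F' (mapf \<eta> x) S"
      using c'.bd_sum[OF mx k I(1,2) I', of S] True by simp
    finally show ?thesis by simp
  qed
qed

lemma mapf_lift:
  assumes y: "y \<in> fchains F' k" and k: "1 \<le> k"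
    and im: "\<And>S. \<Inter>S \<in> Q \<Longrightarrow> y S \<noteq> 0 \<Longrightarrow> y S \<in> \<eta> (\<Inter>S) ` obj F (\<Inter>S)"
  shows "\<exists>x\<in>fchains F k. mapf \<eta> x = y"
proof -
  define x where "x S = (if y S = 0 then 0 else SOME z. z \<in> obj F (\<Inter>S) \<and> \<eta> (\<Inter>S) z = y S)" for S
  have x: "x S \<in> obj F (\<Inter>S) \<and> \<eta> (\<Inter>S) (x S) = y S" if "y S \<noteq> 0" for S
  proof -
    have "\<exists>z. z \<in> obj F (\<Inter>S) \<and> \<eta> (\<Inter>S) z = y S"
      using im[OF chains_Inter[OF y k that] that] by auto
    then show ?thesis using that by (auto simp: x_def intro!: someI_ex[where P = "\<lambda>z. z \<in> _ \<and> _ z = _"])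
  qed
  have yx: "x S \<noteq> 0 \<Longrightarrow> y S \<noteq> 0" for S by (simp add: x_def split: if_splits)
  have "x \<in> fchains F k"
    using x yx chainsD[OF y] by (auto simp: set_chains_def intro!: finite_subset[OF _ chainsD(1)[OF y]])
  moreover have "mapf \<eta> x S = y S" for S
  proof (cases "y S = 0")
    case False
    then show ?thesis using x[OF False] mapf_apply[OF chains_Inter[OF y k False]] by simp
  qed (simp add: mapf_def x_def)
  ultimately show ?thesis by auto
qed

end

text \<open>The free functor splits over p: in the summand of p the coefficient at S is G p if p
  \<subseteq> \<Inter>S and 0 otherwise. This is the chain complex, with coefficients in G p, of the
  full simplex on the hyperplanes containing p, and coning off at one such hyperplane fills every
  cycle of positive degree.\<close>

lemma free_functor_acyclic:
  fixes s :: "'k::field \<Rightarrow> 'c::ab_group_add \<Rightarrow> 'c" and G :: "('v set, 'v set list \<Rightarrow>\<^sub>0 'c) vfunctor"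
  assumes s: "vector_space s" and G: "is_functor (pm_scale s) Q G"
    and x: "x \<in> fchains (free_functor Q G) (Suc (Suc n))" and dx: "fbd (free_functor Q G) x = 0"
  shows "\<exists>y\<in>fchains (free_functor Q G) (Suc (Suc (Suc n))). fbd (free_functor Q G) y = x"
proof -
  let ?P = "free_functor Q G" and ?u = "pm_scale s :: 'k \<Rightarrow> ('v set list \<Rightarrow>\<^sub>0 'c) \<Rightarrow> _"
  have u: "vector_space ?u" by (rule vector_space_pm_scale[OF s])
  have P: "is_functor ?u Q ?P" by (rule is_functor_free[OF s G])
  interpret c: cech H f ?u "\<lambda>S. obj ?P (\<Inter>S)" "\<lambda>T S. arr ?P (\<Inter>T) (\<Inter>S)" 1 by (rule cech_functor[OF u P])
  have x': "x S \<in> free_obj Q G (\<Inter>S)" if "x S \<noteq> 0" for S using chainsD(5)[OF x that] by simp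
  note lp = linearD[OF linear_prepend[OF s]] and lt = linearD[OF linear_tail_at[OF s]]
  \<comment> \<open>The component of x in the summand of p, put back into the free functor. It is
    nonzero for finitely many p only, all of them in the set J below.\<close>
  define part where "part p S = prepend p (tail_at p (x S))" for p S
  define J where "J = (\<Union>S\<in>{S. x S \<noteq> 0}. {p. tail_at p (x S) \<noteq> 0})"
  have fJ: "finite J" unfolding J_def using chainsD(1)[OF x] finite_tails by auto
  have part_nz: "x S \<noteq> 0 \<and> tail_at p (x S) \<noteq> 0" if "part p S \<noteq> 0" for p S
    using that by (auto simp: part_def lp lt)
  have JQ: "J \<subseteq> Q" using tail_at_free_obj(1)[OF x'] by (auto simp: J_def)
  have "\<exists>h. \<forall>p\<in>J. h p \<in> H \<and> p \<subseteq> h p" using cov JQ by (intro bchoice) blast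
  then obtain h where h: "\<And>p. p \<in> J \<Longrightarrow> h p \<in> H" "\<And>p. p \<in> J \<Longrightarrow> p \<subseteq> h p" by blast
  define Y where "Y p = join f (h p) 0 (\<lambda>S. if h p \<in> S then 0 else part p S)" for p
  \<comment> \<open>Projection to a summand is linear and the arrows of the free functor are
    identities, so the components of a cycle are cycles.\<close>
  have dpart: "ibd f (part p) = 0" for p
  proof
    fix S
    define I where "I = \<Union>{S. x S \<noteq> 0}"
    have I: "finite I" "I \<subseteq> H" "\<And>T. x T \<noteq> 0 \<Longrightarrow> T \<subseteq> I"
      using c.support_bound[OF x] by (auto simp: I_def)
    let ?L = "\<lambda>y. prepend p (tail_at p y)"
    have L: "Vector_Spaces.linear ?u ?u ?L"
      using Vector_Spaces.linear_compose[OF linear_tail_at[OF s] linear_prepend[OF s]] by (simp add: comp_def)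
    have "ibd f (part p) S = (\<Sum>a\<in>I - S. sgd f a S (part p (insert a S)))"
      by (rule bd_eq) (use I part_nz in blast)+
    also have "\<dots> = ?L (\<Sum>a\<in>I - S. sgd f a S (x (insert a S)))"
      unfolding linearD(6)[OF L] by (simp add: part_def sgd_linear[OF L])
    also have "(\<Sum>a\<in>I - S. sgd f a S (x (insert a S))) = ibd f x S"
      by (rule bd_eq[symmetric]) (use I in auto)
    also have "\<dots> = 0" using dx by simp
    finally show "ibd f (part p) S = 0 S" using linearD(3)[OF L] by simp
  qed
  have dY: "ibd f (Y p) = part p" if "p \<in> J" for p
    unfolding Y_def
  proof (rule bd_cone[OF _ _ _ h(1)[OF that] inj dpart])
    show "finite {S. part p S \<noteq> 0}"
      by (rule finite_subset[OF _ chainsD(1)[OF x]]) (use part_nz in blast)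
    show "part p S \<noteq> 0 \<Longrightarrow> finite S" "part p S \<noteq> 0 \<Longrightarrow> S \<subseteq> H" for S
      using part_nz chainsD(2,3)[OF x] by blast+
  qed
  have Yin: "Y p \<in> fchains ?P (Suc (Suc (Suc n)))" if p: "p \<in> J" for p
  proof -
    have 1: "h p \<in> S \<and> part p (S - {h p}) \<noteq> 0 \<and> Y p S = sgd f (h p) (S - {h p}) (part p (S - {h p}))"
      if "Y p S \<noteq> 0" for S
      using that by (auto simp: Y_def join_def split: if_splits)
    have "{S. Y p S \<noteq> 0} \<subseteq> insert (h p) ` {S. x S \<noteq> 0}"
    proof
      fix S assume "S \<in> {S. Y p S \<noteq> 0}"
      then have "x (S - {h p}) \<noteq> 0" "S = insert (h p) (S - {h p})" using 1[of S] part_nz by auto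
      then show "S \<in> insert (h p) ` {S. x S \<noteq> 0}" by blast
    qed
    then have "finite {S. Y p S \<noteq> 0}" using chainsD(1)[OF x] finite_surj by blast
    moreover have "finite S \<and> S \<subseteq> H \<and> card S = Suc (Suc (Suc n)) \<and> Y p S \<in> free_obj Q G (\<Inter>S)"
      if "Y p S \<noteq> 0" for S
    proof -
      define T where "T = S - {h p}"
      have S: "S = insert (h p) T" "h p \<notin> T" and T: "part p T \<noteq> 0"
        and Y: "Y p S = sgd f (h p) T (part p T)"
        using 1[OF that] by (auto simp: T_def)
      have xT: "x T \<noteq> 0" "tail_at p (x T) \<noteq> 0" using part_nz[OF T] by auto
      note cT = chainsD(2-4)[OF x xT(1)]
      have S': "finite S" "S \<subseteq> H" "card S = Suc (Suc (Suc n))" using S cT h(1)[OF p] by auto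
      have t: "p \<in> Q" "p \<subseteq> \<Inter>T" "tail_at p (x T) \<in> obj G p"
        using tail_at_free_obj[OF x'[OF xT(1)] xT(2)] by auto
      \<comment> \<open>Here the choice of \<open>h p\<close> matters: it contains p, so p remains
        below the intersection after \<open>h p\<close> has been added.\<close>
      have "part p T \<in> free_obj Q G (\<Inter>S)"
        unfolding part_def
        by (rule prepend_in_free_obj) (use t h(2)[OF p] S subspaceD(1)[OF u is_functorD(1)[OF G]] in auto)
      moreover have "module.subspace ?u (free_obj Q G (\<Inter>S))"
        using is_functorD(1)[OF P, of "\<Inter>S"] Inter_in[OF S'(1,2)] S(1) by auto
      ultimately show ?thesis using S' Y sgd_in[OF u] by simp
    qed
    ultimately show ?thesis by (auto simp: set_chains_def)
  qed
  have fs: "vector_space (fscale ?u :: _ \<Rightarrow> ('v set set \<Rightarrow> _) \<Rightarrow> _)" by (rule vector_space_fscale[OF u])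
  have sub: "module.subspace (fscale ?u) (fchains ?P (Suc (Suc (Suc n))))"
    by (rule c.subspace_chains) simp
  have lin: "lin_on (fscale ?u) (fscale ?u) (fchains ?P (Suc (Suc (Suc n)))) (fchains ?P (Suc (Suc n))) (fbd ?P)"
    by (rule c.lin_on_bd) simp
  note ld = lin_onD[OF fs fs sub lin]
  have "fbd ?P (\<Sum>p\<in>J'. Y p) = (\<Sum>p\<in>J'. part p) \<and> (\<Sum>p\<in>J'. Y p) \<in> fchains ?P (Suc (Suc (Suc n)))"
    if "J' \<subseteq> J" for J'
    using finite_subset[OF that fJ] that
  proof (induction J' rule: finite_induct)
    case empty
    show ?case using ld(5) subspaceD(1)[OF fs sub] by (simp add: zero_fun_def)
  next
    case (insert p J')
    then show ?case using ld(2)[OF Yin, of p "\<Sum>p\<in>J'. Y p"] dY[of p] subspaceD(2)[OF fs sub Yin, of p "\<Sum>p\<in>J'. Y p"]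
      by (simp add: plus_fun_def)
  qed
  moreover have "(\<Sum>p\<in>J. part p) = x"
  proof
    fix S
    show "(\<Sum>p\<in>J. part p) S = x S"
    proof (cases "x S = 0")
      case True
      then show ?thesis using part_nz by (auto simp: sum_fun_apply intro!: sum.neutral)
    next
      case False
      have "(\<Sum>p\<in>J. part p) S = (\<Sum>p | p \<in> Q \<and> p \<subseteq> \<Inter>S \<and> tail_at p (x S) \<noteq> 0. part p S)"
        unfolding sum_fun_apply
      proof (rule sum.mono_neutral_right[OF fJ])
        show "{p. p \<in> Q \<and> p \<subseteq> \<Inter>S \<and> tail_at p (x S) \<noteq> 0} \<subseteq> J" using False by (auto simp: J_def)
        show "\<forall>p\<in>J - {p. p \<in> Q \<and> p \<subseteq> \<Inter>S \<and> tail_at p (x S) \<noteq> 0}. part p S = 0"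
          using part_nz tail_at_free_obj[OF x'] by blast
      qed
      also have "\<dots> = x S" unfolding part_def by (rule sum_prepend_tail_at[OF x'[OF False]])
      finally show ?thesis .
    qed
  qed
  ultimately show ?thesis by blast
qed

text \<open>Acyclicity passes to retracts: the cycle is carried into the free functor by the
  section, filled there, and the filling is carried back by the free cover.\<close>

lemma projective_acyclic:
  fixes s :: "'k::field \<Rightarrow> 'c::ab_group_add \<Rightarrow> 'c" and P :: "('v set, 'v set list \<Rightarrow>\<^sub>0 'c) vfunctor"
  assumes s: "vector_space s" and P: "is_projective (pm_scale s) Q P"
    and x: "x \<in> fchains P (Suc (Suc n))" and dx: "fbd P x = 0"
  shows "\<exists>y\<in>fchains P (Suc (Suc (Suc n))). fbd P y = x"
proof -
  let ?u = "pm_scale s :: 'k \<Rightarrow> ('v set list \<Rightarrow>\<^sub>0 'c) \<Rightarrow> _"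
  have u: "vector_space ?u" by (rule vector_space_pm_scale[OF s])
  have F: "is_functor ?u Q P" using P by (simp add: is_projective_def)
  have Fr: "is_functor ?u Q (free_functor Q P)" by (rule is_functor_free[OF s F])
  obtain \<sigma> where \<sigma>: "is_nat_trans ?u ?u Q P (free_functor Q P) \<sigma>"
    "\<And>q x. q \<in> Q \<Longrightarrow> x \<in> obj P q \<Longrightarrow> free_cover Q P q (\<sigma> q x) = x"
    using projective_section[OF s P] by metis
  have e: "is_nat_trans ?u ?u Q (free_functor Q P) P (free_cover Q P)"
    by (rule nat_trans_free_cover[OF s F])
  have mx: "mapf \<sigma> x \<in> fchains (free_functor Q P) (Suc (Suc n))"
    using lin_on_mapf[OF u u F Fr \<sigma>(1), of "Suc (Suc n)"] x by (auto simp: lin_on_def)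
  have "fbd (free_functor Q P) (mapf \<sigma> x) = 0"
    using mapf_bd[OF u u F Fr \<sigma>(1) x] dx by (auto simp: mapf_def)
  then obtain y where y: "y \<in> fchains (free_functor Q P) (Suc (Suc (Suc n)))"
    "fbd (free_functor Q P) y = mapf \<sigma> x"
    using free_functor_acyclic[OF s F mx] by blast
  have "fbd P (mapf (free_cover Q P) y) = mapf (free_cover Q P) (mapf \<sigma> x)"
    using mapf_bd[OF u u Fr F e y(1)] y(2) by simp
  also have "\<dots> = x"
  proof
    fix S show "mapf (free_cover Q P) (mapf \<sigma> x) S = x S"
    proof (cases "x S = 0")
      case False
      then show ?thesis
        using chains_Inter[OF x _ False] mapf_apply[OF u u F Fr \<sigma>(1)] mapf_apply[OF u u Fr F e] \<sigma>(2) chainsD(5)[OF x False]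
        by simp
    qed (simp add: mapf_def)
  qed
  finally show ?thesis
    using lin_on_mapf[OF u u Fr F e, of "Suc (Suc (Suc n))"] y(1) by (auto simp: lin_on_def)
qed

end

section \<open>Direct sums, colimit relations and natural transformations\<close>

lemma mapp_lookup: "Poly_Mapping.lookup (Poly_Mapping.mapp g x) k =
    (if Poly_Mapping.lookup x k = 0 then 0 else g k (Poly_Mapping.lookup x k))"
  by (simp add: mapp.rep_eq when_def in_keys_iff)

lemma mapp_lookup_linear:
  assumes "is_nat_trans u w Q F F' \<eta>" "Poly_Mapping.keys x \<subseteq> Q"
  shows "Poly_Mapping.lookup (Poly_Mapping.mapp \<eta> x) k =
    (if k \<in> Q then \<eta> k (Poly_Mapping.lookup x k) else 0)"
  using assms(2) linearD(3)[OF is_nat_transD(1)[OF assms(1)]]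
  by (auto simp: mapp_lookup in_keys_iff)

lemma dsum_subspace:
  fixes u :: "'k::field \<Rightarrow> 'b::ab_group_add \<Rightarrow> 'b"
  assumes u: "vector_space u" and F: "is_functor u Q F"
  shows "module.subspace (pm_scale u) (dsum Q F)"
proof -
  interpret p: vector_space "pm_scale u :: 'k \<Rightarrow> ('a \<Rightarrow>\<^sub>0 'b) \<Rightarrow> _" by (rule vector_space_pm_scale[OF u])
  interpret u: vector_space u by (rule u)
  show ?thesis
  proof (rule p.subspaceI)
    show "0 \<in> dsum Q F" using subspaceD(1)[OF u is_functorD(1)[OF F]] by (simp add: dsum_def)
    show "x + y \<in> dsum Q F" if "x \<in> dsum Q F" "y \<in> dsum Q F" for x y
      using that subspaceD(2)[OF u is_functorD(1)[OF F]] keys_add[of x y]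
      by (auto simp: dsum_def lookup_add)
    show "pm_scale u c x \<in> dsum Q F" if x: "x \<in> dsum Q F" for c x
    proof -
      have "Poly_Mapping.keys (pm_scale u c x) \<subseteq> Poly_Mapping.keys x"
        by (auto simp: in_keys_iff lookup_pm_scale[OF u])
      then show ?thesis using x subspaceD(4)[OF u is_functorD(1)[OF F]]
        by (auto simp: dsum_def lookup_pm_scale[OF u])
    qed
  qed
qed

lemma single_in_dsum:
  assumes u: "vector_space u" and F: "is_functor u Q F" and "p \<in> Q" "x \<in> obj F p"
  shows "Poly_Mapping.single p x \<in> dsum Q F"
  using assms(3,4) subspaceD(1)[OF u is_functorD(1)[OF F]]
  by (auto simp: dsum_def lookup_single when_def)

lemma colim_rel_subspace:
  assumes "vector_space u"
  shows "module.subspace (pm_scale u) (colim_rel u Q F)"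
proof -
  interpret p: vector_space "pm_scale u" by (rule vector_space_pm_scale[OF assms])
  show ?thesis by (simp add: colim_rel_def)
qed

lemma colim_relI:
  assumes u: "vector_space u" and "p \<in> Q" "q \<in> Q" "p \<le> q" "x \<in> obj F p"
  shows "Poly_Mapping.single p x - Poly_Mapping.single q (arr F p q x) \<in> colim_rel u Q F"
proof -
  interpret p: vector_space "pm_scale u" by (rule vector_space_pm_scale[OF u])
  show ?thesis unfolding colim_rel_def by (rule p.span_base) (use assms in blast)
qed

lemma colim_rel_induct:
  assumes u: "vector_space u" and z: "z \<in> colim_rel u Q F" and S: "module.subspace (pm_scale u) T"
    and base: "\<And>p q x. p \<in> Q \<Longrightarrow> q \<in> Q \<Longrightarrow> p \<le> q \<Longrightarrow> x \<in> obj F p \<Longrightarrow>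
      Poly_Mapping.single p x - Poly_Mapping.single q (arr F p q x) \<in> T"
  shows "z \<in> T"
proof -
  interpret p: vector_space "pm_scale u" by (rule vector_space_pm_scale[OF u])
  show ?thesis using z unfolding colim_rel_def by (rule set_mp[OF p.span_minimal[OF _ S], rotated]) (use base in blast)
qed

lemma colim_rel_dsum:
  assumes u: "vector_space u" and F: "is_functor u Q F"
  shows "colim_rel u Q F \<subseteq> dsum Q F"
proof
  fix z assume "z \<in> colim_rel u Q F"
  then show "z \<in> dsum Q F"
    by (rule colim_rel_induct[OF u _ dsum_subspace[OF u F]])
      (intro subspaceD(3)[OF vector_space_pm_scale[OF u] dsum_subspace[OF u F]] single_in_dsum[OF u F]
        is_functorD(3)[OF F])
qed

lemma mapp_add:
  assumes "is_nat_trans u w Q F F' \<eta>" "Poly_Mapping.keys x \<subseteq> Q" "Poly_Mapping.keys y \<subseteq> Q"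
  shows "Poly_Mapping.mapp \<eta> (x + y) = Poly_Mapping.mapp \<eta> x + Poly_Mapping.mapp \<eta> y"
proof (rule poly_mapping_eqI)
  fix k
  have "Poly_Mapping.keys (x + y) \<subseteq> Q" using keys_add[of x y] assms(2,3) by auto
  then show "Poly_Mapping.lookup (Poly_Mapping.mapp \<eta> (x + y)) k =
      Poly_Mapping.lookup (Poly_Mapping.mapp \<eta> x + Poly_Mapping.mapp \<eta> y) k"
    using linearD(1)[OF is_nat_transD(1)[OF assms(1)]]
    by (simp add: lookup_add mapp_lookup_linear[OF assms(1)] assms(2,3))
qed

lemma mapp_scale:
  assumes u: "vector_space u" and w: "vector_space w"
    and "is_nat_trans u w Q F F' \<eta>" "Poly_Mapping.keys x \<subseteq> Q"
  shows "Poly_Mapping.mapp \<eta> (pm_scale u c x) = pm_scale w c (Poly_Mapping.mapp \<eta> x)"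
proof (rule poly_mapping_eqI)
  fix k
  interpret u: vector_space u by (rule u)
  interpret w: vector_space w by (rule w)
  have "Poly_Mapping.keys (pm_scale u c x) \<subseteq> Q"
    using assms(4) by (auto simp: in_keys_iff lookup_pm_scale[OF u])
  then show "Poly_Mapping.lookup (Poly_Mapping.mapp \<eta> (pm_scale u c x)) k =
      Poly_Mapping.lookup (pm_scale w c (Poly_Mapping.mapp \<eta> x)) k"
    using linearD(2)[OF is_nat_transD(1)[OF assms(3)]] assms(4)
    by (simp add: mapp_lookup_linear[OF assms(3)] lookup_pm_scale[OF u] lookup_pm_scale[OF w])
qed

lemma mapp_single:
  assumes "is_nat_trans u w Q F F' \<eta>" "p \<in> Q"
  shows "Poly_Mapping.mapp \<eta> (Poly_Mapping.single p x) = Poly_Mapping.single p (\<eta> p x)"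
  using linearD(3)[OF is_nat_transD(1)[OF assms]]
  by (intro poly_mapping_eqI) (auto simp: mapp_lookup lookup_single when_def)

lemma mapp_in_dsum:
  assumes "is_nat_trans u w Q F F' \<eta>" "x \<in> dsum Q F"
  shows "Poly_Mapping.mapp \<eta> x \<in> dsum Q F'"
proof -
  have k: "Poly_Mapping.keys x \<subseteq> Q" "\<And>q. q \<in> Q \<Longrightarrow> Poly_Mapping.lookup x q \<in> obj F q"
    using assms(2) by (auto simp: dsum_def)
  show ?thesis
    using k(2) is_nat_transD(2)[OF assms(1)]
    by (auto simp: dsum_def in_keys_iff mapp_lookup_linear[OF assms(1) k(1)] split: if_splits)
qed

lemma mapp_colim_rel:
  assumes u: "vector_space u" and w: "vector_space w" and F: "is_functor u Q F"
    and \<eta>: "is_nat_trans u w Q F F' \<eta>" and z: "z \<in> colim_rel u Q F"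
  shows "Poly_Mapping.mapp \<eta> z \<in> colim_rel w Q F'"
proof -
  let ?T = "{z. Poly_Mapping.keys z \<subseteq> Q \<and> Poly_Mapping.mapp \<eta> z \<in> colim_rel w Q F'}"
  interpret p: vector_space "pm_scale u" by (rule vector_space_pm_scale[OF u])
  interpret uu: vector_space u by (rule u)
  note cw = subspaceD[OF vector_space_pm_scale[OF w] colim_rel_subspace[OF w]]
  have "z \<in> ?T"
  proof (rule colim_rel_induct[OF u z], rule p.subspaceI)
    have "Poly_Mapping.mapp \<eta> 0 = 0" by (intro poly_mapping_eqI) (simp add: mapp_lookup)
    then show "0 \<in> ?T" using cw(1) by simp
    show "x + y \<in> ?T" if "x \<in> ?T" "y \<in> ?T" for x y
      using that keys_add[of x y] cw(2) by (auto simp: mapp_add[OF \<eta>])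
    show "pm_scale u c x \<in> ?T" if x: "x \<in> ?T" for c x
    proof -
      have "Poly_Mapping.keys (pm_scale u c x) \<subseteq> Poly_Mapping.keys x"
        by (auto simp: in_keys_iff lookup_pm_scale[OF u])
      then show ?thesis using x cw(4) by (auto simp: mapp_scale[OF u w \<eta>])
    qed
  next
    fix p q x assume pq: "p \<in> Q" "q \<in> Q" "p \<le> q" "x \<in> obj F p"
    let ?a = "Poly_Mapping.single p x" and ?b = "Poly_Mapping.single q (arr F p q x)"
    have k: "Poly_Mapping.keys ?a \<subseteq> Q" "Poly_Mapping.keys ?b \<subseteq> Q" "Poly_Mapping.keys (?a - ?b) \<subseteq> Q"
      using pq by (auto simp: in_keys_iff lookup_minus lookup_single when_def split: if_splits)
    have "Poly_Mapping.mapp \<eta> (?a - ?b) + Poly_Mapping.mapp \<eta> ?b = Poly_Mapping.mapp \<eta> ?a"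
      using mapp_add[OF \<eta> k(3,2)] by simp
    then have "Poly_Mapping.mapp \<eta> (?a - ?b) =
        Poly_Mapping.single p (\<eta> p x) - Poly_Mapping.single q (arr F' p q (\<eta> p x))"
      using is_nat_transD(3)[OF \<eta> pq] by (simp add: mapp_single[OF \<eta>] pq eq_diff_eq)
    then show "?a - ?b \<in> ?T"
      using k(3) colim_relI[OF w pq(1-3) is_nat_transD(2)[OF \<eta> pq(1,4)]] by simp
  qed
  then show ?thesis by simp
qed

section \<open>The colimit as Cech homology in degree zero\<close>

context cover
begin

definition to_dsum :: "('v set set \<Rightarrow> 'b::zero) \<Rightarrow> 'v set \<Rightarrow>\<^sub>0 'b" where
  "to_dsum x = Abs_poly_mapping (\<lambda>q. x {q})"

definition to_colim :: "('k::field \<Rightarrow> 'b::ab_group_add \<Rightarrow> 'b) \<Rightarrow> ('v set, 'b) vfunctor \<Rightarrow>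
    ('v set set \<Rightarrow> 'b) \<Rightarrow> 'v set \<Rightarrow>\<^sub>0 'b" where
  "to_colim u F x = quot_map (pm_scale u) (colim_rel u Q F) (to_dsum x)"

definition spike :: "'v set \<Rightarrow> 'b::zero \<Rightarrow> 'v set set \<Rightarrow> 'b" where
  "spike h y S = (if S = {h} then y else 0)"

lemma lookup_to_dsum:
  assumes "finite {S. x S \<noteq> 0}"
  shows "Poly_Mapping.lookup (to_dsum x) q = x {q}"
proof -
  have "{q. x {q} \<noteq> 0} = (\<lambda>q. {q}) -` {S. x S \<noteq> 0}" by auto
  then have "finite {q. x {q} \<noteq> 0}"
    using finite_vimageI[OF assms, of "\<lambda>q. {q}"] by simp
  then show ?thesis by (simp add: to_dsum_def)
qed

end

locale cover_functor = cover Q H f for Q H :: "'v set set" and f +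
  fixes u :: "'k::field \<Rightarrow> 'b::ab_group_add \<Rightarrow> 'b" and F :: "('v set, 'b) vfunctor"
  assumes u: "vector_space u" and F: "is_functor u Q F"
begin

sublocale c: cech H f u "\<lambda>S. obj F (\<Inter>S)" "\<lambda>T S. arr F (\<Inter>T) (\<Inter>S)" 1
  by (rule cech_functor[OF u F])

abbreviation "pu \<equiv> pm_scale u :: 'k \<Rightarrow> ('v set \<Rightarrow>\<^sub>0 'b) \<Rightarrow> _"
abbreviation "fu \<equiv> fscale u :: 'k \<Rightarrow> ('v set set \<Rightarrow> 'b) \<Rightarrow> _"
abbreviation "R \<equiv> colim_rel u Q F"

lemma pu: "vector_space pu" by (rule vector_space_pm_scale[OF u])
lemma fu: "vector_space fu" by (rule vector_space_fscale[OF u])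
lemma subR: "module.subspace pu R" by (rule colim_rel_subspace[OF u])

lemmas Rs = subspaceD[OF pu subR]
lemmas qm = quot_map[OF pu subR]
lemmas FD = is_functorD[OF F]
lemmas oF = subspaceD[OF u is_functorD(1)[OF F]]

lemma sub_chains: "module.subspace fu (fchains F (Suc k))"
  by (rule c.subspace_chains) simp

lemmas cs = subspaceD[OF fu sub_chains]

lemma lin_fbd: "lin_on fu fu (fchains F (Suc (Suc k))) (fchains F (Suc k)) (fbd F)"
  by (rule c.lin_on_bd) simp

lemmas ld = lin_onD[OF fu fu sub_chains lin_fbd]

lemma HQ': "h \<in> H \<Longrightarrow> h \<in> Q" using HQ by blast

lemma to_dsum_in: "x \<in> fchains F (Suc 0) \<Longrightarrow> to_dsum x \<in> dsum Q F"
proof -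
  assume x: "x \<in> fchains F (Suc 0)"
  have "x {q} \<in> obj F q" if "q \<in> Q" for q
    using chainsD(5)[OF x, of "{q}"] oF(1)[OF that] by (cases "x {q} = 0") auto
  moreover have "q \<in> Q" if "x {q} \<noteq> 0" for q
    using chainsD(3)[OF x that] HQ by auto
  ultimately show "to_dsum x \<in> dsum Q F"
    by (auto simp: dsum_def in_keys_iff lookup_to_dsum[OF chainsD(1)[OF x]])
qed

lemma subspace_colim: "module.subspace pu (colim u Q F)"
  unfolding colim_def by (rule subspace_quot[OF pu subR dsum_subspace[OF u F]])

lemma colim_sub: "colim u Q F \<subseteq> dsum Q F"
  unfolding colim_def by (rule quot_sub[OF pu subR dsum_subspace[OF u F] colim_rel_dsum[OF u F]])

lemma lin_to_colim: "lin_on fu pu (fchains F (Suc 0)) (colim u Q F) (to_colim u F)"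
  unfolding lin_on_def
proof (intro conjI ballI allI)
  show "to_colim u F x \<in> colim u Q F" if "x \<in> fchains F (Suc 0)" for x
    using to_dsum_in[OF that] by (auto simp: to_colim_def colim_def quot_def)
next
  fix x y assume x: "x \<in> fchains F (Suc 0)" and y: "y \<in> fchains F (Suc 0)"
  have "to_dsum (x + y) = to_dsum x + to_dsum y"
    by (rule poly_mapping_eqI)
      (simp add: lookup_add lookup_to_dsum[OF chainsD(1)[OF x]] lookup_to_dsum[OF chainsD(1)[OF y]]
        lookup_to_dsum[OF chainsD(1)[OF cs(2)[OF x y]]])
  then show "to_colim u F (x + y) = to_colim u F x + to_colim u F y"
    by (simp add: to_colim_def linearD(1)[OF qm(1)])
next
  fix a x assume x: "x \<in> fchains F (Suc 0)"
  have "to_dsum (fu a x) = pu a (to_dsum x)"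
    by (rule poly_mapping_eqI)
      (simp add: lookup_pm_scale[OF u] lookup_to_dsum[OF chainsD(1)[OF x]]
        lookup_to_dsum[OF chainsD(1)[OF cs(4)[OF x]]])
  then show "to_colim u F (fu a x) = pu a (to_colim u F x)"
    by (simp add: to_colim_def linearD(2)[OF qm(1)])
qed

lemma spike_in: "h \<in> H \<Longrightarrow> y \<in> obj F h \<Longrightarrow> spike h y \<in> fchains F (Suc 0)"
  by (auto simp: set_chains_def spike_def intro: finite_subset[of _ "{{h}}"])

abbreviation "N \<equiv> fbd F ` fchains F (Suc (Suc 0))"

lemma sub_N: "module.subspace fu N"
  by (rule subspace_lin_on_image[OF fu fu sub_chains lin_fbd])

lemmas Ns = subspaceD[OF fu sub_N]

text \<open>The two hyperplanes span an edge whose coefficient is the image of y in F (h \<inter>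
  h'); up to sign its boundary is the difference of the two transports.\<close>

lemma edge:
  assumes p: "p \<in> Q" "y \<in> obj F p" and h: "h \<in> H" "h' \<in> H" "p \<subseteq> h" "p \<subseteq> h'"
  shows "spike h (arr F p h y) - spike h' (arr F p h' y) \<in> N"
proof (cases "h = h'")
  case True
  then show ?thesis using Ns(1) by simp
next
  case False
  define z where "z S = (if S = {h, h'} then arr F p (h \<inter> h') y else 0)" for S
  have hh: "h \<inter> h' \<in> Q" using Inter_in[of "{h, h'}"] h by simp
  have v: "arr F p (h \<inter> h') y \<in> obj F (h \<inter> h')" by (rule FD(3)[OF p(1) hh _ p(2)]) (use h in simp)
  have z: "z \<in> fchains F (Suc (Suc 0))"
    using False h v by (auto simp: set_chains_def z_def intro: finite_subset[of _ "{{h, h'}}"])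
  have ff: "f h \<noteq> f h'" using inj h False by (auto simp: inj_on_def)
  have bI: "fbd F z S = (if finite S \<and> S \<subseteq> H \<and> card S = Suc 0
    then \<Sum>a\<in>{h, h'} - S. sgd f a S (arr F (\<Inter>(insert a S)) (\<Inter>S) (z (insert a S))) else 0)" for S
    by (rule c.bd_sum[OF z]) (use h in \<open>auto simp: z_def split: if_splits\<close>)
  have comp: "arr F (h \<inter> h') h (arr F p (h \<inter> h') y) = arr F p h y"
    "arr F (h \<inter> h') h' (arr F p (h \<inter> h') y) = arr F p h' y"
    using FD(5)[OF p(1) hh HQ'[OF h(1)] _ _ p(2)] FD(5)[OF p(1) hh HQ'[OF h(2)] _ _ p(2)] h by auto
  have s1: "sgd f h' {h} x = (if f h < f h' then - x else x)" and
    s2: "sgd f h {h'} x = (if f h' < f h then - x else x)" for x :: 'b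
  proof -
    have "{c. c = h \<and> f c < f h'} = (if f h < f h' then {h} else {})"
      "{c. c = h' \<and> f c < f h} = (if f h' < f h then {h'} else {})" by auto
    then show "sgd f h' {h} x = (if f h < f h' then - x else x)"
      "sgd f h {h'} x = (if f h' < f h then - x else x)" by (auto simp: sgd_def)
  qed
  have e1: "fbd F z {h} = (if f h < f h' then - arr F p h y else arr F p h y)"
    using False h by (simp add: bI s1 z_def comp insert_commute Int_commute insert_Diff_if)
  have e2: "fbd F z {h'} = (if f h' < f h then - arr F p h' y else arr F p h' y)"
    using False h by (simp add: bI s2 z_def comp insert_Diff_if)
  have e3: "fbd F z S = 0" if "S \<noteq> {h}" "S \<noteq> {h'}" for S
  proof (rule bd_eq_0)
    fix a assume a: "a \<notin> S"
    have "insert a S \<noteq> {h, h'}"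
    proof
      assume e: "insert a S = {h, h'}"
      have "S = {h, h'} - {a}" unfolding e[symmetric] using a by simp
      moreover have "a = h \<or> a = h'" using e by blast
      moreover have "{h, h'} - {h} = {h'}" "{h, h'} - {h'} = {h}" using False by auto
      ultimately show False using that by metis
    qed
    then show "z (insert a S) = 0" by (simp add: z_def)
  qed
  let ?D = "spike h (arr F p h y) - spike h' (arr F p h' y)"
  \<comment> \<open>The numbering decides the orientation of the edge; the sign is absorbed because
    N is a subspace.\<close>
  have "fbd F z = (if f h < f h' then - ?D else ?D)"
  proof
    fix S show "fbd F z S = (if f h < f h' then - ?D else ?D) S"
    proof (cases "S = {h} \<or> S = {h'}")
      case True
      then show ?thesis using False ff e1 e2 by (auto simp: spike_def)
    next
      case f: False
      then show ?thesis using e3[of S] by (auto simp: spike_def)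
    qed
  qed
  then have "(if f h < f h' then - ?D else ?D) \<in> N" using z by force
  then show ?thesis using Ns(5)[of "- ?D"] by (cases "f h < f h'") simp_all
qed

text \<open>A section of \<open>to_colim\<close> modulo boundaries.\<close>

definition top :: "'v set \<Rightarrow> 'v set" where
  "top p = (SOME h. h \<in> H \<and> p \<subseteq> h)"

lemma top: "p \<in> Q \<Longrightarrow> top p \<in> H" "p \<in> Q \<Longrightarrow> p \<subseteq> top p"
proof -
  have "top p \<in> H \<and> p \<subseteq> top p" if "p \<in> Q"
    unfolding top_def by (rule someI_ex) (use cov[OF that] in blast)
  then show "p \<in> Q \<Longrightarrow> top p \<in> H" "p \<in> Q \<Longrightarrow> p \<subseteq> top p" by auto
qed

text \<open>Moves each component to one arbitrarily chosen hyperplane above it. The choice is not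
  functorial, but two choices differ by edges, hence by boundaries.\<close>

definition lift :: "('v set \<Rightarrow>\<^sub>0 'b) \<Rightarrow> 'v set set \<Rightarrow> 'b" where
  "lift z = (\<Sum>p\<in>Poly_Mapping.keys z. spike (top p) (arr F p (top p) (Poly_Mapping.lookup z p)))"

lemma arr_top: "p \<in> Q \<Longrightarrow> Vector_Spaces.linear u u (arr F p (top p))"
  by (rule FD(2)) (use top HQ' in auto)

lemma lift_eq:
  assumes "finite K" "Poly_Mapping.keys z \<subseteq> K" "K \<subseteq> Q"
  shows "lift z = (\<Sum>p\<in>K. spike (top p) (arr F p (top p) (Poly_Mapping.lookup z p)))"
  unfolding lift_def
proof (rule sum.mono_neutral_left[OF assms(1,2)], rule ballI)
  fix p assume "p \<in> K - Poly_Mapping.keys z"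
  then have "p \<in> Q" "Poly_Mapping.lookup z p = 0" using assms by (auto simp: in_keys_iff)
  then show "spike (top p) (arr F p (top p) (Poly_Mapping.lookup z p)) = 0"
    using linearD(3)[OF arr_top] by (auto simp: spike_def fun_eq_iff)
qed

lemma lift_in: "z \<in> dsum Q F \<Longrightarrow> lift z \<in> fchains F (Suc 0)"
  unfolding lift_def
proof (rule cs(6), rule spike_in)
  fix p assume "z \<in> dsum Q F" "p \<in> Poly_Mapping.keys z"
  then have "p \<in> Q" "Poly_Mapping.lookup z p \<in> obj F p" by (auto simp: dsum_def)
  then show "top p \<in> H" "arr F p (top p) (Poly_Mapping.lookup z p) \<in> obj F (top p)"
    using top FD(3) HQ' by auto
qed

lemma lift_colim: "z \<in> dsum Q F \<Longrightarrow> to_colim u F (lift z) = quot_map pu R z"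
proof -
  assume z: "z \<in> dsum Q F"
  let ?K = "Poly_Mapping.keys z"
  have K: "p \<in> Q" "Poly_Mapping.lookup z p \<in> obj F p" if "p \<in> ?K" for p
    using z that by (auto simp: dsum_def)
  have "to_dsum (lift z) = (\<Sum>p\<in>?K. Poly_Mapping.single (top p) (arr F p (top p) (Poly_Mapping.lookup z p)))"
    by (rule poly_mapping_eqI, subst lookup_to_dsum[OF chainsD(1)[OF lift_in[OF z]]])
      (auto simp: lookup_sum lookup_single lift_def sum_fun_apply spike_def when_def intro!: sum.cong)
  moreover have "z = (\<Sum>p\<in>?K. Poly_Mapping.single p (Poly_Mapping.lookup z p))"
    by (rule poly_mapping_eqI) (auto simp: lookup_sum lookup_single when_def in_keys_iff)
  ultimately have "z - to_dsum (lift z) = (\<Sum>p\<in>?K. Poly_Mapping.single p (Poly_Mapping.lookup z p) -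
      Poly_Mapping.single (top p) (arr F p (top p) (Poly_Mapping.lookup z p)))"
    by (simp only: sum_subtractf)
  also have "\<dots> \<in> R"
    by (rule Rs(6), rule colim_relI[OF u]) (use K top HQ' in auto)
  finally show ?thesis
    unfolding to_colim_def quot_map_eq_iff[OF pu subR, of z, symmetric] by (rule sym)
qed

lemma to_colim_surj: "a \<in> colim u Q F \<Longrightarrow> \<exists>x\<in>fchains F (Suc 0). to_colim u F x = a"
  using lift_colim lift_in by (auto simp: colim_def quot_def intro!: bexI[of _ "lift _"])

text \<open>A generating relation compares x at p with its image at q. Both transports end at
  hyperplanes containing p, so \<open>edge\<close> applies; linearity of \<open>lift\<close> extends
  this to the span.\<close>

lemma lift_rel:
  assumes "z \<in> R"
  shows "lift z \<in> N"
proof -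
  interpret p: vector_space pu by (rule pu)
  interpret uu: vector_space u by (rule u)
  let ?T = "{z. Poly_Mapping.keys z \<subseteq> Q \<and> lift z \<in> N}"
  have spike_add: "spike h (x + y) = spike h x + spike h (y :: 'b)"
    and spike_scale: "spike h (u a x) = fu a (spike h x)" for h x y a
    by (auto simp: spike_def fun_eq_iff)
  have add: "lift (x + y) = lift x + lift y" if "Poly_Mapping.keys x \<subseteq> Q" "Poly_Mapping.keys y \<subseteq> Q" for x y
  proof -
    let ?K = "Poly_Mapping.keys x \<union> Poly_Mapping.keys y"
    have K: "finite ?K" "?K \<subseteq> Q" using that by auto
    have "lift (x + y) = (\<Sum>p\<in>?K. spike (top p) (arr F p (top p) (Poly_Mapping.lookup (x + y) p)))"
      by (rule lift_eq[OF K(1) keys_add K(2)])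
    also have "\<dots> = (\<Sum>p\<in>?K. spike (top p) (arr F p (top p) (Poly_Mapping.lookup x p)))
       + (\<Sum>p\<in>?K. spike (top p) (arr F p (top p) (Poly_Mapping.lookup y p)))"
      unfolding sum.distrib[symmetric]
    proof (rule sum.cong[OF refl])
      fix p assume "p \<in> ?K"
      then have "p \<in> Q" using K by blast
      from linearD(1)[OF arr_top[OF this]]
      show "spike (top p) (arr F p (top p) (Poly_Mapping.lookup (x + y) p)) =
        spike (top p) (arr F p (top p) (Poly_Mapping.lookup x p)) + spike (top p) (arr F p (top p) (Poly_Mapping.lookup y p))"
        by (simp add: lookup_add spike_add)
    qed
    also have "\<dots> = lift x + lift y"
      using lift_eq[OF K(1) _ K(2), of x] lift_eq[OF K(1) _ K(2), of y] by simp
    finally show ?thesis .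
  qed
  have scale: "lift (pu a x) = fu a (lift x)" if "Poly_Mapping.keys x \<subseteq> Q" for a x
  proof -
    interpret fv: vector_space fu by (rule fu)
    let ?K = "Poly_Mapping.keys x"
    have "Poly_Mapping.keys (pu a x) \<subseteq> ?K" by (auto simp: in_keys_iff lookup_pm_scale[OF u])
    then have "lift (pu a x) = (\<Sum>p\<in>?K. spike (top p) (arr F p (top p) (Poly_Mapping.lookup (pu a x) p)))"
      by (rule lift_eq[OF _ _ that, rotated]) simp
    also have "\<dots> = (\<Sum>p\<in>?K. fu a (spike (top p) (arr F p (top p) (Poly_Mapping.lookup x p))))"
    proof (rule sum.cong[OF refl])
      fix p assume "p \<in> ?K"
      then have "p \<in> Q" using that by blast
      from linearD(2)[OF arr_top[OF this]]
      show "spike (top p) (arr F p (top p) (Poly_Mapping.lookup (pu a x) p)) =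
        fu a (spike (top p) (arr F p (top p) (Poly_Mapping.lookup x p)))"
        by (simp add: lookup_pm_scale[OF u] spike_scale)
    qed
    finally show ?thesis by (simp add: lift_def fv.scale_sum_right)
  qed
  have single: "lift (Poly_Mapping.single p x) = spike (top p) (arr F p (top p) x)" if "p \<in> Q" for p x
    using lift_eq[of "{p}" "Poly_Mapping.single p x"] that by simp
  have "z \<in> ?T"
  proof (rule colim_rel_induct[OF u assms], rule p.subspaceI)
    show "0 \<in> ?T" using Ns(1) by (simp add: lift_def zero_fun_def)
    show "x + y \<in> ?T" if "x \<in> ?T" "y \<in> ?T" for x y
      using that keys_add[of x y] Ns(2)[of "lift x" "lift y"] add[of x y] by auto
    show "pu a x \<in> ?T" if x: "x \<in> ?T" for a x
    proof -
      have "Poly_Mapping.keys (pu a x) \<subseteq> Poly_Mapping.keys x"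
        by (auto simp: in_keys_iff lookup_pm_scale[OF u])
      then show ?thesis using x Ns(4)[of "lift x" a] scale[of x a] by auto
    qed
  next
    fix p q x assume pq: "p \<in> Q" "q \<in> Q" "p \<le> q" "x \<in> obj F p"
    let ?a = "Poly_Mapping.single p x" and ?b = "Poly_Mapping.single q (arr F p q x)"
    have k: "Poly_Mapping.keys ?a \<subseteq> Q" "Poly_Mapping.keys ?b \<subseteq> Q" "Poly_Mapping.keys (?a - ?b) \<subseteq> Q"
      using pq by (auto simp: in_keys_iff lookup_minus lookup_single when_def split: if_splits)
    have "lift ?a = lift (?a - ?b) + lift ?b" using add[OF k(3,2)] by simp
    then have "lift (?a - ?b) = spike (top p) (arr F p (top p) x) - spike (top q) (arr F q (top q) (arr F p q x))"
      using single pq by (simp add: eq_diff_eq)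
    also have "arr F q (top q) (arr F p q x) = arr F p (top q) x"
      by (rule FD(5)) (use pq top HQ' in auto)
    also have "spike (top p) (arr F p (top p) x) - spike (top q) (arr F p (top q) x) \<in> N"
      by (rule edge) (use pq top order_trans[of p q "top q"] in auto)
    finally show "?a - ?b \<in> ?T" using k(3) by simp
  qed
  then show ?thesis by simp
qed

text \<open>A chain x differs from \<open>lift (to_dsum x)\<close> by edges joining h with
  \<open>top h\<close>, and the latter chain is a boundary by \<open>lift_rel\<close>.\<close>

lemma to_colim_ker:
  assumes x: "x \<in> fchains F (Suc 0)" and z: "to_colim u F x = 0"
  shows "\<exists>y\<in>fchains F (Suc (Suc 0)). fbd F y = x"
proof -
  let ?K = "Poly_Mapping.keys (to_dsum x)"
  note lk = lookup_to_dsum[OF chainsD(1)[OF x]]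
  have K: "h \<in> H" "x {h} \<in> obj F h" if "h \<in> ?K" for h
    using that chainsD(3,5)[OF x, of "{h}"] by (auto simp: in_keys_iff lk)
  have "to_dsum x \<in> R" using z quot_map_eq_0_iff[OF pu subR] by (simp add: to_colim_def)
  then have l: "lift (to_dsum x) \<in> N" by (rule lift_rel)
  have xs: "x = (\<Sum>h\<in>?K. spike h (arr F h h (x {h})))"
  proof
    fix S
    show "x S = (\<Sum>h\<in>?K. spike h (arr F h h (x {h}))) S"
    proof (cases "x S = 0")
      case True
      then have "(\<Sum>h\<in>?K. spike h (arr F h h (x {h})) S) = 0"
        by (intro sum.neutral) (auto simp: spike_def in_keys_iff lk)
      then show ?thesis using True by (simp add: sum_fun_apply)
    next
      case False
      then obtain h where h: "S = {h}" using chainsD(4)[OF x False] by (auto simp: card_Suc_eq)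
      have hK: "h \<in> ?K" using False h by (simp add: in_keys_iff lk)
      have "(\<Sum>h'\<in>?K. spike h' (arr F h' h' (x {h'}))) S = (\<Sum>h'\<in>?K. if h' = h then arr F h h (x {h}) else 0)"
        by (auto simp: sum_fun_apply spike_def h intro!: sum.cong)
      also have "\<dots> = x S" using hK K[OF hK] FD(4) HQ' h by simp
      finally show ?thesis by simp
    qed
  qed
  have "x - lift (to_dsum x) = (\<Sum>h\<in>?K. spike h (arr F h h (x {h})) - spike (top h) (arr F h (top h) (x {h})))"
    by (subst xs) (simp add: lift_def lk sum_subtractf)
  also have "\<dots> \<in> N"
    by (rule Ns(6), rule edge) (use K HQ' top in auto)
  finally have "x - lift (to_dsum x) + lift (to_dsum x) \<in> N" using l by (rule Ns(2))
  then show ?thesis by auto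
qed

text \<open>Modulo the relations, the image of \<open>x {h, a}\<close> in F h may be replaced by
  \<open>x {h, a}\<close> itself, placed at h \<inter> a. The two ends of each edge then carry
  opposite signs at the same place.\<close>

lemma to_colim_bd:
  assumes x: "x \<in> fchains F (Suc (Suc 0))"
  shows "to_colim u F (fbd F x) = 0"
proof -
  define I where "I = \<Union>{S. x S \<noteq> 0}"
  have I: "finite I" "I \<subseteq> H" "\<And>T. x T \<noteq> 0 \<Longrightarrow> T \<subseteq> I"
    using c.support_bound[OF x] by (auto simp: I_def)
  have dx: "fbd F x \<in> fchains F (Suc 0)" by (rule ld(1)[OF x])
  note bI = c.bd_sum[OF x _ I]
  have hh: "h \<inter> a \<in> Q" if "h \<in> I" "a \<in> I" for h a
    using Inter_in[of "{h, a}"] that I(2) by auto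
  have xin: "x {h, a} \<in> obj F (h \<inter> a)" if "h \<in> I" "a \<in> I" for h a
    using chainsD(5)[OF x, of "{h, a}"] oF(1)[OF hh[OF that]] by fastforce
  have 1: "to_dsum (fbd F x) = (\<Sum>h\<in>I. \<Sum>a\<in>I - {h}. Poly_Mapping.single h (sgd f a {h} (arr F (h \<inter> a) h (x {h, a}))))"
  proof (rule poly_mapping_eqI)
    fix q
    have b: "fbd F x {q} = (if q \<in> I then \<Sum>a\<in>I - {q}. sgd f a {q} (arr F (q \<inter> a) q (x {q, a})) else 0)"
    proof (cases "q \<in> I")
      case True
      then show ?thesis using bI[of "{q}"] I(2) by (auto simp: insert_commute Int_commute)
    next
      case False
      then have "x (insert a {q}) = 0" for a using I(3)[of "insert a {q}"] by blast
      then have "fbd F x {q} = 0" by (intro bd_eq_0)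
      then show ?thesis using False by simp
    qed
    have "Poly_Mapping.lookup (\<Sum>h\<in>I. \<Sum>a\<in>I - {h}. Poly_Mapping.single h (sgd f a {h} (arr F (h \<inter> a) h (x {h, a})))) q
      = (\<Sum>h\<in>I. if h = q then \<Sum>a\<in>I - {h}. sgd f a {h} (arr F (h \<inter> a) h (x {h, a})) else 0)"
      by (auto simp: lookup_sum lookup_single when_def intro!: sum.cong)
    also have "\<dots> = fbd F x {q}" using b I(1) by simp
    finally show "Poly_Mapping.lookup (to_dsum (fbd F x)) q = Poly_Mapping.lookup
        (\<Sum>h\<in>I. \<Sum>a\<in>I - {h}. Poly_Mapping.single h (sgd f a {h} (arr F (h \<inter> a) h (x {h, a})))) q"
      by (simp add: lookup_to_dsum[OF chainsD(1)[OF dx]])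
  qed
  have 2: "(\<Sum>h\<in>I. \<Sum>a\<in>I - {h}. Poly_Mapping.single (h \<inter> a) (sgd f a {h} (x {h, a}))) = 0"
  proof (rule sum_offdiag_antisym[OF I(1)])
    fix h a assume ha: "h \<in> I" "a \<in> I" "h \<noteq> a"
    then have "f h \<noteq> f a" using inj I(2) by (auto simp: inj_on_def)
    then have "sgd f a {h} y = - sgd f h {a} y" for y :: 'b
      using sgd_swap[of "{}" a h f y] ha by (simp add: sgd_def)
    then show "Poly_Mapping.single (h \<inter> a) (sgd f a {h} (x {h, a})) =
        - Poly_Mapping.single (a \<inter> h) (sgd f h {a} (x {a, h}))"
      by (simp add: insert_commute Int_commute single_uminus[symmetric])
  qed
  have "Poly_Mapping.single (h \<inter> a) (sgd f a {h} (x {h, a})) -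
      Poly_Mapping.single h (sgd f a {h} (arr F (h \<inter> a) h (x {h, a}))) \<in> R"
    if "h \<in> I" "a \<in> I" for h a
  proof -
    have q: "h \<in> Q" "h \<inter> a \<in> Q" "h \<inter> a \<subseteq> h" using that I(2) HQ hh by auto
    have o: "sgd f a {h} (x {h, a}) \<in> obj F (h \<inter> a)"
      by (rule sgd_in[OF u FD(1)[OF q(2)] xin[OF that]])
    show ?thesis
      using colim_relI[OF u q(2,1,3) o] by (simp add: sgd_linear[OF FD(2)[OF q(2,1,3)]])
  qed
  then have "(\<Sum>h\<in>I. \<Sum>a\<in>I - {h}. Poly_Mapping.single (h \<inter> a) (sgd f a {h} (x {h, a})) -
      Poly_Mapping.single h (sgd f a {h} (arr F (h \<inter> a) h (x {h, a})))) \<in> R"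
    by (intro Rs(6)) auto
  then have "- to_dsum (fbd F x) \<in> R" unfolding sum_subtractf 1[symmetric] 2 by simp
  then have "to_dsum (fbd F x) \<in> R" using Rs(5)[of "- to_dsum (fbd F x)"] by simp
  then show ?thesis using quot_map_eq_0_iff[OF pu subR] by (simp add: to_colim_def)
qed

end

section \<open>The double complex of a projective resolution\<close>

lemma mapp_diff:
  assumes "is_nat_trans u w Q F F' \<eta>" "Poly_Mapping.keys x \<subseteq> Q" "Poly_Mapping.keys y \<subseteq> Q"
  shows "Poly_Mapping.mapp \<eta> (x - y) = Poly_Mapping.mapp \<eta> x - Poly_Mapping.mapp \<eta> y"
proof -
  have "Poly_Mapping.keys (x - y) \<subseteq> Q"
    using assms(2,3) by (auto simp: in_keys_iff lookup_minus subset_iff) metis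
  from mapp_add[OF assms(1) this assms(3)] show ?thesis by simp
qed

text \<open>Only the augmentation sees F, so an isomorphism between functors with values in
  different types is absorbed there. This lets the quotient model of the exterior powers be
  exchanged for a model by subspaces without comparing two resolutions.\<close>

lemma proj_resolution_iso:
  fixes u :: "'k::field \<Rightarrow> 'b::ab_group_add \<Rightarrow> 'b" and t :: "'k \<Rightarrow> 'c::ab_group_add \<Rightarrow> 'c"
    and t' :: "'k \<Rightarrow> 'e::ab_group_add \<Rightarrow> 'e"
  assumes R: "is_proj_resolution u t Q P d \<epsilon> F"
    and \<theta>: "is_nat_trans t t' Q F F' \<theta>" "\<And>q. q \<in> Q \<Longrightarrow> \<theta> q ` obj F q = obj F' q"
      "\<And>q x. q \<in> Q \<Longrightarrow> x \<in> obj F q \<Longrightarrow> \<theta> q x = 0 \<Longrightarrow> x = 0"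
  shows "is_proj_resolution u t' Q P d (\<lambda>q. \<theta> q \<circ> \<epsilon> q) F'"
proof -
  have \<epsilon>: "is_nat_trans u t Q (P 0) F \<epsilon>" and sur: "\<And>q. q \<in> Q \<Longrightarrow> \<epsilon> q ` obj (P 0) q = obj F q"
    and ker: "\<And>q. q \<in> Q \<Longrightarrow> d 0 q ` obj (P 1) q = {x \<in> obj (P 0) q. \<epsilon> q x = 0}"
    using R by (auto simp: is_proj_resolution_def)
  have nt: "is_nat_trans u t' Q (P 0) F' (\<lambda>q. \<theta> q \<circ> \<epsilon> q)"
    unfolding is_nat_trans_def
  proof (intro conjI ballI impI)
    show "Vector_Spaces.linear u t' (\<theta> q \<circ> \<epsilon> q)" if "q \<in> Q" for q
      by (rule Vector_Spaces.linear_compose[OF is_nat_transD(1)[OF \<epsilon> that] is_nat_transD(1)[OF \<theta>(1) that]])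
    show "(\<theta> q \<circ> \<epsilon> q) ` obj (P 0) q \<subseteq> obj F' q" if "q \<in> Q" for q
      using is_nat_transD(2)[OF \<epsilon> that] is_nat_transD(2)[OF \<theta>(1) that] by auto
    show "(\<theta> q \<circ> \<epsilon> q) (arr (P 0) p q x) = arr F' p q ((\<theta> p \<circ> \<epsilon> p) x)"
      if "p \<in> Q" "q \<in> Q" "p \<le> q" "x \<in> obj (P 0) p" for p q x
      using is_nat_transD(3)[OF \<epsilon> that] is_nat_transD(3)[OF \<theta>(1) that(1-3), of "\<epsilon> p x"]
        is_nat_transD(2)[OF \<epsilon> that(1,4)] by simp
  qed
  have im: "(\<theta> q \<circ> \<epsilon> q) ` obj (P 0) q = obj F' q" if "q \<in> Q" for q
    unfolding image_comp[symmetric] using sur[OF that] \<theta>(2)[OF that] by simp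
  have z: "\<theta> q (\<epsilon> q x) = 0 \<longleftrightarrow> \<epsilon> q x = 0" if "q \<in> Q" "x \<in> obj (P 0) q" for q x
    using \<theta>(3)[OF that(1)] is_nat_transD(2)[OF \<epsilon> that] linearD(3)[OF is_nat_transD(1)[OF \<theta>(1) that(1)]]
    by auto
  have ker': "d 0 q ` obj (P 1) q = {x \<in> obj (P 0) q. (\<theta> q \<circ> \<epsilon> q) x = 0}" if "q \<in> Q" for q
    using ker[OF that] z[OF that] by auto
  show ?thesis
    unfolding is_proj_resolution_def
  proof (intro conjI ballI)
    show "is_nat_trans u t' Q (P 0) F' (\<lambda>q. \<theta> q \<circ> \<epsilon> q)" by (rule nt)
    fix q assume q: "q \<in> Q"
    show "(\<theta> q \<circ> \<epsilon> q) ` obj (P 0) q = obj F' q" by (rule im[OF q])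
    show "d 0 q ` obj (P 1) q = {x \<in> obj (P 0) q. (\<theta> q \<circ> \<epsilon> q) x = 0}" by (rule ker'[OF q])
  qed (use R in \<open>simp_all add: is_proj_resolution_def\<close>)
qed

context cover
begin

lemma cover_functorI: "vector_space u \<Longrightarrow> is_functor u Q F \<Longrightarrow> cover_functor Q H f u F"
  by (intro cover_functor.intro cover_functor_axioms.intro cover_axioms)

lemma colim_map_lin:
  assumes u: "vector_space u" and F: "is_functor u Q F" "is_functor u Q F'"
    and \<eta>: "is_nat_trans u u Q F F' \<eta>"
  shows "lin_on (pm_scale u) (pm_scale u) (colim u Q F) (colim u Q F') (colim_map u Q F' \<eta>)"
proof -
  interpret F: cover_functor Q H f u F by (rule cover_functorI[OF u F(1)])
  interpret F': cover_functor Q H f u F' by (rule cover_functorI[OF u F(2)])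
  have k: "Poly_Mapping.keys x \<subseteq> Q" if "x \<in> colim u Q F" for x
    using that F.colim_sub by (auto simp: dsum_def)
  show ?thesis
    unfolding lin_on_def
    using F.colim_sub mapp_in_dsum[OF \<eta>] mapp_add[OF \<eta> k k] mapp_scale[OF u u \<eta> k]
    by (auto simp: colim_map_def linearD[OF F'.qm(1)]) (auto simp: colim_def quot_def)
qed

lemma to_colim_mapf:
  assumes u: "vector_space u" and F: "is_functor u Q F" "is_functor u Q F'"
    and \<eta>: "is_nat_trans u u Q F F' \<eta>" and x: "x \<in> fchains F (Suc 0)"
  shows "to_colim u F' (mapf \<eta> x) = colim_map u Q F' \<eta> (to_colim u F x)"
proof -
  interpret F: cover_functor Q H f u F by (rule cover_functorI[OF u F(1)])
  interpret F': cover_functor Q H f u F' by (rule cover_functorI[OF u F(2)])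
  have mx: "mapf \<eta> x \<in> fchains F' (Suc 0)"
    using lin_on_mapf[OF u u F \<eta>, of "Suc 0"] x by (auto simp: lin_on_def)
  have 1: "to_dsum (mapf \<eta> x) = Poly_Mapping.mapp \<eta> (to_dsum x)"
    by (rule poly_mapping_eqI)
      (auto simp: lookup_to_dsum[OF chainsD(1)[OF mx]] mapp_lookup lookup_to_dsum[OF chainsD(1)[OF x]] mapf_def)
  have k: "Poly_Mapping.keys (to_dsum x) \<subseteq> Q" "Poly_Mapping.keys (to_colim u F x) \<subseteq> Q"
    using F.to_dsum_in[OF x] lin_onD(1)[OF F.fu F.pu F.sub_chains F.lin_to_colim x] F.colim_sub
    by (auto simp: dsum_def)
  \<comment> \<open>The representative chosen by \<open>quot_map\<close> differs from the plain sum
    by a relation, and natural transformations preserve relations.\<close>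
  have "to_dsum x - to_colim u F x \<in> F.R"
    unfolding to_colim_def by (rule quot_map_diff_in(1)[OF F.pu F.subR])
  then have "Poly_Mapping.mapp \<eta> (to_dsum x - to_colim u F x) \<in> F'.R"
    by (rule mapp_colim_rel[OF u u F(1) \<eta>])
  then have "Poly_Mapping.mapp \<eta> (to_dsum x) - Poly_Mapping.mapp \<eta> (to_colim u F x) \<in> F'.R"
    by (simp add: mapp_diff[OF \<eta> k])
  then show ?thesis
    using quot_map_eq_iff[OF F'.pu F'.subR] by (simp add: colim_map_def to_colim_def[of u F'] 1)
qed

lemma mapf_comp_0:
  fixes u :: "'k::field \<Rightarrow> 'b::ab_group_add \<Rightarrow> 'b" and v :: "'k \<Rightarrow> 'd::ab_group_add \<Rightarrow> 'd"
    and w :: "'k \<Rightarrow> 'c::ab_group_add \<Rightarrow> 'c"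
  assumes \<eta>: "is_nat_trans u v Q F F' \<eta>" and \<zeta>: "is_nat_trans v w Q F' F'' \<zeta>"
    and z: "\<And>q x. q \<in> Q \<Longrightarrow> x \<in> obj F q \<Longrightarrow> \<zeta> q (\<eta> q x) = 0" and x: "x \<in> fchains F (Suc k)"
  shows "mapf \<zeta> (mapf \<eta> x) = 0"
proof
  fix S show "mapf \<zeta> (mapf \<eta> x) S = 0 S"
  proof (cases "x S = 0")
    case False
    then show ?thesis using z[OF chains_Inter[OF x _ False] chainsD(5)[OF x False]]
      by (simp add: mapf_def)
  qed (simp add: mapf_def)
qed

lemma mapf_exact:
  fixes u :: "'k::field \<Rightarrow> 'b::ab_group_add \<Rightarrow> 'b" and v :: "'k \<Rightarrow> 'd::ab_group_add \<Rightarrow> 'd"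
  assumes u: "vector_space u" "vector_space v" "is_functor u Q F" "is_functor v Q F'"
    and \<eta>: "is_nat_trans u v Q F F' \<eta>" and \<zeta>: "is_nat_trans v w Q F' F'' \<zeta>"
    and ex: "\<And>q. q \<in> Q \<Longrightarrow> \<eta> q ` obj F q = {x \<in> obj F' q. \<zeta> q x = 0}"
    and x: "x \<in> fchains F' (Suc k)" "mapf \<zeta> x = 0"
  shows "\<exists>y\<in>fchains F (Suc k). mapf \<eta> y = x"
proof (rule mapf_lift[OF u \<eta> x(1)])
  fix S assume S: "\<Inter>S \<in> Q" "x S \<noteq> 0"
  then have "\<zeta> (\<Inter>S) (x S) = 0" using fun_cong[OF x(2), of S] by (simp add: mapf_def)
  then show "x S \<in> \<eta> (\<Inter>S) ` obj F (\<Inter>S)" using ex[OF S(1)] chainsD(5)[OF x(1) S(2)] by simp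
qed simp

text \<open>Exactness along m holds at each intersection because the resolution is exact objectwise;
  exactness along n is acyclicity of projectives together with the description of the colimit in
  degree 0.\<close>

lemma bicomplex_of_resolution:
  fixes s :: "'k::field \<Rightarrow> 'c::ab_group_add \<Rightarrow> 'c" and t :: "'k \<Rightarrow> 'e::ab_group_add \<Rightarrow> 'e"
    and P :: "nat \<Rightarrow> ('v set, 'v set list \<Rightarrow>\<^sub>0 'c) vfunctor"
  assumes s: "vector_space s" and t: "vector_space t" and F: "is_functor t Q F"
    and R: "is_proj_resolution (pm_scale s) t Q P d \<epsilon> F"
  shows "bicomplex (fscale (pm_scale s)) (pm_scale (pm_scale s)) (fscale t)
    (\<lambda>m n. fchains (P m) (Suc n)) (\<lambda>m. colim (pm_scale s) Q (P m)) (\<lambda>n. fchains F (Suc n))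
    (\<lambda>m n. mapf (d m)) (\<lambda>m n. fbd (P m)) (\<lambda>m. to_colim (pm_scale s) (P m)) (\<lambda>n. mapf \<epsilon>)
    (\<lambda>m. colim_map (pm_scale s) Q (P m) (d m)) (\<lambda>n. fbd F)"
proof -
  let ?u = "pm_scale s :: 'k \<Rightarrow> ('v set list \<Rightarrow>\<^sub>0 'c) \<Rightarrow> _"
  have u: "vector_space ?u" by (rule vector_space_pm_scale[OF s])
  have proj: "is_projective ?u Q (P m)" and d: "is_nat_trans ?u ?u Q (P (Suc m)) (P m) (d m)"
    and \<epsilon>: "is_nat_trans ?u t Q (P 0) F \<epsilon>"
    and sur: "q \<in> Q \<Longrightarrow> \<epsilon> q ` obj (P 0) q = obj F q"
    and ex0: "q \<in> Q \<Longrightarrow> d 0 q ` obj (P (Suc 0)) q = {x \<in> obj (P 0) q. \<epsilon> q x = 0}"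
    and exS: "q \<in> Q \<Longrightarrow> d (Suc m) q ` obj (P (Suc (Suc m))) q = {x \<in> obj (P (Suc m)) q. d m q x = 0}"
    for m q using R by (auto simp: is_proj_resolution_def)
  have PF: "is_functor ?u Q (P m)" for m using proj by (simp add: is_projective_def)
  have cP: "cover_functor Q H f ?u (P m)" for m by (rule cover_functorI[OF u PF])
  have cF: "cover_functor Q H f t F" by (rule cover_functorI[OF t F])
  show ?thesis
  proof (rule bicomplex.intro)
    show "vector_space (fscale ?u :: _ \<Rightarrow> ('v set set \<Rightarrow> _) \<Rightarrow> _)" by (rule vector_space_fscale[OF u])
    show "vector_space (pm_scale ?u :: _ \<Rightarrow> ('v set \<Rightarrow>\<^sub>0 _) \<Rightarrow> _)" by (rule vector_space_pm_scale[OF u])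
    show "vector_space (fscale t :: _ \<Rightarrow> ('v set set \<Rightarrow> _) \<Rightarrow> _)" by (rule vector_space_fscale[OF t])
    fix m n
    show "module.subspace (fscale ?u) (fchains (P m) (Suc n))" by (rule cover_functor.sub_chains[OF cP])
    show "module.subspace (pm_scale ?u) (colim ?u Q (P m))" by (rule cover_functor.subspace_colim[OF cP])
    show "module.subspace (fscale t) (fchains F (Suc n))" by (rule cover_functor.sub_chains[OF cF])
    show "lin_on (fscale ?u) (fscale ?u) (fchains (P (Suc m)) (Suc n)) (fchains (P m) (Suc n)) (mapf (d m))"
      by (rule lin_on_mapf[OF u u PF PF d]) simp
    show "lin_on (fscale ?u) (fscale ?u) (fchains (P m) (Suc (Suc n))) (fchains (P m) (Suc n)) (fbd (P m))"
      by (rule cover_functor.lin_fbd[OF cP])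
    show "lin_on (fscale ?u) (pm_scale ?u) (fchains (P m) (Suc 0)) (colim ?u Q (P m)) (to_colim ?u (P m))"
      by (rule cover_functor.lin_to_colim[OF cP])
    show "lin_on (fscale ?u) (fscale t) (fchains (P 0) (Suc n)) (fchains F (Suc n)) (mapf \<epsilon>)"
      by (rule lin_on_mapf[OF u t PF F \<epsilon>]) simp
    show "lin_on (pm_scale ?u) (pm_scale ?u) (colim ?u Q (P (Suc m))) (colim ?u Q (P m)) (colim_map ?u Q (P m) (d m))"
      by (rule colim_map_lin[OF u PF PF d])
    show "lin_on (fscale t) (fscale t) (fchains F (Suc (Suc n))) (fchains F (Suc n)) (fbd F)"
      by (rule cover_functor.lin_fbd[OF cF])
    show "mapf (d m) (fbd (P (Suc m)) x) = fbd (P m) (mapf (d m) x)"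
      if "x \<in> fchains (P (Suc m)) (Suc (Suc n))" for x
      using mapf_bd[OF u u PF PF d that] by simp
    show "mapf (d m) (mapf (d (Suc m)) x) = 0" if "x \<in> fchains (P (Suc (Suc m))) (Suc n)" for x
      by (rule mapf_comp_0[OF d d _ that]) (use exS in auto)
    show "fbd (P m) (fbd (P m) x) = 0" if "x \<in> fchains (P m) (Suc (Suc (Suc n)))" for x
      by (rule cech.bd_bd[OF cech_functor[OF u PF] that]) simp
    show "to_colim ?u (P m) (fbd (P m) x) = 0" if "x \<in> fchains (P m) (Suc (Suc 0))" for x
      by (rule cover_functor.to_colim_bd[OF cP that])
    show "mapf \<epsilon> (mapf (d 0) x) = 0" if "x \<in> fchains (P (Suc 0)) (Suc n)" for x
      by (rule mapf_comp_0[OF d \<epsilon> _ that]) (use ex0 in auto)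
    show "to_colim ?u (P m) (mapf (d m) x) = colim_map ?u Q (P m) (d m) (to_colim ?u (P (Suc m)) x)"
      if "x \<in> fchains (P (Suc m)) (Suc 0)" for x
      by (rule to_colim_mapf[OF u PF PF d that])
    show "mapf \<epsilon> (fbd (P 0) x) = fbd F (mapf \<epsilon> x)" if "x \<in> fchains (P 0) (Suc (Suc n))" for x
      using mapf_bd[OF u t PF F \<epsilon> that] by simp
    show "\<exists>y\<in>fchains (P (Suc (Suc m))) (Suc n). mapf (d (Suc m)) y = x"
      if "x \<in> fchains (P (Suc m)) (Suc n)" "mapf (d m) x = 0" for x
      by (rule mapf_exact[OF u u PF PF d d exS that])
    show "\<exists>y\<in>fchains (P m) (Suc (Suc (Suc n))). fbd (P m) y = x"
      if "x \<in> fchains (P m) (Suc (Suc n))" "fbd (P m) x = 0" for x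
      by (rule projective_acyclic[OF s proj that])
    show "\<exists>y\<in>fchains (P m) (Suc (Suc 0)). fbd (P m) y = x"
      if "x \<in> fchains (P m) (Suc 0)" "to_colim ?u (P m) x = 0" for x
      by (rule cover_functor.to_colim_ker[OF cP that])
    show "\<exists>y\<in>fchains (P (Suc 0)) (Suc n). mapf (d 0) y = x"
      if "x \<in> fchains (P 0) (Suc n)" "mapf \<epsilon> x = 0" for x
      by (rule mapf_exact[OF u u PF PF d \<epsilon> ex0 that])
    show "\<exists>x\<in>fchains (P m) (Suc 0). to_colim ?u (P m) x = a" if "a \<in> colim ?u Q (P m)" for a
      by (rule cover_functor.to_colim_surj[OF cP that])
    show "\<exists>x\<in>fchains (P 0) (Suc n). mapf \<epsilon> x = b" if "b \<in> fchains F (Suc n)" for b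
      by (rule mapf_lift[OF u t PF F \<epsilon> that]) (use sur chainsD(5)[OF that] in auto)
  qed
qed

text \<open>In degree 0 every chain is a cycle: this complex is not augmented, and its lowest chains
  live on single hyperplanes.\<close>

definition fcycles :: "('v set, 'e::ab_group_add) vfunctor \<Rightarrow> nat \<Rightarrow> ('v set set \<Rightarrow> 'e) set" where
  "fcycles F i = {x \<in> fchains F (Suc i). i \<noteq> 0 \<longrightarrow> fbd F x = 0}"

text \<open>The choice operator may return any resolution of F, and the double complex is built for
  that one. The isomorphism \<theta> allows the homology to be computed with F' in place of
  F.\<close>

theorem derived_colim_dim_eq:
  fixes s :: "'k::field \<Rightarrow> 'c::ab_group_add \<Rightarrow> 'c" and t :: "'k \<Rightarrow> 'e::ab_group_add \<Rightarrow> 'e"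
  assumes s: "vector_space s" and t: "vector_space t" and F: "is_functor s Q F" and F': "is_functor t Q F'"
    and \<theta>: "is_nat_trans s t Q F F' \<theta>" "\<And>q. q \<in> Q \<Longrightarrow> \<theta> q ` obj F q = obj F' q"
      "\<And>q x. q \<in> Q \<Longrightarrow> x \<in> obj F q \<Longrightarrow> \<theta> q x = 0 \<Longrightarrow> x = 0"
  shows "derived_colim_dim s Q F i =o
    vdim (fscale t) (quot (fscale t) (fcycles F' i) (fbd F' ` fchains F' (Suc (Suc i))))"
proof -
  let ?P = "\<lambda>(P :: nat \<Rightarrow> ('v set, 'v set list \<Rightarrow>\<^sub>0 'c) vfunctor, d, \<epsilon>).
    is_proj_resolution (pm_scale s) s Q P d \<epsilon> F"
  obtain P d \<epsilon> where e: "(SOME x. ?P x) = (P, d, \<epsilon>)" by (cases "SOME x. ?P x") auto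
  have "\<exists>x. ?P x" using proj_resolution_exists[OF s F] by auto
  then have "?P (SOME x. ?P x)" by (rule someI_ex)
  then have R: "is_proj_resolution (pm_scale s) s Q P d \<epsilon> F" by (simp add: e)
  interpret bicomplex "fscale (pm_scale s)" "pm_scale (pm_scale s)" "fscale t"
    "\<lambda>m n. fchains (P m) (Suc n)" "\<lambda>m. colim (pm_scale s) Q (P m)" "\<lambda>n. fchains F' (Suc n)"
    "\<lambda>m n. mapf (d m)" "\<lambda>m n. fbd (P m)" "\<lambda>m. to_colim (pm_scale s) (P m)" "\<lambda>n. mapf (\<lambda>q. \<theta> q \<circ> \<epsilon> q)"
    "\<lambda>m. colim_map (pm_scale s) Q (P m) (d m)" "\<lambda>n. fbd F'"
    by (rule bicomplex_of_resolution[OF s t F' proj_resolution_iso[OF R \<theta>]])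
  have "derived_colim s Q F i = colim_homology (pm_scale s) Q P d i"
    unfolding derived_colim_def using e by simp
  also have "\<dots> = quot (pm_scale (pm_scale s)) (ZA i)
      (colim_map (pm_scale s) Q (P i) (d i) ` colim (pm_scale s) Q (P (Suc i)))"
    by (cases i) (auto simp: ZA_def)
  finally have "derived_colim_dim s Q F i = vdim (pm_scale (pm_scale s)) (quot (pm_scale (pm_scale s)) (ZA i)
      (colim_map (pm_scale s) Q (P i) (d i) ` colim (pm_scale s) Q (P (Suc i))))"
    by (simp add: derived_colim_dim_def)
  moreover have "ZB i = fcycles F' i" by (auto simp: ZB_def fcycles_def split: nat.splits)
  ultimately show ?thesis using vdim_quot_eq[of i] by simp
qed

end

section \<open>A concrete model of the exterior powers\<close>

context finite_dimensional_vector_space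
begin

text \<open>
  The exterior algebra as functions on subsets of the basis. Left multiplication by a vector and
  contraction with a linear form satisfy the Clifford relation \<open>contract_wedge\<close>, from which
  everything else follows.
\<close>

abbreviation escale :: "'a \<Rightarrow> ('b set \<Rightarrow> 'a) \<Rightarrow> 'b set \<Rightarrow> 'a" where
  "escale \<equiv> fscale (*)"

definition idx :: "'b \<Rightarrow> nat" where
  "idx = to_nat_on Basis"

definition wedge :: "'b \<Rightarrow> ('b set \<Rightarrow> 'a) \<Rightarrow> 'b set \<Rightarrow> 'a" where
  "wedge v \<omega> S = (if S \<subseteq> Basis then
     \<Sum>b\<in>S. sgd idx b (S - {b}) (representation Basis v b * \<omega> (S - {b})) else 0)"

definition contract :: "('b \<Rightarrow> 'a) \<Rightarrow> ('b set \<Rightarrow> 'a) \<Rightarrow> 'b set \<Rightarrow> 'a" where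
  "contract \<phi> \<omega> S = (if S \<subseteq> Basis then
     \<Sum>b\<in>Basis - S. sgd idx b S (\<phi> b * \<omega> (insert b S)) else 0)"

definition unit :: "'b set \<Rightarrow> 'a" where
  "unit S = (if S = {} then 1 else 0)"

definition wlist :: "'b list \<Rightarrow> 'b set \<Rightarrow> 'a" where
  "wlist ws = foldr wedge ws unit"

text \<open>Exterior powers of subspaces sit inside the exterior algebra of the whole space, so the
  arrows of the functor become inclusions and the transition maps of the chain complexes
  identities.\<close>

definition ext :: "nat \<Rightarrow> 'b set \<Rightarrow> ('b set \<Rightarrow> 'a) set" where
  "ext j W = module.span escale (wlist ` tuples j W)"

lemma wlist_simps [simp]: "wlist [] = unit" "wlist (w # ws) = wedge w (wlist ws)"
  by (simp_all add: wlist_def)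

lemma inj_idx: "inj_on idx Basis"
  unfolding idx_def using finite_Basis by (intro inj_on_to_nat_on countable_finite)

lemma vs_escale: "vector_space (escale :: 'a \<Rightarrow> ('b set \<Rightarrow> 'a) \<Rightarrow> _)"
  by (rule vector_space_fscale[OF vector_space_times])

sublocale ev: vector_space "escale :: 'a \<Rightarrow> ('b set \<Rightarrow> 'a) \<Rightarrow> _"
  by (rule vs_escale)

lemma rep_add: "representation Basis (v + w) b = representation Basis v b + representation Basis w b"
  and rep_scale: "representation Basis (scale c v) b = c * representation Basis v b"
  using representation_add[OF independent_Basis, of w v] representation_scale[OF independent_Basis, of v c]
  by (simp_all add: span_Basis)

lemma sgd_mult: "sgd f b S (c * x) = c * sgd f b S (x :: 'a)"
  by (simp add: sgd_def)

lemma wedge_add_left: "wedge (v + w) \<omega> = wedge v \<omega> + wedge w \<omega>"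
  by (auto simp: fun_eq_iff wedge_def rep_add ring_distribs sgd_add sum.distrib)

lemma wedge_scale_left: "wedge (scale c v) \<omega> = escale c (wedge v \<omega>)"
  by (auto simp: fun_eq_iff wedge_def rep_scale sum_distrib_left sgd_mult[symmetric] mult.assoc)

lemma linear_wedge: "Vector_Spaces.linear escale escale (wedge v)"
  by (rule linearI[OF vs_escale vs_escale])
    (auto simp: fun_eq_iff wedge_def ring_distribs sgd_add sum.distrib sum_distrib_left sgd_mult[symmetric] mult_ac)

lemma linear_contract: "Vector_Spaces.linear escale escale (contract \<phi>)"
  by (rule linearI[OF vs_escale vs_escale])
    (auto simp: fun_eq_iff contract_def ring_distribs sgd_add sum.distrib sum_distrib_left sgd_mult[symmetric] mult_ac)

lemmas lw = linearD[OF linear_wedge]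
lemmas lc = linearD[OF linear_contract]

text \<open>The terms for (b, c) and (c, b) are opposite; cancelling them by
  \<open>sum_offdiag_antisym\<close> is valid in characteristic 2 as well.\<close>

lemma wedge_wedge_self: "wedge v (wedge v \<omega>) = 0"
proof
  fix S :: "'b set"
  show "wedge v (wedge v \<omega>) S = 0 S"
  proof (cases "S \<subseteq> Basis")
    case False
    then show ?thesis by (simp add: wedge_def)
  next
    case True
    then have fS: "finite S" using finite_Basis finite_subset by blast
    define r where "r = representation Basis v"
    define F where "F b c = sgd idx b (S - {b}) (sgd idx c (S - {b} - {c}) (r b * (r c * \<omega> (S - {b} - {c}))))" for b c
    have "wedge v \<omega> (S - {b}) = (\<Sum>c\<in>S - {b}. sgd idx c (S - {b} - {c}) (r c * \<omega> (S - {b} - {c})))" for b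
      using True by (auto simp: wedge_def r_def)
    then have "wedge v (wedge v \<omega>) S = (\<Sum>b\<in>S. \<Sum>c\<in>S - {b}. F b c)"
      using True by (simp add: wedge_def F_def r_def sum_distrib_left sgd_sum sgd_mult)
    also have "\<dots> = 0"
    proof (rule sum_offdiag_antisym[OF fS])
      fix b c assume bc: "b \<in> S" "c \<in> S" "b \<noteq> c"
      define T where "T = S - {b} - {c}"
      have e: "S - {b} = insert c T" "S - {c} = insert b T" "S - {c} - {b} = T" "finite T" "b \<notin> T" "c \<notin> T"
        using bc fS by (auto simp: T_def)
      have "idx b \<noteq> idx c" using inj_idx bc True by (auto simp: inj_on_def)
      then show "F b c = - F c b"
        unfolding F_def e(3) T_def[symmetric] unfolding e(1,2)
        using sgd_swap[OF e(4,5,6), of idx "r b * (r c * \<omega> T)"] by (simp add: mult.left_commute)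
    qed
    finally show ?thesis by simp
  qed
qed

lemma wedge_swap: "wedge v (wedge w \<omega>) = - wedge w (wedge v \<omega>)"
proof -
  have "wedge (v + w) (wedge (v + w) \<omega>) = 0" by (rule wedge_wedge_self)
  then have "wedge v (wedge w \<omega>) + wedge w (wedge v \<omega>) = 0"
    by (simp add: wedge_add_left lw wedge_wedge_self add.commute)
  then show ?thesis by (simp add: eq_neg_iff_add_eq_0)
qed

lemma linear_form_eq:
  assumes "Vector_Spaces.linear scale (*) \<phi>"
  shows "\<phi> v = (\<Sum>b\<in>Basis. representation Basis v b * \<phi> b)"
proof -
  have "\<phi> v = \<phi> (\<Sum>b\<in>Basis. scale (representation Basis v b) b)"
    using sum_representation_eq[OF independent_Basis, of v Basis] by (simp add: span_Basis finite_Basis)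
  then show ?thesis by (simp add: linearD[OF assms])
qed

text \<open>In both composites one basis vector is inserted and one removed. Distinct ones
  anticommute by \<open>sgd_swap'\<close>. Equal ones contribute coordinates of v times values of
  \<phi>, from outside S in one composite and from inside S in the other, and together these add up
  to \<phi> v.\<close>

lemma contract_wedge:
  assumes \<phi>: "Vector_Spaces.linear scale (*) \<phi>" and \<omega>: "\<And>S. \<not> S \<subseteq> Basis \<Longrightarrow> \<omega> S = 0"
  shows "contract \<phi> (wedge v \<omega>) = escale (\<phi> v) \<omega> - wedge v (contract \<phi> \<omega>)"
proof
  fix S :: "'b set"
  show "contract \<phi> (wedge v \<omega>) S = (escale (\<phi> v) \<omega> - wedge v (contract \<phi> \<omega>)) S"
  proof (cases "S \<subseteq> Basis")
    case False
    then show ?thesis using \<omega> by (simp add: contract_def wedge_def)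
  next
    case S: True
    then have fS: "finite S" using finite_Basis finite_subset by blast
    define r where "r = representation Basis v"
    define G where "G b c = sgd idx c (S - {c}) (sgd idx b (S - {c}) (r c * \<phi> b * \<omega> (insert b S - {c})))" for b c
    have "contract \<phi> (wedge v \<omega>) S = (\<Sum>b\<in>Basis - S. r b * \<phi> b * \<omega> S - (\<Sum>c\<in>S. G b c))"
      unfolding contract_def if_P[OF S]
    proof (rule sum.cong[OF refl])
      fix b assume b: "b \<in> Basis - S"
      have t: "sgd idx b S (sgd idx c (insert b S - {c}) x) = - sgd idx c (S - {c}) (sgd idx b (S - {c}) x)"
        if c: "c \<in> S" for c and x :: 'a
      proof -
        define T where "T = S - {c}"
        have e: "S = insert c T" "insert b S - {c} = insert b T" "finite T" "b \<notin> T" "c \<notin> T"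
          using b c fS by (auto simp: T_def)
        have "idx b \<noteq> idx c" using inj_idx b c S by (auto simp: inj_on_def)
        then show ?thesis unfolding T_def[symmetric] e(2) using sgd_swap'[OF e(3,4,5)] e(1) by simp
      qed
      have "wedge v \<omega> (insert b S) =
          (\<Sum>c\<in>insert b S. sgd idx c (insert b S - {c}) (r c * \<omega> (insert b S - {c})))"
        using b S by (simp add: wedge_def r_def)
      also have "\<dots> = sgd idx b S (r b * \<omega> S) + (\<Sum>c\<in>S. sgd idx c (insert b S - {c}) (r c * \<omega> (insert b S - {c})))"
        using b fS by simp
      finally have "sgd idx b S (\<phi> b * wedge v \<omega> (insert b S)) = r b * \<phi> b * \<omega> S +
          (\<Sum>c\<in>S. sgd idx b S (sgd idx c (insert b S - {c}) (r c * \<phi> b * \<omega> (insert b S - {c}))))"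
        by (simp add: ring_distribs sum_distrib_left sgd_add sgd_sum sgd_mult mult_ac)
      also have "\<dots> = r b * \<phi> b * \<omega> S - (\<Sum>c\<in>S. G b c)"
        using t by (simp add: G_def sum_negf)
      finally show "sgd idx b S (\<phi> b * wedge v \<omega> (insert b S)) = r b * \<phi> b * \<omega> S - (\<Sum>c\<in>S. G b c)" .
    qed
    moreover have "wedge v (contract \<phi> \<omega>) S = (\<Sum>c\<in>S. r c * \<phi> c * \<omega> S + (\<Sum>b\<in>Basis - S. G b c))"
      unfolding wedge_def if_P[OF S]
    proof (rule sum.cong[OF refl])
      fix c assume c: "c \<in> S"
      have e: "Basis - (S - {c}) = insert c (Basis - S)" using c S by auto
      have "contract \<phi> \<omega> (S - {c}) =
          sgd idx c (S - {c}) (\<phi> c * \<omega> S) + (\<Sum>b\<in>Basis - S. sgd idx b (S - {c}) (\<phi> b * \<omega> (insert b (S - {c}))))"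
        unfolding contract_def e using c S finite_Basis by (auto simp: insert_absorb)
      moreover have "insert b (S - {c}) = insert b S - {c}" if "b \<in> Basis - S" for b
        using that c by auto
      ultimately have "contract \<phi> \<omega> (S - {c}) =
          sgd idx c (S - {c}) (\<phi> c * \<omega> S) + (\<Sum>b\<in>Basis - S. sgd idx b (S - {c}) (\<phi> b * \<omega> (insert b S - {c})))"
        by simp
      then show "sgd idx c (S - {c}) (representation Basis v c * contract \<phi> \<omega> (S - {c})) =
          r c * \<phi> c * \<omega> S + (\<Sum>b\<in>Basis - S. G b c)"
        by (simp add: r_def[symmetric] G_def ring_distribs sum_distrib_left sgd_add sgd_sum sgd_mult mult_ac)
    qed
    moreover have "(\<Sum>c\<in>S. \<Sum>b\<in>Basis - S. G b c) = (\<Sum>b\<in>Basis - S. \<Sum>c\<in>S. G b c)"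
      by (rule sum.swap)
    moreover have "\<phi> v * \<omega> S = (\<Sum>b\<in>Basis. r b * \<phi> b * \<omega> S)"
      by (simp add: linear_form_eq[OF \<phi>, of v] sum_distrib_right r_def)
    moreover have "(\<Sum>b\<in>Basis. r b * \<phi> b * \<omega> S) = (\<Sum>b\<in>Basis - S. r b * \<phi> b * \<omega> S) + (\<Sum>b\<in>S. r b * \<phi> b * \<omega> S)"
      by (rule sum.subset_diff[OF S finite_Basis])
    ultimately show ?thesis by (simp add: sum.distrib sum_subtractf)
  qed
qed

lemma subspace_ext: "ev.subspace (ext j W)"
  by (simp add: ext_def)

lemmas es = subspaceD[OF vs_escale subspace_ext]

lemma wlist_in_ext: "ws \<in> tuples j W \<Longrightarrow> wlist ws \<in> ext j W"
  unfolding ext_def by (intro ev.span_base) auto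

lemma ext_mono: "U \<subseteq> W \<Longrightarrow> ext j U \<subseteq> ext j W"
  unfolding ext_def by (intro ev.span_mono image_mono) (auto simp: tuples_def)

lemma ext_induct [consumes 1, case_names zero step]:
  assumes "\<omega> \<in> ext j W" "P 0" "\<And>c ws \<eta>. ws \<in> tuples j W \<Longrightarrow> P \<eta> \<Longrightarrow> P (escale c (wlist ws) + \<eta>)"
  shows "P \<omega>"
  using assms(1) unfolding ext_def
proof (induction rule: ev.span_induct_alt)
  case base
  show "P 0" by (rule assms(2))
next
  case (step c x y)
  then obtain ws where "ws \<in> tuples j W" "x = wlist ws" by auto
  then show "P (escale c x + y)" using assms(3) step(2) by blast
qed

lemma wlist_support: "\<not> S \<subseteq> Basis \<Longrightarrow> wlist ws S = 0"
  by (cases ws) (auto simp: unit_def wedge_def)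

lemma ext_support: "\<omega> \<in> ext j W \<Longrightarrow> \<not> S \<subseteq> Basis \<Longrightarrow> \<omega> S = 0"
  by (induction rule: ext_induct) (auto simp: wlist_support)

lemma wedge_in_ext:
  assumes "w \<in> W" "\<omega> \<in> ext j W"
  shows "wedge w \<omega> \<in> ext (Suc j) W"
  using assms(2)
proof (induction rule: ext_induct)
  case zero
  show "wedge w 0 \<in> ext (Suc j) W" using es(1) by (simp add: lw)
next
  case (step c ws \<eta>)
  then have "w # ws \<in> tuples (Suc j) W" using assms(1) by (auto simp: tuples_def)
  from es(4)[OF wlist_in_ext[OF this]] step(2)
  show "wedge w (escale c (wlist ws) + \<eta>) \<in> ext (Suc j) W" by (simp add: lw es)
qed

text \<open>By \<open>contract_wedge\<close>, contraction passes each factor w at the cost of \<phi>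
  w, which is 0, until it reaches the unit.\<close>

lemma contract_ext_eq_0:
  assumes \<phi>: "Vector_Spaces.linear scale (*) \<phi>" "\<And>w. w \<in> W \<Longrightarrow> \<phi> w = 0" and \<omega>: "\<omega> \<in> ext j W"
  shows "contract \<phi> \<omega> = 0"
proof -
  have *: "contract \<phi> (wlist ws) = 0" if "set ws \<subseteq> W" for ws
    using that
  proof (induction ws)
    case Nil
    show ?case by (auto simp: fun_eq_iff contract_def unit_def intro!: sum.neutral)
  next
    case (Cons w ws)
    then have IH: "contract \<phi> (wlist ws) = 0" and w: "\<phi> w = 0" using \<phi>(2) by auto
    have "contract \<phi> (wedge w (wlist ws)) = escale (\<phi> w) (wlist ws) - wedge w (contract \<phi> (wlist ws))"
      by (rule contract_wedge[OF \<phi>(1) wlist_support])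
    then show "contract \<phi> (wlist (w # ws)) = 0" unfolding IH w lw(3) by simp
  qed
  show ?thesis using \<omega>
  proof (induction rule: ext_induct)
    case zero
    show "contract \<phi> 0 = 0" by (rule lc(3))
  next
    case (step c ws \<eta>)
    have "contract \<phi> (wlist ws) = 0" by (rule *) (use step(1) in \<open>simp add: tuples_def\<close>)
    then show "contract \<phi> (escale c (wlist ws) + \<eta>) = 0"
      by (simp only: lc step(2) ev.scale_zero_right add_0_left)
  qed
qed

text \<open>The decomposition of the exterior powers of \<open>U \<oplus> \<langle>v\<rangle>\<close>, with \<open>U \<subseteq> ker \<phi>\<close>.\<close>

lemma ext_decomp:
  assumes \<phi>: "Vector_Spaces.linear scale (*) \<phi>" "\<And>u. u \<in> U \<Longrightarrow> \<phi> u = 0" "\<phi> v = 1"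
    and U: "subspace U" and W: "\<And>w. w \<in> W \<Longrightarrow> w - scale (\<phi> w) v \<in> U"
    and \<omega>: "\<omega> \<in> ext j W"
  shows "\<omega> - wedge v (contract \<phi> \<omega>) \<in> ext j U"
    and "case j of 0 \<Rightarrow> contract \<phi> \<omega> = 0 | Suc i \<Rightarrow> contract \<phi> \<omega> \<in> ext i U"
proof -
  \<comment> \<open>There is no exterior power below degree 0, so the factor of v is 0
    there.\<close>
  define D where "D j = (case j of 0 \<Rightarrow> {0} | Suc i \<Rightarrow> ext i U)" for j
  have D: "ev.subspace (D j)" for j by (simp add: D_def subspace_ext split: nat.splits)
  note Ds = subspaceD[OF vs_escale D]
  have wD: "wedge u y \<in> ext j U" if "u \<in> U" "y \<in> D j" for u y j
    using that wedge_in_ext by (cases j) (auto simp: D_def lw es(1))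
  define dec where "dec j \<omega> \<longleftrightarrow> (\<exists>x\<in>ext j U. \<exists>y\<in>D j. \<omega> = x + wedge v y)" for j \<omega>
  have dec: "dec (length ws) (wlist ws)" if "set ws \<subseteq> W" for ws
    using that
  proof (induction ws)
    case Nil
    have u: "unit \<in> ext 0 U" using wlist_in_ext[of "[]" 0 U] by (simp add: tuples_def)
    have "\<exists>x\<in>ext 0 U. \<exists>y\<in>D 0. wlist [] = x + wedge v y"
      by (rule bexI[OF _ u], rule bexI[of _ 0]) (simp_all add: D_def lw(3))
    then show ?case by (simp add: dec_def)
  next
    case (Cons w ws)
    then obtain x y where xy: "x \<in> ext (length ws) U" "y \<in> D (length ws)" "wlist ws = x + wedge v y"
      by (auto simp: dec_def)
    define u where "u = w - scale (\<phi> w) v"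
    have u: "u \<in> U" using W Cons.prems by (simp add: u_def)
    have w: "w = u + scale (\<phi> w) v" by (simp add: u_def)
    have "wedge w (wlist ws) = wedge u x + wedge u (wedge v y) + escale (\<phi> w) (wedge v x)"
      by (subst w) (simp add: wedge_add_left wedge_scale_left xy(3) lw wedge_wedge_self)
    also have "\<dots> = wedge u x + wedge v (escale (\<phi> w) x - wedge u y)"
      by (simp add: wedge_swap[of u v] lw)
    finally have "wlist (w # ws) = wedge u x + wedge v (escale (\<phi> w) x - wedge u y)" by simp
    moreover have "escale (\<phi> w) x - wedge u y \<in> D (Suc (length ws))"
      using es(3)[OF es(4)[OF xy(1)] wD[OF u xy(2)]] by (simp add: D_def)
    moreover have "wedge u x \<in> ext (Suc (length ws)) U" by (rule wedge_in_ext[OF u xy(1)])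
    ultimately show ?case unfolding dec_def by (metis length_Cons)
  qed
  have "dec j \<omega>"
    using \<omega>
  proof (induction rule: ext_induct)
    case zero
    show "dec j 0"
      unfolding dec_def
      by (rule bexI[OF bexI[OF _ Ds(1)] es(1)]) (simp add: lw)
  next
    case (step c ws \<eta>)
    obtain x y where xy: "x \<in> ext j U" "y \<in> D j" "wlist ws = x + wedge v y"
      using dec[of ws] step(1) by (auto simp: tuples_def dec_def)
    obtain x' y' where xy': "x' \<in> ext j U" "y' \<in> D j" "\<eta> = x' + wedge v y'" using step(2) by (auto simp: dec_def)
    show "dec j (escale c (wlist ws) + \<eta>)"
      unfolding dec_def
      by (rule bexI[of _ "escale c x + x'"], rule bexI[of _ "escale c y + y'"])
        (auto simp: xy xy' lw ev.scale_right_distrib es Ds)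
  qed
  then obtain x y where xy: "x \<in> ext j U" "y \<in> D j" "\<omega> = x + wedge v y" by (auto simp: dec_def)
  have cy: "contract \<phi> y = 0" "\<And>S. \<not> S \<subseteq> Basis \<Longrightarrow> y S = 0"
    using xy(2) contract_ext_eq_0[OF \<phi>(1,2)] ext_support by (auto simp: D_def lc split: nat.splits)
  \<comment> \<open>Contraction kills both x and y, which are built from U, so the Clifford relation
    makes it read off the factor of v.\<close>
  have "contract \<phi> \<omega> = y"
    using xy(3) contract_ext_eq_0[OF \<phi>(1,2) xy(1)] cy(1)
    by (simp add: lc lw contract_wedge[OF \<phi>(1) cy(2)] \<phi>(3))
  then show "\<omega> - wedge v (contract \<phi> \<omega>) \<in> ext j U"
    "case j of 0 \<Rightarrow> contract \<phi> \<omega> = 0 | Suc i \<Rightarrow> contract \<phi> \<omega> \<in> ext i U"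
    using xy by (auto simp: D_def split: nat.splits)
qed

end

section \<open>Rank and nullity on finite-dimensional subspaces\<close>

lemma (in vector_space) span_disjoint_eq_0:
  assumes "independent C" "B \<subseteq> C" "x \<in> span B" "x \<in> span (C - B)"
  shows "x = 0"
proof -
  have "representation C x b = 0" for b
  proof (rule ccontr)
    assume n: "representation C x b \<noteq> 0"
    have "representation C x = representation B x" "representation C x = representation (C - B) x"
      using representation_extend[OF assms(1,3,2)] representation_extend[OF assms(1,4)] by auto
    then have "b \<in> B" "b \<in> C - B" using n representation_ne_zero by metis+
    then show False by simp
  qed
  moreover have "x \<in> span C" using assms(2,3) span_mono by blast
  ultimately show ?thesis using sum_nonzero_representation_eq[OF assms(1), of x] by simp
qed

text \<open>Finiteness is demanded of a set spanning U only, because the ambient spaces of chains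
  may be infinite-dimensional.\<close>

lemma (in vector_space_pair) dim_kernel_image:
  assumes f: "Vector_Spaces.linear s1 s2 f" and U: "vs1.subspace U" and fin: "finite A" "U \<subseteq> vs1.span A"
  shows "vs1.dim U = vs1.dim {x \<in> U. f x = 0} + vs2.dim (f ` U)"
proof -
  interpret l: Vector_Spaces.linear s1 s2 f by (rule f)
  let ?K = "{x \<in> U. f x = 0}"
  obtain B where B: "B \<subseteq> ?K" "vs1.independent B" "?K \<subseteq> vs1.span B"
    using vs1.maximal_independent_subset[of ?K] by blast
  obtain C where C: "B \<subseteq> C" "C \<subseteq> U" "vs1.independent C" "U \<subseteq> vs1.span C"
    using vs1.maximal_independent_subset_extend[of B U] B by blast
  have fC: "finite C" using vs1.independent_span_bound[OF fin(1) C(3)] C(2) fin(2) by blast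
  have spC: "vs1.span C = U" using C U vs1.span_minimal by blast
  have D: "vs1.independent (C - B)" using C(3) vs1.independent_mono by blast
  have spD: "vs1.span (C - B) \<subseteq> U" using spC vs1.span_mono[of "C - B" C] by blast
  have inj: "inj_on f (vs1.span (C - B))"
  proof (rule inj_onI)
    fix x y assume xy: "x \<in> vs1.span (C - B)" "y \<in> vs1.span (C - B)" "f x = f y"
    then have d: "x - y \<in> vs1.span (C - B)" by (simp add: vs1.span_diff)
    then have "x - y \<in> ?K" using spD xy(3) by (auto simp: l.diff)
    then have "x - y \<in> vs1.span B" using B(3) by blast
    then show "x = y" using vs1.span_disjoint_eq_0[OF C(3,1) _ d] by simp
  qed
  have "f ` U = vs2.span (f ` (C - B))"
  proof
    have "f c \<in> vs2.span (f ` (C - B))" if "c \<in> C" for c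
    proof (cases "c \<in> B")
      case True
      then have "f c = 0" using B(1) by blast
      then show ?thesis by (simp add: vs2.span_zero)
    qed (use that in \<open>auto intro: vs2.span_base\<close>)
    then have "vs2.span (f ` C) \<subseteq> vs2.span (f ` (C - B))"
      by (intro vs2.span_minimal) auto
    then show "f ` U \<subseteq> vs2.span (f ` (C - B))" using l.span_image[of C] spC by simp
    show "vs2.span (f ` (C - B)) \<subseteq> f ` U" using l.span_image[of "C - B"] spD by auto
  qed
  then have "vs2.dim (f ` U) = card (f ` (C - B))"
    using linear_independent_injective_image[OF f D inj] vs2.dim_span_eq_card_independent by simp
  also have "\<dots> = card (C - B)"
    by (rule card_image) (rule inj_on_subset[OF inj vs1.span_superset])
  also have "\<dots> = card C - card B" by (rule card_Diff_subset[OF finite_subset[OF C(1) fC] C(1)])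
  finally have "vs2.dim (f ` U) = card C - card B" .
  moreover have "vs1.dim U = card C" using vs1.basis_card_eq_dim[OF C(2,4,3)] by simp
  moreover have "vs1.dim ?K = card B" using vs1.basis_card_eq_dim[OF B(1,3,2)] by simp
  ultimately show ?thesis using card_mono[OF fC C(1)] by simp
qed

lemma prepend_single: "prepend w (Poly_Mapping.single ws c) = Poly_Mapping.single (w # ws) c"
  by (intro poly_mapping_eqI) (auto simp: lookup_prepend lookup_single when_def split: list.splits)

section \<open>Dimensions of the exterior powers\<close>

context finite_dimensional_vector_space
begin

definition ind :: "'b set \<Rightarrow> 'b set \<Rightarrow> 'a" where
  "ind S T = (if T = S then 1 else 0)"

lemma ext_finite_span: "finite (ind ` Pow Basis)" "ext j W \<subseteq> ev.span (ind ` Pow Basis)"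
proof -
  show "finite (ind ` Pow Basis)" using finite_Basis by simp
  show "ext j W \<subseteq> ev.span (ind ` Pow Basis)"
  proof
    fix \<omega> assume "\<omega> \<in> ext j W"
    then have "\<omega> = (\<Sum>S\<in>Pow Basis. escale (\<omega> S) (ind S))"
      using ext_support finite_Basis
      by (auto simp: fun_eq_iff sum_fun_apply ind_def if_distrib[of "\<lambda>x. _ * x"] cong: if_cong)
    also have "\<dots> \<in> ev.span (ind ` Pow Basis)"
      by (intro ev.span_sum ev.span_scale ev.span_base) auto
    finally show "\<omega> \<in> ev.span (ind ` Pow Basis)" .
  qed
qed

lemma ext_0: "ext 0 W = ev.span {unit}"
proof -
  have "tuples 0 W = {[]}" by (auto simp: tuples_def)
  then show ?thesis by (simp add: ext_def)
qed

lemma unit_nonzero: "unit \<noteq> 0"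
  by (auto simp: unit_def fun_eq_iff)

lemma dim_ext_0: "ev.dim (ext 0 W) = 1"
  unfolding ext_0 using ev.dim_span_eq_card_independent[of "{unit}"] unit_nonzero by simp

lemma ext_Suc_zero: "ext (Suc j) {0} = {0}"
proof -
  have "wedge 0 \<omega> = 0" for \<omega> using wedge_scale_left[of 0 0 \<omega>] by simp
  then have "wlist ` tuples (Suc j) {0} \<subseteq> {0}"
    by (auto simp: tuples_def length_Suc_conv)
  then have "ev.span (wlist ` tuples (Suc j) {0}) \<subseteq> {0}"
    by (intro ev.span_minimal) (simp_all add: ev.subspace_single_0)
  then show ?thesis using es(1)[of "Suc j" "{0}"] by (auto simp: ext_def)
qed

lemma linear_form_exists:
  assumes "independent (insert v B)" "v \<notin> B"
  obtains \<phi> where "Vector_Spaces.linear scale (*) \<phi>" "\<phi> v = 1" "\<And>u. u \<in> span B \<Longrightarrow> \<phi> u = 0"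
    "\<And>w. w \<in> span (insert v B) \<Longrightarrow> w - scale (\<phi> w) v \<in> span B"
proof -
  interpret k: vector_space "(*) :: 'a \<Rightarrow> 'a \<Rightarrow> 'a" by (rule vector_space_times)
  interpret p: vector_space_pair scale "(*) :: 'a \<Rightarrow> 'a \<Rightarrow> 'a" by unfold_locales
  obtain \<phi> where \<phi>: "Vector_Spaces.linear scale (*) \<phi>" "\<And>x. x \<in> insert v B \<Longrightarrow> \<phi> x = (if x = v then 1 else 0)"
    using p.linear_independent_extend[OF assms(1), of "\<lambda>x. if x = v then 1 else 0"] by blast
  have z: "\<phi> u = 0" if "u \<in> span B" for u
    using that
  proof (induction rule: span_induct_alt)
    case (step c x y)
    then show ?case using \<phi>(2)[of x] assms(2) by (auto simp: linearD[OF \<phi>(1)])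
  qed (simp add: linearD[OF \<phi>(1)])
  have "w - scale (\<phi> w) v \<in> span B" if "w \<in> span (insert v B)" for w
  proof -
    obtain k where k: "w - scale k v \<in> span B" using \<open>w \<in> _\<close> by (auto simp: span_insert)
    then have "\<phi> w = k" using z[OF k] \<phi>(2)[of v] by (simp add: linearD[OF \<phi>(1)])
    then show ?thesis using k by simp
  qed
  then show thesis using that[OF \<phi>(1)] \<phi>(2)[of v] z by simp
qed

text \<open>For W = U \<oplus> \<langle>v\<rangle> contraction gives a short exact sequence: the
  kernel is the exterior power of U in the same degree, the image the one in the degree below.
  Dimensions therefore obey Pascal's rule.\<close>

lemma ext_contract_image:
  assumes \<phi>: "Vector_Spaces.linear scale (*) \<phi>" "\<And>u. u \<in> U \<Longrightarrow> \<phi> u = 0" "\<phi> v = 1"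
    and U: "subspace U" "U \<subseteq> W" "v \<in> W" and W: "\<And>w. w \<in> W \<Longrightarrow> w - scale (\<phi> w) v \<in> U"
  shows "contract \<phi> ` ext (Suc j) W = ext j U" "{\<omega> \<in> ext (Suc j) W. contract \<phi> \<omega> = 0} = ext (Suc j) U"
proof -
  note dec = ext_decomp[OF \<phi> U(1) W]
  show "contract \<phi> ` ext (Suc j) W = ext j U"
  proof
    show "contract \<phi> ` ext (Suc j) W \<subseteq> ext j U" using dec(2) by fastforce
    show "ext j U \<subseteq> contract \<phi> ` ext (Suc j) W"
    proof
      fix \<eta> assume \<eta>: "\<eta> \<in> ext j U"
      then have "wedge v \<eta> \<in> ext (Suc j) W" using wedge_in_ext[OF U(3)] ext_mono[OF U(2)] by blast
      moreover have "contract \<phi> (wedge v \<eta>) = escale (\<phi> v) \<eta> - wedge v (contract \<phi> \<eta>)"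
        by (rule contract_wedge[OF \<phi>(1) ext_support[OF \<eta>]])
      then have "contract \<phi> (wedge v \<eta>) = \<eta>"
        using contract_ext_eq_0[OF \<phi>(1,2) \<eta>] \<phi>(3) by (simp add: lw)
      ultimately show "\<eta> \<in> contract \<phi> ` ext (Suc j) W" by force
    qed
  qed
  show "{\<omega> \<in> ext (Suc j) W. contract \<phi> \<omega> = 0} = ext (Suc j) U"
    using dec(1)[where j = "Suc j"] ext_mono[OF U(2), of "Suc j"] contract_ext_eq_0[OF \<phi>(1,2)]
    by (fastforce simp: lw)
qed

lemma dim_ext_span:
  assumes "finite B" "independent B"
  shows "ev.dim (ext j (span B)) = card B choose j"
  using assms
proof (induction B arbitrary: j rule: finite_induct)
  case empty
  show "ev.dim (ext j (span {})) = card {} choose j"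
  proof (cases j)
    case 0
    then show ?thesis by (simp add: dim_ext_0)
  next
    case (Suc i)
    have "ev.dim ({0} :: ('b set \<Rightarrow> 'a) set) = 0"
      using ev.dim_span_eq_card_independent[of "{}"] ev.independent_empty by simp
    then show ?thesis using Suc ext_Suc_zero by simp
  qed
next
  case (insert v B)
  have iB: "independent B" using insert.prems independent_mono by blast
  show "ev.dim (ext j (span (insert v B))) = card (insert v B) choose j"
  proof (cases j)
    case 0
    then show ?thesis by (simp add: dim_ext_0)
  next
    case (Suc i)
    have IH: "ev.dim (ext k (span B)) = card B choose k" for k by (rule insert.IH[OF iB])
    obtain \<phi> where \<phi>: "Vector_Spaces.linear scale (*) \<phi>" "\<phi> v = 1" "\<And>u. u \<in> span B \<Longrightarrow> \<phi> u = 0"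
      "\<And>w. w \<in> span (insert v B) \<Longrightarrow> w - scale (\<phi> w) v \<in> span B"
      using linear_form_exists[OF insert.prems insert.hyps(2)] by blast
    have sub: "span B \<subseteq> span (insert v B)" "v \<in> span (insert v B)"
      by (auto intro: span_mono[THEN subsetD] span_base)
    note im = ext_contract_image[OF \<phi>(1,3,2) subspace_span sub \<phi>(4)]
    interpret p: vector_space_pair escale escale by unfold_locales
    have "ev.dim (ext (Suc i) (span (insert v B))) = ev.dim (ext (Suc i) (span B)) + ev.dim (ext i (span B))"
      using p.dim_kernel_image[OF linear_contract[of \<phi>] subspace_ext ext_finite_span] im by simp
    then show ?thesis using insert.hyps Suc by (simp add: IH)
  qed
qed

lemma dim_ext:
  assumes "subspace W"
  shows "ev.dim (ext j W) = dim W choose j"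
proof -
  obtain B where B: "B \<subseteq> W" "independent B" "W \<subseteq> span B" "card B = dim W"
    using basis_exists by blast
  then have "W = span B" using assms span_minimal by blast
  then show ?thesis using dim_ext_span[OF finiteI_independent B(2)] B by simp
qed

lemma ext_eq_0:
  assumes "subspace W" "dim W < j"
  shows "ext j W = {0}"
proof -
  have "ev.dim (ext j W) = 0" using dim_ext[OF assms(1)] assms(2) by (simp add: binomial_eq_0)
  moreover obtain B where B: "B \<subseteq> ext j W" "ev.independent B" "ext j W \<subseteq> ev.span B" "card B = ev.dim (ext j W)"
    using ev.basis_exists by blast
  moreover have "finite B" using ev.independent_span_bound[OF ext_finite_span(1) B(2)] B(1) ext_finite_span(2) by blast
  ultimately have "B = {}" by simp
  then show ?thesis using B(3) es(1) by auto
qed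

subsection \<open>Comparison with the quotient of the free vector space on tuples\<close>

abbreviation tscale :: "'a \<Rightarrow> ('b list \<Rightarrow>\<^sub>0 'a) \<Rightarrow> 'b list \<Rightarrow>\<^sub>0 'a" where
  "tscale \<equiv> pm_scale (*)"

lemma vs_tscale: "vector_space tscale"
  by (rule vector_space_pm_scale[OF vector_space_times])

sublocale tv: vector_space tscale
  by (rule vs_tscale)

abbreviation rel :: "nat \<Rightarrow> 'b set \<Rightarrow> ('b list \<Rightarrow>\<^sub>0 'a) set" where
  "rel \<equiv> ext_rel scale"

definition ev_tuples :: "('b list \<Rightarrow>\<^sub>0 'a) \<Rightarrow> 'b set \<Rightarrow> 'a" where
  "ev_tuples z = (\<Sum>ws\<in>Poly_Mapping.keys z. escale (Poly_Mapping.lookup z ws) (wlist ws))"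

lemma ev_tuples_eq:
  assumes "finite K" "Poly_Mapping.keys z \<subseteq> K"
  shows "ev_tuples z = (\<Sum>ws\<in>K. escale (Poly_Mapping.lookup z ws) (wlist ws))"
  unfolding ev_tuples_def
  by (rule sum.mono_neutral_left[OF assms]) (auto simp: in_keys_iff)

lemma linear_ev_tuples: "Vector_Spaces.linear tscale escale ev_tuples"
proof (rule linearI[OF vs_tscale vs_escale])
  fix x y :: "'b list \<Rightarrow>\<^sub>0 'a" and c
  let ?K = "Poly_Mapping.keys x \<union> Poly_Mapping.keys y"
  show "ev_tuples (x + y) = ev_tuples x + ev_tuples y"
    using ev_tuples_eq[of ?K "x + y"] ev_tuples_eq[of ?K x] ev_tuples_eq[of ?K y] keys_add[of x y]
    by (simp add: lookup_add ev.scale_left_distrib sum.distrib)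
  have "Poly_Mapping.keys (tscale c x) \<subseteq> Poly_Mapping.keys x"
    by (auto simp: in_keys_iff lookup_pm_scale[OF vector_space_times])
  then show "ev_tuples (tscale c x) = escale c (ev_tuples x)"
    using ev_tuples_eq[of "Poly_Mapping.keys x" "tscale c x"] ev_tuples_eq[of "Poly_Mapping.keys x" x]
    by (simp add: lookup_pm_scale[OF vector_space_times] ev.scale_sum_right)
qed

lemmas le = linearD[OF linear_ev_tuples]

lemma ev_tuples_single: "ev_tuples (Poly_Mapping.single ws c) = escale c (wlist ws)"
  using ev_tuples_eq[of "{ws}" "Poly_Mapping.single ws c"] by simp

lemma single_tscale: "Poly_Mapping.single ws c = tscale c (Poly_Mapping.single ws 1)"
  by (intro poly_mapping_eqI) (simp add: lookup_pm_scale[OF vector_space_times] lookup_single when_def)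

lemma free_tuples_span: "free_tuples j W = tv.span ((\<lambda>ws. Poly_Mapping.single ws 1) ` tuples j W)"
proof
  show "free_tuples j W \<subseteq> tv.span ((\<lambda>ws. Poly_Mapping.single ws 1) ` tuples j W)"
  proof
    fix z :: "'b list \<Rightarrow>\<^sub>0 'a" assume z: "z \<in> free_tuples j W"
    have "z = (\<Sum>ws\<in>Poly_Mapping.keys z. tscale (Poly_Mapping.lookup z ws) (Poly_Mapping.single ws 1))"
      unfolding single_tscale[symmetric]
      by (intro poly_mapping_eqI) (auto simp: lookup_sum lookup_single when_def in_keys_iff)
    also have "\<dots> \<in> tv.span ((\<lambda>ws. Poly_Mapping.single ws 1) ` tuples j W)"
      by (intro tv.span_sum tv.span_scale tv.span_base) (use z in \<open>auto simp: free_tuples_def\<close>)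
    finally show "z \<in> tv.span ((\<lambda>ws. Poly_Mapping.single ws 1) ` tuples j W)" .
  qed
  have "tv.subspace (free_tuples j W)"
  proof (rule tv.subspaceI)
    show "x + y \<in> free_tuples j W" if "x \<in> free_tuples j W" "y \<in> free_tuples j W" for x y :: "'b list \<Rightarrow>\<^sub>0 'a"
      using that keys_add[of x y] by (auto simp: free_tuples_def)
    show "tscale c x \<in> free_tuples j W" if "x \<in> free_tuples j W" for c and x :: "'b list \<Rightarrow>\<^sub>0 'a"
      using that by (auto simp: free_tuples_def in_keys_iff lookup_pm_scale[OF vector_space_times])
  qed (simp add: free_tuples_def)
  then show "tv.span ((\<lambda>ws. Poly_Mapping.single ws 1) ` tuples j W) \<subseteq> free_tuples j W"
    by (rule tv.span_minimal[rotated]) (auto simp: free_tuples_def)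
qed

lemma subspace_free_tuples: "tv.subspace (free_tuples j W)"
  unfolding free_tuples_span by simp

lemma subspace_rel: "tv.subspace (rel j W)"
  by (simp add: ext_rel_def)

lemmas rs = subspaceD[OF vs_tscale subspace_rel]
lemmas fts = subspaceD[OF vs_tscale subspace_free_tuples]

lemma rel_induct:
  assumes "z \<in> rel j W" "tv.subspace T"
    and "\<And>ws m u v. ws \<in> tuples j W \<Longrightarrow> m < j \<Longrightarrow> u \<in> W \<Longrightarrow> v \<in> W \<Longrightarrow>
      Poly_Mapping.single (ws[m := u + v]) 1 - Poly_Mapping.single (ws[m := u]) 1
         - Poly_Mapping.single (ws[m := v]) 1 \<in> T"
    and "\<And>ws m c u. ws \<in> tuples j W \<Longrightarrow> m < j \<Longrightarrow> u \<in> W \<Longrightarrow>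
      Poly_Mapping.single (ws[m := scale c u]) 1 - Poly_Mapping.single (ws[m := u]) c \<in> T"
    and "\<And>ws l m. ws \<in> tuples j W \<Longrightarrow> l < m \<Longrightarrow> m < j \<Longrightarrow> ws ! l = ws ! m \<Longrightarrow> Poly_Mapping.single ws 1 \<in> T"
  shows "z \<in> T"
  using assms(1) unfolding ext_rel_def
  by (rule set_mp[OF tv.span_minimal[OF _ assms(2)], rotated]) (use assms(3-5) in blast)

lemma rel_add: "ws \<in> tuples j W \<Longrightarrow> m < j \<Longrightarrow> u \<in> W \<Longrightarrow> v \<in> W \<Longrightarrow>
      Poly_Mapping.single (ws[m := u + v]) 1 - Poly_Mapping.single (ws[m := u]) 1
         - Poly_Mapping.single (ws[m := v]) 1 \<in> rel j W"
  unfolding ext_rel_def by (rule tv.span_base) blast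

lemma rel_scale: "ws \<in> tuples j W \<Longrightarrow> m < j \<Longrightarrow> u \<in> W \<Longrightarrow>
      Poly_Mapping.single (ws[m := scale c u]) 1 - Poly_Mapping.single (ws[m := u]) c \<in> rel j W"
  unfolding ext_rel_def by (rule tv.span_base) blast

lemma rel_alt: "ws \<in> tuples j W \<Longrightarrow> l < m \<Longrightarrow> m < j \<Longrightarrow> ws ! l = ws ! m \<Longrightarrow> Poly_Mapping.single ws 1 \<in> rel j W"
  unfolding ext_rel_def by (rule tv.span_base) blast

lemma rel_mono: "U \<subseteq> W \<Longrightarrow> rel j U \<subseteq> rel j W"
proof
  fix z assume UW: "U \<subseteq> W" and z: "z \<in> rel j U"
  have t: "tuples j U \<subseteq> tuples j W" using UW by (auto simp: tuples_def)
  show "z \<in> rel j W"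
    by (rule rel_induct[OF z subspace_rel];
        (rule rel_add rel_scale rel_alt; (assumption | rule subsetD[OF t] subsetD[OF UW])+))
qed

lemma rel_free_tuples:
  assumes W: "subspace W"
  shows "rel j W \<subseteq> free_tuples j W"
proof
  fix z assume z: "z \<in> rel j W"
  have upd: "ws[m := u] \<in> tuples j W" if "ws \<in> tuples j W" "u \<in> W" for ws m u
    using that set_update_subset_insert[of ws m u] by (auto simp: tuples_def)
  have s: "Poly_Mapping.single ws c \<in> free_tuples j W" if "ws \<in> tuples j W" for ws and c :: 'a
    using that by (auto simp: free_tuples_def)
  show "z \<in> free_tuples j W"
    by (rule rel_induct[OF z subspace_free_tuples])
      (intro fts(3) s upd subspace_add[OF W] subspace_scale[OF W]; assumption)+
qed

lemma wlist_update_add: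
  "m < length ws \<Longrightarrow> wlist (ws[m := u + v]) = wlist (ws[m := u]) + wlist (ws[m := v])"
proof (induction ws arbitrary: m)
  case (Cons w ws)
  show "wlist ((w # ws)[m := u + v]) = wlist ((w # ws)[m := u]) + wlist ((w # ws)[m := v])"
  proof (cases m)
    case 0
    then show ?thesis by (simp add: wedge_add_left)
  next
    case (Suc k)
    have "wlist (ws[k := u + v]) = wlist (ws[k := u]) + wlist (ws[k := v])"
      using Cons.IH[of k] Cons.prems Suc by (simp del: zero_fun_apply plus_fun_apply fscale_apply)
    then show ?thesis using Suc by (simp add: lw)
  qed
qed simp

lemma wlist_update_scale:
  "m < length ws \<Longrightarrow> wlist (ws[m := scale c u]) = escale c (wlist (ws[m := u]))"
proof (induction ws arbitrary: m)
  case (Cons w ws)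
  show "wlist ((w # ws)[m := scale c u]) = escale c (wlist ((w # ws)[m := u]))"
  proof (cases m)
    case 0
    then show ?thesis by (simp add: wedge_scale_left)
  next
    case (Suc k)
    have "wlist (ws[k := scale c u]) = escale c (wlist (ws[k := u]))"
      using Cons.IH[of k] Cons.prems Suc by (simp del: zero_fun_apply plus_fun_apply fscale_apply)
    then show ?thesis using Suc by (simp add: lw)
  qed
qed simp

lemma wedge_wlist_member: "w \<in> set ws \<Longrightarrow> wedge w (wlist ws) = 0"
proof (induction ws)
  case (Cons a ws)
  have "wedge w (wedge a (wlist ws)) = 0"
  proof (cases "w = a")
    case False
    then have "wedge w (wlist ws) = 0" using Cons by (simp del: zero_fun_apply plus_fun_apply fscale_apply)
    then show ?thesis using wedge_swap[of w a "wlist ws"] by (simp add: lw)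
  qed (simp add: wedge_wedge_self)
  then show "wedge w (wlist (a # ws)) = 0" by simp
qed simp

lemma wlist_alt: "l < m \<Longrightarrow> m < length ws \<Longrightarrow> ws ! l = ws ! m \<Longrightarrow> wlist ws = 0"
proof (induction ws arbitrary: l m)
  case (Cons w ws)
  obtain m' where m: "m = Suc m'" using Cons.prems(1) by (cases m) auto
  have "wedge w (wlist ws) = 0"
  proof (cases l)
    case 0
    then have "w \<in> set ws" using Cons.prems m by auto
    then show ?thesis by (rule wedge_wlist_member)
  next
    case (Suc l')
    then have "wlist ws = 0" using Cons.IH[of l' m'] Cons.prems m by (simp del: zero_fun_apply plus_fun_apply fscale_apply)
    then show ?thesis by (simp add: lw)
  qed
  then show "wlist (w # ws) = 0" by simp
qed simp

lemma ev_tuples_rel: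
  assumes "z \<in> rel j W"
  shows "ev_tuples z = 0"
proof -
  interpret l: Vector_Spaces.linear tscale escale ev_tuples by (rule linear_ev_tuples)
  have "z \<in> {z. ev_tuples z = 0}"
    by (rule rel_induct[OF assms l.subspace_kernel])
      (auto simp: le ev_tuples_single tuples_def wlist_update_add wlist_update_scale wlist_alt)
  then show ?thesis by simp
qed

lemma ev_tuples_image: "ev_tuples ` free_tuples j W = ext j W"
proof -
  interpret l: Vector_Spaces.linear tscale escale ev_tuples by (rule linear_ev_tuples)
  show ?thesis
    unfolding free_tuples_span l.span_image[symmetric] ext_def image_image by (simp add: ev_tuples_single)
qed

lemma prepend_rel:
  assumes z: "z \<in> rel j W" and w: "w \<in> W"
  shows "prepend w z \<in> rel (Suc j) W"
proof -
  interpret l: Vector_Spaces.linear tscale tscale "prepend w"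
    by (rule linear_prepend[OF vector_space_times])
  have t: "w # ws \<in> tuples (Suc j) W" if "ws \<in> tuples j W" for ws
    using that w by (auto simp: tuples_def)
  have "z \<in> {z. prepend w z \<in> rel (Suc j) W}"
  proof (rule rel_induct[OF z l.subspace_linear_preimage[OF subspace_rel]])
    fix ws m u v assume "ws \<in> tuples j W" "m < j" "u \<in> W" "v \<in> W"
    then show "Poly_Mapping.single (ws[m := u + v]) 1 - Poly_Mapping.single (ws[m := u]) 1
         - Poly_Mapping.single (ws[m := v]) 1 \<in> {z. prepend w z \<in> rel (Suc j) W}"
      using rel_add[OF t, of ws "Suc m" u v] by (simp add: l.diff prepend_single)
  next
    fix ws m c u assume "ws \<in> tuples j W" "m < j" "u \<in> W"
    then show "Poly_Mapping.single (ws[m := scale c u]) 1 - Poly_Mapping.single (ws[m := u]) c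
         \<in> {z. prepend w z \<in> rel (Suc j) W}"
      using rel_scale[OF t, of ws "Suc m" u c] by (simp add: l.diff prepend_single)
  next
    fix ws l m assume "ws \<in> tuples j W" "l < m" "m < j" "ws ! l = ws ! m"
    then show "Poly_Mapping.single ws 1 \<in> {z. prepend w z \<in> rel (Suc j) W}"
      using rel_alt[OF t, of ws "Suc l" "Suc m"] by (simp add: prepend_single)
  qed
  then show ?thesis by simp
qed

lemmas lpre = linearD[OF linear_prepend[OF vector_space_times]]

lemma prepend_free_tuples:
  fixes z :: "'b list \<Rightarrow>\<^sub>0 'a"
  assumes "z \<in> free_tuples j W" "w \<in> W"
  shows "prepend w z \<in> free_tuples (Suc j) W"
proof -
  interpret l: Vector_Spaces.linear tscale tscale "prepend w"
    by (rule linear_prepend[OF vector_space_times])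
  have "z \<in> {z. prepend w z \<in> free_tuples (Suc j) W}"
    using assms(1) unfolding free_tuples_span[of j]
    by (rule set_mp[OF tv.span_minimal[OF _ l.subspace_linear_preimage[OF subspace_free_tuples]], rotated])
      (use assms(2) in \<open>auto simp: prepend_single free_tuples_def tuples_def\<close>)
  then show ?thesis by simp
qed

lemma ev_tuples_prepend: "ev_tuples (prepend w z) = wedge w (ev_tuples z)"
proof -
  let ?z = "\<Sum>ws\<in>Poly_Mapping.keys z. Poly_Mapping.single ws (Poly_Mapping.lookup z ws)"
  have z: "?z = z"
    by (intro poly_mapping_eqI) (auto simp: lookup_sum lookup_single when_def in_keys_iff)
  have "ev_tuples (prepend w ?z) = wedge w (ev_tuples ?z)"
    by (simp add: lpre le lw prepend_single ev_tuples_single)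
  then show ?thesis unfolding z .
qed

lemma prepend_add_rel:
  assumes z: "z \<in> free_tuples j W" and u: "u \<in> W" "v \<in> W" and W: "subspace W"
  shows "prepend (u + scale c v) z - (prepend u z + tscale c (prepend v z)) \<in> rel (Suc j) W"
  using z unfolding free_tuples_span
proof (induction rule: tv.span_induct_alt)
  case base
  show ?case using rs(1) by (simp add: lpre)
next
  case (step a x y)
  then obtain ws where ws: "ws \<in> tuples j W" "x = Poly_Mapping.single ws 1" by auto
  have t: "u # ws \<in> tuples (Suc j) W" using ws(1) u(1) by (auto simp: tuples_def)
  have cv: "scale c v \<in> W" using u(2) W subspace_scale by blast
  have "Poly_Mapping.single ((u + scale c v) # ws) 1 - Poly_Mapping.single (u # ws) 1
      - Poly_Mapping.single (scale c v # ws) 1 \<in> rel (Suc j) W"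
    using rel_add[OF t, of 0 u "scale c v"] u cv by simp
  moreover have "Poly_Mapping.single (scale c v # ws) 1 - Poly_Mapping.single (v # ws) c \<in> rel (Suc j) W"
    using rel_scale[OF t, of 0 v c] u by simp
  ultimately have "(Poly_Mapping.single ((u + scale c v) # ws) 1 - Poly_Mapping.single (u # ws) 1
      - Poly_Mapping.single (scale c v # ws) 1) + (Poly_Mapping.single (scale c v # ws) 1
      - Poly_Mapping.single (v # ws) c) \<in> rel (Suc j) W"
    by (rule rs(2))
  then have "prepend (u + scale c v) x - (prepend u x + tscale c (prepend v x)) \<in> rel (Suc j) W"
    by (simp add: ws(2) prepend_single single_tscale[of _ c, symmetric] algebra_simps)
  from rs(2)[OF rs(4)[OF this, of a] step(2)]
  show ?case
    by (simp add: lpre tv.scale_right_diff_distrib tv.scale_right_distrib algebra_simps)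
qed

lemma prepend_twice_rel:
  assumes z: "z \<in> free_tuples j W" and u: "u \<in> W"
  shows "prepend u (prepend u z) \<in> rel (Suc (Suc j)) W"
  using z unfolding free_tuples_span
proof (induction rule: tv.span_induct_alt)
  case base
  show ?case using rs(1) by (simp add: lpre)
next
  case (step a x y)
  then obtain ws where ws: "ws \<in> tuples j W" "x = Poly_Mapping.single ws 1" by auto
  have "u # u # ws \<in> tuples (Suc (Suc j)) W" using ws(1) u by (auto simp: tuples_def)
  from rel_alt[OF this, of 0 1] have "prepend u (prepend u x) \<in> rel (Suc (Suc j)) W"
    by (simp add: ws(2) prepend_single)
  from rs(2)[OF rs(4)[OF this, of a] step(2)] show ?case by (simp add: lpre)
qed

text \<open>Polarisation of the alternating relation at u + v. It is carried out modulo the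
  relations themselves, since the injectivity of evaluation is still to be derived from it.\<close>

lemma prepend_swap_rel:
  assumes z: "z \<in> free_tuples j W" and u: "u \<in> W" "v \<in> W" and W: "subspace W"
  shows "prepend u (prepend v z) + prepend v (prepend u z) \<in> rel (Suc (Suc j)) W"
proof -
  define w where "w = u + scale 1 v"
  have w: "w \<in> W" using subspace_add[OF W u] by (simp add: w_def)
  have "prepend w z - (prepend u z + prepend v z) \<in> rel (Suc j) W"
    using prepend_add_rel[OF z u W, of 1] by (simp add: w_def)
  from prepend_rel[OF this u(1)] prepend_rel[OF this u(2)]
  have 1: "prepend u (prepend w z) - (prepend u (prepend u z) + prepend u (prepend v z)) \<in> rel (Suc (Suc j)) W"
    "prepend v (prepend w z) - (prepend v (prepend u z) + prepend v (prepend v z)) \<in> rel (Suc (Suc j)) W"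
    by (simp_all add: lpre)
  have 2: "prepend w (prepend w z) - (prepend u (prepend w z) + prepend v (prepend w z)) \<in> rel (Suc (Suc j)) W"
    using prepend_add_rel[OF prepend_free_tuples[OF z w] u W, of 1] by (simp add: w_def)
  let ?uw = "prepend u (prepend w z)" and ?vw = "prepend v (prepend w z)" and ?ww = "prepend w (prepend w z)"
  let ?uu = "prepend u (prepend u z)" and ?vv = "prepend v (prepend v z)"
  \<comment> \<open>The square of w minus its expansion by additivity in each slot: all terms cancel
    except the two mixed ones.\<close>
  have "?ww - ((?ww - (?uw + ?vw)) + ((?uw - (?uu + prepend u (prepend v z))) +
      ((?vw - (prepend v (prepend u z) + ?vv)) + (?uu + ?vv)))) \<in> rel (Suc (Suc j)) W"
    by (rule rs(3)[OF prepend_twice_rel[OF z w] rs(2)[OF 2 rs(2)[OF 1(1) rs(2)[OF 1(2)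
            rs(2)[OF prepend_twice_rel[OF z u(1)] prepend_twice_rel[OF z u(2)]]]]]])
  then show ?thesis by (simp add: algebra_simps)
qed

text \<open>The relations alone already split off the vector \<open>v\<close>, as in \<open>ext_decomp\<close>.\<close>

lemma free_tuples_decomp:
  assumes U: "subspace U" "U \<subseteq> W" and v: "v \<in> W" and W: "subspace W" and k: "\<And>w. w \<in> W \<Longrightarrow> w - scale (\<phi> w) v \<in> U"
    and z: "z \<in> free_tuples j W"
  shows "\<exists>x\<in>free_tuples j U. \<exists>y\<in>(case j of 0 \<Rightarrow> {0} | Suc i \<Rightarrow> free_tuples i U). z - (x + prepend v y) \<in> rel j W"
proof -
  define D where "D j = (case j of 0 \<Rightarrow> {0 :: 'b list \<Rightarrow>\<^sub>0 'a} | Suc i \<Rightarrow> free_tuples i U)" for j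
  have D: "tv.subspace (D j)" for j by (simp add: D_def subspace_free_tuples split: nat.splits)
  note Ds = subspaceD[OF vs_tscale D]
  define dec where "dec j z \<longleftrightarrow> (\<exists>x\<in>free_tuples j U. \<exists>y\<in>D j. z - (x + prepend v y) \<in> rel j W)" for j z
  have ft: "free_tuples j U \<subseteq> (free_tuples j W :: ('b list \<Rightarrow>\<^sub>0 'a) set)" for j
    using U(2) by (auto simp: free_tuples_def tuples_def)
  have single: "dec (length ws) (Poly_Mapping.single ws 1)" if "set ws \<subseteq> W" for ws
    using that
  proof (induction ws)
    case Nil
    have "Poly_Mapping.single [] 1 \<in> (free_tuples 0 U :: ('b list \<Rightarrow>\<^sub>0 'a) set)" by (auto simp: free_tuples_def tuples_def)
    then show ?case unfolding dec_def
      by (auto simp: D_def lpre rs(1) intro!: bexI[of _ "Poly_Mapping.single [] 1"])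
  next
    case (Cons w ws)
    let ?j = "length ws"
    obtain x y where xy: "x \<in> free_tuples ?j U" "y \<in> D ?j" "Poly_Mapping.single ws 1 - (x + prepend v y) \<in> rel ?j W"
      using Cons by (auto simp: dec_def)
    define u c where "u = w - scale (\<phi> w) v" and "c = \<phi> w"
    have w: "w \<in> W" "w = u + scale c v" using Cons.prems by (auto simp: u_def c_def)
    have u: "u \<in> U" "u \<in> W" using k[OF w(1)] U(2) by (auto simp: u_def)
    have y: "prepend v y \<in> free_tuples ?j W" "prepend u y \<in> D (Suc ?j)"
      "prepend u (prepend v y) + prepend v (prepend u y) \<in> rel (Suc ?j) W" "prepend v (prepend v y) \<in> rel (Suc ?j) W"
    proof -
      show "prepend v y \<in> free_tuples ?j W"
        using xy(2) fts(1) prepend_free_tuples[OF subsetD[OF ft] v]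
        by (auto simp: D_def lpre split: nat.splits)
      show "prepend u y \<in> D (Suc ?j)"
        using xy(2) fts(1) prepend_free_tuples[OF _ u(1)] by (auto simp: D_def lpre split: nat.splits)
      show "prepend u (prepend v y) + prepend v (prepend u y) \<in> rel (Suc ?j) W"
        using xy(2) rs(1) prepend_swap_rel[OF subsetD[OF ft] u(2) v W]
        by (auto simp: D_def lpre split: nat.splits)
      show "prepend v (prepend v y) \<in> rel (Suc ?j) W"
        using xy(2) rs(1) prepend_twice_rel[OF subsetD[OF ft] v]
        by (auto simp: D_def lpre split: nat.splits)
    qed
    define q where "q = x + prepend v y"
    have q: "q \<in> free_tuples ?j W" unfolding q_def using fts(2)[OF subsetD[OF ft xy(1)] y(1)] .
    have 1: "Poly_Mapping.single (w # ws) 1 - prepend w q \<in> rel (Suc ?j) W"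
      using prepend_rel[OF xy(3) w(1)] by (simp add: q_def lpre(4) prepend_single)
    have 2: "prepend w q - (prepend u q + tscale c (prepend v q)) \<in> rel (Suc ?j) W"
      unfolding w(2) by (rule prepend_add_rel[OF q u(2) v W])
    \<comment> \<open>Expanding (u + c v) \<and> (x + v \<and> y) with v \<and> v = 0 and u \<and> v
      = - v \<and> u leaves u \<and> x + v \<and> (c x - u \<and> y).\<close>
    define y' where "y' = tscale c x - prepend u y"
    have "prepend u q + tscale c (prepend v q) - (prepend u x + prepend v y') =
        (prepend u (prepend v y) + prepend v (prepend u y)) + tscale c (prepend v (prepend v y))"
      by (simp add: q_def y'_def lpre tv.scale_right_distrib)
    also have "\<dots> \<in> rel (Suc ?j) W" by (rule rs(2)[OF y(3) rs(4)[OF y(4)]])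
    finally have 3: "prepend u q + tscale c (prepend v q) - (prepend u x + prepend v y') \<in> rel (Suc ?j) W" .
    have "Poly_Mapping.single (w # ws) 1 - (prepend u x + prepend v y') \<in> rel (Suc ?j) W"
      using rs(2)[OF 1 rs(2)[OF 2 3]] by (simp add: algebra_simps)
    moreover have "prepend u x \<in> free_tuples (Suc ?j) U" by (rule prepend_free_tuples[OF xy(1) u(1)])
    moreover have "y' \<in> D (Suc ?j)"
      unfolding y'_def by (rule Ds(3)[OF _ y(2)]) (use xy(1) fts(4) in \<open>simp add: D_def\<close>)
    ultimately show ?case unfolding dec_def by (metis length_Cons)
  qed
  have "dec j z"
    using z unfolding free_tuples_span
  proof (induction rule: tv.span_induct_alt)
    case base
    show ?case unfolding dec_def
      by (rule bexI[OF bexI[OF _ Ds(1)] fts(1)]) (simp add: lpre rs(1))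
  next
    case (step c s y)
    then obtain ws where ws: "ws \<in> tuples j W" "s = Poly_Mapping.single ws 1" by auto
    obtain a b where ab: "a \<in> free_tuples j U" "b \<in> D j" "s - (a + prepend v b) \<in> rel j W"
      using single[of ws] ws by (auto simp: dec_def tuples_def)
    obtain a' b' where ab': "a' \<in> free_tuples j U" "b' \<in> D j" "y - (a' + prepend v b') \<in> rel j W"
      using step(2) by (auto simp: dec_def)
    have "tscale c s + y - ((tscale c a + a') + prepend v (tscale c b + b')) =
        tscale c (s - (a + prepend v b)) + (y - (a' + prepend v b'))"
      by (simp add: lpre tv.scale_right_diff_distrib tv.scale_right_distrib algebra_simps)
    also have "\<dots> \<in> rel j W" by (rule rs(2)[OF rs(4)[OF ab(3)] ab'(3)])
    finally show ?case unfolding dec_def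
      by (rule bexI[OF bexI[OF _ Ds(2)[OF Ds(4)[OF ab(2)] ab'(2)]] fts(2)[OF fts(4)[OF ab(1)] ab'(1)]])
  qed
  then show ?thesis by (simp add: dec_def D_def)
qed

text \<open>Splitting off a basis vector v writes z as x + v \<and> y modulo relations. Contraction
  separates the two parts after evaluation, so both evaluate to 0 and the induction hypothesis
  applies to each. Hence the listed relations are all the relations.\<close>

lemma ev_tuples_injective:
  assumes "finite B" "independent B" "z \<in> free_tuples j (span B)" "ev_tuples z = 0"
  shows "z \<in> rel j (span B)"
  using assms
proof (induction B arbitrary: j z rule: finite_induct)
  case empty
  show ?case
  proof (cases j)
    case 0
    then have "Poly_Mapping.keys z \<subseteq> {[]}" using empty.prems(2) by (auto simp: free_tuples_def tuples_def)
    then have z: "z = Poly_Mapping.single [] (Poly_Mapping.lookup z [])"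
      by (intro poly_mapping_eqI) (auto simp: lookup_single when_def in_keys_iff)
    have "ev_tuples (Poly_Mapping.single [] (Poly_Mapping.lookup z [])) = 0"
      unfolding z[symmetric] by (rule empty.prems(3))
    then have "escale (Poly_Mapping.lookup z []) unit = 0"
      unfolding ev_tuples_single by (simp only: wlist_simps)
    then have "Poly_Mapping.lookup z [] = 0" using unit_nonzero by simp
    then show ?thesis using z rs(1) by simp
  next
    case (Suc i)
    have "Poly_Mapping.single ws 1 \<in> rel j {0}" if ws: "ws \<in> tuples j {0}" for ws
    proof -
      \<comment> \<open>A tuple of zero vectors is a relation: its first entry is 0 times 0, and the
        subtracted term then has coefficient 0.\<close>
      have w0: "ws[0 := 0] = ws" using ws Suc by (cases ws) (auto simp: tuples_def)
      show ?thesis using rel_scale[OF ws, of 0 0 0] Suc w0 by simp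
    qed
    then have "free_tuples j {0} \<subseteq> rel j {0}"
      unfolding free_tuples_span by (intro tv.span_minimal) (auto simp: subspace_rel)
    then show ?thesis using empty.prems(2) by auto
  qed
next
  case (insert v B)
  have iB: "independent B" using insert.prems(1) independent_mono by blast
  obtain \<phi> where \<phi>: "Vector_Spaces.linear scale (*) \<phi>" "\<phi> v = 1" "\<And>u. u \<in> span B \<Longrightarrow> \<phi> u = 0"
    "\<And>w. w \<in> span (insert v B) \<Longrightarrow> w - scale (\<phi> w) v \<in> span B"
    using linear_form_exists[OF insert.prems(1) insert.hyps(2)] by blast
  have sub: "span B \<subseteq> span (insert v B)" "v \<in> span (insert v B)"
    by (auto intro: span_mono[THEN subsetD] span_base)
  obtain x y where xy: "x \<in> free_tuples j (span B)" "y \<in> (case j of 0 \<Rightarrow> {0} | Suc i \<Rightarrow> free_tuples i (span B))"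
    "z - (x + prepend v y) \<in> rel j (span (insert v B))"
    using free_tuples_decomp[OF subspace_span sub subspace_span \<phi>(4) insert.prems(2)] by auto
  have z0: "ev_tuples z = 0" by (rule insert.prems(3))
  have e: "ev_tuples x + wedge v (ev_tuples y) = 0"
    using ev_tuples_rel[OF xy(3)] by (simp only: le ev_tuples_prepend z0 diff_0 neg_equal_0_iff_equal)
  have x: "ev_tuples x \<in> ext j (span B)" using xy(1) ev_tuples_image by blast
  have y: "contract \<phi> (ev_tuples y) = 0" "\<And>S. \<not> S \<subseteq> Basis \<Longrightarrow> ev_tuples y S = 0"
  proof -
    have "ev_tuples y = 0 \<or> (\<exists>i. ev_tuples y \<in> ext i (span B))"
      using xy(2) ev_tuples_image by (auto simp: le split: nat.splits)
    then show "contract \<phi> (ev_tuples y) = 0" "\<And>S. \<not> S \<subseteq> Basis \<Longrightarrow> ev_tuples y S = 0"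
      using contract_ext_eq_0[OF \<phi>(1,3)] ext_support by (metis lc(3), metis zero_fun_apply)
  qed
  have "contract \<phi> (ev_tuples x + wedge v (ev_tuples y)) = ev_tuples y"
    using contract_ext_eq_0[OF \<phi>(1,3) x] y(1) by (simp add: lc contract_wedge[OF \<phi>(1) y(2)] \<phi>(2) lw)
  then have y0: "ev_tuples y = 0" using e by (simp add: lc)
  then have x0: "ev_tuples x = 0" using e by (simp add: lw)
  have "x \<in> rel j (span B)" by (rule insert.IH[OF iB xy(1) x0])
  then have 1: "x \<in> rel j (span (insert v B))" using rel_mono[OF sub(1)] by blast
  have 2: "prepend v y \<in> rel j (span (insert v B))"
  proof (cases j)
    case 0
    then show ?thesis using xy(2) rs(1) by (simp add: lpre)
  next
    case (Suc i)
    then have "y \<in> free_tuples i (span B)" using xy(2) by simp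
    then have "y \<in> rel i (span B)" using y0 by (rule insert.IH[OF iB])
    then have "y \<in> rel i (span (insert v B))" using rel_mono[OF sub(1)] by blast
    then show ?thesis using prepend_rel[OF _ sub(2)] Suc by simp
  qed
  show ?case using rs(2)[OF xy(3) rs(2)[OF 1 2]] by simp
qed

lemma ev_tuples_kernel:
  assumes W: "subspace W" and z: "z \<in> free_tuples j W" "ev_tuples z = 0"
  shows "z \<in> rel j W"
proof -
  obtain B where B: "B \<subseteq> W" "independent B" "W \<subseteq> span B"
    using maximal_independent_subset[of W] by blast
  then have e: "span B = W" using span_subspace[OF _ _ W] by blast
  show ?thesis by (rule ev_tuples_injective[OF finiteI_independent[OF B(2)] B(2), of z j, unfolded e, OF z])
qed

end

section \<open>Vanishing by deletion and restriction\<close>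

lemma ibd_linear:
  assumes L: "Vector_Spaces.linear s t L" and I: "finite I" "\<And>S. x S \<noteq> 0 \<Longrightarrow> S \<subseteq> I"
  shows "ibd f (\<lambda>S. L (x S)) = (\<lambda>S. L (ibd f x S))"
proof
  fix S
  note l = linearD[OF L]
  have "ibd f (\<lambda>S. L (x S)) S = (\<Sum>a\<in>I - S. sgd f a S (L (x (insert a S))))"
  proof (rule bd_eq[OF I(1)])
    show "S \<subseteq> I" if "L (x S) \<noteq> 0" for S using that I(2)[of S] l(3) by (cases "x S = 0") auto
  qed simp
  also have "\<dots> = L (\<Sum>a\<in>I - S. sgd f a S (x (insert a S)))"
    by (simp add: l(6) sgd_linear[OF L])
  also have "(\<Sum>a\<in>I - S. sgd f a S (x (insert a S))) = ibd f x S"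
    by (rule bd_eq[symmetric]) (use I in auto)
  finally show "ibd f (\<lambda>S. L (x S)) S = L (ibd f x S)" .
qed

lemma ibd_diff:
  assumes I: "finite I" "\<And>S. x S \<noteq> 0 \<Longrightarrow> S \<subseteq> I" "\<And>S. y S \<noteq> 0 \<Longrightarrow> S \<subseteq> I"
  shows "ibd f (x - y) = ibd f x - ibd f y"
proof
  fix S
  have 1: "(x - y) S \<noteq> 0 \<Longrightarrow> S \<subseteq> I" for S using I(2,3)[of S] by (cases "x S = 0") auto
  have sd: "sgd f a S (u - v) = sgd f a S u - sgd f a S v" for a u v by (simp add: sgd_def)
  have "ibd f z S = (\<Sum>a\<in>I - S. sgd f a S (z (insert a S)))" if "\<And>S. z S \<noteq> 0 \<Longrightarrow> S \<subseteq> I" for z :: "'a set \<Rightarrow> 'b"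
    by (rule bd_eq) (use I(1) that in auto)
  from this[of "x - y", OF 1] this[of x, OF I(2)] this[of y, OF I(3)]
  show "ibd f (x - y) S = (ibd f x - ibd f y) S" by (simp add: sd sum_subtractf)
qed

lemma ibd_minus: "ibd f (- x) = - ibd f x"
  by (simp add: bd_def fun_eq_iff sgd_minus sum_negf)

lemma ibd_0: "ibd f 0 = 0"
  by (rule ext) (auto intro!: bd_eq_0)

text \<open>At k = 0 every chain is a cycle, so exactness there is surjectivity of the augmentation;
  degree i of the unaugmented complex is k = i + 1.\<close>

definition exact_at :: "('i \<Rightarrow> nat) \<Rightarrow> 'i set \<Rightarrow> ('i set \<Rightarrow> 'b::ab_group_add set) \<Rightarrow> nat \<Rightarrow> bool" where
  "exact_at f H X k \<longleftrightarrow> (\<forall>x\<in>set_chains H X k. ibd f x = 0 \<longrightarrow> (\<exists>y\<in>set_chains H X (Suc k). ibd f y = x))"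

lemma zero_chain: "0 \<in> set_chains H X k"
  by (simp add: set_chains_def)

lemma exact_atI0:
  assumes "\<And>x. x \<in> set_chains H X k \<Longrightarrow> ibd f x = 0 \<Longrightarrow> x = 0"
  shows "exact_at f H X k"
  unfolding exact_at_def
proof (intro ballI impI)
  fix x assume "x \<in> set_chains H X k" "ibd f x = 0"
  then have "x = 0" by (rule assms)
  then show "\<exists>y\<in>set_chains H X (Suc k). ibd f y = x"
    by (intro bexI[of _ 0]) (simp_all only: ibd_0 zero_chain)
qed

lemma chains_mono:
  assumes "x \<in> set_chains H X k" "\<And>S. finite S \<Longrightarrow> S \<subseteq> H \<Longrightarrow> X S \<subseteq> Y S"
  shows "x \<in> set_chains H Y k"
  using subsetD[OF assms(2)[OF chainsD(2,3)[OF assms(1)]] chainsD(5)[OF assms(1)]] chainsD(1-4)[OF assms(1)]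
  by (auto simp: set_chains_def)

lemma chains_transform:
  assumes x: "x \<in> set_chains H X k" and "\<And>S. x S = 0 \<Longrightarrow> y S = 0"
    and "\<And>S. x S \<noteq> 0 \<Longrightarrow> y S \<in> Y S"
  shows "y \<in> set_chains H Y k"
proof -
  have nz: "x S \<noteq> 0" if "y S \<noteq> 0" for S using assms(2) that by blast
  have "finite {S. y S \<noteq> 0}" by (rule finite_subset[OF _ chainsD(1)[OF x]]) (use nz in blast)
  then show ?thesis using chainsD(2-4)[OF x nz] assms(3)[OF nz] by (simp add: set_chains_def)
qed

lemma chains_empty:
  assumes "x \<in> set_chains {} X k" "k \<noteq> 0 \<or> X {} = {0}"
  shows "x = 0"
proof (rule ccontr)
  assume "x \<noteq> 0"
  then obtain S where "x S \<noteq> 0" by (auto simp: fun_eq_iff)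
  with chainsD(2-5)[OF assms(1) this] assms(2) show False by auto
qed

locale subspace_family =
  fixes f :: "'i \<Rightarrow> nat" and s :: "'k::field \<Rightarrow> 'b::ab_group_add \<Rightarrow> 'b" and X :: "'i set \<Rightarrow> 'b set"
  assumes vs: "vector_space s" and subX: "\<And>S. module.subspace s (X S)"
    and anti: "\<And>S T. S \<subseteq> T \<Longrightarrow> X T \<subseteq> X S"
begin

lemma cech: "inj_on f H \<Longrightarrow> cech H f s X (\<lambda>_ _ y. y) 0"
proof (rule cech.intro)
  interpret vector_space s by (rule vs)
  show "Vector_Spaces.linear s s (\<lambda>y. y)" by (rule linear_ident)
  show "x \<in> X (insert a S) \<Longrightarrow> x \<in> X S" for a S x using anti[of S "insert a S"] by blast
qed (use vs subX in auto)

lemma sub_chains: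
  assumes "inj_on f H"
  shows "module.subspace (fscale s) (set_chains H X k)"
proof -
  interpret cech H f s X "\<lambda>_ _ y. y" 0 by (rule cech[OF assms])
  show ?thesis by (rule subspace_chains) simp
qed

lemma chains_diff: "inj_on f H \<Longrightarrow> x \<in> set_chains H X k \<Longrightarrow> y \<in> set_chains H X k \<Longrightarrow> x - y \<in> set_chains H X k"
  using subspaceD(3)[OF vector_space_fscale[OF vs] sub_chains] .

lemma chains_uminus: "inj_on f H \<Longrightarrow> x \<in> set_chains H X k \<Longrightarrow> - x \<in> set_chains H X k"
  using subspaceD(5)[OF vector_space_fscale[OF vs] sub_chains] .

lemma restrict_family: "subspace_family s (\<lambda>S. X (insert w S))"
proof (rule subspace_family.intro)
  show "S \<subseteq> T \<Longrightarrow> X (insert w T) \<subseteq> X (insert w S)" for S T by (rule anti) auto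
qed (rule vs subX)+

end

lemma join_chain:
  assumes w: "w \<notin> I" and y': "y' \<in> set_chains I X (Suc k)"
    and y'': "y'' \<in> set_chains I (\<lambda>S. X (insert w S)) k" and X: "\<And>S x. x \<in> X S \<Longrightarrow> - x \<in> X S"
  shows "join f w y' y'' \<in> set_chains (insert w I) X (Suc k)"
proof -
  have "finite S \<and> S \<subseteq> insert w I \<and> card S = Suc k \<and> join f w y' y'' S \<in> X S" if nz: "join f w y' y'' S \<noteq> 0" for S
  proof (cases "w \<in> S")
    case True
    define T where "T = S - {w}"
    have S: "S = insert w T" "w \<notin> T" using True by (auto simp: T_def)
    have "y'' T \<noteq> 0" and e: "join f w y' y'' S = sgd f w T (y'' T)"
      using nz True by (auto simp: join_def T_def)
    with chainsD(2-5)[OF y'' this(1)] S show ?thesis using X by (auto simp: sgd_def)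
  next
    case False
    then have "y' S \<noteq> 0" "join f w y' y'' S = y' S" using nz by (auto simp: join_def)
    with chainsD(2-5)[OF y' this(1)] show ?thesis by auto
  qed
  moreover have "{S. join f w y' y'' S \<noteq> 0} \<subseteq> {S. y' S \<noteq> 0} \<union> insert w ` {S. y'' S \<noteq> 0}"
  proof
    fix S assume "S \<in> {S. join f w y' y'' S \<noteq> 0}"
    then have "y' S \<noteq> 0 \<or> w \<in> S \<and> y'' (S - {w}) \<noteq> 0" by (auto simp: join_def split: if_splits)
    then show "S \<in> {S. y' S \<noteq> 0} \<union> insert w ` {S. y'' S \<noteq> 0}"
      by (metis (mono_tags, lifting) UnI1 UnI2 imageI insert_Diff mem_Collect_eq)
  qed
  then have "finite {S. join f w y' y'' S \<noteq> 0}"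
    by (rule finite_subset) (simp add: chainsD(1)[OF y'] chainsD(1)[OF y''])
  ultimately show ?thesis by (auto simp: set_chains_def)
qed

lemma chain_split:
  assumes w: "w \<notin> I" and x: "x \<in> set_chains (insert w I) X k" and X: "\<And>S x. x \<in> X S \<Longrightarrow> - x \<in> X S"
    and I: "finite I" "inj_on f (insert w I)" and dx: "ibd f x = 0"
  obtains x' x'' where "x = join f w x' x''" "x' \<in> set_chains I X k"
    "case k of 0 \<Rightarrow> x'' = 0 | Suc i \<Rightarrow> x'' \<in> set_chains I (\<lambda>S. X (insert w S)) i"
    "ibd f x' + x'' = 0" "ibd f x'' = 0"
proof -
  define x' x'' where "x' = (\<lambda>S. if w \<in> S then 0 else x S)"
    and "x'' = (\<lambda>S. if w \<in> S then 0 else sgd f w S (x (insert w S)))"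
  have xj: "x = join f w x' x''" unfolding x'_def x''_def by (rule join_split)
  have x': "x' \<in> set_chains I X k"
    using chainsD[OF x] by (auto simp: set_chains_def x'_def intro!: finite_subset[OF _ chainsD(1)[OF x]])
  have x''nz: "w \<notin> S \<and> x (insert w S) \<noteq> 0 \<and> finite S \<and> S \<subseteq> I \<and> Suc (card S) = k \<and> x'' S \<in> X (insert w S)"
    if "x'' S \<noteq> 0" for S
  proof -
    have a: "w \<notin> S" "x (insert w S) \<noteq> 0" "x'' S = sgd f w S (x (insert w S))"
      using that by (auto simp: x''_def split: if_splits)
    with chainsD(2-5)[OF x a(2)] show ?thesis using X by (auto simp: sgd_def)
  qed
  have "finite {S. x'' S \<noteq> 0}"
    by (rule finite_subset[of _ "Pow I"]) (use x''nz I(1) in auto)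
  then have x'': "case k of 0 \<Rightarrow> x'' = 0 | Suc i \<Rightarrow> x'' \<in> set_chains I (\<lambda>S. X (insert w S)) i"
    using x''nz by (cases k) (auto simp: set_chains_def fun_eq_iff)
  have wz: "ibd f x' S = 0" "ibd f x'' S = 0" if "w \<in> S" for S
    using that by (auto intro!: bd_eq_0 simp: x'_def x''_def)
  have b: "x' S \<noteq> 0 \<Longrightarrow> S \<subseteq> I" "x'' S \<noteq> 0 \<Longrightarrow> S \<subseteq> I" for S
    using chainsD(3)[OF x'] x''nz by auto
  have "join f w (ibd f x' + x'') (- ibd f x'') = ibd f (join f w x' x'')"
    by (rule bd_join[OF I(1) w I(2), symmetric]) (use b in auto)
  also have "\<dots> = 0" using dx xj by simp
  also have "0 = join f w 0 (0 :: 'a set \<Rightarrow> 'b)" by (auto simp: join_def fun_eq_iff)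
  finally have j: "join f w (ibd f x' + x'') (- ibd f x'') = join f w 0 0" .
  have w''0: "x'' S = 0" if "w \<in> S" for S using that by (simp add: x''_def)
  have 1: "ibd f x' + x'' = 0"
    by (rule join_inject(1)[OF j]) (simp_all add: wz w''0)
  have "- ibd f x'' = 0"
    by (rule join_inject(2)[OF j]) (simp_all add: wz w''0)
  then have 2: "ibd f x'' = 0" by simp
  show thesis by (rule that[OF xj x' x'' 1 2])
qed

context subspace_family
begin

lemma X_uminus: "x \<in> X S \<Longrightarrow> - x \<in> X S"
  using subspaceD(5)[OF vs subX] .

text \<open>The long exact sequence of the cone, carried out on chains. The component x'' is a cycle
  of the restriction and, up to sign, is filled by y''; then x' - y'' is a cycle of the deletion,
  filled by y'.\<close>

lemma exact_at_insert:
  assumes w: "w \<notin> I" and I: "finite I" "inj_on f (insert w I)"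
    and E: "exact_at f I X k" "\<And>i. k = Suc i \<Longrightarrow> exact_at f I (\<lambda>S. X (insert w S)) i"
  shows "exact_at f (insert w I) X k"
  unfolding exact_at_def
proof (intro ballI impI)
  interpret r: subspace_family f s "\<lambda>S. X (insert w S)" by (rule restrict_family)
  have inj: "inj_on f I" using I(2) by simp
  fix x assume x: "x \<in> set_chains (insert w I) X k" "ibd f x = 0"
  obtain x' x'' where xs: "x = join f w x' x''" "x' \<in> set_chains I X k"
    "case k of 0 \<Rightarrow> x'' = 0 | Suc i \<Rightarrow> x'' \<in> set_chains I (\<lambda>S. X (insert w S)) i"
    "ibd f x' + x'' = 0" "ibd f x'' = 0"
    using chain_split[OF w x(1) X_uminus I x(2)] by blast
  have "\<exists>y''\<in>set_chains I (\<lambda>S. X (insert w S)) k. - ibd f y'' = x''"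
  proof (cases k)
    case 0
    then show ?thesis using xs(3) zero_chain ibd_0 by (intro bexI[of _ 0]) auto
  next
    case (Suc i)
    then have x'': "x'' \<in> set_chains I (\<lambda>S. X (insert w S)) i" using xs(3) by simp
    have "ibd f (- x'') = 0" using xs(5) by (simp add: ibd_minus)
    then obtain y'' where "y'' \<in> set_chains I (\<lambda>S. X (insert w S)) k" "ibd f y'' = - x''"
      using E(2)[OF Suc] r.chains_uminus[OF inj x''] Suc by (auto simp: exact_at_def)
    then show ?thesis by force
  qed
  then obtain y'' where y'': "y'' \<in> set_chains I (\<lambda>S. X (insert w S)) k" "- ibd f y'' = x''" by blast
  have y''X: "y'' \<in> set_chains I X k" by (rule chains_mono[OF y''(1)]) (use anti in blast)
  have z: "x' - y'' \<in> set_chains I X k" by (rule chains_diff[OF inj xs(2) y''X])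
  have "ibd f (x' - y'') = ibd f x' - ibd f y''"
    by (rule ibd_diff[OF I(1)]) (use chainsD(3)[OF xs(2)] chainsD(3)[OF y''X] in auto)
  also have "\<dots> = ibd f x' + x''" unfolding y''(2)[symmetric] by simp
  also have "\<dots> = 0" by (rule xs(4))
  finally obtain y' where y': "y' \<in> set_chains I X (Suc k)" "ibd f y' = x' - y''"
    using E(1) z by (auto simp: exact_at_def)
  have "ibd f (join f w y' y'') = join f w (ibd f y' + y'') (- ibd f y'')"
    by (rule bd_join[OF I(1) w I(2)]) (use chainsD(3)[OF y'(1)] chainsD(3)[OF y''X] in auto)
  also have "\<dots> = x" using y'(2) y''(2) xs(1) by simp
  finally show "\<exists>y\<in>set_chains (insert w I) X (Suc k). ibd f y = x"
    using join_chain[OF w y'(1) y''(1) X_uminus] by blast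
qed

text \<open>If adding w does not shrink the coefficients, the component x' may be moved to the sets
  containing w, and the cone with apex w fills x.\<close>

lemma exact_at_cone:
  assumes w: "w \<in> I" and I: "finite I" "inj_on f I" and X: "\<And>S. S \<subseteq> I \<Longrightarrow> X S \<subseteq> X (insert w S)"
  shows "exact_at f I X k"
proof -
  define J where "J = I - {w}"
  have J: "I = insert w J" "w \<notin> J" "finite J" using w I by (auto simp: J_def)
  have injJ: "inj_on f (insert w J)" using I(2) J(1) by simp
  show ?thesis
    unfolding exact_at_def
  proof (intro ballI impI)
    fix x assume "x \<in> set_chains I X k" "ibd f x = 0"
    then have x: "x \<in> set_chains (insert w J) X k" "ibd f x = 0" using J(1) by auto
    obtain x' x'' where xs: "x = join f w x' x''" "x' \<in> set_chains J X k" "ibd f x' + x'' = 0"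
      using chain_split[OF J(2) x(1) X_uminus J(3) injJ x(2)] by blast
    have x'w: "x' \<in> set_chains J (\<lambda>S. X (insert w S)) k"
      by (rule chains_mono[OF xs(2)]) (use X J(1) in blast)
    have e: "- ibd f x' = x''" using xs(3) by (simp add: neg_eq_iff_add_eq_0)
    have "ibd f (join f w 0 x') = join f w (ibd f 0 + x') (- ibd f x')"
      by (rule bd_join[OF J(3,2) injJ]) (use chainsD(3)[OF xs(2)] in auto)
    also have "\<dots> = x" using xs(1) e by (simp add: ibd_0)
    finally show "\<exists>y\<in>set_chains I X (Suc k). ibd f y = x"
      using join_chain[OF J(2) zero_chain x'w X_uminus] J(1) by metis
  qed
qed

end

section \<open>Exactness of the augmented complexes of exterior powers\<close>

context finite_dimensional_vector_space
begin

text \<open>Hyperplanes enter the induction through linear forms: contraction needs them, and on a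
  smaller U they remain forms, possibly zero.\<close>

definition form_kernel :: "'b set \<Rightarrow> bool" where
  "form_kernel w \<longleftrightarrow> (\<exists>\<phi>. Vector_Spaces.linear scale (*) \<phi> \<and> w = {v. \<phi> v = 0})"

abbreviation efam :: "nat \<Rightarrow> 'b set \<Rightarrow> 'b set set \<Rightarrow> ('b set \<Rightarrow> 'a) set" where
  "efam j U \<equiv> (\<lambda>S. ext j (U \<inter> \<Inter>S))"

lemma efam_insert: "efam j U (insert w S) = efam j (U \<inter> w) S"
  by (simp add: Int_assoc)

lemma subspace_family_efam: "subspace_family escale (efam j U)"
proof (rule subspace_family.intro)
  show "S \<subseteq> T \<Longrightarrow> efam j U T \<subseteq> efam j U S" for S T by (rule ext_mono) auto
qed (use vs_escale subspace_ext in auto)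

lemma form_kernel_subspace:
  assumes "form_kernel w"
  shows "subspace w"
proof -
  obtain \<phi> where \<phi>: "Vector_Spaces.linear scale (*) \<phi>" "w = {v. \<phi> v = 0}"
    using assms by (auto simp: form_kernel_def)
  interpret Vector_Spaces.linear scale "(*)" \<phi> by (rule \<phi>(1))
  show ?thesis unfolding \<phi>(2) by (rule subspace_kernel)
qed

lemma form_kernel_normalize:
  assumes w: "form_kernel w" and v: "v \<notin> w"
  obtains \<phi> where "Vector_Spaces.linear scale (*) \<phi>" "\<And>u. u \<in> w \<longleftrightarrow> \<phi> u = 0" "\<phi> v = 1"
proof -
  obtain \<phi> where \<phi>: "Vector_Spaces.linear scale (*) \<phi>" "w = {v. \<phi> v = 0}"
    using w by (auto simp: form_kernel_def)
  have nz: "\<phi> v \<noteq> 0" using v \<phi>(2) by simp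
  have "Vector_Spaces.linear scale (*) (\<lambda>u. inverse (\<phi> v) * \<phi> u)"
    by (rule linearI[OF vector_space_axioms vector_space_times]) (simp_all add: linearD[OF \<phi>(1)] ring_distribs)
  then show thesis by (rule that) (use nz \<phi>(2) in auto)
qed

lemma dim_Int_form_kernel:
  assumes w: "form_kernel w" and U: "subspace U" and v: "v \<in> U" "v \<notin> w"
  shows "dim U = dim (U \<inter> w) + 1"
proof -
  obtain \<phi> where \<phi>: "Vector_Spaces.linear scale (*) \<phi>" "\<And>u. u \<in> w \<longleftrightarrow> \<phi> u = 0" "\<phi> v = 1"
    using form_kernel_normalize[OF w v(2)] by blast
  have sub: "subspace (U \<inter> w)" by (rule subspace_inter[OF U form_kernel_subspace[OF w]])
  have "span (insert v (U \<inter> w)) = U"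
  proof
    show "span (insert v (U \<inter> w)) \<subseteq> U" by (rule span_minimal) (use v U in auto)
    show "U \<subseteq> span (insert v (U \<inter> w))"
    proof
      fix u assume u: "u \<in> U"
      have "u - scale (\<phi> u) v \<in> U \<inter> w"
        using subspace_diff[OF U u subspace_scale[OF U v(1)]] \<phi> by (simp add: linearD[OF \<phi>(1)])
      then show "u \<in> span (insert v (U \<inter> w))"
        unfolding span_insert using span_base by blast
    qed
  qed
  then have "dim U = dim (insert v (U \<inter> w))" using dim_span by metis
  also have "\<dots> = dim (U \<inter> w) + 1"
    using v(2) sub by (simp add: dim_insert span_eq_iff[THEN iffD2])
  finally show ?thesis .
qed

lemma subspace_Int_Inter:
  assumes "subspace U" "\<And>w. w \<in> I \<Longrightarrow> form_kernel w"
  shows "subspace (U \<inter> \<Inter>I)"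
  using subspace_inter[OF assms(1) subspace_Inter] form_kernel_subspace[OF assms(2)] by auto

lemma exact_efam_cone:
  assumes "w \<in> I" "finite I" "inj_on f I" "U \<subseteq> w"
  shows "exact_at f I (efam j U) k"
proof -
  interpret subspace_family f escale "efam j U" by (rule subspace_family_efam)
  show ?thesis by (rule exact_at_cone[OF assms(1-3)], rule ext_mono) (use assms(4) in auto)
qed

lemma exact_efam_insert:
  assumes "w \<notin> I" "finite I" "inj_on f (insert w I)" "exact_at f I (efam j U) k"
    "\<And>i. k = Suc i \<Longrightarrow> exact_at f I (efam j (U \<inter> w)) i"
  shows "exact_at f (insert w I) (efam j U) k"
proof -
  interpret subspace_family f escale "efam j U" by (rule subspace_family_efam)
  show ?thesis
    by (rule exact_at_insert[OF assms(1-4)]) (use assms(5) in \<open>simp add: Int_assoc\<close>)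
qed

text \<open>Restriction lowers dim U and k by one each and deletion changes neither, so the bound is
  inherited. When no hyperplane is left, the only possible chains are at k = 0, with coefficients in
  a vanishing exterior power.\<close>

lemma exact_above_dim:
  assumes "finite I" "inj_on f I" "\<And>w. w \<in> I \<Longrightarrow> form_kernel w" "subspace U" "dim U < k + j"
  shows "exact_at f I (efam j U) k"
  using assms
proof (induction I arbitrary: U k rule: finite_induct)
  case empty
  show ?case
  proof (rule exact_atI0)
    fix x assume x: "x \<in> set_chains {} (efam j U) k"
    have "ext j U = {0}" if "k = 0" by (rule ext_eq_0) (use empty.prems that in auto)
    then show "x = 0" by (intro chains_empty[OF x]) auto
  qed
next
  case (insert w I)
  note w = insert.prems(2)[of w, simplified]
  show ?case
  proof (cases "U \<subseteq> w")
    case True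
    show ?thesis by (rule exact_efam_cone[OF _ _ _ True]) (use insert in auto)
  next
    case False
    then obtain v where v: "v \<in> U" "v \<notin> w" by blast
    have d: "dim U = dim (U \<inter> w) + 1" by (rule dim_Int_form_kernel[OF w insert.prems(3) v])
    have inj: "inj_on f I" using insert.prems(1) by simp
    show ?thesis
    proof (rule exact_efam_insert[OF insert.hyps(2,1) insert.prems(1)])
      show "exact_at f I (efam j U) k"
        by (rule insert.IH[OF inj insert.prems(2) insert.prems(3,4)]) simp
      show "exact_at f I (efam j (U \<inter> w)) i" if "k = Suc i" for i
        by (rule insert.IH[OF inj insert.prems(2) subspace_inter[OF insert.prems(3) form_kernel_subspace[OF w]]])
          (use d that insert.prems(4) in auto)
    qed
  qed
qed

text \<open>The bound compares k with the rank dim U - dim (U \<inter> \<Inter>I), which deletion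
  does not increase and restriction lowers together with k. Restriction from k = 1 leaves the range
  k \<ge> 1; its rank is then 0, and either a remaining hyperplane contracts the complex or none is
  left.\<close>

lemma exact_above_rank:
  assumes "finite I" "inj_on f I" "\<And>w. w \<in> I \<Longrightarrow> form_kernel w" "subspace U" "1 \<le> k"
    "dim U \<le> k + dim (U \<inter> \<Inter>I)"
  shows "exact_at f I (efam j U) k"
  using assms
proof (induction I arbitrary: U k rule: finite_induct)
  case empty
  show ?case
  proof (rule exact_atI0)
    fix x assume x: "x \<in> set_chains {} (efam j U) k"
    show "x = 0" by (rule chains_empty[OF x]) (use empty.prems in simp)
  qed
next
  case (insert w I)
  note w = insert.prems(2)[of w, simplified] and inj = insert.prems(1)
  have injI: "inj_on f I" using inj by simp
  have fkI: "\<And>w. w \<in> I \<Longrightarrow> form_kernel w" using insert.prems(2) by simp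
  show ?case
  proof (cases "U \<subseteq> w")
    case True
    show ?thesis by (rule exact_efam_cone[OF _ _ _ True]) (use insert in auto)
  next
    case False
    then obtain v where v: "v \<in> U" "v \<notin> w" by blast
    have d: "dim U = dim (U \<inter> w) + 1" by (rule dim_Int_form_kernel[OF w insert.prems(3) v])
    have subw: "subspace (U \<inter> w)" by (rule subspace_inter[OF insert.prems(3) form_kernel_subspace[OF w]])
    have e: "U \<inter> \<Inter>(insert w I) = U \<inter> w \<inter> \<Inter>I" by auto
    have dI: "dim (U \<inter> w \<inter> \<Inter>I) \<le> dim (U \<inter> \<Inter>I)" by (rule dim_subset) auto
    have le: "dim U \<le> k + dim (U \<inter> w \<inter> \<Inter>I)" using insert.prems(5) unfolding e .
    have EU: "exact_at f I (efam j U) k"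
      by (rule insert.IH[OF injI fkI insert.prems(3,4)]) (use le dI in auto)
    show ?thesis
    proof (cases "k = 1 \<and> I = {}")
      \<comment> \<open>A single hyperplane: cycles vanish because the boundary is the inclusion of
        the exterior power of U \<inter> w into that of U.\<close>
      case True
      show ?thesis
      proof (rule exact_atI0)
        fix x assume x: "x \<in> set_chains (insert w I) (efam j U) k" "ibd f x = 0"
        have neg: "\<And>S x. x \<in> efam j U S \<Longrightarrow> - x \<in> efam j U S" using es(5) .
        obtain x' x'' where xs: "x = join f w x' x''" "x' \<in> set_chains I (efam j U) k" "ibd f x' + x'' = 0"
          using chain_split[OF insert.hyps(2) x(1) neg insert.hyps(1) inj x(2)] by blast
        have "x' = 0" by (rule chains_empty) (use xs(2) True in auto)
        then have "x'' = 0" using xs(3) by (simp add: ibd_0)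
        then show "x = 0" unfolding xs(1) \<open>x' = 0\<close> by (intro ext) (simp add: join_def)
      qed
    next
      case nt: False
      show ?thesis
      proof (rule exact_efam_insert[OF insert.hyps(2,1) inj EU])
        fix i assume i: "k = Suc i"
        show "exact_at f I (efam j (U \<inter> w)) i"
        proof (cases "i = 0")
          case True
          then obtain w' where w': "w' \<in> I" using nt i by auto
          \<comment> \<open>Rank 0 means that every remaining hyperplane contains U \<inter> w, so
            any of them is an apex.\<close>
          have "dim (U \<inter> w) \<le> dim (U \<inter> w \<inter> \<Inter>I)" using le d i True by simp
          then have "U \<inter> w \<inter> \<Inter>I = U \<inter> w"
            by (intro subspace_dim_equal subspace_Int_Inter[OF subw fkI] subw) auto
          then have "U \<inter> w \<subseteq> w'" using w' by blast
          then show ?thesis by (rule exact_efam_cone[OF w' insert.hyps(1) injI])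
        next
          case False
          show ?thesis by (rule insert.IH[OF injI fkI subw]) (use False le d i in auto)
        qed
      qed
    qed
  qed
qed

text \<open>
  For a cycle \<open>(x', x'')\<close> of the cone, contraction of \<open>x'\<close> with the form defining \<open>w\<close> is a cycle of
  degree \<open>j\<close> on the restriction, since contraction kills \<open>x''\<close>.
\<close>

lemma exact_coloop:
  assumes w: "w \<notin> I" "form_kernel w" and I: "finite I" "inj_on f (insert w I)" "\<And>w. w \<in> I \<Longrightarrow> form_kernel w"
    and U: "subspace U" and v: "v \<in> U" "v \<in> \<Inter>I" "v \<notin> w"
    and E: "exact_at f I (efam j (U \<inter> w)) k"
  shows "exact_at f (insert w I) (efam (Suc j) U) k"
  unfolding exact_at_def
proof (intro ballI impI)
  fix x assume x: "x \<in> set_chains (insert w I) (efam (Suc j) U) k" "ibd f x = 0"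
  have neg: "\<And>S x. x \<in> efam (Suc j) U S \<Longrightarrow> - x \<in> efam (Suc j) U S" using es(5) .
  obtain x' x'' where xs: "x = join f w x' x''" "x' \<in> set_chains I (efam (Suc j) U) k"
    "case k of 0 \<Rightarrow> x'' = 0 | Suc i \<Rightarrow> x'' \<in> set_chains I (\<lambda>S. efam (Suc j) U (insert w S)) i"
    "ibd f x' + x'' = 0" "ibd f x'' = 0"
    using chain_split[OF w(1) x(1) neg I(1,2) x(2)] by blast
  obtain \<phi> where \<phi>: "Vector_Spaces.linear scale (*) \<phi>" "\<And>u. u \<in> w \<longleftrightarrow> \<phi> u = 0" "\<phi> v = 1"
    using form_kernel_normalize[OF w(2) v(3)] by blast
  let ?c = "contract \<phi>"
  let ?p = "\<lambda>\<omega>. \<omega> - wedge v (?c \<omega>)"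
  interpret pr: vector_space_pair escale escale by unfold_locales
  have lin_wc: "Vector_Spaces.linear escale escale (\<lambda>\<omega>. wedge v (?c \<omega>))"
    using Vector_Spaces.linear_compose[OF linear_contract linear_wedge] by (simp add: comp_def)
  have lin_p: "Vector_Spaces.linear escale escale ?p"
    by (rule pr.linear_compose_sub[OF ev.linear_ident lin_wc])
  have dec: "?p \<omega> \<in> efam (Suc j) (U \<inter> w) S \<and> ?c \<omega> \<in> efam j (U \<inter> w) S"
    if "\<omega> \<in> efam (Suc j) U S" "S \<subseteq> I" for \<omega> S
  proof -
    have sS: "subspace (\<Inter>S)" using form_kernel_subspace I(3) that(2) by (intro subspace_Inter) auto
    have a1: "\<phi> u = 0" if "u \<in> U \<inter> w \<inter> \<Inter>S" for u using that \<phi>(2) by blast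
    have a2: "subspace (U \<inter> w \<inter> \<Inter>S)"
      by (intro subspace_inter U form_kernel_subspace[OF w(2)] sS)
    have a3: "u - scale (\<phi> u) v \<in> U \<inter> w \<inter> \<Inter>S" if u: "u \<in> U \<inter> \<Inter>S" for u
    proof -
      have "v \<in> U \<inter> \<Inter>S" using v \<open>S \<subseteq> I\<close> by blast
      then have "u - scale (\<phi> u) v \<in> U \<inter> \<Inter>S"
        using u subspace_diff[OF subspace_inter[OF U sS]] subspace_scale[OF subspace_inter[OF U sS]] by blast
      moreover have "u - scale (\<phi> u) v \<in> w" using \<phi>(2,3) by (simp add: linearD[OF \<phi>(1)])
      ultimately show ?thesis by blast
    qed
    show ?thesis using ext_decomp[OF \<phi>(1) a1 \<phi>(3) a2 a3 that(1)] by simp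
  qed
  have sup: "x' S \<noteq> 0 \<Longrightarrow> S \<subseteq> I" for S using chainsD(3)[OF xs(2)] .
  have x'': "x'' = - ibd f x'" using xs(4) by (simp add: eq_neg_iff_add_eq_0 add.commute)
  have c0: "?c (x'' S) = 0" for S
  proof (cases "x'' S = 0")
    case False
    then obtain i where "k = Suc i" "x'' \<in> set_chains I (\<lambda>S. efam (Suc j) U (insert w S)) i"
      using xs(3) by (cases k) auto
    then have "x'' S \<in> ext (Suc j) (U \<inter> \<Inter>(insert w S))" using chainsD(5) False by blast
    then show ?thesis by (rule contract_ext_eq_0[OF \<phi>(1), rotated]) (use \<phi>(2) in auto)
  qed (simp add: lc)
  then have cb: "?c (ibd f x' S) = 0" for S using c0[of S] unfolding x'' by (simp add: lc)
  have z: "(\<lambda>S. ?c (x' S)) \<in> set_chains I (efam j (U \<inter> w)) k"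
    by (rule chains_transform[OF xs(2)]) (use lc(3) dec chainsD(5)[OF xs(2)] sup in auto)
  have "ibd f (\<lambda>S. ?c (x' S)) = (\<lambda>S. ?c (ibd f x' S))"
    by (rule ibd_linear[OF linear_contract I(1) sup])
  also have "\<dots> = 0" using cb by auto
  finally obtain t where t: "t \<in> set_chains I (efam j (U \<inter> w)) (Suc k)" "ibd f t = (\<lambda>S. ?c (x' S))"
    using E z by (auto simp: exact_at_def)
  define y' where "y' = (\<lambda>S. wedge v (t S))"
  have y': "y' \<in> set_chains I (efam (Suc j) U) (Suc k)"
  proof (rule chains_transform[OF t(1)])
    show "y' S = 0" if "t S = 0" for S using that lw(3) by (auto simp: y'_def)
    show "y' S \<in> efam (Suc j) U S" if "t S \<noteq> 0" for S
    proof -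
      have "v \<in> U \<inter> \<Inter>S" using v chainsD(3)[OF t(1) that] by blast
      moreover have "t S \<in> ext j (U \<inter> \<Inter>S)"
        using chainsD(5)[OF t(1) that] ext_mono[of "U \<inter> w \<inter> \<Inter>S" "U \<inter> \<Inter>S" j] by blast
      ultimately show ?thesis unfolding y'_def by (rule wedge_in_ext)
    qed
  qed
  \<comment> \<open>With c for contraction, the pair (y', y'') has cone boundary x: d y' + y'' is v
    \<and> c x' plus x' - v \<and> c x', and - d y'' is x'' because c kills d x'.\<close>
  define y'' where "y'' = (\<lambda>S. ?p (x' S))"
  have y'': "y'' \<in> set_chains I (\<lambda>S. efam (Suc j) U (insert w S)) k"
  proof (rule chains_transform[OF xs(2)])
    show "y'' S = 0" if "x' S = 0" for S using that linearD(3)[OF lin_p] by (simp add: y''_def)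
    show "y'' S \<in> efam (Suc j) U (insert w S)" if "x' S \<noteq> 0" for S
      using dec[OF chainsD(5)[OF xs(2) that] sup[OF that]] unfolding efam_insert y''_def by blast
  qed
  have dy': "ibd f y' = (\<lambda>S. wedge v (?c (x' S)))"
    unfolding y'_def by (subst ibd_linear[OF linear_wedge I(1)]) (use chainsD(3)[OF t(1)] t(2) in auto)
  have dy'': "ibd f y'' = (\<lambda>S. ?p (ibd f x' S))"
    unfolding y''_def by (rule ibd_linear[OF lin_p I(1) sup])
  have "ibd f (join f w y' y'') = join f w (ibd f y' + y'') (- ibd f y'')"
    by (rule bd_join[OF I(1) w(1) I(2)]) (use chainsD(3)[OF y'] chainsD(3)[OF y''] in auto)
  also have "ibd f y' + y'' = x'" by (simp add: dy' y''_def fun_eq_iff)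
  also have "- ibd f y'' = x''" by (rule ext) (simp add: dy'' x'' cb lw(3))
  finally show "\<exists>y\<in>set_chains (insert w I) (efam (Suc j) U) (Suc k). ibd f y = x"
    using join_chain[OF w(1) y' y'' neg] xs(1) by metis
qed

text \<open>If w contains U \<inter> \<Inter>I, deleting it keeps the rank and restricting lowers
  rank and k by one each, so the bound is inherited. Otherwise deletion would lower the rank;
  \<open>exact_coloop\<close> then trades one unit of rank for one of j and keeps k.\<close>

lemma exact_below_rank:
  assumes "finite I" "inj_on f I" "\<And>w. w \<in> I \<Longrightarrow> form_kernel w" "subspace U"
    "k + j + dim (U \<inter> \<Inter>I) < dim U"
  shows "exact_at f I (efam j U) k"
  using assms
proof (induction I arbitrary: U k j rule: finite_induct)
  case empty
  then show ?case by simp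
next
  case (insert w I)
  note w = insert.prems(2)[of w, simplified] and inj = insert.prems(1)
  have injI: "inj_on f I" using inj by simp
  have fkI: "\<And>w. w \<in> I \<Longrightarrow> form_kernel w" using insert.prems(2) by simp
  show ?case
  proof (cases "U \<subseteq> w")
    case True
    show ?thesis by (rule exact_efam_cone[OF _ _ _ True]) (use insert in auto)
  next
    case False
    then obtain v where v: "v \<in> U" "v \<notin> w" by blast
    have d: "dim U = dim (U \<inter> w) + 1" by (rule dim_Int_form_kernel[OF w insert.prems(3) v])
    have subw: "subspace (U \<inter> w)" by (rule subspace_inter[OF insert.prems(3) form_kernel_subspace[OF w]])
    have e: "U \<inter> \<Inter>(insert w I) = U \<inter> w \<inter> \<Inter>I" by auto
    have lt: "k + j + dim (U \<inter> w \<inter> \<Inter>I) < dim U" using insert.prems(4) unfolding e .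
    show ?thesis
    proof (cases "U \<inter> \<Inter>I \<subseteq> w")
      case True
      then have e': "U \<inter> w \<inter> \<Inter>I = U \<inter> \<Inter>I" by blast
      show ?thesis
      proof (rule exact_efam_insert[OF insert.hyps(2,1) inj])
        show "exact_at f I (efam j U) k"
          by (rule insert.IH[OF injI fkI insert.prems(3)]) (use lt e' in auto)
        show "exact_at f I (efam j (U \<inter> w)) i" if "k = Suc i" for i
          by (rule insert.IH[OF injI fkI subw]) (use lt d that in auto)
      qed
    next
      case False
      then obtain v where v: "v \<in> U" "v \<in> \<Inter>I" "v \<notin> w" by blast
      show ?thesis
      proof (cases j)
        case 0
        \<comment> \<open>For j = 0 there is no smaller exterior power to pass to, but the
          coefficients are constant, so w serves as apex.\<close>
        interpret subspace_family f escale "efam 0 U" by (rule subspace_family_efam)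
        have "exact_at f (insert w I) (efam 0 U) k"
          by (rule exact_at_cone[of w]) (use insert.hyps inj in \<open>auto simp: ext_0\<close>)
        then show ?thesis using 0 by simp
      next
        case (Suc i)
        have "exact_at f I (efam i (U \<inter> w)) k"
          by (rule insert.IH[OF injI fkI subw]) (use lt d Suc in auto)
        then show ?thesis
          using exact_coloop[OF insert.hyps(2) w insert.hyps(1) inj fkI insert.prems(3) v] Suc by simp
      qed
    qed
  qed
qed

end

section \<open>Euler characteristic and Moebius function\<close>

lemma vdim_finite:
  assumes s: "vector_space s" and U: "module.subspace s U" and A: "finite A" "U \<subseteq> module.span s A"
  shows "vdim s U =o |{..<vector_space.dim s U}|"
proof -
  interpret vector_space s by (rule s)
  obtain B where B: "B \<subseteq> U" "independent B" "U \<subseteq> span B"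
    using maximal_independent_subset[of U] by blast
  have fin: "finite B" using independent_span_bound[OF A(1) B(2)] B(1) A(2) by blast
  have "vdim s U =o |B|"
    by (rule vdim_basis[OF s B(2)]) (use span_subspace[OF B(1,3) U] in simp)
  moreover have "card B = dim U" by (rule basis_card_eq_dim[OF B(1,3,2)])
  then obtain g where "bij_betw g B {..<dim U}"
    using finite_same_card_bij[OF fin, of "{..<dim U}"] by auto
  then have "|B| =o |{..<dim U}|" by (rule card_of_ordIsoI)
  ultimately show ?thesis by (rule ordIso_transitive)
qed

lemma dim_quot:
  assumes s: "vector_space s" and Z: "module.subspace s Z" and B: "module.subspace s B" "B \<subseteq> Z"
    and A: "finite A" "Z \<subseteq> module.span s A"
  shows "vector_space.dim s Z = vector_space.dim s B + vector_space.dim s (quot s Z B)"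
proof -
  interpret vector_space s by (rule s)
  interpret vector_space_pair s s by unfold_locales
  have "{x \<in> Z. quot_map s B x = 0} = B" using quot_map_eq_0_iff[OF s B(1)] B(2) by auto
  then show ?thesis using dim_kernel_image[OF quot_map(1)[OF s B(1)] Z A] by (simp add: quot_def)
qed

text \<open>Here a, z and b are the dimensions of chains, cycles and boundaries; the last term
  corrects for b M, whose partner a (Suc M) lies beyond the truncation.\<close>

lemma alternating_sum_telescope:
  fixes a b z :: "nat \<Rightarrow> nat"
  assumes "a 0 = z 0" "\<And>k. a (Suc k) = z (Suc k) + b k"
  shows "(\<Sum>k\<le>M. (-1) ^ k * int (a k)) = (\<Sum>k\<le>M. (-1) ^ k * (int (z k) - int (b k))) + (-1) ^ M * int (b M)"
  by (induction M) (simp_all add: assms algebra_simps)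

subsection \<open>Dimensions of spaces of finitely supported functions\<close>

definition supported :: "'i set \<Rightarrow> ('i \<Rightarrow> 'b set) \<Rightarrow> ('i \<Rightarrow> 'b::zero) set" where
  "supported K X = {x. \<forall>i. x i \<noteq> 0 \<longrightarrow> i \<in> K \<and> x i \<in> X i}"

lemma supported_dim:
  fixes s :: "'k::field \<Rightarrow> 'b::ab_group_add \<Rightarrow> 'b" and X :: "'i \<Rightarrow> 'b set"
  assumes s: "vector_space s" and X: "\<And>i. module.subspace s (X i)"
    and A: "finite A" "\<And>i. X i \<subseteq> module.span s A" and K: "finite K"
  shows "module.subspace (fscale s) (supported K X)"
    and "\<exists>B. finite B \<and> supported K X \<subseteq> module.span (fscale s) B"
    and "vector_space.dim (fscale s) (supported K X) = (\<Sum>i\<in>K. vector_space.dim s (X i))"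
proof -
  interpret s: vector_space s by (rule s)
  interpret f: vector_space "fscale s :: 'k \<Rightarrow> ('i \<Rightarrow> 'b) \<Rightarrow> _" by (rule vector_space_fscale[OF s])
  interpret p: vector_space_pair s "fscale s :: 'k \<Rightarrow> ('i \<Rightarrow> 'b) \<Rightarrow> _" by unfold_locales
  interpret q: vector_space_pair "fscale s :: 'k \<Rightarrow> ('i \<Rightarrow> 'b) \<Rightarrow> _" s by unfold_locales
  have X0: "0 \<in> X i" and Xadd: "x \<in> X i \<Longrightarrow> y \<in> X i \<Longrightarrow> x + y \<in> X i"
    and Xscale: "x \<in> X i \<Longrightarrow> s c x \<in> X i" for i x y c
    using subspaceD(1,2,4)[OF s X] by blast+
  show sub: "f.subspace (supported K X)" for K
  proof (rule f.subspaceI)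
    show "0 \<in> supported K X" by (simp add: supported_def)
    fix x y assume x: "x \<in> supported K X" and y: "y \<in> supported K X"
    have "x i + y i \<in> X i" for i
      using x y X0[of i] Xadd[of "x i" i "y i"] by (cases "x i = 0"; cases "y i = 0") (auto simp: supported_def)
    moreover have "i \<in> K" if "x i + y i \<noteq> 0" for i
      using x y that by (cases "x i = 0") (auto simp: supported_def)
    ultimately show "x + y \<in> supported K X" by (simp add: supported_def)
  next
    fix c x assume "x \<in> supported K X"
    then show "fscale s c x \<in> supported K X" using Xscale by (auto simp: supported_def)
  qed
  define sp where "sp i y = (\<lambda>j. if j = i then y else (0::'b))" for i :: 'i and y
  have lsp: "Vector_Spaces.linear s (fscale s) (sp i)" for i
    by (rule linearI[OF s vector_space_fscale[OF s]]) (auto simp: sp_def fun_eq_iff)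
  have fin: "finite (\<Union>i\<in>K. sp i ` A)" "supported K X \<subseteq> f.span (\<Union>i\<in>K. sp i ` A)" if K: "finite K" for K
  proof -
    show "finite (\<Union>i\<in>K. sp i ` A)" using K A(1) by simp
    show "supported K X \<subseteq> f.span (\<Union>i\<in>K. sp i ` A)"
    proof
      fix x assume x: "x \<in> supported K X"
      have "x = (\<Sum>i\<in>K. sp i (x i))"
        using x K by (auto simp: fun_eq_iff sum_fun_apply sp_def supported_def)
      also have "\<dots> \<in> f.span (\<Union>i\<in>K. sp i ` A)"
      proof (rule f.span_sum)
        fix i assume i: "i \<in> K"
        interpret l: Vector_Spaces.linear s "fscale s" "sp i" by (rule lsp)
        have "x i \<in> s.span A" using x A(2)[of i] s.span_zero by (cases "x i = 0") (auto simp: supported_def)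
        then have "sp i (x i) \<in> f.span (sp i ` A)" unfolding l.span_image by blast
        then show "sp i (x i) \<in> f.span (\<Union>i\<in>K. sp i ` A)"
          using f.span_mono[of "sp i ` A" "\<Union>i\<in>K. sp i ` A"] i by blast
      qed
      finally show "x \<in> f.span (\<Union>i\<in>K. sp i ` A)" .
    qed
  qed
  show "\<exists>B. finite B \<and> supported K X \<subseteq> f.span B" using fin[OF K] by blast
  show "f.dim (supported K X) = (\<Sum>i\<in>K. s.dim (X i))"
    using K
  proof (induction K rule: finite_induct)
    case empty
    have "supported {} X = {0}" by (auto simp: supported_def fun_eq_iff)
    moreover have "f.dim {0} = 0" using f.dim_span_eq_card_independent[of "{}"] f.independent_empty by simp
    ultimately show "f.dim (supported {} X) = (\<Sum>i\<in>{}. s.dim (X i))" by simp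
  next
    case (insert i K)
    have l: "Vector_Spaces.linear (fscale s) s (\<lambda>x. x i)"
      by (rule linearI[OF vector_space_fscale[OF s] s]) auto
    have k: "{x \<in> supported (insert i K) X. x i = 0} = supported K X"
      using insert.hyps(2) by (auto simp: supported_def)
    have im: "(\<lambda>x. x i) ` supported (insert i K) X = X i"
    proof
      show "(\<lambda>x. x i) ` supported (insert i K) X \<subseteq> X i"
      proof
        fix y assume "y \<in> (\<lambda>x. x i) ` supported (insert i K) X"
        then obtain x where "x \<in> supported (insert i K) X" "y = x i" by blast
        then show "y \<in> X i" using X0[of i] by (cases "x i = 0") (auto simp: supported_def)
      qed
      show "X i \<subseteq> (\<lambda>x. x i) ` supported (insert i K) X"
      proof
        fix y assume "y \<in> X i"
        then have "sp i y \<in> supported (insert i K) X" by (auto simp: supported_def sp_def)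
        then show "y \<in> (\<lambda>x. x i) ` supported (insert i K) X" by (intro image_eqI[of _ _ "sp i y"]) (simp_all add: sp_def)
      qed
    qed
    have "finite (insert i K)" using insert.hyps by simp
    note d = q.dim_kernel_image[OF l sub fin[OF this], unfolded k im]
    have IH: "f.dim (supported K X) = (\<Sum>i\<in>K. s.dim (X i))" by (rule insert.IH)
    show "f.dim (supported (insert i K) X) = (\<Sum>i\<in>insert i K. s.dim (X i))"
      unfolding d IH using insert.hyps by simp
  qed
qed

lemma set_chains_supported:
  assumes "finite H" "\<And>S. 0 \<in> X S"
  shows "set_chains H X k = supported {S \<in> Pow H. card S = k} X"
proof -
  have "finite {S. x S \<noteq> 0}" if "x \<in> supported {S \<in> Pow H. card S = k} X" for x
    by (rule finite_subset[of _ "Pow H"]) (use that assms(1) in \<open>auto simp: supported_def\<close>)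
  then show ?thesis using finite_subset[OF _ assms(1)] by (auto simp: set_chains_def supported_def)
qed

section \<open>Euler characteristic of the augmented complex\<close>

context finite_dimensional_vector_space
begin

abbreviation cscale :: "'a \<Rightarrow> ('b set set \<Rightarrow> 'b set \<Rightarrow> 'a) \<Rightarrow> 'b set set \<Rightarrow> 'b set \<Rightarrow> 'a" where
  "cscale \<equiv> fscale escale"

lemma vs_cscale: "vector_space (cscale :: 'a \<Rightarrow> ('b set set \<Rightarrow> 'b set \<Rightarrow> 'a) \<Rightarrow> _)"
  by (rule vector_space_fscale[OF vs_escale])

sublocale cv: vector_space "cscale :: 'a \<Rightarrow> ('b set set \<Rightarrow> 'b set \<Rightarrow> 'a) \<Rightarrow> _"
  by (rule vs_cscale)

context
  fixes H :: "'b set set" and f :: "'b set \<Rightarrow> nat" and U :: "'b set" and j :: nat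
  assumes H: "finite H" "inj_on f H" "\<And>w. w \<in> H \<Longrightarrow> form_kernel w" and U: "subspace U"
begin

interpretation fam: subspace_family f escale "efam j U" by (rule subspace_family_efam)
interpretation c: cech H f escale "efam j U" "\<lambda>_ _ y. y" 0 by (rule fam.cech[OF H(2)])

abbreviation "Ch k \<equiv> set_chains H (efam j U) k"
abbreviation "Zc k \<equiv> {x \<in> Ch k. ibd f x = 0}"
abbreviation "Bc k \<equiv> ibd f ` Ch (Suc k)"

lemma chain_dim:
  "\<exists>B. finite B \<and> Ch k \<subseteq> cv.span B"
  "cv.dim (Ch k) = (\<Sum>S\<in>{S \<in> Pow H. card S = k}. dim (U \<inter> \<Inter>S) choose j)"
proof -
  have fin: "finite {S \<in> Pow H. card S = k}" using H(1) by simp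
  have e: "Ch k = supported {S \<in> Pow H. card S = k} (efam j U)"
    by (rule set_chains_supported[OF H(1) es(1)])
  note sd = supported_dim[where X = "efam j U", OF vs_escale subspace_ext ext_finite_span fin]
  show "\<exists>B. finite B \<and> Ch k \<subseteq> cv.span B" unfolding e by (rule sd(2))
  have "dim (U \<inter> \<Inter>S) choose j = ev.dim (efam j U S)" if "S \<in> {S \<in> Pow H. card S = k}" for S
    by (rule dim_ext[symmetric]) (rule subspace_Int_Inter[OF U], use H(3) that in auto)
  then show "cv.dim (Ch k) = (\<Sum>S\<in>{S \<in> Pow H. card S = k}. dim (U \<inter> \<Inter>S) choose j)"
    unfolding e sd(3) by (intro sum.cong) auto
qed

lemma sub_Ch: "cv.subspace (Ch k)" by (rule c.subspace_chains) simp

lemma lin_ibd: "lin_on cscale cscale (Ch (Suc k)) (Ch k) (ibd f)"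
  by (rule c.lin_on_bd) simp

lemma Z_0: "Zc 0 = Ch 0"
proof -
  have "ibd f x = 0" if "x \<in> Ch 0" for x
  proof
    fix S
    have "x (insert a S) = 0" for a
    proof (rule ccontr)
      assume "x (insert a S) \<noteq> 0"
      from chainsD(2,4)[OF that this] show False by auto
    qed
    then show "ibd f x S = 0 S" by (simp add: bd_eq_0)
  qed
  then show ?thesis by blast
qed

lemma B_sub_Z: "Bc k \<subseteq> Zc k"
proof
  fix x assume "x \<in> Bc k"
  then obtain y where y: "y \<in> Ch (Suc k)" "x = ibd f y" by blast
  have "ibd f x = 0"
  proof (cases k)
    case 0
    then have "x \<in> Ch 0" using lin_onD(1)[OF vs_cscale vs_cscale sub_Ch lin_ibd] y by blast
    then show ?thesis using Z_0 by blast
  next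
    case (Suc i)
    then show ?thesis using c.bd_bd[of y i] y by simp
  qed
  then show "x \<in> Zc k" using lin_onD(1)[OF vs_cscale vs_cscale sub_Ch lin_ibd] y by blast
qed

lemma dim_Ch_Suc: "cv.dim (Ch (Suc k)) = cv.dim (Zc (Suc k)) + cv.dim (Bc k)"
proof -
  interpret p: vector_space_pair cscale cscale by unfold_locales
  \<comment> \<open>\<open>ibd f\<close> sums over a range depending on the chain and need not be
    linear on all functions; D sums over all of H, is linear everywhere, and agrees with it on
    chains.\<close>
  define D where "D x S = (\<Sum>a\<in>H - S. sgd f a S (x (insert a S)))"
    for x :: "'b set set \<Rightarrow> 'b set \<Rightarrow> 'a" and S
  have "Vector_Spaces.linear cscale cscale D"
  proof (rule linearI[OF vs_cscale vs_cscale])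
    show "D (x + y) = D x + D y" for x y by (rule ext) (simp add: D_def sgd_add sum.distrib)
    show "D (cscale r x) = cscale r (D x)" for r x
    proof (rule ext)
      fix S
      have "sgd f a S (escale r y) = escale r (sgd f a S y)" for a y by (simp add: sgd_def)
      then show "D (cscale r x) S = cscale r (D x) S"
        unfolding D_def fscale_apply[of escale] by (simp only: ev.scale_sum_right)
    qed
  qed
  moreover have e: "D x = ibd f x" if "x \<in> Ch k" for x k
  proof
    fix S show "D x S = ibd f x S"
      unfolding D_def by (rule bd_eq[symmetric]) (use H(1) chainsD(3)[OF that] in auto)
  qed
  moreover obtain B where "finite B" "Ch (Suc k) \<subseteq> cv.span B" using chain_dim(1) by blast
  ultimately have "cv.dim (Ch (Suc k)) = cv.dim {x \<in> Ch (Suc k). D x = 0} + cv.dim (D ` Ch (Suc k))"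
    using p.dim_kernel_image sub_Ch by blast
  moreover have "{x \<in> Ch (Suc k). D x = 0} = Zc (Suc k)" "D ` Ch (Suc k) = Bc k"
    using e by (auto simp: image_def)
  ultimately show ?thesis by simp
qed

lemma euler_partial:
  "(\<Sum>k\<le>M. (-1) ^ k * int (cv.dim (Ch k))) =
    (\<Sum>k\<le>M. (-1) ^ k * (int (cv.dim (Zc k)) - int (cv.dim (Bc k)))) + (-1) ^ M * int (cv.dim (Bc M))"
  by (rule alternating_sum_telescope) (use Z_0 dim_Ch_Suc in simp_all)

lemma euler_char:
  assumes ex: "\<And>k. k \<noteq> k0 \<Longrightarrow> exact_at f H (efam j U) k"
  shows "int (cv.dim (Zc k0)) - int (cv.dim (Bc k0)) =
    (-1) ^ k0 * (\<Sum>S\<in>Pow H. (-1) ^ card S * int (dim (U \<inter> \<Inter>S) choose j))"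
proof -
  \<comment> \<open>Large enough that there are no chains at M + 1 and that k0 lies in the range of
    summation.\<close>
  define M where "M = card H + k0"
  have "Ch (Suc M) = {0}"
  proof -
    have "x = 0" if "x \<in> Ch (Suc M)" for x
    proof
      fix S show "x S = 0 S"
      proof (rule ccontr)
        assume "x S \<noteq> 0 S"
        then have "S \<subseteq> H" "card S = Suc M" using chainsD(3,4)[OF that, of S] by auto
        then show False using card_mono[OF H(1), of S] by (simp add: M_def)
      qed
    qed
    then show ?thesis using zero_chain by blast
  qed
  then have BM: "cv.dim (Bc M) = 0"
    using cv.dim_span_eq_card_independent[of "{}"] cv.independent_empty by (simp add: ibd_0)
  have z: "cv.dim (Zc k) = cv.dim (Bc k)" if "k \<noteq> k0" for k
  proof -
    have "Zc k = Bc k" using B_sub_Z ex[OF that] unfolding exact_at_def by blast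
    then show ?thesis by simp
  qed
  have "(\<Sum>k\<le>M. (-1) ^ k * (int (cv.dim (Zc k)) - int (cv.dim (Bc k)))) =
      (\<Sum>k\<le>M. if k = k0 then (-1) ^ k0 * (int (cv.dim (Zc k0)) - int (cv.dim (Bc k0))) else 0)"
  proof (rule sum.cong[OF refl])
    fix k show "(-1) ^ k * (int (cv.dim (Zc k)) - int (cv.dim (Bc k))) =
        (if k = k0 then (-1) ^ k0 * (int (cv.dim (Zc k0)) - int (cv.dim (Bc k0))) else 0)"
      using z[of k] by (cases "k = k0") simp_all
  qed
  then have "(\<Sum>k\<le>M. (-1) ^ k * int (cv.dim (Ch k))) =
      (\<Sum>k\<le>M. if k = k0 then (-1) ^ k0 * (int (cv.dim (Zc k0)) - int (cv.dim (Bc k0))) else 0)"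
    unfolding euler_partial BM of_nat_0 mult_zero_right add_0_right .
  also have "\<dots> = (-1) ^ k0 * (int (cv.dim (Zc k0)) - int (cv.dim (Bc k0)))"
    by (simp add: M_def)
  finally have 1: "(\<Sum>k\<le>M. (-1) ^ k * int (cv.dim (Ch k))) =
      (-1) ^ k0 * (int (cv.dim (Zc k0)) - int (cv.dim (Bc k0)))" .
  have "(\<Sum>k\<le>M. (-1) ^ k * int (cv.dim (Ch k))) =
      (\<Sum>k\<le>M. \<Sum>S\<in>{S \<in> Pow H. card S = k}. (-1) ^ card S * int (dim (U \<inter> \<Inter>S) choose j))"
    unfolding chain_dim(2) by (auto simp: sum_distrib_left intro!: sum.cong)
  also have "\<dots> = (\<Sum>S\<in>Pow H. (-1) ^ card S * int (dim (U \<inter> \<Inter>S) choose j))"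
  proof (rule sum.group)
    have "card S \<le> M" if "S \<in> Pow H" for S
      using card_mono[OF H(1), of S] that by (simp add: M_def)
    then show "card ` Pow H \<subseteq> {..M}" by auto
  qed (use H(1) in auto)
  finally have "(-1) ^ k0 * (int (cv.dim (Zc k0)) - int (cv.dim (Bc k0))) =
      (\<Sum>S\<in>Pow H. (-1) ^ card S * int (dim (U \<inter> \<Inter>S) choose j))"
    unfolding 1 .
  then show ?thesis by (cases "even k0") auto
qed

end

subsection \<open>The Moebius function of the arrangement lattice\<close>

text \<open>The cross-cut sum for intersections taken inside U; letting U vary makes a
  deletion-restriction recursion available.\<close>

definition mu_sum :: "'b set set \<Rightarrow> 'b set \<Rightarrow> 'b set \<Rightarrow> int" where
  "mu_sum I U x = (\<Sum>S\<in>{S \<in> Pow I. U \<inter> \<Inter>S = x}. (-1) ^ card S)"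

lemma inj_on_insert_Pow: "w \<notin> I \<Longrightarrow> inj_on (insert w) (Pow I)"
proof (rule inj_onI)
  fix S T assume "w \<notin> I" "S \<in> Pow I" "T \<in> Pow I" "insert w S = insert w T"
  moreover from this have "w \<notin> S" "w \<notin> T" by auto
  ultimately show "S = T" using insert_ident by metis
qed

lemma mu_sum_insert:
  assumes "finite I" "w \<notin> I"
  shows "mu_sum (insert w I) U x = mu_sum I U x - mu_sum I (U \<inter> w) x"
proof -
  have e: "{S \<in> Pow (insert w I). U \<inter> \<Inter>S = x} =
      {S \<in> Pow I. U \<inter> \<Inter>S = x} \<union> insert w ` {S \<in> Pow I. U \<inter> w \<inter> \<Inter>S = x}"
    by (auto simp: Pow_insert)
  have inj: "inj_on (insert w) {S \<in> Pow I. U \<inter> w \<inter> \<Inter>S = x}"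
    by (rule inj_on_subset[OF inj_on_insert_Pow[OF assms(2)]]) auto
  have "(\<Sum>S\<in>insert w ` {S \<in> Pow I. U \<inter> w \<inter> \<Inter>S = x}. (-1::int) ^ card S) =
      (\<Sum>S\<in>{S \<in> Pow I. U \<inter> w \<inter> \<Inter>S = x}. - ((-1) ^ card S))"
    unfolding sum.reindex[OF inj]
  proof (rule sum.cong[OF refl])
    fix S assume "S \<in> {S \<in> Pow I. U \<inter> w \<inter> \<Inter>S = x}"
    then have "finite S" "w \<notin> S" using assms finite_subset by auto
    then show "((\<lambda>S. (-1::int) ^ card S) \<circ> insert w) S = - ((-1) ^ card S)" by simp
  qed
  then show ?thesis
    unfolding mu_sum_def e
    by (subst sum.union_disjoint) (use assms in \<open>auto simp: sum_negf\<close>)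
qed

text \<open>The recursion subtracts the restriction from the deletion, and restricting lowers dim U
  by one, so both contributions have the same sign. If U \<subseteq> w they cancel.\<close>

lemma mu_sum_sign:
  assumes "finite I" "\<And>w. w \<in> I \<Longrightarrow> form_kernel w" "subspace U"
  shows "0 \<le> (-1) ^ (dim U - dim x) * mu_sum I U x"
  using assms
proof (induction I arbitrary: U rule: finite_induct)
  case empty
  have "{S \<in> Pow {}. U \<inter> \<Inter>S = x} = (if U = x then {{}} else {})" by auto
  then show ?case by (simp add: mu_sum_def)
next
  case (insert w I)
  note w = insert.prems(1)[of w, simplified]
  have subw: "subspace (U \<inter> w)" by (rule subspace_inter[OF insert.prems(2) form_kernel_subspace[OF w]])
  show ?case
  proof (cases "U \<subseteq> w")
    case True
    then have "U \<inter> w = U" by blast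
    then show ?thesis by (simp add: mu_sum_insert[OF insert.hyps])
  next
    case False
    then obtain v where v: "v \<in> U" "v \<notin> w" by blast
    have d: "dim U = dim (U \<inter> w) + 1" by (rule dim_Int_form_kernel[OF w insert.prems(2) v])
    have 1: "0 \<le> (-1) ^ (dim U - dim x) * mu_sum I U x"
      by (rule insert.IH) (use insert.prems in auto)
    have 2: "0 \<le> (-1) ^ (dim (U \<inter> w) - dim x) * mu_sum I (U \<inter> w) x"
      by (rule insert.IH) (use insert.prems subw in auto)
    \<comment> \<open>If no S yields x, the sum is empty. Otherwise x lies in U \<inter> w, so
      neither difference is truncated and they differ by exactly one.\<close>
    have "0 \<le> - ((-1) ^ (dim U - dim x) * mu_sum I (U \<inter> w) x)"
    proof (cases "{S \<in> Pow I. U \<inter> w \<inter> \<Inter>S = x} = {}")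
      case True
      then show ?thesis unfolding mu_sum_def True by simp
    next
      case False
      then have "x \<subseteq> U \<inter> w" by blast
      then have "dim x \<le> dim (U \<inter> w)" by (rule dim_subset)
      then have "dim U - dim x = Suc (dim (U \<inter> w) - dim x)" using d by simp
      then show ?thesis using 2 by simp
    qed
    then show ?thesis using 1 by (simp add: mu_sum_insert[OF insert.hyps] right_diff_distrib)
  qed
qed

lemma finite_arr_lattice: "finite H \<Longrightarrow> finite (arr_lattice H)"
proof -
  assume "finite H"
  moreover have "arr_lattice H = Inter ` Pow H" by (auto simp: arr_lattice_def)
  ultimately show ?thesis by simp
qed

lemma sum_Pow_sign:
  assumes "finite A" "A \<noteq> {}"
  shows "(\<Sum>S\<in>Pow A. (-1::int) ^ card S) = 0"
proof -
  obtain a where a: "a \<in> A" using assms(2) by blast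
  define B where "B = A - {a}"
  have A: "A = insert a B" "a \<notin> B" "finite B" using a assms by (auto simp: B_def)
  have inj: "inj_on (insert a) (Pow B)" by (rule inj_on_insert_Pow[OF A(2)])
  have "(\<Sum>S\<in>insert a ` Pow B. (-1::int) ^ card S) = (\<Sum>S\<in>Pow B. - ((-1) ^ card S))"
    unfolding sum.reindex[OF inj]
  proof (rule sum.cong[OF refl])
    fix S assume "S \<in> Pow B"
    then have "finite S" "a \<notin> S" using A finite_subset by auto
    then show "((\<lambda>S. (-1::int) ^ card S) \<circ> insert a) S = - ((-1) ^ card S)" by simp
  qed
  moreover have "(\<Sum>S\<in>Pow A. (-1::int) ^ card S) =
      (\<Sum>S\<in>Pow B. (-1) ^ card S) + (\<Sum>S\<in>insert a ` Pow B. (-1) ^ card S)"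
    unfolding A(1) Pow_insert by (rule sum.union_disjoint) (use A in auto)
  ultimately show ?thesis by (simp add: sum_negf)
qed

text \<open>An instance of Rota's cross-cut theorem.\<close>

lemma moebius_eq_mu_sum:
  fixes H :: "'b set set"
  assumes H: "finite H" "UNIV \<notin> H" and x: "x \<in> arr_lattice H"
  shows "moebius (arr_lattice H) x UNIV = mu_sum H UNIV x"
  using x
proof (induction "card {r \<in> arr_lattice H. x \<subset> r}" arbitrary: x rule: less_induct)
  case less
  let ?L = "arr_lattice H"
  have fL: "finite ?L" by (rule finite_arr_lattice[OF H(1)])
  show ?case
  proof (cases "x = UNIV")
    case True
    have "{S \<in> Pow H. UNIV \<inter> \<Inter>S = UNIV} = {{}}"
    proof -
      have "S = {}" if "S \<subseteq> H" "\<Inter>S = UNIV" for S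
      proof (rule ccontr)
        assume "S \<noteq> {}"
        then obtain h where "h \<in> S" by blast
        then have "h = UNIV" using that(2) by blast
        then show False using \<open>h \<in> S\<close> that(1) H(2) by blast
      qed
      then show ?thesis by auto
    qed
    then show ?thesis using True by (simp add: mu_sum_def moebius.simps)
  next
    case False
    have "moebius ?L x UNIV = - (\<Sum>r\<in>{r \<in> ?L. x \<subset> r}. moebius ?L r UNIV)"
      using False fL by (subst moebius.simps) simp
    also have "(\<Sum>r\<in>{r \<in> ?L. x \<subset> r}. moebius ?L r UNIV) = (\<Sum>r\<in>{r \<in> ?L. x \<subset> r}. mu_sum H UNIV r)"
    proof (rule sum.cong[OF refl])
      fix r assume r: "r \<in> {r \<in> ?L. x \<subset> r}"
      then have "{t \<in> ?L. r \<subset> t} \<subset> {t \<in> ?L. x \<subset> t}" by auto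
      then have "card {t \<in> ?L. r \<subset> t} < card {t \<in> ?L. x \<subset> t}"
        using fL by (intro psubset_card_mono) auto
      then show "moebius ?L r UNIV = mu_sum H UNIV r" using less(1) r by blast
    qed
    finally have 1: "moebius ?L x UNIV = - (\<Sum>r\<in>{r \<in> ?L. x \<subset> r}. mu_sum H UNIV r)" .
    \<comment> \<open>The sets S with x \<subseteq> \<Inter>S are the subsets of A, which is
      nonempty as x is not the top. So the cross-cut sums of all elements above x, including x, add
      up to 0, which is the recursion of the Moebius function.\<close>
    define A where "A = {h \<in> H. x \<subseteq> h}"
    have A: "finite A" "A \<noteq> {}"
    proof -
      show "finite A" using H(1) by (simp add: A_def)
      obtain S where "S \<subseteq> H" "x = \<Inter>S" using less.prems by (auto simp: arr_lattice_def)
      then show "A \<noteq> {}" using False by (auto simp: A_def)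
    qed
    have "(\<Sum>r\<in>{r \<in> ?L. x \<subseteq> r}. mu_sum H UNIV r) = (\<Sum>r\<in>{r \<in> ?L. x \<subseteq> r}. \<Sum>S\<in>{S \<in> Pow A. \<Inter>S = r}. (-1) ^ card S)"
    proof (rule sum.cong[OF refl])
      fix r assume r: "r \<in> {r \<in> ?L. x \<subseteq> r}"
      have "{S \<in> Pow H. UNIV \<inter> \<Inter>S = r} = {S \<in> Pow A. \<Inter>S = r}" using r by (auto simp: A_def)
      then show "mu_sum H UNIV r = (\<Sum>S\<in>{S \<in> Pow A. \<Inter>S = r}. (-1) ^ card S)"
        by (simp add: mu_sum_def)
    qed
    also have "\<dots> = (\<Sum>S\<in>Pow A. (-1) ^ card S)"
    proof (rule sum.group)
      show "Inter ` Pow A \<subseteq> {r \<in> ?L. x \<subseteq> r}" by (auto simp: A_def arr_lattice_def)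
    qed (use A(1) fL in auto)
    also have "\<dots> = 0" by (rule sum_Pow_sign[OF A])
    finally have 2: "(\<Sum>r\<in>{r \<in> ?L. x \<subseteq> r}. mu_sum H UNIV r) = 0" .
    have "{r \<in> ?L. x \<subseteq> r} = insert x {r \<in> ?L. x \<subset> r}" using less.prems by auto
    then have "(\<Sum>r\<in>{r \<in> ?L. x \<subseteq> r}. mu_sum H UNIV r) = mu_sum H UNIV x + (\<Sum>r\<in>{r \<in> ?L. x \<subset> r}. mu_sum H UNIV r)"
      using fL by simp
    then show ?thesis using 1 2 by simp
  qed
qed

text \<open>Subsets are grouped by their intersection, each group giving a Moebius value; the sign
  rule \<open>mu_sum_sign\<close> turns it into an absolute value with the sign of the
  codimension.\<close>

lemma sum_Pow_moebius:
  fixes H :: "'b set set"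
  assumes H: "finite H" "UNIV \<notin> H" and fk: "\<And>w. w \<in> H \<Longrightarrow> form_kernel w"
  shows "(\<Sum>S\<in>Pow H. (-1) ^ card S * int (g (\<Inter>S))) =
    (\<Sum>x\<in>arr_lattice H. (-1) ^ (dim UNIV - dim x) * int (g x) * \<bar>moebius (arr_lattice H) x UNIV\<bar>)"
proof -
  have "(\<Sum>S\<in>Pow H. (-1) ^ card S * int (g (\<Inter>S))) =
      (\<Sum>x\<in>arr_lattice H. \<Sum>S\<in>{S \<in> Pow H. \<Inter>S = x}. (-1) ^ card S * int (g (\<Inter>S)))"
    by (rule sum.group[symmetric]) (use H(1) finite_arr_lattice in \<open>auto simp: arr_lattice_def\<close>)
  also have "\<dots> = (\<Sum>x\<in>arr_lattice H. int (g x) * moebius (arr_lattice H) x UNIV)"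
    by (intro sum.cong refl)
      (auto simp: moebius_eq_mu_sum[OF H] mu_sum_def sum_distrib_left mult.commute intro!: sum.cong)
  also have "\<dots> = (\<Sum>x\<in>arr_lattice H. (-1) ^ (dim UNIV - dim x) * int (g x) * \<bar>moebius (arr_lattice H) x UNIV\<bar>)"
  proof (rule sum.cong[OF refl])
    fix x assume x: "x \<in> arr_lattice H"
    have "0 \<le> (-1) ^ (dim UNIV - dim x) * moebius (arr_lattice H) x UNIV"
      using mu_sum_sign[OF H(1) fk subspace_UNIV] moebius_eq_mu_sum[OF H x] by simp
    then have "\<bar>moebius (arr_lattice H) x UNIV\<bar> = (-1) ^ (dim UNIV - dim x) * moebius (arr_lattice H) x UNIV"
      by (cases "even (dim UNIV - dim x)") auto
    then show "int (g x) * moebius (arr_lattice H) x UNIV =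
        (-1) ^ (dim UNIV - dim x) * int (g x) * \<bar>moebius (arr_lattice H) x UNIV\<bar>"
      by (cases "even (dim UNIV - dim x)") auto
  qed
  finally show ?thesis .
qed

end

section \<open>Hyperplane arrangements\<close>

lemma vdim_quot_zero:
  assumes "vector_space s" "module.subspace s N" "Z \<subseteq> N" "0 \<in> Z"
  shows "vdim s (quot s Z N) =o |{} :: 'z set|"
proof -
  have "quot s Z N = {0}"
    using quot_map_eq_0_iff[OF assms(1,2)] assms(3,4) by (force simp: quot_def image_iff)
  then show ?thesis using vdim_zero[OF assms(1)] by simp
qed

lemma minus_one_power_cong: "even a = even b \<Longrightarrow> (-1::int) ^ a = (-1) ^ b"
  by (cases "even a") auto

locale arrangement = finite_dimensional_vector_space scale Basis
  for scale :: "'k::field \<Rightarrow> 'v::ab_group_add \<Rightarrow> 'v" and Basis +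
  fixes H :: "'v set set"
  assumes countable_H: "countable H" and hyp: "\<And>h. h \<in> H \<Longrightarrow> hyperplane scale h"
begin

abbreviation "num \<equiv> to_nat_on H"
abbreviation "Q \<equiv> arr_lattice H - {UNIV}"
abbreviation "C j k \<equiv> set_chains H (efam j UNIV) k"

lemma inj_num: "inj_on num H"
  by (rule inj_on_to_nat_on[OF countable_H])

lemma dim_h: "h \<in> H \<Longrightarrow> dim h + 1 = dim UNIV"
  and subspace_h: "h \<in> H \<Longrightarrow> subspace h"
  using hyp by (auto simp: hyperplane_def)

lemma UNIV_notin_H: "UNIV \<notin> H"
  using dim_h[of UNIV] by auto

text \<open>A basis of h completed by one vector v spans the space by counting dimensions; the
  coordinate of v is the form.\<close>

lemma form_kernel_h:
  assumes h: "h \<in> H"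
  shows "form_kernel h"
proof -
  obtain B where B: "B \<subseteq> h" "independent B" "h \<subseteq> span B" "card B = dim h"
    using basis_exists by blast
  have spB: "span B = h" by (rule span_subspace[OF B(1,3) subspace_h[OF h]])
  have "h \<noteq> UNIV" using UNIV_notin_H h by blast
  then obtain v where v: "v \<notin> h" by auto
  have vB: "v \<notin> B" using v B(1) by blast
  have ind: "independent (insert v B)" by (rule independent_insertI) (use v spB B(2) in auto)
  have "dim (span (insert v B)) = dim UNIV"
    using ind vB finiteI_independent[OF B(2)] B(4) dim_h[OF h] by (simp add: dim_span_eq_card_independent del: dim_span dim_UNIV)
  then have full: "span (insert v B) = UNIV"
    by (intro subspace_dim_equal) auto
  obtain \<phi> where \<phi>: "Vector_Spaces.linear scale (*) \<phi>" "\<phi> v = 1" "\<And>u. u \<in> span B \<Longrightarrow> \<phi> u = 0"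
    "\<And>w. w \<in> span (insert v B) \<Longrightarrow> w - scale (\<phi> w) v \<in> span B"
    using linear_form_exists[OF ind vB] by blast
  have "w \<in> h" if "\<phi> w = 0" for w
    using \<phi>(4)[of w] full that spB by simp
  then have "h = {w. \<phi> w = 0}" using \<phi>(3) spB by auto
  then show ?thesis using \<phi>(1) by (auto simp: form_kernel_def)
qed

lemma subspace_lattice: "x \<in> arr_lattice H \<Longrightarrow> subspace x"
  using subspace_h by (auto simp: arr_lattice_def intro!: subspace_Inter)

sublocale cov: cover Q H num
proof
  show "inj_on num H" by (rule inj_num)
  show "H \<subseteq> Q"
  proof
    fix h assume "h \<in> H"
    then have "h \<in> arr_lattice H" unfolding arr_lattice_def by (auto intro!: exI[of _ "{h}"])
    then show "h \<in> Q" using \<open>h \<in> H\<close> UNIV_notin_H by blast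
  qed
  show "\<exists>h\<in>H. p \<subseteq> h" if p: "p \<in> Q" for p
  proof -
    obtain S where S: "S \<subseteq> H" "p = \<Inter>S" using p unfolding arr_lattice_def by blast
    then have "S \<noteq> {}" using p by auto
    then show ?thesis using S by blast
  qed
  show "\<Inter>S \<in> Q" if "S \<subseteq> H" "S \<noteq> {}" for S
  proof -
    obtain h where "h \<in> S" using \<open>S \<noteq> {}\<close> by blast
    then have "\<Inter>S \<subseteq> h" "h \<noteq> UNIV" using UNIV_notin_H \<open>S \<subseteq> H\<close> by auto
    then have "\<Inter>S \<noteq> UNIV" by auto
    moreover have "\<Inter>S \<in> arr_lattice H" using \<open>S \<subseteq> H\<close> by (auto simp only: arr_lattice_def)
    ultimately show ?thesis by blast
  qed
qed

section \<open>Derived functors of the exterior power functor\<close>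

definition ext_functor :: "nat \<Rightarrow> ('v set, 'v set \<Rightarrow> 'k) vfunctor" where
  "ext_functor j = \<lparr>obj = ext j, arr = (\<lambda>_ _ y. y)\<rparr>"

lemma is_functor_ext: "is_functor escale Q (ext_functor j)"
  unfolding is_functor_def ext_functor_def
  using subspace_ext ev.linear_ident ext_mono by auto

text \<open>Relations over a smaller subspace are relations over a larger one, so passing to a
  representative in between does not change the final class; this is the composition law.\<close>

lemma is_functor_ext_power: "is_functor tscale Q (ext_power scale j)"
proof -
  have ob: "obj (ext_power scale j) W = quot tscale (free_tuples j W) (rel j W)"
    and ar: "arr (ext_power scale j) W' W = quot_map tscale (rel j W)" for W W' by (simp_all add: ext_power_def)
  note qm = quot_map[OF vs_tscale subspace_rel]
  have in_ft: "x \<in> free_tuples j W" if "x \<in> quot tscale (free_tuples j W) (rel j W)" "W \<in> Q" for x W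
    using quot_sub[OF vs_tscale subspace_rel subspace_free_tuples rel_free_tuples] subspace_lattice that by blast
  have ft_mono: "free_tuples j p \<subseteq> (free_tuples j q :: ('v list \<Rightarrow>\<^sub>0 'k) set)" if "p \<subseteq> q" for p q
    using that by (auto simp: free_tuples_def tuples_def)
  show ?thesis
    unfolding is_functor_def ob ar
  proof (intro conjI ballI impI)
    show "tv.subspace (quot tscale (free_tuples j q) (rel j q))" for q
      by (rule subspace_quot[OF vs_tscale subspace_rel subspace_free_tuples])
    show "Vector_Spaces.linear tscale tscale (quot_map tscale (rel j q))" for q by (rule qm(1))
    show "quot_map tscale (rel j q) ` quot tscale (free_tuples j p) (rel j p) \<subseteq> quot tscale (free_tuples j q) (rel j q)"
      if "p \<in> Q" "p \<le> q" for p q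
      using in_ft[OF _ that(1)] ft_mono[OF that(2)] unfolding quot_def[of _ "free_tuples j q"] by blast
    show "quot_map tscale (rel j q) x = x" if "x \<in> quot tscale (free_tuples j q) (rel j q)" for x q
      using that qm(2) by (auto simp: quot_def)
    show "quot_map tscale (rel j r) (quot_map tscale (rel j q) x) = quot_map tscale (rel j r) x"
      if "q \<le> r" for x q r
      using quot_map_diff_in(2)[OF vs_tscale subspace_rel, of j q x] rel_mono[OF that] 
        quot_map_eq_iff[OF vs_tscale subspace_rel] by blast
  qed
qed

text \<open>Evaluation does not see the choice of representatives, and by
  \<open>ev_tuples_kernel\<close> it separates classes over every subspace. The functor of the
  theorem may thus be exchanged for one whose arrows are inclusions.\<close>

lemma ev_tuples_nat_trans:
  "is_nat_trans tscale escale Q (ext_power scale j) (ext_functor j) (\<lambda>_. ev_tuples)"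
  "q \<in> Q \<Longrightarrow> ev_tuples ` obj (ext_power scale j) q = obj (ext_functor j) q"
  "q \<in> Q \<Longrightarrow> x \<in> obj (ext_power scale j) q \<Longrightarrow> ev_tuples x = 0 \<Longrightarrow> x = 0"
proof -
  note qm = quot_map[OF vs_tscale subspace_rel]
  have ob: "obj (ext_power scale j) W = quot_map tscale (rel j W) ` free_tuples j W"
    and ar: "arr (ext_power scale j) W' W = quot_map tscale (rel j W)" for W W' by (simp_all add: ext_power_def quot_def)
  have e: "ev_tuples (quot_map tscale (rel j W) x) = ev_tuples x" for W x
    using ev_tuples_rel[OF quot_map_diff_in(2)[OF vs_tscale subspace_rel, of j W x]] by (simp add: le(4))
  have im: "ev_tuples ` obj (ext_power scale j) q = obj (ext_functor j) q" for q
    unfolding ob image_image e ev_tuples_image by (simp add: ext_functor_def)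
  then show "q \<in> Q \<Longrightarrow> ev_tuples ` obj (ext_power scale j) q = obj (ext_functor j) q" by simp
  show "is_nat_trans tscale escale Q (ext_power scale j) (ext_functor j) (\<lambda>_. ev_tuples)"
    unfolding is_nat_trans_def using im linear_ev_tuples by (auto simp: ar e ext_functor_def)
  show "x = 0" if q: "q \<in> Q" and x: "x \<in> obj (ext_power scale j) q" "ev_tuples x = 0"
  proof -
    obtain z where z: "z \<in> free_tuples j q" "x = quot_map tscale (rel j q) z" using x(1) ob by auto
    then have "ev_tuples z = 0" using x(2) e by simp
    then have "z \<in> rel j q" using ev_tuples_kernel[OF subspace_lattice z(1)] q by blast
    then show ?thesis using z(2) quot_map_eq_0_iff[OF vs_tscale subspace_rel] by simp
  qed
qed

definition cycles :: "nat \<Rightarrow> nat \<Rightarrow> ('v set set \<Rightarrow> 'v set \<Rightarrow> 'k) set" where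
  "cycles j i = {x \<in> C j (Suc i). i \<noteq> 0 \<longrightarrow> ibd num x = 0}"

lemma arr_hdim_eq:
  "arr_hdim scale H i j =o vdim cscale (quot cscale (cycles j i) (ibd num ` C j (Suc (Suc i))))"
proof -
  have ch: "cov.fchains (ext_functor j) k = C j k" for k by (simp add: ext_functor_def)
  have bd: "cov.fbd (ext_functor j) = ibd num" by (simp add: ext_functor_def)
  have cy: "cov.fcycles (ext_functor j) i = cycles j i"
    unfolding cov.fcycles_def cycles_def ch bd ..
  show ?thesis
    unfolding arr_hdim_def
    using cov.derived_colim_dim_eq[OF vs_tscale vs_escale is_functor_ext_power is_functor_ext
        ev_tuples_nat_trans[where j = j], where i = i]
    unfolding ch bd cy .
qed

lemma fam: "subspace_family escale (efam j UNIV)"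
  by (rule subspace_family_efam)

lemma cech_H: "cech H num escale (efam j UNIV) (\<lambda>_ _ y. y) 0"
  by (rule subspace_family.cech[OF fam inj_num])

lemma sub_C: "cv.subspace (C j k)"
  by (rule subspace_family.sub_chains[OF fam inj_num])

lemma lin_bd: "lin_on cscale cscale (C j (Suc k)) (C j k) (ibd num)"
  by (rule cech.lin_on_bd[OF cech_H]) simp

lemma sub_bd: "cv.subspace (ibd num ` C j (Suc k))"
  by (rule subspace_lin_on_image[OF vs_cscale vs_cscale sub_C lin_bd])

lemma sub_cycles: "cv.subspace (cycles j i)"
proof (cases i)
  case 0
  then have "cycles j i = C j 1" by (auto simp: cycles_def)
  then show ?thesis using sub_C by simp
next
  case (Suc k)
  then have "cycles j i = {x \<in> C j (Suc i). ibd num x = 0}" by (auto simp: cycles_def)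
  then show ?thesis using subspace_lin_on_kernel[OF vs_cscale vs_cscale sub_C lin_bd] by simp
qed

lemma bd_sub_cycles: "ibd num ` C j (Suc (Suc i)) \<subseteq> cycles j i"
proof
  fix x assume "x \<in> ibd num ` C j (Suc (Suc i))"
  then obtain y where y: "y \<in> C j (Suc (Suc i))" "x = ibd num y" by blast
  have "x \<in> C j (Suc i)" using lin_onD(1)[OF vs_cscale vs_cscale sub_C lin_bd] y by blast
  moreover have "ibd num x = 0" using cech.bd_bd[OF cech_H y(1)] y(2) by simp
  ultimately show "x \<in> cycles j i" by (simp add: cycles_def)
qed

section \<open>Exactness ranges, also for infinite arrangements\<close>

lemma finite_subarrangement: "\<exists>I. finite I \<and> I \<subseteq> H \<and> \<Inter>I = \<Inter>H"
proof -
  let ?P = "\<lambda>I. finite I \<and> I \<subseteq> H"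
  \<comment> \<open>A finite intersection of least dimension cannot be cut further by any member of
    H.\<close>
  obtain I where I: "?P I" "\<And>J. ?P J \<Longrightarrow> dim (\<Inter>I) \<le> dim (\<Inter>J)"
    using ex_has_least_nat[of ?P "{}" "\<lambda>I. dim (\<Inter>I)"] by auto
  have sub: "subspace (\<Inter>J)" if "J \<subseteq> H" for J using subspace_h that by (intro subspace_Inter) auto
  have "\<Inter>I \<subseteq> h" if h: "h \<in> H" for h
  proof -
    have "dim (\<Inter>I) \<le> dim (\<Inter>(insert h I))" using I(1) I(2)[of "insert h I"] h by simp
    then have "\<Inter>(insert h I) = \<Inter>I"
      using I(1) h by (intro subspace_dim_equal sub) auto
    then show ?thesis by blast
  qed
  then have "\<Inter>I = \<Inter>H" using I(1) by blast
  then show ?thesis using I(1) by blast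
qed

text \<open>A cycle involves finitely many hyperplanes. Adding a finite subarrangement with the same
  total intersection as H ensures that bounds in terms of the rank hold for the finite set as
  well.\<close>

lemma exact_at_H:
  assumes "\<And>I. finite I \<Longrightarrow> I \<subseteq> H \<Longrightarrow> \<Inter>I = \<Inter>H \<Longrightarrow> exact_at num I (efam j UNIV) k"
  shows "exact_at num H (efam j UNIV) k"
  unfolding exact_at_def
proof (intro ballI impI)
  fix x assume x: "x \<in> C j k" "ibd num x = 0"
  obtain I0 where I0: "finite I0" "I0 \<subseteq> H" "\<Inter>I0 = \<Inter>H" using finite_subarrangement by blast
  define I where "I = I0 \<union> \<Union>{S. x S \<noteq> 0}"
  have I: "finite I" "I \<subseteq> H" "\<Inter>I = \<Inter>H"
    using I0 cech.support_bound(1,2)[OF cech_H x(1)] by (auto simp: I_def)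
  have "x \<in> set_chains I (efam j UNIV) k"
    using chainsD[OF x(1)] by (auto simp: set_chains_def I_def)
  then obtain y where "y \<in> set_chains I (efam j UNIV) (Suc k)" "ibd num y = x"
    using assms[OF I] x(2) by (auto simp: exact_at_def)
  then show "\<exists>y\<in>C j (Suc k). ibd num y = x"
    using I(2) by (intro bexI[of _ y]) (auto simp: set_chains_def)
qed

abbreviation "r \<equiv> lat_deg scale H UNIV"

lemma r_def: "dim UNIV = r + dim (\<Inter>H)"
  using dim_subset[of "\<Inter>H" UNIV] by (simp add: lat_deg_def)

lemma exact_low: "k + j < r \<Longrightarrow> exact_at num H (efam j UNIV) k"
  by (intro exact_at_H exact_below_rank)
    (use form_kernel_h inj_on_subset[OF inj_num] r_def in \<open>auto simp del: dim_UNIV\<close>)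

lemma exact_high: "dim UNIV < k + j \<Longrightarrow> exact_at num H (efam j UNIV) k"
  by (intro exact_at_H exact_above_dim)
    (use form_kernel_h inj_on_subset[OF inj_num] in \<open>auto simp del: dim_UNIV\<close>)

lemma exact_top: "1 \<le> k \<Longrightarrow> r \<le> k \<Longrightarrow> exact_at num H (efam j UNIV) k"
  by (intro exact_at_H exact_above_rank)
    (use form_kernel_h inj_on_subset[OF inj_num] r_def in \<open>auto simp del: dim_UNIV\<close>)

section \<open>Vanishing and the dimensions in degree zero\<close>

lemma hdim_zero:
  assumes "cycles j i \<subseteq> ibd num ` C j (Suc (Suc i))"
  shows "arr_hdim scale H i j =o |{} :: nat set|"
  using arr_hdim_eq vdim_quot_zero[OF vs_cscale sub_bd assms] subspaceD(1)[OF vs_cscale sub_cycles]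
    ordIso_transitive by blast

lemma hdim_zero_pos:
  assumes "i \<noteq> 0" "exact_at num H (efam j UNIV) (Suc i)"
  shows "arr_hdim scale H i j =o |{} :: nat set|"
  by (rule hdim_zero) (use assms in \<open>auto simp: cycles_def exact_at_def image_iff\<close>)

lemma C_eq_0:
  assumes "\<And>S. finite S \<Longrightarrow> S \<subseteq> H \<Longrightarrow> card S = k \<Longrightarrow> dim (\<Inter>S) < j"
  shows "C j k = {0}"
proof -
  have "x = 0" if x: "x \<in> C j k" for x
  proof
    fix S show "x S = 0 S"
    proof (rule ccontr)
      assume "x S \<noteq> 0 S"
      then have nz: "x S \<noteq> 0" by simp
      have S: "finite S" "S \<subseteq> H" "card S = k" using chainsD(2-4)[OF x nz] by auto
      have "subspace (\<Inter>S)" using S(2) subspace_h by (intro subspace_Inter) auto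
      then have "ext j (\<Inter>S) = {0}" using assms[OF S] by (rule ext_eq_0)
      then show False using chainsD(5)[OF x nz] nz by simp
    qed
  qed
  then show ?thesis using zero_chain by blast
qed

lemma hdim_zero_0:
  assumes "dim UNIV \<le> j"
  shows "arr_hdim scale H 0 j =o |{} :: nat set|"
proof (rule hdim_zero)
  have "C j (Suc 0) = {0}"
  proof (rule C_eq_0)
    fix S assume "S \<subseteq> H" "card S = Suc 0"
    then obtain h where "S = {h}" "h \<in> H" by (auto simp: card_Suc_eq)
    then show "dim (\<Inter>S) < j" using dim_h[of h] assms by (simp del: dim_UNIV)
  qed
  then show "cycles j 0 \<subseteq> ibd num ` C j (Suc (Suc 0))"
    using subspaceD(1)[OF vs_cscale sub_bd] by (auto simp: cycles_def)
qed

theorem hdim_vanishing: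
  assumes "i = 0 \<longrightarrow> dim UNIV \<le> j"
    and "i \<noteq> 0 \<longrightarrow> r \<le> Suc i \<or> Suc (i + j) < r \<or> dim UNIV \<le> i + j"
  shows "arr_hdim scale H i j =o |{} :: nat set|"
proof (cases "i = 0")
  case True
  then show ?thesis using hdim_zero_0 assms(1) by simp
next
  case False
  show ?thesis
  proof (rule hdim_zero_pos[OF False])
    \<comment> \<open>Degree i sits at cardinality i + 1; the three alternatives are the three
      exactness ranges.\<close>
    consider "r \<le> Suc i" | "Suc i + j < r" | "dim UNIV < Suc i + j" using assms(2) False by force
    then show "exact_at num H (efam j UNIV) (Suc i)"
      using exact_top[of "Suc i" j] exact_low[of "Suc i" j] exact_high[of "Suc i" j] by cases auto
  qed
qed

text \<open>The augmentation maps chains on single hyperplanes to the exterior power of V. For j + 1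
  below the rank the augmented complex is exact at cardinalities 0 and 1, which makes this map
  surjective and identifies its kernel with the boundaries.\<close>

theorem hdim_0_low:
  assumes j: "Suc j < r"
  shows "arr_hdim scale H 0 j =o |{..<dim UNIV choose j}|"
proof -
  let ?R = "\<lambda>x \<omega>. x \<in> C j (Suc 0) \<and> ibd num x {} = \<omega>"
  note lb = lin_onD[OF vs_cscale vs_cscale sub_C lin_bd]
  have c0: "cycles j 0 = C j (Suc 0)" by (simp add: cycles_def)
  have supp: "ibd num x S = 0" if "x \<in> C j (Suc 0)" "S \<noteq> {}" for x S
    using chainsD(2,4)[OF lb(1)[OF that(1)], of S] that(2) by auto
  have "vdim cscale (quot cscale (C j (Suc 0)) (ibd num ` C j (Suc (Suc 0)))) =o vdim escale (quot escale (ext j UNIV) {0})"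
  proof (rule vdim_quot_cong[where R = ?R, OF vs_cscale vs_escale sub_C sub_bd _ subspace_ext ev.subspace_single_0])
    show "ibd num ` C j (Suc (Suc 0)) \<subseteq> C j (Suc 0)" using lb(1) by blast
    show "{0} \<subseteq> ext j UNIV" using es(1) by simp
    show "x \<in> C j (Suc 0) \<and> \<omega> \<in> ext j UNIV" if "?R x \<omega>" for x \<omega>
    proof (cases "\<omega> = 0")
      case False
      then show ?thesis using chainsD(5)[OF lb(1), where S = "{}"] that by fastforce
    qed (use that es(1) in simp)
    show "?R (x + x') (\<omega> + \<omega>')" if "?R x \<omega>" "?R x' \<omega>'" for x \<omega> x' \<omega>'
      using that subspaceD(2)[OF vs_cscale sub_C] lb(2) by auto
    show "?R (cscale c x) (escale c \<omega>)" if "?R x \<omega>" for c x \<omega>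
      using that subspaceD(4)[OF vs_cscale sub_C] lb(3) by auto
    show "\<exists>\<omega>. ?R x \<omega>" if "x \<in> C j (Suc 0)" for x using that by blast
    show "\<exists>x. ?R x \<omega>" if \<omega>: "\<omega> \<in> ext j UNIV" for \<omega>
    proof -
      define z where "z S = (if S = {} then \<omega> else 0)" for S :: "'v set set"
      have z: "z \<in> C j 0"
        using \<omega> by (auto simp: set_chains_def z_def intro: finite_subset[of _ "{{}}"])
      have "ibd num z = 0"
        by (rule ext, rule trans[OF bd_eq_0]) (auto simp: z_def)
      then obtain y where y: "y \<in> C j (Suc 0)" "ibd num y = z"
        using exact_low[of 0 j] j z by (auto simp: exact_at_def)
      then have "ibd num y {} = \<omega>" by (simp add: z_def)
      then show ?thesis using y(1) by blast
    qed
    show "x \<in> ibd num ` C j (Suc (Suc 0)) \<longleftrightarrow> \<omega> \<in> {0}" if R: "?R x \<omega>" for x \<omega>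
    proof
      assume "x \<in> ibd num ` C j (Suc (Suc 0))"
      then have "ibd num x = 0" using cech.bd_bd[OF cech_H] by auto
      then show "\<omega> \<in> {0}" using R by simp
    next
      assume "\<omega> \<in> {0}"
      then have "ibd num x = 0" using R supp by (intro ext) (metis singletonD zero_fun_apply)
      then show "x \<in> ibd num ` C j (Suc (Suc 0))"
        using exact_low[of "Suc 0" j] j R by (force simp: exact_at_def)
    qed
  qed
  also have "vdim escale (quot escale (ext j UNIV) {0}) =o |{..<dim UNIV choose j}|"
    unfolding quot_zero[OF vs_escale subspace_ext] dim_ext[OF subspace_UNIV, symmetric]
    by (rule vdim_finite[OF vs_escale subspace_ext ext_finite_span])
  finally show ?thesis using ordIso_transitive[OF arr_hdim_eq[of 0 j]] unfolding c0 by blast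
qed

text \<open>Distinct hyperplanes meet in a space of dimension below j, so there are no chains on
  pairs and no boundaries. Each hyperplane contributes its top exterior power, a line, and these
  lines give a basis indexed by H even when H is infinite.\<close>

theorem hdim_0_top:
  assumes j: "Suc j = dim UNIV"
  shows "arr_hdim scale H 0 j =o |H|"
proof -
  have C2: "C j (Suc (Suc 0)) = {0}"
  proof (rule C_eq_0)
    fix S assume S: "S \<subseteq> H" "card S = Suc (Suc 0)"
    then obtain g h where gh: "S = {g, h}" "g \<noteq> h" "g \<in> H" "h \<in> H"
      by (auto simp: card_Suc_eq)
    have "dim (g \<inter> h) < dim h"
    proof (rule ccontr)
      assume "\<not> dim (g \<inter> h) < dim h"
      then have "dim h \<le> dim (g \<inter> h)" by simp
      then have e: "g \<inter> h = h"
        by (intro subspace_dim_equal subspace_inter subspace_h gh) auto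
      have "dim g \<le> dim h" using dim_h[OF gh(3)] dim_h[OF gh(4)] by simp
      then have "h = g" using e by (intro subspace_dim_equal subspace_h gh) auto
      then show False using gh(2) by simp
    qed
    then show "dim (\<Inter>S) < j" using gh(1) dim_h[OF gh(4)] j by simp
  qed
  have c0: "cycles j 0 = C j (Suc 0)" by (simp add: cycles_def)
  have "ibd num ` C j (Suc (Suc 0)) = {0}" unfolding C2 by (simp add: ibd_0)
  then have q: "quot cscale (cycles j 0) (ibd num ` C j (Suc (Suc 0))) = C j (Suc 0)"
    using quot_zero[OF vs_cscale sub_C] c0 by simp
  have "\<exists>w. w \<noteq> 0 \<and> ext j h = ev.span {w}" if h: "h \<in> H" for h
  proof -
    have "dim h = j" using dim_h[OF h] j by (simp del: dim_UNIV)
    then have d: "ev.dim (ext j h) = 1" using dim_ext[OF subspace_h[OF h], of j] by simp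
    obtain B where B: "B \<subseteq> ext j h" "ev.independent B" "ext j h \<subseteq> ev.span B" "card B = ev.dim (ext j h)"
      using ev.basis_exists by blast
    then obtain w where "B = {w}" using d by (auto simp: card_1_singleton_iff)
    then show ?thesis
      using B ev.span_subspace[OF B(1,3) subspace_ext] by (intro exI[of _ w]) auto
  qed
  then obtain w where w: "\<And>h. h \<in> H \<Longrightarrow> w h \<noteq> 0" "\<And>h. h \<in> H \<Longrightarrow> ext j h = ev.span {w h}" by metis
  define b where "b h = cov.spike h (w h)" for h
  have b_at: "b h {g} = (if g = h then w h else 0)" for g h by (auto simp: b_def cov.spike_def)
  have inj: "inj_on b H"
  proof (rule inj_onI)
    fix g h assume gh: "g \<in> H" "h \<in> H" "b g = b h"
    then have "b g {g} = b h {g}" by simp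
    then show "g = h" using w(1)[OF gh(1)] by (auto simp: b_at split: if_splits)
  qed
  have ind: "cv.independent (b ` H)"
    unfolding cv.dependent_def
  proof
    assume "\<exists>a\<in>b ` H. a \<in> cv.span (b ` H - {a})"
    then obtain h where h: "h \<in> H" "b h \<in> cv.span (b ` H - {b h})" by blast
    have "cv.span (b ` H - {b h}) \<subseteq> {x. x {h} = 0}"
    proof (rule cv.span_minimal)
      show "b ` H - {b h} \<subseteq> {x. x {h} = 0}" by (auto simp: b_at)
      show "cv.subspace {x. x {h} = 0}" by (rule cv.subspaceI) auto
    qed
    then have "b h {h} = 0" using h(2) by blast
    then show False using w(1)[OF h(1)] by (simp add: b_at)
  qed
  have span: "cv.span (b ` H) = C j (Suc 0)"
  proof
    show "cv.span (b ` H) \<subseteq> C j (Suc 0)"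
    proof (rule cv.span_minimal[OF _ sub_C])
      show "b ` H \<subseteq> C j (Suc 0)"
        using w(2) ev.span_base[of "w _" "{w _}"]
        by (auto simp: set_chains_def b_def cov.spike_def split: if_splits intro: finite_subset[of _ "{{_}}"])
    qed
    show "C j (Suc 0) \<subseteq> cv.span (b ` H)"
    proof
      fix x assume x: "x \<in> C j (Suc 0)"
      have sing: "\<exists>h\<in>H. S = {h}" if "x S \<noteq> 0" for S
        using chainsD(3,4)[OF x that] by (auto simp: card_Suc_eq)
      have "x = (\<Sum>S\<in>{S. x S \<noteq> 0}. (\<lambda>T. if T = S then x S else 0))"
        using chainsD(1)[OF x] by (auto simp: fun_eq_iff sum_fun_apply)
      also have "\<dots> \<in> cv.span (b ` H)"
      proof (rule cv.span_sum)
        fix S assume "S \<in> {S. x S \<noteq> 0}"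
        then have nz: "x S \<noteq> 0" by simp
        then obtain h where h: "h \<in> H" "S = {h}" using sing by blast
        have "x S \<in> ev.span {w h}" using chainsD(5)[OF x nz] h w(2) by simp
        then obtain c where "x S = escale c (w h)" unfolding ev.span_singleton by blast
        then have "(\<lambda>T. if T = S then x S else 0) = cscale c (b h)"
          using h(2) by (auto simp: fun_eq_iff b_def cov.spike_def)
        then show "(\<lambda>T. if T = S then x S else 0) \<in> cv.span (b ` H)"
          using cv.span_scale[OF cv.span_base, of "b h" "b ` H" c] h(1) by simp
      qed
      finally show "x \<in> cv.span (b ` H)" .
    qed
  qed
  have "vdim cscale (C j (Suc 0)) =o |b ` H|" by (rule vdim_basis[OF vs_cscale ind span])
  moreover have "|b ` H| =o |H|"
    using card_of_ordIsoI[OF inj_on_imp_bij_betw[OF inj]] ordIso_symmetric by blast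
  ultimately show ?thesis using arr_hdim_eq[of 0 j] unfolding q by (meson ordIso_transitive)
qed

lemma arr_lattice_dim_full: "x \<in> arr_lattice H \<Longrightarrow> dim x = dim UNIV \<longleftrightarrow> x = UNIV"
proof
  assume x: "x \<in> arr_lattice H" and d: "dim x = dim UNIV"
  show "x = UNIV" by (rule subspace_dim_equal[OF subspace_lattice[OF x] subspace_UNIV]) (use d in auto)
qed simp

text \<open>As \<Inter>H has dimension 0, the rank equals n, and the exactness ranges k + j < n and
  k + j > n leave only k = i + 1. The homology there is an Euler characteristic, which becomes the
  Moebius sum.\<close>

theorem hdim_diagonal:
  assumes fin: "finite H" and z: "dim (\<Inter>H) = 0" and i: "1 \<le> i" "i + j + 1 = r"
  shows "\<exists>m::nat. arr_hdim scale H i j =o |{..<m}| \<and>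
    int m = (-1) ^ (i + 1) * int (dim UNIV choose j) +
      (\<Sum>k = r - 1 - i..r - 1. (-1) ^ (k - (r - 1 - i)) * int (k choose j) *
        (\<Sum>x\<in>{x \<in> arr_lattice H. lat_deg scale H x = k}. \<bar>moebius (arr_lattice H) x UNIV\<bar>))"
proof -
  let ?L = "arr_lattice H" and ?n = "dim UNIV"
  let ?mu = "\<lambda>x. \<bar>moebius (arr_lattice H) x UNIV\<bar>"
  have rn: "r = ?n" using r_def z by simp
  have deg: "lat_deg scale H x = dim x" for x unfolding lat_deg_def z by simp
  have fL: "finite ?L" by (rule finite_arr_lattice[OF fin])
  note ctx = fin inj_num form_kernel_h subspace_UNIV
  let ?Z = "cycles j i" and ?B = "ibd num ` C j (Suc (Suc i))"
  have Z: "?Z = {x \<in> C j (Suc i). ibd num x = 0}" using i by (auto simp: cycles_def)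
  define m where "m = cv.dim (quot cscale ?Z ?B)"
  obtain A where A: "finite A" "C j (Suc i) \<subseteq> cv.span A" using chain_dim(1)[OF ctx] by blast
  have ZA: "?Z \<subseteq> cv.span A" using A(2) by (auto simp: cycles_def)
  have subq: "cv.subspace (quot cscale ?Z ?B)" by (rule subspace_quot[OF vs_cscale sub_bd sub_cycles])
  have "quot cscale ?Z ?B \<subseteq> ?Z" by (rule quot_sub[OF vs_cscale sub_bd sub_cycles bd_sub_cycles])
  then have 1: "arr_hdim scale H i j =o |{..<m}|"
    unfolding m_def
    using ordIso_transitive[OF arr_hdim_eq vdim_finite[OF vs_cscale subq A(1)]] ZA by blast
  have "cv.dim ?Z = cv.dim ?B + m"
    unfolding m_def by (rule dim_quot[OF vs_cscale sub_cycles sub_bd bd_sub_cycles A(1) ZA])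
  then have "int m = int (cv.dim ?Z) - int (cv.dim ?B)" by simp
  also have "\<dots> = (-1) ^ Suc i * (\<Sum>S\<in>Pow H. (-1) ^ card S * int (dim (UNIV \<inter> \<Inter>S) choose j))"
    unfolding Z
  proof (rule euler_char[OF ctx])
    fix k assume "k \<noteq> Suc i"
    then consider "k + j < r" | "?n < k + j" using i rn by linarith
    then show "exact_at num H (efam j UNIV) k" using exact_low exact_high by cases auto
  qed
  also have "(\<Sum>S\<in>Pow H. (-1) ^ card S * int (dim (UNIV \<inter> \<Inter>S) choose j)) =
      (\<Sum>x\<in>?L. (-1) ^ (?n - dim x) * int (dim x choose j) * ?mu x)"
    using sum_Pow_moebius[OF fin UNIV_notin_H form_kernel_h, of "\<lambda>x. dim x choose j"] by simp
  \<comment> \<open>The top element is split off: its degree n is outside the range of k in the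
    claim, and its Moebius value 1 gives the separate binomial.\<close>
  also have "\<dots> = (-1) ^ (?n - ?n) * int (?n choose j) * ?mu UNIV +
      (\<Sum>x\<in>?L - {UNIV}. (-1) ^ (?n - dim x) * int (dim x choose j) * ?mu x)"
  proof (rule sum.remove[OF fL])
    show "UNIV \<in> ?L" by (auto simp: arr_lattice_def intro!: exI[of _ "{}"])
  qed
  also have "(\<Sum>x\<in>?L - {UNIV}. (-1) ^ (?n - dim x) * int (dim x choose j) * ?mu x) =
      (\<Sum>k<?n. \<Sum>x\<in>{x \<in> ?L - {UNIV}. dim x = k}. (-1) ^ (?n - dim x) * int (dim x choose j) * ?mu x)"
  proof (rule sum.group[symmetric])
    show "dim ` (?L - {UNIV}) \<subseteq> {..<?n}"
    proof
      fix k assume "k \<in> dim ` (?L - {UNIV})"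
      then obtain x where x: "x \<in> ?L" "x \<noteq> UNIV" "k = dim x" by auto
      then show "k \<in> {..<?n}" using arr_lattice_dim_full[OF x(1)] dim_subset[of x UNIV] by (simp del: dim_UNIV)
    qed
  qed (use fL in auto)
  also have "\<dots> = (\<Sum>k<?n. (-1) ^ (?n - k) * int (k choose j) * (\<Sum>x\<in>{x \<in> ?L. dim x = k}. ?mu x))"
  proof (rule sum.cong[OF refl])
    fix k assume "k \<in> {..<?n}"
    then have "{x \<in> ?L - {UNIV}. dim x = k} = {x \<in> ?L. dim x = k}" by (auto simp del: dim_UNIV)
    then show "(\<Sum>x\<in>{x \<in> ?L - {UNIV}. dim x = k}. (-1) ^ (?n - dim x) * int (dim x choose j) * ?mu x) =
        (-1) ^ (?n - k) * int (k choose j) * (\<Sum>x\<in>{x \<in> ?L. dim x = k}. ?mu x)"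
      by (simp add: sum_distrib_left del: dim_UNIV)
  qed
  \<comment> \<open>Below j the binomials vanish, which produces the lower limit j = r - 1 -
    i.\<close>
  also have "\<dots> = (\<Sum>k=j..?n - 1. (-1) ^ (?n - k) * int (k choose j) * (\<Sum>x\<in>{x \<in> ?L. dim x = k}. ?mu x))"
    by (rule sum.mono_neutral_right) (use i rn in \<open>auto simp: not_le binomial_eq_0 simp del: dim_UNIV\<close>)
  also have "(-1) ^ (?n - ?n) * int (?n choose j) * ?mu UNIV = int (?n choose j)"
    by (simp add: moebius.simps del: dim_UNIV)
  finally have "int m = (-1) ^ (i + 1) * int (?n choose j) + (-1) ^ (i + 1) *
      (\<Sum>k=j..?n - 1. (-1) ^ (?n - k) * int (k choose j) * (\<Sum>x\<in>{x \<in> ?L. dim x = k}. ?mu x))"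
    by (simp add: distrib_left del: dim_UNIV)
  also have "(-1) ^ (i + 1) * (\<Sum>k=j..?n - 1. (-1) ^ (?n - k) * int (k choose j) * (\<Sum>x\<in>{x \<in> ?L. dim x = k}. ?mu x)) =
      (\<Sum>k=j..?n - 1. (-1) ^ (k - j) * int (k choose j) * (\<Sum>x\<in>{x \<in> ?L. dim x = k}. ?mu x))"
    unfolding sum_distrib_left[of "(-1) ^ (i + 1)"]
  proof (rule sum.cong[OF refl])
    fix k assume k: "k \<in> {j..?n - 1}"
    have "even (i + 1 + (?n - k)) = even (k - j)"
    proof -
      \<comment> \<open>Since n - j = i + 1, the exponents i + 1 + (n - k) and k - j have an even
        sum, so the signs agree.\<close>
      have e: "i + 1 + (?n - k) + (k - j) = 2 * (i + 1)" using k i rn by auto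
      have "even (i + 1 + (?n - k) + (k - j))" unfolding e by (rule dvd_triv_left)
      then show ?thesis unfolding even_add[of "i + 1 + (?n - k)"] .
    qed
    then have "(-1::int) ^ (i + 1) * (-1) ^ (?n - k) = (-1) ^ (k - j)"
      unfolding power_add[symmetric] by (rule minus_one_power_cong)
    then show "(-1) ^ (i + 1) * ((-1) ^ (?n - k) * int (k choose j) * (\<Sum>x\<in>{x \<in> ?L. dim x = k}. ?mu x)) =
        (-1) ^ (k - j) * int (k choose j) * (\<Sum>x\<in>{x \<in> ?L. dim x = k}. ?mu x)"
      by (simp add: mult.assoc[symmetric])
  qed
  finally have "int m = (-1) ^ (i + 1) * int (?n choose j) +
      (\<Sum>k=j..?n - 1. (-1) ^ (k - j) * int (k choose j) * (\<Sum>x\<in>{x \<in> ?L. dim x = k}. ?mu x))" .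
  moreover have "?n - 1 - i = j" using i rn by simp
  ultimately show ?thesis using 1 unfolding deg by (intro exI[of _ m]) (simp del: dim_UNIV)
qed

end

text \<open>The bounds are compared as integers because r - 2 and n - 1 would be truncated for small
  r and n. Dimensions are cardinals, since for infinite H the space with i = 0 and j = n - 1 is
  infinite-dimensional; the signed formula therefore speaks of a natural number m giving the
  cardinality.\<close>

theorem theorem3:
  fixes scale :: "'k::field \<Rightarrow> 'v::ab_group_add \<Rightarrow> 'v"
    and Basis :: "'v set" and H :: "'v set set"
  assumes "finite_dimensional_vector_space scale Basis"
    and "countable H"
    and "\<And>h. h \<in> H \<Longrightarrow> hyperplane scale h"
  shows "let dim = vector_space.dim scale;
             n = dim UNIV;
             deg = lat_deg scale H;
             r = deg UNIV;
             d = arr_hdim scale H;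
             A = {(i, j). i = 0 \<and> 0 \<le> int j \<and> int j \<le> int n - 1};
             B = {(i, j). 1 \<le> int i \<and> int i \<le> int r - 2 \<and>
                          int r - 1 \<le> int i + int j \<and> int i + int j \<le> int n - 1}
         in (\<forall>i j. (i, j) \<notin> A \<union> B \<longrightarrow> d i j =o |{} :: nat set| ) \<and>
            (\<forall>j. int j \<le> int r - 2 \<longrightarrow> d 0 j =o |{..<n choose j}| ) \<and>
            (\<forall>j. int j = int n - 1 \<longrightarrow> d 0 j =o |H| ) \<and>
            (finite H \<and> dim (\<Inter>H) = 0 \<longrightarrow>
              (\<forall>i j. 1 \<le> int i \<and> int i \<le> int r - 2 \<and> int i + int j = int r - 1 \<longrightarrow>
                (\<exists>m::nat. d i j =o |{..<m}| \<and>
                  int m = (-1) ^ (i + 1) * int (n choose j) +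
                    (\<Sum>k = r - 1 - i..r - 1. (-1) ^ (k - (r - 1 - i)) * int (k choose j) *
                      (\<Sum>x\<in>{x \<in> arr_lattice H. deg x = k}. \<bar>moebius (arr_lattice H) x UNIV\<bar>)))))"
proof -
  interpret finite_dimensional_vector_space scale Basis by (rule assms(1))
  interpret arrangement scale Basis H by unfold_locales (use assms(2,3) in auto)
  show ?thesis
    unfolding Let_def
  proof (intro conjI allI impI)
    fix i j assume "(i, j) \<notin> {(i, j). i = 0 \<and> 0 \<le> int j \<and> int j \<le> int (dim UNIV) - 1} \<union>
      {(i, j). 1 \<le> int i \<and> int i \<le> int r - 2 \<and> int r - 1 \<le> int i + int j \<and> int i + int j \<le> int (dim UNIV) - 1}"
    then show "arr_hdim scale H i j =o |{} :: nat set|"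
      by (intro hdim_vanishing) (auto simp del: dim_UNIV)
  next
    fix j assume "int j \<le> int r - 2"
    then show "arr_hdim scale H 0 j =o |{..<dim UNIV choose j}|" by (intro hdim_0_low) simp
  next
    fix j assume "int j = int (dim UNIV) - 1"
    then show "arr_hdim scale H 0 j =o |H|" by (intro hdim_0_top) (simp del: dim_UNIV)
  next
    fix i j assume "finite H \<and> dim (\<Inter>H) = 0" "1 \<le> int i \<and> int i \<le> int r - 2 \<and> int i + int j = int r - 1"
    then show "\<exists>m::nat. arr_hdim scale H i j =o |{..<m}| \<and>
      int m = (-1) ^ (i + 1) * int (dim UNIV choose j) +
        (\<Sum>k = r - 1 - i..r - 1. (-1) ^ (k - (r - 1 - i)) * int (k choose j) *
          (\<Sum>x\<in>{x \<in> arr_lattice H. lat_deg scale H x = k}. \<bar>moebius (arr_lattice H) x UNIV\<bar>))"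
      by (intro hdim_diagonal) auto
  qed
qed

end
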